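(* Let $P$ be an arbitrary knot projection. The circle arrangement $\tau(P)$ (considered up to isotopy of the sphere) is invariant under strong (1, 2) homotopy; that is, if $P$ and $P'$ are strongly (1, 2) homotopic knot projections, then $\tau(P)$ and $\tau(P')$ are isotopic on the sphere.
   Context: A knot projection is the image of a generic immersion of a circle into the 2-sphere $S^2$ (the only singularities are finitely many transverse double points). It is regarded as a 4-valent graph whose vertices are the double points, and is considered up to isotopy of the sphere. A 1-gon (resp. 2-gon) is the boundary of a disk that is a face (the interior of the disk is disjoint from the projection) and whose boundary has exactly one vertex and one edge (resp. exactly two vertices and two edges). A 2-gon is coherent if, after orienting the knot projection, its two edges are oriented consistently around its boundary (independent of the chosen orientation). The move RI (first flat Reidemeister move) locally adds or removes a 1-gon (kink). The second flat Reidemeister move replaces, inside a disk, two disjoint arcs by two arcs crossing each other at two points and forming a 2-gon, or the inverse; it is called strong RII if this 2-gon is coherent. Two knot projections are strongly (1, 2) homotopic if they are related by a finite sequence of moves RI and strong RII, together with isotopies. Non-Seifert resolution $A^{-1}$: orient $P$ arbitrarily; of the two planar smoothings of a double point, $A^{-1}$ is the one that does not respect the orientation, i.e. it joins the two incoming branches to each other and the two outgoing branches to each other. This does not depend on the orientation chosen. Applying $A^{-1}$ simultaneously at every double point of $P$ (with respect to an orientation of $P$) yields a finite collection of pairwise disjoint simple closed curves on $S^2$, denoted $\tau(P)$ and called the circle arrangement of $P$; it is considered up to isotopy of the sphere. *)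

theory Defs
  imports "HOL-Analysis.Analysis"
begin

abbreviation S2 :: "(real^3) set" where
  "S2 \<equiv> sphere 0 1"

text \<open>Closed curves are 1-periodic functions on the real line; only parameters in
  \<open>{0..<1}\<close> are compared when looking for multiple points.\<close>

definition double_points :: "(real \<Rightarrow> real^3) \<Rightarrow> (real^3) set" where
  "double_points \<gamma> = {v. \<exists>s\<in>{0..<1}. \<exists>t\<in>{0..<1}. s \<noteq> t \<and> \<gamma> s = v \<and> \<gamma> t = v}"

text \<open>Two velocities at a double point are tangent to the sphere, so transversality means
  linear independence. It is stated by \<open>\<not> collinear {0, x, y}\<close>; \<open>independent {x, y}\<close>
  would be satisfied by \<open>x = y \<noteq> 0\<close>.\<close>

definition generic_immersion :: "(real \<Rightarrow> real^3) \<Rightarrow> bool" where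
  "generic_immersion \<gamma> \<longleftrightarrow>
     range \<gamma> \<subseteq> S2 \<and> (\<forall>t. \<gamma> (t + 1) = \<gamma> t) \<and>
     \<gamma> C1_differentiable_on UNIV \<and> (\<forall>t. vector_derivative \<gamma> (at t) \<noteq> 0) \<and>
     finite (double_points \<gamma>) \<and>
     (\<forall>r\<in>{0..<1}. \<forall>s\<in>{0..<1}. \<forall>t\<in>{0..<1}.
        \<gamma> r = \<gamma> s \<and> \<gamma> s = \<gamma> t \<longrightarrow> r = s \<or> s = t \<or> r = t) \<and>
     (\<forall>s\<in>{0..<1}. \<forall>t\<in>{0..<1}. s \<noteq> t \<and> \<gamma> s = \<gamma> t \<longrightarrow>
        \<not> collinear {0, vector_derivative \<gamma> (at s), vector_derivative \<gamma> (at t)})"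

definition knot_projection :: "(real^3) set \<Rightarrow> bool" where
  "knot_projection P \<longleftrightarrow> (\<exists>\<gamma>. generic_immersion \<gamma> \<and> P = range \<gamma>)"

definition isotopic :: "(real^3) set \<Rightarrow> (real^3) set \<Rightarrow> bool" where
  "isotopic A B \<longleftrightarrow>
     (\<exists>H :: real \<Rightarrow> real^3 \<Rightarrow> real^3.
        continuous_on ({0..1} \<times> S2) (\<lambda>(t, x). H t x) \<and>
        (\<forall>t\<in>{0..1}. \<exists>K. homeomorphism S2 S2 (H t) K) \<and>
        (\<forall>x\<in>S2. H 0 x = x) \<and> H 1 ` A = B)"

text \<open>A closed disk in the sphere together with a parametrization by the unit disk; no
  orientation is prescribed, so every local model below also stands for its mirror image.\<close>

definition disk_embedding :: "(complex \<Rightarrow> real^3) \<Rightarrow> bool" where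
  "disk_embedding \<phi> \<longleftrightarrow>
     continuous_on (cball 0 1) \<phi> \<and> inj_on \<phi> (cball 0 1) \<and> \<phi> ` cball 0 1 \<subseteq> S2"

text \<open>The oriented curve \<open>\<gamma>\<close> runs along the arc \<open>A\<close> from \<open>p\<close> to \<open>q\<close>.\<close>

definition runs_along :: "(real \<Rightarrow> real^3) \<Rightarrow> (real^3) set \<Rightarrow> real^3 \<Rightarrow> real^3 \<Rightarrow> bool" where
  "runs_along \<gamma> A p q \<longleftrightarrow> (\<exists>a b. a < b \<and> \<gamma> a = p \<and> \<gamma> b = q \<and> \<gamma> ` {a..b} = A)"

text \<open>Inside the disk \<open>\<phi>\<close> the curve is exactly a crossing at \<open>v\<close>. Both branches are oriented
  in the positive direction of the coordinate axes: the incoming ends are \<open>-1\<close> and \<open>-\<i>\<close>,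
  the outgoing ends are \<open>1\<close> and \<open>\<i>\<close>.\<close>

definition crossing_chart :: "(real \<Rightarrow> real^3) \<Rightarrow> real^3 \<Rightarrow> (complex \<Rightarrow> real^3) \<Rightarrow> bool" where
  "crossing_chart \<gamma> v \<phi> \<longleftrightarrow>
     disk_embedding \<phi> \<and> \<phi> 0 = v \<and>
     range \<gamma> \<inter> \<phi> ` cball 0 1 = \<phi> ` (closed_segment (-1) 1 \<union> closed_segment (-\<i>) \<i>) \<and>
     runs_along \<gamma> (\<phi> ` closed_segment (-1) 1) (\<phi> (-1)) (\<phi> 1) \<and>
     runs_along \<gamma> (\<phi> ` closed_segment (-\<i>) \<i>) (\<phi> (-\<i>)) (\<phi> \<i>)"

text \<open>In a crossing chart, one chord joins the two incoming ends, the other one the two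
  outgoing ends.\<close>

definition nonseifert_chords :: "complex set" where
  "nonseifert_chords = closed_segment (-1) (-\<i>) \<union> closed_segment 1 \<i>"

text \<open>\<open>C\<close> is (the union of the circles of) a circle arrangement of \<open>P\<close>: all double points are
  resolved simultaneously inside pairwise disjoint disks. As a set, \<open>C\<close> depends on the choice
  of the orientation and of the disks \<open>\<phi> v\<close>, so this is a relation.\<close>

definition circle_arrangement :: "(real^3) set \<Rightarrow> (real^3) set \<Rightarrow> bool" where
  "circle_arrangement P C \<longleftrightarrow>
     (\<exists>\<gamma> \<phi>. generic_immersion \<gamma> \<and> P = range \<gamma> \<and>
        (\<forall>v\<in>double_points \<gamma>. crossing_chart \<gamma> v (\<phi> v)) \<and>
        (\<forall>v\<in>double_points \<gamma>. \<forall>w\<in>double_points \<gamma>.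
           v \<noteq> w \<longrightarrow> \<phi> v ` cball 0 1 \<inter> \<phi> w ` cball 0 1 = {}) \<and>
        C = (P - (\<Union>v\<in>double_points \<gamma>. \<phi> v ` cball 0 1)) \<union>
            (\<Union>v\<in>double_points \<gamma>. \<phi> v ` nonseifert_chords))"

text \<open>\<open>P'\<close> arises from \<open>P\<close> by replacing, inside the disk \<open>\<phi>\<close>, the planar model \<open>X\<close> by \<open>Y\<close>.\<close>

definition replaces_in_disk ::
    "(complex \<Rightarrow> real^3) \<Rightarrow> complex set \<Rightarrow> complex set \<Rightarrow> (real^3) set \<Rightarrow> (real^3) set \<Rightarrow> bool" where
  "replaces_in_disk \<phi> X Y P P' \<longleftrightarrow>
     disk_embedding \<phi> \<and>
     P \<inter> \<phi> ` cball 0 1 = \<phi> ` X \<and> P' \<inter> \<phi> ` cball 0 1 = \<phi> ` Y \<and>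
     P - \<phi> ` cball 0 1 = P' - \<phi> ` cball 0 1"

text \<open>An arc from \<open>-1\<close> to \<open>1\<close> in the unit disk whose only double point is \<open>\<i> / 4\<close>, attained at
  the parameters \<open>t = \<plusminus> 1 / sqrt 2\<close>; the part in between is the boundary of a 1-gon.\<close>

definition kink :: "complex set" where
  "kink = (\<lambda>t. Complex (2 * t ^ 3 - t) ((1 - t\<^sup>2) / 2)) ` {-1..1}"

definition RI_move :: "(real^3) set \<Rightarrow> (real^3) set \<Rightarrow> bool" where
  "RI_move P P' \<longleftrightarrow> (\<exists>\<phi>. replaces_in_disk \<phi> (closed_segment (-1) 1) kink P P')"

text \<open>The two parallel chords \<open>Im z = \<plusminus> 1 / 2\<close>, and the two parabolic arcs
  \<open>Im z = \<plusminus> ((Re z)\<^sup>2 - 1 / 4)\<close> with the same four end points on the unit circle. The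
  parabolic arcs cross at \<open>\<plusminus> 1 / 2\<close> and bound a 2-gon with the two edges below.\<close>

definition parallel_arcs :: "complex set" where
  "parallel_arcs = {z \<in> cball 0 1. \<bar>Im z\<bar> = 1 / 2}"

definition crossing_arcs :: "complex set" where
  "crossing_arcs = {z \<in> cball 0 1. \<bar>Im z\<bar> = \<bar>(Re z)\<^sup>2 - 1 / 4\<bar>}"

definition lower_edge :: "complex set" where
  "lower_edge = (\<lambda>x. Complex x (x\<^sup>2 - 1 / 4)) ` {-(1/2)..1/2}"

definition upper_edge :: "complex set" where
  "upper_edge = (\<lambda>x. Complex x (1 / 4 - x\<^sup>2)) ` {-(1/2)..1/2}"

text \<open>Coherence of the 2-gon: for some orientation of \<open>P'\<close>, one edge is traversed from
  \<open>-1/2\<close> to \<open>1/2\<close> and the other one back from \<open>1/2\<close> to \<open>-1/2\<close>. The opposite direction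
  around the 2-gon is covered by reversing \<open>\<gamma>\<close>.\<close>

definition strong_RII_move :: "(real^3) set \<Rightarrow> (real^3) set \<Rightarrow> bool" where
  "strong_RII_move P P' \<longleftrightarrow>
     (\<exists>\<phi> \<gamma>. replaces_in_disk \<phi> parallel_arcs crossing_arcs P P' \<and>
        generic_immersion \<gamma> \<and> P' = range \<gamma> \<and>
        runs_along \<gamma> (\<phi> ` lower_edge) (\<phi> (-(1/2))) (\<phi> (1/2)) \<and>
        runs_along \<gamma> (\<phi> ` upper_edge) (\<phi> (1/2)) (\<phi> (-(1/2))))"

definition strong_12_step :: "(real^3) set \<Rightarrow> (real^3) set \<Rightarrow> bool" where
  "strong_12_step P P' \<longleftrightarrow>
     knot_projection P \<and> knot_projection P' \<and>
     (isotopic P P' \<or> RI_move P P' \<or> RI_move P' P \<or>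
      strong_RII_move P P' \<or> strong_RII_move P' P)"

definition strongly_12_homotopic :: "(real^3) set \<Rightarrow> (real^3) set \<Rightarrow> bool" where
  "strongly_12_homotopic = strong_12_step\<^sup>*\<^sup>*"

end

(*
Smoothness is discarded at once: a generic immersion is only used through its crossing charts, i.e.
as a continuous closed curve with finitely many double points, each with a disk in which the curve is
a cross. Such a curve can be modified freely inside disks.

The arrangement of a set P does not depend on the choices: two parametrizations of P by such curves
agree up to orientation, reversing the orientation exchanges the two chords of every crossing, and
two charts at the same double point are compared quadrant by quadrant, each replacement being
realized by a homeomorphism of a disk fixing its boundary (which is isotopic to the identity by the
Alexander trick).

For a move P -> P' in a disk, one curve for P' is obtained from a curve for P by composing with a map
that folds the arcs in the disk into the model with crossings. For explicit charts at the new
crossings, the resolved model is the image of the old arcs under a homeomorphism of the disk fixing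
the boundary, so the two arrangements are isotopic. For RII this needs that the two strands run in
opposite directions, which is what coherence of the 2-gon means; it is transferred from the smooth
parametrization to the modified curve by comparing their directions along the two edges.
*)
theory Submission
  imports Defs
begin

subsection \<open>Homeomorphisms of the disk that fix the boundary circle\<close>

text \<open>Straightening the transition map between two topological charts would need a theorem of
  Schoenflies type. An asymmetry of the resolved picture avoids this: once the outgoing chord has
  been pushed onto the outgoing half axes, a chart matters only through its values on the incoming
  closed quadrant. Charts that agree on the incoming or on the outgoing quadrant therefore give
  isotopic resolutions, and any two charts are connected by a third one that agrees, up to
  rescaling, with the first on the outgoing and with the second on the incoming quadrant. For the
  moves, the fold and the homeomorphism of the disk agree near the boundary circle. Both resulting
  curves then share the charts of all other double points, and their resolutions are equal as sets.
  \<open>runs_along\<close> prescribes the end points and the image of a stretch of a curve, not a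
  monotone passage. Finiteness of the set of double points is what turns such data into monotone
  passages and makes two parametrizations of one set agree locally up to direction.\<close>

definition disk_homeo :: "(complex \<Rightarrow> complex) \<Rightarrow> bool" where
  "disk_homeo G \<longleftrightarrow> continuous_on (cball 0 1) G \<and> bij_betw G (cball 0 1) (cball 0 1) \<and>
     (\<forall>z. norm z = 1 \<longrightarrow> G z = z)"

lemma disk_homeo_compose:
  assumes "disk_homeo F" "disk_homeo G"
  shows "disk_homeo (F \<circ> G)"
  unfolding disk_homeo_def
proof (intro conjI)
  show "continuous_on (cball 0 1) (F \<circ> G)"
    using assms by (intro continuous_on_compose) (simp_all add: disk_homeo_def bij_betw_def)
  show "bij_betw (F \<circ> G) (cball 0 1) (cball 0 1)"
    using assms by (intro bij_betw_trans[of G _ "cball 0 1"]) (simp_all add: disk_homeo_def)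
qed (use assms in \<open>simp add: disk_homeo_def\<close>)

text \<open>Fibre maps move points in the vertical direction only; conjugation by a rotation
  provides the diagonal and the horizontal direction.\<close>

lemma disk_homeo_conjugate:
  assumes G: "disk_homeo G" and c: "norm c = 1"
  shows "disk_homeo (\<lambda>z. G (z * c) / c)"
proof -
  have c0: "c \<noteq> 0" using c by auto
  have 1: "bij_betw (\<lambda>z. z * c) (cball 0 1) (cball 0 1)"
    by (rule bij_betw_byWitness[of _ "\<lambda>z. z / c"]) (use c c0 in \<open>auto simp: norm_mult norm_divide\<close>)
  have 2: "bij_betw (\<lambda>z. z / c) (cball 0 1) (cball 0 1)"
    by (rule bij_betw_byWitness[of _ "\<lambda>z. z * c"]) (use c c0 in \<open>auto simp: norm_mult norm_divide\<close>)
  have 3: "bij_betw G (cball 0 1) (cball 0 1)" using G by (simp add: disk_homeo_def)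
  have b: "bij_betw ((\<lambda>z. z / c) \<circ> (G \<circ> (\<lambda>z. z * c))) (cball 0 1) (cball 0 1)"
    by (rule bij_betw_trans[OF bij_betw_trans[OF 1 3] 2])
  have "continuous_on (cball 0 1) G" using G by (simp add: disk_homeo_def)
  then have "continuous_on (cball 0 1) (\<lambda>z. G (z * c))"
    by (rule continuous_on_compose2) (use 1 in \<open>auto simp: bij_betw_def intro!: continuous_intros simp del: mem_cball_0\<close>)
  then have "continuous_on (cball 0 1) (\<lambda>z. G (z * c) / c)"
    using c0 by (intro continuous_on_divide continuous_on_const) auto
  then show ?thesis
    using G b c c0 unfolding disk_homeo_def by (auto simp: o_def norm_mult)
qed

text \<open>A piecewise linear map of [A, B] with one break, at \<open>n\<close>. The two clamped
  terms stop and start there, so one formula covers both pieces, and a piece of length zero gets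
  slope 0 because division by zero yields 0.\<close>

definition interpolate :: "real \<Rightarrow> real \<Rightarrow> real \<Rightarrow> real \<Rightarrow> real \<Rightarrow> real" where
  "interpolate A n m B y = A + (m - A) / (n - A) * (min y n - A) + (B - m) / (B - n) * (max y n - n)"

lemma interpolate_node: "A \<le> n \<Longrightarrow> A = n \<longleftrightarrow> A = m \<Longrightarrow> interpolate A n m B n = m"
  by (auto simp: interpolate_def)

lemma interpolate_ends:
  assumes "A \<le> n" "n \<le> B" "A = n \<longleftrightarrow> A = m" "B = n \<longleftrightarrow> B = m"
  shows "interpolate A n m B A = A" "interpolate A n m B B = B"
  using assms by (auto simp: interpolate_def)

text \<open>Exchanging the nodes inverts the map piece by piece. The equivalences let a piece shrink
  to a point for both nodes or for neither, so no interval of positive length collapses.\<close>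

lemma interpolate_inverse:
  assumes "A \<le> n" "n \<le> B" "A \<le> m" "m \<le> B" "A = n \<longleftrightarrow> A = m" "B = n \<longleftrightarrow> B = m" "A \<le> y" "y \<le> B"
  shows "interpolate A m n B (interpolate A n m B y) = y"
    and "A \<le> interpolate A n m B y" and "interpolate A n m B y \<le> B"
proof -
  have "interpolate A m n B (interpolate A n m B y) = y \<and> A \<le> interpolate A n m B y \<and> interpolate A n m B y \<le> B"
  proof (cases "y \<le> n")
    case True
    have e: "interpolate A n m B y = A + (m - A) / (n - A) * (y - A)"
      using True by (simp add: interpolate_def)
    show ?thesis
    proof (cases "A = n")
      case True
      with \<open>y \<le> n\<close> assms e show ?thesis by (auto simp: interpolate_def)
    next
      case False
      then have "A < n" "A < m" using assms by auto
      have "0 \<le> (y - A) / (n - A)" "(y - A) / (n - A) \<le> 1"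
        using \<open>A < n\<close> assms True by (auto simp: divide_simps)
      then have "0 \<le> (m - A) * ((y - A) / (n - A))" "(m - A) * ((y - A) / (n - A)) \<le> (m - A) * 1"
        using \<open>A < m\<close> by (intro mult_left_mono mult_nonneg_nonneg; simp)+
      then have r: "A \<le> interpolate A n m B y" "interpolate A n m B y \<le> m"
        by (auto simp: e)
      have "interpolate A m n B (interpolate A n m B y) = A + (n - A) / (m - A) * (interpolate A n m B y - A)"
        using r(2) by (simp add: interpolate_def)
      also have "\<dots> = y" using \<open>A < n\<close> \<open>A < m\<close> by (simp add: e)
      finally show ?thesis using r assms by auto
    qed
  next
    case False
    then have "n < B" "m < B" using assms by auto
    have "A + (m - A) / (n - A) * (n - A) = m" using assms by auto
    then have e: "interpolate A n m B y = m + (B - m) / (B - n) * (y - n)"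
      using False by (simp add: interpolate_def)
    have "0 \<le> (y - n) / (B - n)" "(y - n) / (B - n) \<le> 1"
      using False assms \<open>n < B\<close> by (auto simp: divide_simps)
    then have "0 \<le> (B - m) * ((y - n) / (B - n))" "(B - m) * ((y - n) / (B - n)) \<le> (B - m) * 1"
      using \<open>m < B\<close> by (intro mult_left_mono mult_nonneg_nonneg; simp)+
    then have r: "m \<le> interpolate A n m B y" "interpolate A n m B y \<le> B"
      by (auto simp: e)
    have "A + (n - A) / (m - A) * (m - A) = n" using assms by auto
    then have "interpolate A m n B (interpolate A n m B y) = n + (B - n) / (B - m) * (interpolate A n m B y - m)"
      using r(1) by (simp add: interpolate_def)
    also have "\<dots> = y" using \<open>n < B\<close> \<open>m < B\<close> by (simp add: e)
    finally show ?thesis using r assms by auto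
  qed
  then show "interpolate A m n B (interpolate A n m B y) = y"
    and "A \<le> interpolate A n m B y" and "interpolate A n m B y \<le> B" by auto
qed

text \<open>The bound on \<open>w\<close> keeps the product continuous at the zeros of \<open>d\<close>, where \<open>u / d = 0\<close>.\<close>

lemma continuous_on_divide_times:
  fixes u d w :: "'a::topological_space \<Rightarrow> real"
  assumes "continuous_on S u" "continuous_on S d" "continuous_on S w"
    and w: "\<And>z. z \<in> S \<Longrightarrow> 0 \<le> w z \<and> w z \<le> d z"
    and u: "\<And>z. z \<in> S \<Longrightarrow> d z = 0 \<Longrightarrow> u z = 0"
  shows "continuous_on S (\<lambda>z. u z / d z * w z)"
  unfolding continuous_on_def
proof (intro ballI)
  fix x assume x: "x \<in> S"
  have lim: "(u \<longlongrightarrow> u x) (at x within S)" "(d \<longlongrightarrow> d x) (at x within S)" "(w \<longlongrightarrow> w x) (at x within S)"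
    using assms(1-3) x by (auto simp: continuous_on_def)
  show "((\<lambda>z. u z / d z * w z) \<longlongrightarrow> u x / d x * w x) (at x within S)"
  proof (cases "d x = 0")
    case False
    then show ?thesis using lim by (intro tendsto_intros)
  next
    case True
    have "((\<lambda>z. u z / d z * w z) \<longlongrightarrow> 0) (at x within S)"
    proof (rule Lim_null_comparison)
      have "(u \<longlongrightarrow> 0) (at x within S)" using lim(1) u[OF x True] by simp
      then show "((\<lambda>z. \<bar>u z\<bar>) \<longlongrightarrow> 0) (at x within S)" by (simp add: tendsto_rabs_zero)
      have "norm (u z / d z * w z) \<le> \<bar>u z\<bar>" if "z \<in> S" for z
      proof (cases "d z = 0")
        case False
        then have "0 \<le> w z / d z" "w z / d z \<le> 1" using w[OF that] by (auto simp: divide_simps)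
        then have "\<bar>u z\<bar> * (w z / d z) \<le> \<bar>u z\<bar> * 1" by (intro mult_left_mono) auto
        then show ?thesis using w[OF that] by (simp add: abs_mult)
      qed simp
      then show "\<forall>\<^sub>F z in at x within S. norm (u z / d z * w z) \<le> \<bar>u z\<bar>"
        by (simp add: eventually_at_filter)
    qed
    then show ?thesis using True by simp
  qed
qed

text \<open>On the vertical line over \<open>x\<close> only the interval from \<open>A x\<close> to
  \<open>B x\<close> moves, so that the graph of \<open>n\<close> goes to the graph of
  \<open>m\<close>. By \<open>disk\<close>, a point of the unit circle is never strictly inside this
  interval, hence it stays fixed.\<close>

locale fibre_nodes =
  fixes A n m B :: "real \<Rightarrow> real"
  assumes contA: "continuous_on {-1..1} A" and contn: "continuous_on {-1..1} n"
    and contm: "continuous_on {-1..1} m" and contB: "continuous_on {-1..1} B"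
    and disk: "\<And>x. -1 \<le> x \<Longrightarrow> x \<le> 1 \<Longrightarrow> - sqrt (1 - x\<^sup>2) \<le> A x \<and> B x \<le> sqrt (1 - x\<^sup>2)"
    and order: "\<And>x. -1 \<le> x \<Longrightarrow> x \<le> 1 \<Longrightarrow> A x \<le> n x \<and> n x \<le> B x \<and> A x \<le> m x \<and> m x \<le> B x"
    and degenerate: "\<And>x. -1 \<le> x \<Longrightarrow> x \<le> 1 \<Longrightarrow> (A x = n x \<longleftrightarrow> A x = m x) \<and> (B x = n x \<longleftrightarrow> B x = m x)"
begin

text \<open>Outside the moving interval clamping yields an end point, where the displacement
  vanishes. One formula without cases is thus the identity there, and its continuity reduces to that
  of the two terms with quotients.\<close>

definition fibre_map :: "complex \<Rightarrow> complex" where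
  "fibre_map z = (let x = Re z; y = Im z; c = max (A x) (min y (B x)) in
     Complex x (y + (interpolate (A x) (n x) (m x) (B x) c - c)))"

lemma fibre_swap: "fibre_nodes A m n B"
  using contA contn contm contB disk order degenerate by unfold_locales auto

lemma in_cball_iff: "z \<in> cball 0 1 \<longleftrightarrow> -1 \<le> Re z \<and> Re z \<le> 1 \<and> \<bar>Im z\<bar> \<le> sqrt (1 - (Re z)\<^sup>2)"
proof -
  have "z \<in> cball 0 1 \<longleftrightarrow> (Re z)\<^sup>2 + (Im z)\<^sup>2 \<le> 1"
    by (simp add: cmod_def)
  also have "\<dots> \<longleftrightarrow> \<bar>Re z\<bar> \<le> 1 \<and> \<bar>Im z\<bar> \<le> sqrt (1 - (Re z)\<^sup>2)"
  proof safe
    assume a: "(Re z)\<^sup>2 + (Im z)\<^sup>2 \<le> 1"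
    then have "(Re z)\<^sup>2 \<le> 1" using zero_le_power2[of "Im z"] by linarith
    then show "\<bar>Re z\<bar> \<le> 1" by (simp add: abs_square_le_1)
    have "sqrt ((Im z)\<^sup>2) \<le> sqrt (1 - (Re z)\<^sup>2)" using a by (intro real_sqrt_le_mono) simp
    then show "\<bar>Im z\<bar> \<le> sqrt (1 - (Re z)\<^sup>2)" by simp
  next
    assume a: "\<bar>Re z\<bar> \<le> 1" "\<bar>Im z\<bar> \<le> sqrt (1 - (Re z)\<^sup>2)"
    then have "\<bar>Im z\<bar>\<^sup>2 \<le> (sqrt (1 - (Re z)\<^sup>2))\<^sup>2" by (intro power_mono) auto
    moreover have "(Re z)\<^sup>2 \<le> 1" using a by (simp add: abs_square_le_1)
    ultimately show "(Re z)\<^sup>2 + (Im z)\<^sup>2 \<le> 1" by simp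
  qed
  finally show ?thesis by auto
qed

lemma fibre_map_between:
  assumes "-1 \<le> Re z" "Re z \<le> 1" "A (Re z) \<le> Im z" "Im z \<le> B (Re z)"
  shows "fibre_map z = Complex (Re z) (interpolate (A (Re z)) (n (Re z)) (m (Re z)) (B (Re z)) (Im z))"
  using assms by (simp add: fibre_map_def Let_def)

lemma fibre_map_outside:
  assumes "-1 \<le> Re z" "Re z \<le> 1" "Im z \<le> A (Re z) \<or> B (Re z) \<le> Im z"
  shows "fibre_map z = z"
  using assms order[of "Re z"] degenerate[of "Re z"]
  by (auto simp: fibre_map_def Let_def interpolate_ends complex_eq_iff min_def max_def)

lemma fibre_map_node: "-1 \<le> x \<Longrightarrow> x \<le> 1 \<Longrightarrow> fibre_map (Complex x (n x)) = Complex x (m x)"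
  using order[of x] degenerate[of x] by (simp add: fibre_map_between interpolate_node)

lemma fibre_map_inverse:
  assumes "z \<in> cball 0 1"
  shows "fibre_nodes.fibre_map A m n B (fibre_map z) = z" "fibre_map z \<in> cball 0 1"
proof -
  interpret s: fibre_nodes A m n B by (rule fibre_swap)
  have x: "-1 \<le> Re z" "Re z \<le> 1" using assms in_cball_iff by auto
  have "s.fibre_map (fibre_map z) = z \<and> fibre_map z \<in> cball 0 1"
  proof (cases "A (Re z) \<le> Im z \<and> Im z \<le> B (Re z)")
    case True
    let ?y = "interpolate (A (Re z)) (n (Re z)) (m (Re z)) (B (Re z)) (Im z)"
    have "A (Re z) \<le> ?y" "?y \<le> B (Re z)"
      "interpolate (A (Re z)) (m (Re z)) (n (Re z)) (B (Re z)) ?y = Im z"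
      using interpolate_inverse[of "A (Re z)" "n (Re z)" "B (Re z)" "m (Re z)" "Im z"]
        order[OF x] degenerate[OF x] True by auto
    moreover from this have "Complex (Re z) ?y \<in> cball 0 1"
      unfolding in_cball_iff using x disk[OF x] by auto
    ultimately show ?thesis
      using x True by (simp add: fibre_map_between s.fibre_map_between)
  next
    case False
    then have "Im z \<le> A (Re z) \<or> B (Re z) \<le> Im z" by auto
    then show ?thesis using assms x by (simp only: fibre_map_outside s.fibre_map_outside)
  qed
  then show "fibre_nodes.fibre_map A m n B (fibre_map z) = z" "fibre_map z \<in> cball 0 1" by auto
qed

lemma continuous_fibre_map: "continuous_on (cball 0 1) fibre_map"
proof -
  have Re: "Re ` cball 0 1 \<subseteq> {-1..1}" using in_cball_iff by auto
  note c = contA[THEN continuous_on_compose2, OF continuous_on_Re[OF continuous_on_id] Re]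
    contn[THEN continuous_on_compose2, OF continuous_on_Re[OF continuous_on_id] Re]
    contm[THEN continuous_on_compose2, OF continuous_on_Re[OF continuous_on_id] Re]
    contB[THEN continuous_on_compose2, OF continuous_on_Re[OF continuous_on_id] Re]
  let ?c = "\<lambda>z. max (A (Re z)) (min (Im z) (B (Re z)))"
  have r: "-1 \<le> Re z \<and> Re z \<le> 1" if "z \<in> cball 0 1" for z using that in_cball_iff by auto
  \<comment> \<open>The slope may be unbounded where \<open>n\<close> approaches \<open>A\<close>;
    the factor next to it is at most the denominator, which is what
    \<open>continuous_on_divide_times\<close> asks for.\<close>
  have 1: "continuous_on (cball 0 1) (\<lambda>z. (m (Re z) - A (Re z)) / (n (Re z) - A (Re z)) * (min (?c z) (n (Re z)) - A (Re z)))"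
  proof (rule continuous_on_divide_times)
    fix z :: complex assume "z \<in> cball 0 1"
    note r = r[OF this]
    show "0 \<le> min (?c z) (n (Re z)) - A (Re z) \<and> min (?c z) (n (Re z)) - A (Re z) \<le> n (Re z) - A (Re z)"
      using order[of "Re z"] r by auto
    assume "n (Re z) - A (Re z) = 0"
    then show "m (Re z) - A (Re z) = 0" using degenerate[of "Re z"] r by auto
  qed (intro continuous_intros c)+
  have 2: "continuous_on (cball 0 1) (\<lambda>z. (B (Re z) - m (Re z)) / (B (Re z) - n (Re z)) * (max (?c z) (n (Re z)) - n (Re z)))"
  proof (rule continuous_on_divide_times)
    fix z :: complex assume "z \<in> cball 0 1"
    note r = r[OF this]
    show "0 \<le> max (?c z) (n (Re z)) - n (Re z) \<and> max (?c z) (n (Re z)) - n (Re z) \<le> B (Re z) - n (Re z)"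
      using order[of "Re z"] r by auto
    assume "B (Re z) - n (Re z) = 0"
    then show "B (Re z) - m (Re z) = 0" using degenerate[of "Re z"] r by auto
  qed (intro continuous_intros c)+
  have c': "continuous_on (cball 0 1) ?c" by (intro continuous_intros c)
  have "continuous_on (cball 0 1)
      (\<lambda>z. Im z + (interpolate (A (Re z)) (n (Re z)) (m (Re z)) (B (Re z)) (?c z) - ?c z))"
    unfolding interpolate_def
    by (rule continuous_on_add[OF continuous_on_Im[OF continuous_on_id]
          continuous_on_diff[OF continuous_on_add[OF continuous_on_add[OF c(1) 1] 2] c']])
  note 3 = this
  have "continuous_on (cball 0 1) (\<lambda>z. of_real (Re z) + \<i> * of_real
      (Im z + (interpolate (A (Re z)) (n (Re z)) (m (Re z)) (B (Re z)) (?c z) - ?c z)))"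
    by (rule continuous_on_add[OF continuous_on_of_real[OF continuous_on_Re[OF continuous_on_id]]
          continuous_on_mult_left[OF continuous_on_of_real[OF 3]]])
  moreover have "fibre_map = (\<lambda>z. of_real (Re z) + \<i> * of_real
      (Im z + (interpolate (A (Re z)) (n (Re z)) (m (Re z)) (B (Re z)) (?c z) - ?c z)))"
    by (auto simp: fibre_map_def Let_def Complex_eq)
  ultimately show ?thesis by simp
qed

lemma disk_homeo_fibre_map: "disk_homeo fibre_map"
  unfolding disk_homeo_def
proof (intro conjI allI impI)
  interpret s: fibre_nodes A m n B by (rule fibre_swap)
  show "bij_betw fibre_map (cball 0 1) (cball 0 1)"
    by (rule bij_betw_byWitness[of _ s.fibre_map])
      (use fibre_map_inverse s.fibre_map_inverse in \<open>auto simp del: mem_cball_0\<close>)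
  fix z :: complex assume z: "norm z = 1"
  then have "z \<in> cball 0 1" by simp
  then have x: "-1 \<le> Re z" "Re z \<le> 1" using in_cball_iff by auto
  have "(Re z)\<^sup>2 + (Im z)\<^sup>2 = 1" using z by (simp add: cmod_def)
  then have "sqrt (1 - (Re z)\<^sup>2) = \<bar>Im z\<bar>" by (metis add_diff_cancel_left' real_sqrt_abs)
  then show "fibre_map z = z" using disk[OF x] by (intro fibre_map_outside x) auto
qed (rule continuous_fibre_map)

end

subsection \<open>Ambient isotopies of the sphere\<close>

text \<open>The end map of an ambient isotopy, separated from the set that it moves: the same map
  can then act on a projection and on its arrangement. Only its values on the sphere are
  prescribed.\<close>

definition isotopic_to_id :: "(real^3 \<Rightarrow> real^3) \<Rightarrow> bool" where
  "isotopic_to_id \<Gamma> \<longleftrightarrow>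
     (\<exists>H :: real \<Rightarrow> real^3 \<Rightarrow> real^3.
        continuous_on ({0..1} \<times> S2) (\<lambda>(t, x). H t x) \<and>
        (\<forall>t\<in>{0..1}. \<exists>K. homeomorphism S2 S2 (H t) K) \<and>
        (\<forall>x\<in>S2. H 0 x = x) \<and> (\<forall>x\<in>S2. H 1 x = \<Gamma> x))"

lemma isotopic_iff:
  assumes "A \<subseteq> S2"
  shows "isotopic A B \<longleftrightarrow> (\<exists>\<Gamma>. isotopic_to_id \<Gamma> \<and> \<Gamma> ` A = B)"
proof
  assume "isotopic A B"
  then obtain H :: "real \<Rightarrow> real^3 \<Rightarrow> real^3" where "continuous_on ({0..1} \<times> S2) (\<lambda>(t, x). H t x)"
    "\<forall>t\<in>{0..1}. \<exists>K. homeomorphism S2 S2 (H t) K" "\<forall>x\<in>S2. H 0 x = x" "H 1 ` A = B"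
    unfolding isotopic_def by blast
  then show "\<exists>\<Gamma>. isotopic_to_id \<Gamma> \<and> \<Gamma> ` A = B"
    unfolding isotopic_to_id_def by (intro exI[of _ "H 1"]) auto
next
  assume "\<exists>\<Gamma>. isotopic_to_id \<Gamma> \<and> \<Gamma> ` A = B"
  then obtain \<Gamma> and H :: "real \<Rightarrow> real^3 \<Rightarrow> real^3" where H: "continuous_on ({0..1} \<times> S2) (\<lambda>(t, x). H t x)"
    "\<forall>t\<in>{0..1}. \<exists>K. homeomorphism S2 S2 (H t) K" "\<forall>x\<in>S2. H 0 x = x" "\<forall>x\<in>S2. H 1 x = \<Gamma> x"
    and B: "\<Gamma> ` A = B"
    unfolding isotopic_to_id_def by blast
  have "H 1 ` A = B" using H(4) B assms by (metis (no_types, lifting) image_cong subsetD)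
  then show "isotopic A B" unfolding isotopic_def using H by blast
qed

lemma isotopic_to_id_homeomorphism:
  assumes "isotopic_to_id \<Gamma>"
  obtains K where "homeomorphism S2 S2 \<Gamma> K"
proof -
  obtain H :: "real \<Rightarrow> real^3 \<Rightarrow> real^3"
    where H: "\<forall>t\<in>{0..1}. \<exists>K. homeomorphism S2 S2 (H t) K" "\<forall>x\<in>S2. H 1 x = \<Gamma> x"
    using assms unfolding isotopic_to_id_def by blast
  obtain K where "homeomorphism S2 S2 (H 1) K" using H(1)[rule_format, of 1] by auto
  then have "homeomorphism S2 S2 \<Gamma> K"
    by (rule homeomorphism_cong) (use H(2) in auto)
  then show ?thesis using that by blast
qed

lemma isotopic_to_id_id: "isotopic_to_id (\<lambda>x. x)"
proof -
  have "continuous_on ({0..1} \<times> S2) (\<lambda>(t::real, x::real^3). x)"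
    by (simp add: case_prod_unfold continuous_on_snd)
  moreover have "homeomorphism S2 S2 (\<lambda>x::real^3. x) (\<lambda>x. x)" by (simp add: homeomorphism_def)
  ultimately show ?thesis
    unfolding isotopic_to_id_def by (intro exI[of _ "\<lambda>t x. x"]) auto
qed

lemma isotopic_to_id_compose:
  assumes "isotopic_to_id \<Gamma>" "isotopic_to_id \<Delta>"
  shows "isotopic_to_id (\<Delta> \<circ> \<Gamma>)"
proof -
  obtain H :: "real \<Rightarrow> real^3 \<Rightarrow> real^3" where H: "continuous_on ({0..1} \<times> S2) (\<lambda>(t, x). H t x)"
    "\<And>t. t\<in>{0..1} \<Longrightarrow> \<exists>K. homeomorphism S2 S2 (H t) K" "\<And>x. x\<in>S2 \<Longrightarrow> H 0 x = x" "\<And>x. x\<in>S2 \<Longrightarrow> H 1 x = \<Gamma> x"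
    using assms(1) unfolding isotopic_to_id_def by auto
  obtain J :: "real \<Rightarrow> real^3 \<Rightarrow> real^3" where J: "continuous_on ({0..1} \<times> S2) (\<lambda>(t, x). J t x)"
    "\<And>t. t\<in>{0..1} \<Longrightarrow> \<exists>K. homeomorphism S2 S2 (J t) K" "\<And>x. x\<in>S2 \<Longrightarrow> J 0 x = x" "\<And>x. x\<in>S2 \<Longrightarrow> J 1 x = \<Delta> x"
    using assms(2) unfolding isotopic_to_id_def by auto
  have im: "H t ` S2 = S2" if "t \<in> {0..1}" for t using H(2)[OF that] by (auto simp: homeomorphism_def)
  \<comment> \<open>Composing at equal times, instead of running the isotopies one after the other,
    leaves no time intervals to be glued.\<close>
  let ?L = "\<lambda>t x. J t (H t x)"
  have pair: "continuous_on ({0..1} \<times> S2) (\<lambda>z. (fst z, H (fst z) (snd z)))"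
    using H(1) by (intro continuous_on_Pair continuous_on_fst continuous_on_id) (simp add: case_prod_unfold)
  have "continuous_on ({0..1} \<times> S2) (\<lambda>z. (\<lambda>(t, x). J t x) (fst z, H (fst z) (snd z)))"
    by (rule continuous_on_compose2[OF J(1) pair]) (use im in fastforce)
  then have "continuous_on ({0..1} \<times> S2) (\<lambda>(t, x). ?L t x)"
    by (simp add: case_prod_unfold)
  moreover have "\<exists>K. homeomorphism S2 S2 (?L t) K" if t: "t \<in> {0..1}" for t
  proof -
    obtain K K' where "homeomorphism S2 S2 (H t) K" "homeomorphism S2 S2 (J t) K'"
      using H(2)[OF t] J(2)[OF t] by blast
    then have "homeomorphism S2 S2 (J t \<circ> H t) (K \<circ> K')" by (rule homeomorphism_compose)
    then show ?thesis by (auto simp: o_def)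
  qed
  moreover have "\<Gamma> x \<in> S2" if "x \<in> S2" for x
    using im[of 1] H(4)[OF that] imageI[OF that, of "H 1"] by simp
  then have "\<forall>x\<in>S2. ?L 0 x = x" "\<forall>x\<in>S2. ?L 1 x = (\<Delta> \<circ> \<Gamma>) x"
    using H J by auto
  ultimately show ?thesis unfolding isotopic_to_id_def by (intro exI[of _ ?L]) auto
qed

lemma isotopic_to_id_inverse:
  assumes "isotopic_to_id \<Gamma>" and K: "homeomorphism S2 S2 \<Gamma> K"
  shows "isotopic_to_id K"
proof -
  obtain H :: "real \<Rightarrow> real^3 \<Rightarrow> real^3" where H: "continuous_on ({0..1} \<times> S2) (\<lambda>(t, x). H t x)"
    "\<And>t. t\<in>{0..1} \<Longrightarrow> \<exists>K. homeomorphism S2 S2 (H t) K" "\<And>x. x\<in>S2 \<Longrightarrow> H 0 x = x" "\<And>x. x\<in>S2 \<Longrightarrow> H 1 x = \<Gamma> x"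
    using assms(1) unfolding isotopic_to_id_def by auto
  \<comment> \<open>The isotopy is run backwards after \<open>K\<close>, from
    \<open>\<Gamma>\<close> composed with \<open>K\<close>, which is the identity, to
    \<open>K\<close>. The inverses of the maps \<open>H t\<close> would need an argument for joint
    continuity; here it is immediate.\<close>
  let ?L = "\<lambda>t x. H (1 - t) (K x)"
  have KS: "K x \<in> S2" if "x \<in> S2" for x using K that by (auto simp: homeomorphism_def)
  have "continuous_on ({0..1} \<times> S2) (\<lambda>z. K (snd z))"
    by (rule continuous_on_compose2[OF homeomorphism_cont2[OF K]])
      (auto intro: continuous_on_snd continuous_on_id)
  then have pair: "continuous_on ({0..1} \<times> S2) (\<lambda>z. (1 - fst z :: real, K (snd z)))"
    by (intro continuous_on_Pair continuous_intros)
  have "continuous_on ({0..1} \<times> S2) (\<lambda>z. (\<lambda>(t, x). H t x) (1 - fst z, K (snd z)))"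
    by (rule continuous_on_compose2[OF H(1) pair]) (use KS in fastforce)
  then have "continuous_on ({0..1} \<times> S2) (\<lambda>(t, x). ?L t x)"
    by (simp add: case_prod_unfold)
  moreover have "\<exists>K'. homeomorphism S2 S2 (?L t) K'" if t: "t \<in> {0..1}" for t
  proof -
    have "1 - t \<in> {0..1}" using t by auto
    then obtain K' where "homeomorphism S2 S2 (H (1 - t)) K'" using H(2) by blast
    then have "homeomorphism S2 S2 (H (1 - t) \<circ> K) (\<Gamma> \<circ> K')"
      using K homeomorphism_symD homeomorphism_compose by blast
    then show ?thesis by (auto simp: o_def)
  qed
  moreover have "\<forall>x\<in>S2. ?L 0 x = x" "\<forall>x\<in>S2. ?L 1 x = K x"
    using H KS K by (auto simp: homeomorphism_def)
  ultimately show ?thesis unfolding isotopic_to_id_def by (intro exI[of _ ?L]) auto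
qed

lemma isotopic_subset: "A \<subseteq> S2 \<Longrightarrow> isotopic A B \<Longrightarrow> B \<subseteq> S2"
proof -
  assume A: "A \<subseteq> S2" and "isotopic A B"
  then obtain \<Gamma> where "isotopic_to_id \<Gamma>" "\<Gamma> ` A = B" using isotopic_iff by blast
  then obtain K where "homeomorphism S2 S2 \<Gamma> K" by (auto elim: isotopic_to_id_homeomorphism)
  then have "\<Gamma> ` S2 = S2" by (simp add: homeomorphism_def)
  then show "B \<subseteq> S2" using A \<open>\<Gamma> ` A = B\<close> by blast
qed

lemma isotopic_refl: "A \<subseteq> S2 \<Longrightarrow> isotopic A A"
  using isotopic_to_id_id by (subst isotopic_iff) (auto intro!: exI[of _ "\<lambda>x. x"])

lemma isotopic_trans:
  assumes "A \<subseteq> S2" "isotopic A B" "isotopic B C"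
  shows "isotopic A C"
proof -
  obtain \<Gamma> where "isotopic_to_id \<Gamma>" "\<Gamma> ` A = B" using assms(1,2) isotopic_iff by blast
  moreover have "B \<subseteq> S2" by (rule isotopic_subset[OF assms(1,2)])
  then obtain \<Delta> where "isotopic_to_id \<Delta>" "\<Delta> ` B = C" using assms(3) isotopic_iff by blast
  ultimately have "isotopic_to_id (\<Delta> \<circ> \<Gamma>)" "(\<Delta> \<circ> \<Gamma>) ` A = C"
    using isotopic_to_id_compose by (auto simp: image_comp)
  then show ?thesis using assms isotopic_iff by blast
qed

lemma isotopic_sym:
  assumes "A \<subseteq> S2" "isotopic A B"
  shows "isotopic B A"
proof -
  obtain \<Gamma> where G: "isotopic_to_id \<Gamma>" "\<Gamma> ` A = B"
    using assms isotopic_iff by blast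
  then obtain K where K: "homeomorphism S2 S2 \<Gamma> K" using isotopic_to_id_homeomorphism by blast
  have "K (\<Gamma> x) = x" if "x \<in> A" for x
    by (rule homeomorphism_apply1[OF K]) (use that assms(1) in blast)
  then have "K ` \<Gamma> ` A = A" by (simp add: image_image)
  then have "K ` B = A" using G by simp
  then show ?thesis
    using isotopic_to_id_inverse[OF G(1) K] isotopic_iff isotopic_subset assms by metis
qed

section \<open>Disks in the sphere and the Alexander trick\<close>

lemma disk_embedding_openin:
  assumes "disk_embedding \<phi>"
  shows "openin (top_of_set S2) (\<phi> ` ball 0 1)"
proof -
  have \<phi>: "continuous_on (cball 0 1) \<phi>" "inj_on \<phi> (cball 0 1)" "\<phi> ` cball 0 1 \<subseteq> S2"
    using assms by (auto simp: disk_embedding_def)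
  have p: "\<phi> 1 \<in> S2" using \<phi>(3) by force
  \<comment> \<open>Without \<open>\<phi> 1\<close> the sphere is a plane, where invariance of
    domain applies. This point is suitable because it comes from the boundary circle, so by
    injectivity the image of the open disk misses it.\<close>
  let ?T = "{x::real^3. axis 1 1 \<bullet> x = 0}"
  have "(S2 - {\<phi> 1}) homeomorphic ?T"
    by (rule homeomorphic_punctured_sphere_hyperplane) (use p in \<open>auto simp: axis_eq_0_iff\<close>)
  then obtain h k where hk: "homeomorphism (S2 - {\<phi> 1}) ?T h k" by (auto simp: homeomorphic_def)
  have sub: "\<phi> ` ball 0 1 \<subseteq> S2 - {\<phi> 1}"
  proof
    fix x assume "x \<in> \<phi> ` ball 0 1"
    then obtain z where z: "x = \<phi> z" "norm z < 1" by auto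
    then have "\<phi> z \<noteq> \<phi> 1" using inj_onD[OF \<phi>(2), of z 1] by auto
    then show "x \<in> S2 - {\<phi> 1}" using z \<phi>(3) by (auto simp: image_subset_iff)
  qed
  have c: "continuous_on (ball 0 1) (h \<circ> \<phi>)"
    using hk sub \<phi>(1) unfolding homeomorphism_def
    by (intro continuous_on_compose) (auto intro: continuous_on_subset)
  have i: "inj_on (h \<circ> \<phi>) (ball 0 1)"
  proof (rule comp_inj_on)
    show "inj_on \<phi> (ball 0 1)" using \<phi>(2) by (rule inj_on_subset) auto
    show "inj_on h (\<phi> ` ball 0 1)"
      by (rule inj_on_inverseI[where g = k], rule homeomorphism_apply1[OF hk]) (use sub in blast)
  qed
  have im: "(h \<circ> \<phi>) ` ball 0 1 \<subseteq> ?T" using hk sub by (auto simp: homeomorphism_def)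
  have "openin (top_of_set ?T) ((h \<circ> \<phi>) ` ball 0 1)"
  proof (rule invariance_of_domain_subspaces[OF _ _ _ _ c _ i])
    show "openin (top_of_set UNIV) (ball 0 1 :: complex set)" by (simp add: open_openin[symmetric])
    show "subspace ?T" by (rule subspace_hyperplane)
    have "dim ?T = DIM(real^3) - 1" by (rule dim_hyperplane) (simp add: axis_eq_0_iff)
    then show "dim ?T \<le> dim (UNIV :: complex set)" by simp
  qed (use im in auto)
  then have "openin (top_of_set (S2 - {\<phi> 1})) (k ` (h \<circ> \<phi>) ` ball 0 1)"
    using homeomorphism_imp_open_map[OF homeomorphism_symD[OF hk]] by blast
  also have "k ` (h \<circ> \<phi>) ` ball 0 1 = \<phi> ` ball 0 1"
  proof -
    have "k (h (\<phi> z)) = \<phi> z" if "z \<in> ball 0 1" for z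
      by (rule homeomorphism_apply1[OF hk]) (use that sub in blast)
    then show ?thesis by (simp add: image_image)
  qed
  finally show ?thesis
    by (rule openin_trans) (simp add: openin_delete)
qed

lemma disk_embedding_compact: "disk_embedding \<phi> \<Longrightarrow> compact (\<phi> ` cball 0 1)"
  by (simp add: disk_embedding_def compact_continuous_image)

text \<open>At time \<open>t\<close> the map \<open>G\<close> acts, scaled by \<open>t\<close>, on
  the disk of radius \<open>t\<close>, and the rest is fixed. Expressed by the displacement of
  \<open>G\<close>, extended by 0 to the plane, the family is continuous at time 0 because points
  are displaced by at most \<open>2 * t\<close> at time \<open>t\<close>.\<close>

lemma Alexander_trick:
  assumes "disk_homeo G"
  obtains H :: "real \<Rightarrow> complex \<Rightarrow> complex" where
    "continuous_on ({0..1} \<times> cball 0 1) (\<lambda>(t, z). H t z)"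
    "\<And>t. t \<in> {0..1} \<Longrightarrow> disk_homeo (H t)"
    "\<And>z. H 0 z = z" "\<And>z. z \<in> cball 0 1 \<Longrightarrow> H 1 z = G z"
proof -
  have G: "continuous_on (cball 0 1) G" "bij_betw G (cball 0 1) (cball 0 1)" "\<And>z. norm z = 1 \<Longrightarrow> G z = z"
    using assms by (auto simp: disk_homeo_def)
  define D where "D w = (if norm w \<le> 1 then G w - w else 0)" for w
  \<comment> \<open>At \<open>t = 0\<close> the quotient is 0 by convention, and the factor
    \<open>t\<close> makes the displacement vanish.\<close>
  define H where "H t z = z + of_real t * D (z / of_real t)" for t z
  have GD: "norm (G w) \<le> 1" if "norm w \<le> 1" for w
    using G(2) that by (auto simp: bij_betw_def)
  have bound: "norm (D w) \<le> 2" for w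
    using GD[of w] norm_triangle_ineq4[of "G w" w] by (auto simp: D_def)
  have "continuous_on (cball 0 1 \<union> - ball 0 1) (\<lambda>w. if norm w \<le> 1 then G w - w else 0)"
    by (rule continuous_on_cases) (use G in \<open>auto intro!: continuous_intros\<close>)
  moreover have "cball 0 1 \<union> - ball 0 1 = (UNIV :: complex set)" by auto
  ultimately have cD: "continuous_on UNIV D" by (simp add: D_def[abs_def])
  have cont: "continuous_on ({0..1} \<times> cball 0 1) (\<lambda>(t, z). H t z)"
    unfolding continuous_on_def
  proof (intro ballI)
    fix x :: "real \<times> complex" assume "x \<in> {0..1} \<times> cball 0 1"
    obtain t z where x: "x = (t, z)" by force
    let ?F = "at x within {0..1} \<times> cball 0 1"
    have f: "(fst \<longlongrightarrow> t) ?F" "(snd \<longlongrightarrow> z) ?F"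
      using x tendsto_fst[of "\<lambda>y. y" x ?F] tendsto_snd[of "\<lambda>y. y" x ?F] by (auto simp: tendsto_ident_at)
    have "((\<lambda>y. of_real (fst y) * D (snd y / of_real (fst y))) \<longlongrightarrow> of_real t * D (z / of_real t)) ?F"
    proof (cases "t = 0")
      case False
      have "isCont D (z / of_real t)" using cD by (simp add: continuous_on_eq_continuous_at)
      moreover have "((\<lambda>y. snd y / of_real (fst y)) \<longlongrightarrow> z / of_real t) ?F"
        using False f by (intro tendsto_intros) auto
      ultimately have "((\<lambda>y. D (snd y / of_real (fst y))) \<longlongrightarrow> D (z / of_real t)) ?F"
        by (rule isCont_tendsto_compose)
      then show ?thesis using f by (intro tendsto_intros)
    next
      case True
      have "((\<lambda>y. of_real (fst y) * D (snd y / of_real (fst y))) \<longlongrightarrow> 0) ?F"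
      proof (rule Lim_null_comparison)
        have "norm (of_real (fst y) * D (snd y / of_real (fst y))) \<le> \<bar>fst y\<bar> * 2" for y :: "real \<times> complex"
          unfolding norm_mult by (intro mult_mono) (auto simp: bound)
        then show "\<forall>\<^sub>F y in ?F. norm (of_real (fst y) * D (snd y / of_real (fst y))) \<le> \<bar>fst y\<bar> * 2"
          by simp
        show "((\<lambda>y. \<bar>fst y\<bar> * 2) \<longlongrightarrow> 0) ?F"
          using f(1) True by (intro tendsto_mult_left_zero tendsto_rabs_zero) auto
      qed
      then show ?thesis using True by simp
    qed
    then have "((\<lambda>y. snd y + of_real (fst y) * D (snd y / of_real (fst y))) \<longlongrightarrow> z + of_real t * D (z / of_real t)) ?F"
      using f by (intro tendsto_add)
    then show "((\<lambda>(t, z). H t z) \<longlongrightarrow> (case x of (t, z) \<Rightarrow> H t z)) ?F"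
      by (simp add: x H_def case_prod_unfold)
  qed
  \<comment> \<open>The two descriptions overlap on the circle of radius \<open>t\<close>, where
    \<open>G\<close> acts as the identity.\<close>
  have small: "H t z = of_real t * G (z / of_real t)" if "norm z \<le> t" "0 < t" for t z
    using that by (auto simp: H_def D_def norm_divide field_simps)
  have large: "H t z = z" if "t \<le> norm z" "0 \<le> t" for t z
    using that G(3)[of "z / of_real t"] by (auto simp: H_def D_def norm_divide divide_simps split: if_splits)
  have "disk_homeo (H t)" if t: "t \<in> {0..1}" for t
  proof -
    have ct: "continuous_on (cball 0 1) (H t)"
    proof -
      have "continuous_on (cball 0 1) (\<lambda>z. (\<lambda>(t, z). H t z) (t, z))"
        by (rule continuous_on_compose2[OF cont]) (use t in \<open>auto intro!: continuous_intros\<close>)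
      then show ?thesis by simp
    qed
    have inside: "norm (H t z) \<le> t" "\<exists>w. norm w \<le> t \<and> H t w = z" if "norm z \<le> t" for z
    proof -
      have "norm (H t z) \<le> t \<and> (\<exists>w. norm w \<le> t \<and> H t w = z)"
      proof (cases "t = 0")
        case True
        then show ?thesis using that by (auto simp: H_def)
      next
        case False
        then have t0: "0 < t" using t by auto
        have "norm (z / of_real t) \<le> 1" using that t0 by (simp add: norm_divide)
        moreover from this obtain w where w: "norm w \<le> 1" "G w = z / of_real t"
          using G(2) unfolding bij_betw_def by (metis (no_types, lifting) imageE mem_cball_0)
        moreover have "norm (of_real t * w) \<le> t" using w t0 by (simp add: norm_mult mult_le_one)
        ultimately show ?thesis
          using GD[of "z / of_real t"] t0 that small[of z t] small[of "of_real t * w" t]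
          by (auto simp: norm_mult mult_le_cancel_left2 intro!: exI[of _ "of_real t * w"])
      qed
      then show "norm (H t z) \<le> t" "\<exists>w. norm w \<le> t \<and> H t w = z" by auto
    qed
    have inj: "H t z = H t w \<Longrightarrow> z = w" if "norm z \<le> t" "norm w \<le> t" for z w
    proof (cases "t = 0")
      case False
      then have t0: "0 < t" using t by auto
      assume "H t z = H t w"
      then have "G (z / of_real t) = G (w / of_real t)" using small that t0 by simp
      then have "z / of_real t = w / of_real t"
        by (rule inj_onD[OF bij_betw_imp_inj_on[OF G(2)], of "z / of_real t"]) (use that t0 in \<open>auto simp: norm_divide\<close>)
      then show "z = w" using t0 by simp
    qed (use that in auto)
    have "inj_on (H t) (cball 0 1)"
    proof (rule inj_onI)
      fix z w assume e: "H t z = H t w"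
      consider "norm z \<le> t" "norm w \<le> t" | "norm z \<le> t" "norm w > t" | "norm z > t" "norm w \<le> t"
        | "norm z > t" "norm w > t" by linarith
      then show "z = w"
        using t e inj inside(1)[of z] inside(1)[of w] large[of t z] large[of t w] by cases auto
    qed
    moreover have "H t ` cball 0 1 = cball 0 1"
    proof safe
      fix z :: complex assume "z \<in> cball 0 1"
      then show "H t z \<in> cball 0 1"
        using t inside(1)[of z] large[of t z] by (cases "norm z \<le> t") auto
    next
      fix z :: complex assume z: "z \<in> cball 0 1"
      show "z \<in> H t ` cball 0 1"
      proof (cases "norm z \<le> t")
        case True
        then obtain w where "norm w \<le> t" "H t w = z" using inside(2) by blast
        then show ?thesis using t by (auto intro!: image_eqI[of _ _ w])
      next
        case False
        then show ?thesis using t z large[of t z] by (auto intro!: image_eqI[of _ _ z])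
      qed
    qed
    ultimately show ?thesis
      unfolding disk_homeo_def bij_betw_def using ct large t by auto
  qed
  moreover have "H 0 z = z" for z by (simp add: H_def)
  moreover have "H 1 z = G z" if "z \<in> cball 0 1" for z using that by (simp add: H_def D_def)
  ultimately show ?thesis using that cont by blast
qed

text \<open>The Alexander isotopy is carried to the sphere by \<open>\<phi>\<close> and extended by
  the identity; both parts agree on the boundary circle, which every stage fixes.\<close>

lemma isotopy_extension:
  assumes \<phi>: "disk_embedding \<phi>" and G: "disk_homeo G"
  obtains \<Gamma> where "isotopic_to_id \<Gamma>" "\<And>z. z \<in> cball 0 1 \<Longrightarrow> \<Gamma> (\<phi> z) = \<phi> (G z)"
    "\<And>x. x \<notin> \<phi> ` cball 0 1 \<Longrightarrow> \<Gamma> x = x"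
proof -
  obtain H :: "real \<Rightarrow> complex \<Rightarrow> complex" where H: "continuous_on ({0..1} \<times> cball 0 1) (\<lambda>(t, z). H t z)"
    "\<And>t. t \<in> {0..1} \<Longrightarrow> disk_homeo (H t)"
    "\<And>z. H 0 z = z" "\<And>z. z \<in> cball 0 1 \<Longrightarrow> H 1 z = G z"
    by (rule Alexander_trick[OF G]) blast
  have emb: "continuous_on (cball 0 1) \<phi>" "inj_on \<phi> (cball 0 1)" "\<phi> ` cball 0 1 \<subseteq> S2"
    using \<phi> by (auto simp: disk_embedding_def)
  let ?D = "\<phi> ` cball 0 1"
  obtain \<psi> where \<psi>: "homeomorphism (cball 0 1) ?D \<phi> \<psi>"
    using homeomorphism_compact[OF compact_cball emb(1) refl emb(2)] by blast
  have \<psi>\<phi>: "\<psi> (\<phi> z) = z" if "z \<in> cball 0 1" for z using \<psi> that by (simp add: homeomorphism_def)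
  define K where "K t x = (if x \<in> ?D then \<phi> (H t (\<psi> x)) else x)" for t x
  have K\<phi>: "K t (\<phi> z) = \<phi> (H t z)" if "z \<in> cball 0 1" for t z
    using that \<psi>\<phi> by (simp add: K_def)
  have Kout: "K t x = x" if "x \<notin> \<phi> ` ball 0 1" "t \<in> {0..1}" for t x
  proof (cases "x \<in> ?D")
    case True
    then obtain z where z: "x = \<phi> z" "z \<in> cball 0 1" by blast
    then have "norm z = 1" using that by (cases "norm z < 1") auto
    then have "H t z = z" using H(2)[OF that(2)] by (simp add: disk_homeo_def)
    then show ?thesis using z K\<phi> by simp
  qed (simp add: K_def)
  \<comment> \<open>Gluing needs two closed pieces; that the complement of the open disk is closed
    is invariance of domain.\<close>
  have cl: "closedin (top_of_set S2) (S2 - \<phi> ` ball 0 1)"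
    using disk_embedding_openin[OF \<phi>] by auto
  then have closed2: "closed ({0..1::real} \<times> (S2 - \<phi> ` ball 0 1))"
    by (intro closed_Times) (auto intro: closedin_closed_trans)
  have closed1: "closed ({0..1::real} \<times> ?D)"
    using disk_embedding_compact[OF \<phi>] by (intro closed_Times) (auto intro: compact_imp_closed)
  have cont1: "continuous_on ({0..1} \<times> ?D) (\<lambda>p. \<phi> (H (fst p) (\<psi> (snd p))))"
  proof (rule continuous_on_compose2[OF emb(1)])
    have "continuous_on ({0..1} \<times> ?D) (\<lambda>p. \<psi> (snd p))"
      by (rule continuous_on_compose2[OF homeomorphism_cont2[OF \<psi>]])
        (auto intro: continuous_on_snd continuous_on_id)
    then have "continuous_on ({0..1} \<times> ?D) (\<lambda>p. (fst p :: real, \<psi> (snd p)))"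
      by (intro continuous_on_Pair continuous_on_fst continuous_on_id)
    then have "continuous_on ({0..1} \<times> ?D) (\<lambda>p. (\<lambda>(t, z). H t z) (fst p, \<psi> (snd p)))"
      by (rule continuous_on_compose2[OF H(1)]) (use \<psi>\<phi> in auto)
    then show "continuous_on ({0..1} \<times> ?D) (\<lambda>p. H (fst p) (\<psi> (snd p)))" by simp
    show "(\<lambda>p. H (fst p) (\<psi> (snd p))) ` ({0..1} \<times> ?D) \<subseteq> cball 0 1"
      using H(2) \<psi>\<phi> unfolding disk_homeo_def bij_betw_def by fastforce
  qed
  have cont: "continuous_on ({0..1} \<times> S2) (\<lambda>(t, x). K t x)"
  proof -
    have "continuous_on (({0..1} \<times> ?D) \<union> ({0..1} \<times> (S2 - \<phi> ` ball 0 1)))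
        (\<lambda>p. if snd p \<in> ?D then \<phi> (H (fst p) (\<psi> (snd p))) else snd p)"
    proof (rule continuous_on_cases[OF closed1 closed2 cont1 continuous_on_snd[OF continuous_on_id]], intro allI impI)
      fix p :: "real \<times> (real^3)"
      assume "p \<in> {0..1} \<times> ?D \<and> \<not> snd p \<in> ?D \<or> p \<in> {0..1} \<times> (S2 - \<phi> ` ball 0 1) \<and> snd p \<in> ?D"
      then have "snd p \<in> ?D" "K (fst p) (snd p) = snd p" using Kout[of "snd p" "fst p"] by auto
      then show "\<phi> (H (fst p) (\<psi> (snd p))) = snd p" by (simp add: K_def)
    qed
    moreover have "({0..1::real} \<times> ?D) \<union> ({0..1} \<times> (S2 - \<phi> ` ball 0 1)) = {0..1} \<times> S2"
      using emb(3) by auto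
    ultimately show ?thesis by (simp add: K_def case_prod_unfold)
  qed
  have homeo: "\<exists>L. homeomorphism S2 S2 (K t) L" if t: "t \<in> {0..1}" for t
  proof (rule homeomorphism_compact)
    show "compact S2" by simp
    have "continuous_on S2 (\<lambda>x. (\<lambda>(t, x). K t x) (t, x))"
      by (rule continuous_on_compose2[OF cont]) (use t in \<open>auto intro!: continuous_intros\<close>)
    then show "continuous_on S2 (K t)" by simp
    have b: "bij_betw (H t) (cball 0 1) (cball 0 1)" using H(2)[OF t] by (simp add: disk_homeo_def)
    then have KD: "K t x \<in> ?D \<longleftrightarrow> x \<in> ?D" for x
      using K\<phi> by (cases "x \<in> ?D") (auto simp: K_def bij_betw_def \<psi>\<phi> simp del: mem_cball_0)
    show "inj_on (K t) S2"
    proof (rule inj_onI)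
      fix x y assume e: "K t x = K t y"
      show "x = y"
      proof (cases "x \<in> ?D")
        case True
        then obtain z w where "x = \<phi> z" "y = \<phi> w" "z \<in> cball 0 1" "w \<in> cball 0 1"
          using e KD by (metis imageE)
        moreover from this have "\<phi> (H t z) = \<phi> (H t w)" "H t z \<in> cball 0 1" "H t w \<in> cball 0 1"
          using e K\<phi> b by (auto simp: bij_betw_def simp del: mem_cball_0)
        ultimately show ?thesis using emb(2) b unfolding bij_betw_def inj_on_def by metis
      next
        case False
        then show ?thesis using e KD[of x] KD[of y] by (simp add: K_def)
      qed
    qed
    have "x \<in> K t ` S2" if x: "x \<in> S2" for x
    proof (cases "x \<in> ?D")
      case True
      then obtain z where z: "x = \<phi> z" "z \<in> cball 0 1" by blast
      then obtain w where "w \<in> cball 0 1" "H t w = z" using b by (metis bij_betw_def imageE)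
      then have "K t (\<phi> w) = x" using K\<phi> z by simp
      moreover have "\<phi> w \<in> S2" using \<open>w \<in> cball 0 1\<close> emb(3) by blast
      ultimately have "x \<in> K t ` S2" by (metis imageI)
      then show ?thesis by blast
    next
      case False
      then have "K t x = x" by (simp add: K_def)
      then show ?thesis using x by (metis imageI)
    qed
    moreover have "K t x \<in> S2" if "x \<in> S2" for x
      using that KD[of x] emb(3) by (cases "x \<in> ?D") (auto simp: K_def)
    ultimately show "K t ` S2 = S2" by blast
  qed
  have "\<forall>x\<in>S2. K 0 x = x" using H(3) \<psi>\<phi> by (auto simp: K_def)
  then have "isotopic_to_id (K 1)"
    unfolding isotopic_to_id_def using cont homeo by (intro exI[of _ K]) simp
  moreover have "K 1 (\<phi> z) = \<phi> (G z)" if "z \<in> cball 0 1" for z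
    using that K\<phi> H(4) by simp
  moreover have "K 1 x = x" if "x \<notin> ?D" for x using that by (simp add: K_def)
  ultimately show ?thesis using that by blast
qed

lemma isotopic_disk_replacement:
  assumes "disk_embedding \<phi>" "disk_homeo G" and A: "A \<subseteq> S2" "A \<inter> \<phi> ` cball 0 1 = \<phi> ` X" "X \<subseteq> cball 0 1"
  shows "isotopic A ((A - \<phi> ` cball 0 1) \<union> \<phi> ` G ` X)"
proof -
  obtain \<Gamma> where \<Gamma>: "isotopic_to_id \<Gamma>" "\<And>z. z \<in> cball 0 1 \<Longrightarrow> \<Gamma> (\<phi> z) = \<phi> (G z)"
    "\<And>x. x \<notin> \<phi> ` cball 0 1 \<Longrightarrow> \<Gamma> x = x"
    using isotopy_extension[OF assms(1,2)] by blast
  have "A = (A - \<phi> ` cball 0 1) \<union> \<phi> ` X" using A by blast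
  then have "\<Gamma> ` A = \<Gamma> ` (A - \<phi> ` cball 0 1) \<union> \<Gamma> ` \<phi> ` X" by (metis image_Un)
  also have "\<Gamma> ` (A - \<phi> ` cball 0 1) = A - \<phi> ` cball 0 1" using \<Gamma>(3) by force
  also have "\<Gamma> ` \<phi> ` X = \<phi> ` G ` X" using \<Gamma>(2) A(3) by (force simp: image_image)
  finally show ?thesis using \<Gamma>(1) A(1) isotopic_iff by blast
qed

subsection \<open>Resolving a crossing inside a chart\<close>

definition cross :: "complex set" where
  "cross = {z. norm z \<le> 1 \<and> (Re z = 0 \<or> Im z = 0)}"

lemma cross_eq: "closed_segment (-1) 1 \<union> closed_segment (-\<i>) \<i> = cross"
proof -
  have 1: "z \<in> closed_segment (-1) 1 \<longleftrightarrow> Im z = 0 \<and> norm z \<le> 1" for z :: complex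
  proof
    assume "z \<in> closed_segment (-1) 1"
    then obtain u where u: "0 \<le> u" "u \<le> 1" "z = (1 - u) *\<^sub>R (-1) + u *\<^sub>R 1"
      by (auto simp: closed_segment_def)
    then have "z = of_real (2 * u - 1)" by (auto simp: complex_eq_iff)
    moreover from this have "norm z = \<bar>2 * u - 1\<bar>" by (simp only: norm_of_real)
    ultimately show "Im z = 0 \<and> norm z \<le> 1" using u(1,2) by simp
  next
    assume z: "Im z = 0 \<and> norm z \<le> 1"
    then have e: "z = of_real (Re z)" by (simp add: complex_eq_iff)
    then have "\<bar>Re z\<bar> \<le> 1" using z by (metis norm_of_real)
    then show "z \<in> closed_segment (-1) 1"
      using z by (auto simp: closed_segment_def complex_eq_iff field_simps intro!: exI[of _ "(Re z + 1) / 2"])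
  qed
  have 2: "z \<in> closed_segment (-\<i>) \<i> \<longleftrightarrow> Re z = 0 \<and> norm z \<le> 1" for z :: complex
  proof
    assume "z \<in> closed_segment (-\<i>) \<i>"
    then obtain u where u: "0 \<le> u" "u \<le> 1" "z = (1 - u) *\<^sub>R (-\<i>) + u *\<^sub>R \<i>"
      by (auto simp: closed_segment_def)
    then have "z = \<i> * of_real (2 * u - 1)" by (auto simp: complex_eq_iff)
    moreover from this have "norm z = \<bar>2 * u - 1\<bar>"
      by (simp only: norm_mult norm_ii norm_of_real mult_1_left)
    ultimately show "Re z = 0 \<and> norm z \<le> 1" using u(1,2) by simp
  next
    assume z: "Re z = 0 \<and> norm z \<le> 1"
    then have e: "z = \<i> * of_real (Im z)" by (simp add: complex_eq_iff)
    then have "\<bar>Im z\<bar> \<le> 1" using z by (metis norm_of_real norm_mult norm_ii mult_1)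
    then show "z \<in> closed_segment (-\<i>) \<i>"
      using z by (auto simp: closed_segment_def complex_eq_iff field_simps intro!: exI[of _ "(Im z + 1) / 2"])
  qed
  show ?thesis using 1 2 by (auto simp: cross_def)
qed

definition in_chord :: "complex set" where
  "in_chord = {z. Re z \<le> 0 \<and> Im z \<le> 0 \<and> Re z + Im z = -1}"

definition out_chord :: "complex set" where
  "out_chord = {z. 0 \<le> Re z \<and> 0 \<le> Im z \<and> Re z + Im z = 1}"

lemma nonseifert_chords_eq: "nonseifert_chords = in_chord \<union> out_chord"
proof -
  have "closed_segment (-1) (-\<i>) = in_chord"
  proof safe
    fix z assume "z \<in> closed_segment (-1) (-\<i>)"
    then show "z \<in> in_chord" by (auto simp: closed_segment_def in_chord_def)
  next
    fix z assume "z \<in> in_chord"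
    then show "z \<in> closed_segment (-1) (-\<i>)"
      by (auto simp: closed_segment_def in_chord_def complex_eq_iff intro!: exI[of _ "- Im z"])
  qed
  moreover have "closed_segment 1 \<i> = out_chord"
  proof safe
    fix z assume "z \<in> closed_segment 1 \<i>"
    then show "z \<in> out_chord" by (auto simp: closed_segment_def out_chord_def)
  next
    fix z assume "z \<in> out_chord"
    then show "z \<in> closed_segment 1 \<i>"
      by (auto simp: closed_segment_def out_chord_def complex_eq_iff intro!: exI[of _ "Im z"])
  qed
  ultimately show ?thesis by (simp add: nonseifert_chords_def)
qed

lemma norm_le_1_sum: "\<bar>Re z\<bar> + \<bar>Im z\<bar> \<le> 1 \<Longrightarrow> norm z \<le> 1"
  using cmod_le[of z] by linarith

lemma chords_subset: "nonseifert_chords \<subseteq> cball 0 1"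
  by (auto simp: nonseifert_chords_eq in_chord_def out_chord_def intro!: norm_le_1_sum)

lemma mem_uminus_image: "(z::complex) \<in> uminus ` S \<longleftrightarrow> - z \<in> S"
  by (auto intro!: image_eqI[of _ _ "- z"])

lemma nonseifert_chords_uminus: "uminus ` nonseifert_chords = nonseifert_chords"
proof -
  have "uminus ` in_chord = out_chord"
    by (intro set_eqI, unfold mem_uminus_image) (auto simp: in_chord_def out_chord_def)
  moreover have "uminus ` out_chord = in_chord"
    by (intro set_eqI, unfold mem_uminus_image) (auto simp: in_chord_def out_chord_def)
  ultimately show ?thesis by (auto simp: nonseifert_chords_eq image_Un)
qed

definition transpose_axes :: "complex \<Rightarrow> complex" where
  "transpose_axes z = Complex (Im z) (Re z)"

lemma transpose_axes_simps [simp]: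
  "Re (transpose_axes z) = Im z" "Im (transpose_axes z) = Re z"
  "transpose_axes (transpose_axes z) = z" "norm (transpose_axes z) = norm z"
  by (simp_all add: transpose_axes_def cmod_def add.commute)

lemma nonseifert_chords_transpose: "transpose_axes ` nonseifert_chords = nonseifert_chords"
proof -
  have "z \<in> nonseifert_chords \<Longrightarrow> transpose_axes z \<in> nonseifert_chords" for z
    by (auto simp: nonseifert_chords_eq in_chord_def out_chord_def add.commute)
  then show ?thesis by (auto simp: image_iff) (metis transpose_axes_simps(3))
qed

text \<open>Pushing the outgoing chord onto the outgoing half axes crosses only the outgoing quadrant.
  Afterwards the set no longer depends on the values of the chart in the other three quadrants,
  except for the incoming one.\<close>

lemma push_out_chord:
  obtains G where "disk_homeo G" "G ` nonseifert_chords = in_chord \<union> {z \<in> cross. 0 \<le> Re z \<and> 0 \<le> Im z}"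
proof -
  define s :: real where "s = 1 / sqrt 2"
  have s: "0 < s" "s * s = 1 / 2" "s\<^sup>2 = 1/2" by (auto simp: s_def power2_eq_square)
  define R where "R p = sqrt (1 - p\<^sup>2)" for p :: real
  have R0: "0 \<le> R p" if "-1 \<le> p" "p \<le> 1" for p
    using that by (auto simp: R_def abs_square_le_1)
  have R2: "R p * R p = 1 - p\<^sup>2" if "-1 \<le> p" "p \<le> 1" for p
    using that by (auto simp: R_def abs_square_le_1)
  \<comment> \<open>The line at height \<open>s\<close> and the graph of the absolute value meet the
    circle over the same points, \<open>\<bar>p\<bar> = s\<close>.\<close>
  have Rs: "s \<le> R p \<longleftrightarrow> \<bar>p\<bar> \<le> R p" if p: "-1 \<le> p" "p \<le> 1" for p
  proof -
    have "s \<le> R p \<longleftrightarrow> s\<^sup>2 \<le> (R p)\<^sup>2" using s R0[OF p] abs_le_square_iff[of s "R p"] by simp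
    also have "\<dots> \<longleftrightarrow> \<bar>p\<bar>\<^sup>2 \<le> (R p)\<^sup>2" using s R2[OF p] by (auto simp: power2_eq_square)
    also have "\<dots> \<longleftrightarrow> \<bar>p\<bar> \<le> R p" using R0[OF p] abs_le_square_iff[of "\<bar>p\<bar>" "R p"] by simp
    finally show ?thesis .
  qed
  \<comment> \<open>In coordinates turned by 45 degrees the outgoing chord lies at height
    \<open>s\<close>, the outgoing half axes form the graph of the absolute value, and the incoming
    chord lies at height \<open>- s\<close>, the fixed lower end of the moving interval. The minima
    with \<open>R\<close> only keep the nodes in the disk where
    \<open>\<bar>p\<bar> > s\<close>.\<close>
  interpret F: fibre_nodes "\<lambda>p. max (- s) (- R p)" "\<lambda>p. min s (R p)" "\<lambda>p. min \<bar>p\<bar> (R p)" R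
  proof
    fix p :: real assume p: "-1 \<le> p" "p \<le> 1"
    show "- sqrt (1 - p\<^sup>2) \<le> max (- s) (- R p) \<and> R p \<le> sqrt (1 - p\<^sup>2)"
      by (auto simp: R_def)
    show "max (- s) (- R p) \<le> min s (R p) \<and> min s (R p) \<le> R p \<and> max (- s) (- R p) \<le> min \<bar>p\<bar> (R p) \<and> min \<bar>p\<bar> (R p) \<le> R p"
      using s R0[OF p] by auto
    show "(max (- s) (- R p) = min s (R p) \<longleftrightarrow> max (- s) (- R p) = min \<bar>p\<bar> (R p)) \<and>
       (R p = min s (R p) \<longleftrightarrow> R p = min \<bar>p\<bar> (R p))"
    proof
      have "max (- s) (- R p) = min s (R p) \<longleftrightarrow> R p = 0" using s R0[OF p] by (auto simp: min_def max_def)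
      moreover have "max (- s) (- R p) = min \<bar>p\<bar> (R p) \<longleftrightarrow> R p = 0"
        using s R0[OF p] by (auto simp: min_def max_def)
      ultimately show "max (- s) (- R p) = min s (R p) \<longleftrightarrow> max (- s) (- R p) = min \<bar>p\<bar> (R p)" by simp
      have "R p = s \<Longrightarrow> \<bar>p\<bar> = R p"
      proof -
        assume "R p = s"
        then have "\<bar>p\<bar>\<^sup>2 = s\<^sup>2" using R2[OF p] s by simp
        then have "\<bar>p\<bar> = s" by (rule power2_eq_imp_eq) (use s in auto)
        then show ?thesis using \<open>R p = s\<close> by simp
      qed
      moreover have "\<bar>p\<bar> = R p \<Longrightarrow> R p = s"
      proof -
        assume e: "\<bar>p\<bar> = R p"
        then have "(R p)\<^sup>2 = p\<^sup>2" by (metis power2_abs)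
        then have "(R p)\<^sup>2 = s\<^sup>2" using R2[OF p] s by (simp add: power2_eq_square)
        then show ?thesis by (rule power2_eq_imp_eq) (use s R0[OF p] in auto)
      qed
      ultimately show "R p = min s (R p) \<longleftrightarrow> R p = min \<bar>p\<bar> (R p)"
        using Rs[OF p] by (auto simp: min_def)
    qed
  qed (auto simp: R_def intro!: continuous_intros)
  define c where "c = Complex s s"
  have c1: "norm c = 1" using s by (simp add: c_def cmod_def power2_eq_square)
  then have c0: "c \<noteq> 0" by auto
  define G where "G z = F.fibre_map (z * c) / c" for z
  have dG: "disk_homeo G"
    using disk_homeo_conjugate[OF F.disk_homeo_fibre_map c1] by (simp add: G_def[abs_def])
  have zc: "z * c = Complex (s * (Re z - Im z)) (s * (Re z + Im z))" for z
    by (auto simp: c_def complex_eq_iff algebra_simps)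
  have inv: "w / c = Complex (s * (Re w + Im w)) (s * (Im w - Re w))" for w
  proof -
    have "Complex (s * (Re w + Im w)) (s * (Im w - Re w)) * c = w"
      unfolding zc using s by (auto simp: complex_eq_iff algebra_simps)
    then show ?thesis using c0 by (metis nonzero_mult_div_cancel_right)
  qed
  have ps: "\<bar>p\<bar> \<le> s \<Longrightarrow> \<bar>p\<bar> \<le> R p \<and> s \<le> R p \<and> -1 \<le> p \<and> p \<le> 1" for p
  proof -
    assume a: "\<bar>p\<bar> \<le> s"
    have "s < 1" using s by (simp add: s_def)
    then have p: "-1 \<le> p" "p \<le> 1" using a by auto
    have "\<bar>p\<bar>\<^sup>2 \<le> s\<^sup>2" using a by (intro power_mono) auto
    then have "s\<^sup>2 \<le> (R p)\<^sup>2" using R2[OF p] s by (simp add: power2_eq_square)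
    then have "s \<le> R p" by (rule power2_le_imp_le) (rule R0[OF p])
    then show ?thesis using p Rs[OF p] by simp
  qed
  have in_fix: "G z = z" if "z \<in> in_chord" for z
  proof -
    let ?w = "z * c"
    have "\<bar>Re z - Im z\<bar> \<le> 1" "Re z + Im z = -1" using that by (auto simp: in_chord_def)
    then have "s * \<bar>Re z - Im z\<bar> \<le> s * 1" using s by (intro mult_left_mono) auto
    then have w: "\<bar>Re ?w\<bar> \<le> s" "Im ?w = - s" using s \<open>Re z + Im z = -1\<close> by (auto simp: zc abs_mult)
    have "F.fibre_map ?w = ?w"
      by (rule F.fibre_map_outside) (use ps[OF w(1)] w in auto)
    then show ?thesis using c0 by (simp add: G_def)
  qed
  have out: "G z = (if Im z \<le> Re z then of_real (Re z - Im z) else \<i> * of_real (Im z - Re z))"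
    if "z \<in> out_chord" for z
  proof -
    let ?w = "z * c"
    have h: "\<bar>Re z - Im z\<bar> \<le> 1" "Re z + Im z = 1" using that by (auto simp: out_chord_def)
    then have "s * \<bar>Re z - Im z\<bar> \<le> s * 1" using s by (intro mult_left_mono) auto
    then have w: "\<bar>Re ?w\<bar> \<le> s" "Im ?w = s" using s h by (auto simp: zc abs_mult)
    then have "?w = Complex (Re ?w) (min s (R (Re ?w)))" using ps[OF w(1)] by (simp add: complex_eq_iff)
    then have "F.fibre_map ?w = Complex (Re ?w) (min \<bar>Re ?w\<bar> (R (Re ?w)))"
      using F.fibre_map_node[of "Re ?w"] ps[OF w(1)] by simp
    then have "F.fibre_map ?w = Complex (Re ?w) \<bar>Re ?w\<bar>" using ps[OF w(1)] by simp
    then have "G z = Complex (s * (Re ?w + \<bar>Re ?w\<bar>)) (s * (\<bar>Re ?w\<bar> - Re ?w))"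
      by (simp add: G_def inv)
    moreover have "Re ?w = s * (Re z - Im z)" by (simp add: zc)
    moreover have "s * (s * x + \<bar>s * x\<bar>) = (x + \<bar>x\<bar>) / 2" "s * (\<bar>s * x\<bar> - s * x) = (\<bar>x\<bar> - x) / 2" for x
    proof -
      have "\<bar>s * x\<bar> = s * \<bar>x\<bar>" using s by (simp add: abs_mult)
      then have "s * (s * x + \<bar>s * x\<bar>) = (s * s) * (x + \<bar>x\<bar>)" "s * (\<bar>s * x\<bar> - s * x) = (s * s) * (\<bar>x\<bar> - x)"
        by (simp_all add: algebra_simps)
      then show "s * (s * x + \<bar>s * x\<bar>) = (x + \<bar>x\<bar>) / 2" "s * (\<bar>s * x\<bar> - s * x) = (\<bar>x\<bar> - x) / 2"
        using s(2) by auto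
    qed
    ultimately have "G z = Complex (((Re z - Im z) + \<bar>Re z - Im z\<bar>) / 2) ((\<bar>Re z - Im z\<bar> - (Re z - Im z)) / 2)"
      by simp
    then show ?thesis by (auto simp: complex_eq_iff abs_if split: if_splits)
  qed
  have 1: "G ` in_chord = in_chord" using in_fix by force
  have 2: "G ` out_chord = {z \<in> cross. 0 \<le> Re z \<and> 0 \<le> Im z}"
  proof safe
    fix z assume z: "z \<in> out_chord"
    then have "\<bar>Re z - Im z\<bar> \<le> 1" by (auto simp: out_chord_def)
    then show "G z \<in> cross" "0 \<le> Re (G z)" "0 \<le> Im (G z)" using out[OF z]
      by (auto simp: cross_def norm_mult simp del: of_real_diff simp flip: of_real_diff)
  next
    fix w assume w: "w \<in> cross" "0 \<le> Re w" "0 \<le> Im w"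
    then have n: "Re w \<le> 1" "Im w \<le> 1"
      using complex_Re_le_cmod[of w] abs_Im_le_cmod[of w] by (auto simp: cross_def)
    let ?d = "Re w - Im w"
    let ?z = "Complex ((1 + ?d) / 2) ((1 - ?d) / 2)"
    have z: "?z \<in> out_chord" using w n by (auto simp: out_chord_def cross_def field_simps)
    have "G ?z = w" unfolding out[OF z] using w by (auto simp: cross_def complex_eq_iff field_simps)
    then show "w \<in> G ` out_chord" by (intro image_eqI[OF _ z]) simp
  qed
  show ?thesis using that[OF dG] 1 2 by (simp add: nonseifert_chords_eq image_Un)
qed

text \<open>Resolution of one crossing of an arbitrary subset of the sphere. Neither a curve nor its
  orientation occurs, here or in \<open>cross_disk\<close>, so other crossings of \<open>S\<close>
  may have been resolved before.\<close>

definition resolve_at :: "(real^3) set \<Rightarrow> (complex \<Rightarrow> real^3) \<Rightarrow> (real^3) set" where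
  "resolve_at S \<phi> = (S - \<phi> ` cball 0 1) \<union> \<phi> ` nonseifert_chords"

definition cross_disk :: "(real^3) set \<Rightarrow> (complex \<Rightarrow> real^3) \<Rightarrow> bool" where
  "cross_disk S \<phi> \<longleftrightarrow> disk_embedding \<phi> \<and> S \<inter> \<phi> ` cball 0 1 = \<phi> ` cross"

lemma cross_subset: "cross \<subseteq> cball 0 1" by (auto simp: cross_def)

lemma resolve_at_subset: "S \<subseteq> S2 \<Longrightarrow> cross_disk S \<phi> \<Longrightarrow> resolve_at S \<phi> \<subseteq> S2"
  using chords_subset by (auto simp: resolve_at_def cross_disk_def disk_embedding_def)

text \<open>Both resolutions are isotopic to one set \<open>K\<close>, obtained by pushing the
  outgoing chord onto the half axes, and \<open>K\<close> involves the chart only on the incoming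
  quadrant.\<close>

lemma resolve_at_in_quadrant:
  assumes S: "S \<subseteq> S2" and \<phi>: "cross_disk S \<phi>" and \<phi>': "cross_disk S \<phi>'"
    and eq: "\<And>z. norm z \<le> 1 \<Longrightarrow> Re z \<le> 0 \<Longrightarrow> Im z \<le> 0 \<Longrightarrow> \<phi> z = \<phi>' z"
  shows "isotopic (resolve_at S \<phi>) (resolve_at S \<phi>')"
proof -
  obtain G where G: "disk_homeo G" "G ` nonseifert_chords = in_chord \<union> {z \<in> cross. 0 \<le> Re z \<and> 0 \<le> Im z}"
    by (rule push_out_chord)
  \<comment> \<open>The centre stays outside \<open>Q\<close>: it belongs to the outgoing half axes,
    onto which the chord is pushed, so it survives in \<open>K\<close>.\<close>
  define Q where "Q = {z \<in> cross. Re z \<le> 0 \<and> Im z \<le> 0} - {0}"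
  define K where "K \<phi> = (S - \<phi> ` Q) \<union> \<phi> ` in_chord" for \<phi> :: "complex \<Rightarrow> real^3"
  have step: "isotopic (resolve_at S \<phi>) (K \<phi>)" if \<phi>: "cross_disk S \<phi>" for \<phi>
  proof -
    have d: "disk_embedding \<phi>" "S \<inter> \<phi> ` cball 0 1 = \<phi> ` cross" "inj_on \<phi> (cball 0 1)"
      using \<phi> by (auto simp: cross_disk_def disk_embedding_def)
    have "isotopic (resolve_at S \<phi>) ((resolve_at S \<phi> - \<phi> ` cball 0 1) \<union> \<phi> ` G ` nonseifert_chords)"
      by (rule isotopic_disk_replacement[OF d(1) G(1) resolve_at_subset[OF S \<phi>] _ chords_subset])
        (use chords_subset in \<open>auto simp: resolve_at_def\<close>)
    also have "(resolve_at S \<phi> - \<phi> ` cball 0 1) \<union> \<phi> ` G ` nonseifert_chords = K \<phi>"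
    proof -
      have "resolve_at S \<phi> - \<phi> ` cball 0 1 = S - \<phi> ` cross"
        using chords_subset d(2) by (auto simp: resolve_at_def)
      moreover have "\<phi> ` {z \<in> cross. 0 \<le> Re z \<and> 0 \<le> Im z} = \<phi> ` (cross - Q)"
        by (rule arg_cong[of _ _ "(`) \<phi>"]) (auto simp: Q_def cross_def complex_eq_iff)
      moreover have "\<phi> ` (cross - Q) = \<phi> ` cross - \<phi> ` Q"
        by (rule inj_on_image_set_diff[OF d(3)]) (auto simp: cross_def Q_def)
      moreover have "\<phi> ` Q \<subseteq> \<phi> ` cross" by (auto simp: Q_def)
      moreover have "\<phi> ` cross \<subseteq> S" using d(2) by auto
      ultimately show ?thesis unfolding G(2) K_def image_Un by auto
    qed
    finally show ?thesis .
  qed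
  have "\<phi> ` Q = \<phi>' ` Q" "\<phi> ` in_chord = \<phi>' ` in_chord"
    by (auto simp: Q_def cross_def in_chord_def intro!: image_cong eq norm_le_1_sum)
  then have "K \<phi> = K \<phi>'" by (simp add: K_def)
  then have "isotopic (K \<phi>) (resolve_at S \<phi>')"
    using isotopic_sym[OF resolve_at_subset[OF S \<phi>'] step[OF \<phi>']] by simp
  then show ?thesis using isotopic_trans[OF resolve_at_subset[OF S \<phi>] step[OF \<phi>]] by blast
qed

lemma cross_disk_mem:
  assumes "cross_disk S \<phi>" "norm w \<le> 1"
  shows "\<phi> w \<in> S \<longleftrightarrow> w \<in> cross"
proof -
  have d: "inj_on \<phi> (cball 0 1)" "S \<inter> \<phi> ` cball 0 1 = \<phi> ` cross"
    using assms(1) by (auto simp: cross_disk_def disk_embedding_def)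
  have "\<phi> w \<in> S \<longleftrightarrow> \<phi> w \<in> \<phi> ` cross" using d(2) assms(2) by auto
  also have "\<dots> \<longleftrightarrow> w \<in> cross"
    by (rule inj_on_image_mem_iff[OF d(1)]) (use assms(2) cross_subset in auto)
  finally show ?thesis .
qed

lemma cross_disk_reparametrize:
  assumes "cross_disk S \<phi>" "continuous_on (cball 0 1) \<psi>" "inj_on \<psi> (cball 0 1)"
    and \<psi>: "\<And>z. norm z \<le> 1 \<Longrightarrow> norm (\<psi> z) \<le> 1 \<and> (\<psi> z \<in> cross \<longleftrightarrow> z \<in> cross)"
  shows "cross_disk S (\<phi> \<circ> \<psi>)"
proof -
  have d: "continuous_on (cball 0 1) \<phi>" "inj_on \<phi> (cball 0 1)" "\<phi> ` cball 0 1 \<subseteq> S2"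
    "S \<inter> \<phi> ` cball 0 1 = \<phi> ` cross"
    using assms(1) by (auto simp: cross_disk_def disk_embedding_def)
  have im: "\<psi> ` cball 0 1 \<subseteq> cball 0 1" using \<psi> by auto
  have "disk_embedding (\<phi> \<circ> \<psi>)"
    unfolding disk_embedding_def
  proof (intro conjI)
    show "continuous_on (cball 0 1) (\<phi> \<circ> \<psi>)"
      by (rule continuous_on_compose[OF assms(2) continuous_on_subset[OF d(1) im]])
    show "inj_on (\<phi> \<circ> \<psi>) (cball 0 1)"
      by (rule comp_inj_on[OF assms(3) inj_on_subset[OF d(2) im]])
    show "(\<phi> \<circ> \<psi>) ` cball 0 1 \<subseteq> S2" using d(3) im by fastforce
  qed
  moreover have "S \<inter> (\<phi> \<circ> \<psi>) ` cball 0 1 = (\<phi> \<circ> \<psi>) ` cross"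
  proof -
    have "\<phi> w \<in> S \<longleftrightarrow> w \<in> cross" if "norm w \<le> 1" for w
      by (rule cross_disk_mem[OF assms(1) that])
    then show ?thesis using \<psi> cross_subset by (auto simp: image_iff)
  qed
  ultimately show ?thesis by (simp add: cross_disk_def)
qed

text \<open>The half turn, by which charts follow a reversal of the curve, exchanges the two
  chords.\<close>

lemma resolve_at_uminus: "resolve_at S (\<phi> \<circ> uminus) = resolve_at S \<phi>"
proof -
  have "uminus ` cball (0::complex) 1 = cball 0 1"
    by (intro set_eqI, unfold mem_uminus_image) auto
  then show ?thesis
    unfolding resolve_at_def image_comp[symmetric] by (simp add: nonseifert_chords_uminus)
qed

text \<open>Reflection in the diagonal exchanges the branches and maps each chord to itself: which
  branch is taken as the real axis does not matter.\<close>

lemma resolve_at_transpose: "resolve_at S (\<phi> \<circ> transpose_axes) = resolve_at S \<phi>"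
proof -
  have "transpose_axes ` cball (0::complex) 1 = cball 0 1"
  proof safe
    fix z :: complex assume "z \<in> cball 0 1"
    then show "z \<in> transpose_axes ` cball 0 1"
      by (intro image_eqI[of _ _ "transpose_axes z"]) auto
  qed auto
  then show ?thesis
    unfolding resolve_at_def image_comp[symmetric] by (simp add: nonseifert_chords_transpose)
qed

lemma cross_disk_uminus: "cross_disk S \<phi> \<Longrightarrow> cross_disk S (\<phi> \<circ> uminus)"
  by (erule cross_disk_reparametrize) (auto simp: cross_def intro!: continuous_intros)

lemma cross_disk_transpose: "cross_disk S \<phi> \<Longrightarrow> cross_disk S (\<phi> \<circ> transpose_axes)"
proof (erule cross_disk_reparametrize)
  show "continuous_on (cball 0 1) transpose_axes"
    unfolding transpose_axes_def[abs_def] Complex_eq by (intro continuous_intros)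
  show "inj_on transpose_axes (cball 0 1)" by (metis inj_on_inverseI transpose_axes_simps(3))
qed (auto simp: cross_def)

lemma resolve_at_out_quadrant:
  assumes S: "S \<subseteq> S2" and \<phi>: "cross_disk S \<phi>" and \<phi>': "cross_disk S \<phi>'"
    and eq: "\<And>z. norm z \<le> 1 \<Longrightarrow> 0 \<le> Re z \<Longrightarrow> 0 \<le> Im z \<Longrightarrow> \<phi> z = \<phi>' z"
  shows "isotopic (resolve_at S \<phi>) (resolve_at S \<phi>')"
  using resolve_at_in_quadrant[OF S cross_disk_uminus[OF \<phi>] cross_disk_uminus[OF \<phi>']] eq
  by (simp add: resolve_at_uminus)

subsection \<open>Embeddings of the disk that preserve the cross\<close>

text \<open>Labels the nine cells into which the axes cut the disk: the centre, four open half axes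
  and four open quadrants.\<close>

definition sign_vector :: "complex \<Rightarrow> complex" where
  "sign_vector z = Complex (sgn (Re z)) (sgn (Im z))"

lemma sign_vector_simps [simp]:
  "Re (sign_vector z) = sgn (Re z)" "Im (sign_vector z) = sgn (Im z)"
  by (simp_all add: sign_vector_def)

lemma sign_vector_0_iff: "sign_vector z = 0 \<longleftrightarrow> z = 0"
  by (auto simp: complex_eq_iff sgn_0_0)

lemma convex_sign_class: "convex {z \<in> cball 0 1. sign_vector z = d}"
proof -
  have "convex {x::real. sgn x = e}" for e
  proof -
    consider "e = 1" | "e = 0" | "e = -1" | "e \<notin> {1, 0, -1}" by auto
    then show ?thesis
    proof cases
      case 1
      then have "{x::real. sgn x = e} = {0<..}" by (auto simp: sgn_1_pos)
      then show ?thesis by simp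
    next
      case 2
      then have "{x::real. sgn x = e} = {0}" by (auto simp: sgn_0_0)
      then show ?thesis by simp
    next
      case 3
      then have "{x::real. sgn x = e} = {..<0}" by (auto simp: sgn_1_neg)
      then show ?thesis by simp
    next
      case 4
      then have "{x::real. sgn x = e} = {}" by (auto simp: sgn_real_def)
      then show ?thesis by (metis convex_empty)
    qed
  qed
  then have "convex (Re -` {x. sgn x = Re d})" "convex (Im -` {x. sgn x = Im d})"
    by (intro convex_linear_vimage bounded_linear.linear[OF bounded_linear_Re]
        bounded_linear.linear[OF bounded_linear_Im]; simp)+
  moreover have "{z \<in> cball 0 1. sign_vector z = d} =
    cball 0 1 \<inter> (Re -` {x. sgn x = Re d} \<inter> Im -` {x. sgn x = Im d})"
    by (auto simp: complex_eq_iff)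
  ultimately show ?thesis by (auto intro: convex_Int)
qed

text \<open>An abstraction of the transition map between two charts of one crossing. The aim is its
  effect on the cells, which turns out to be that of a symmetry of the square.\<close>

locale cross_embedding =
  fixes \<psi> :: "complex \<Rightarrow> complex"
  assumes cont: "continuous_on (cball 0 1) \<psi>" and inj: "inj_on \<psi> (cball 0 1)"
    and zero: "\<psi> 0 = 0"
    and cross: "\<And>z. norm z \<le> 1 \<Longrightarrow> \<psi> z \<in> cross \<longleftrightarrow> z \<in> cross"
    and disk: "\<And>z. norm z \<le> 1 \<Longrightarrow> norm (\<psi> z) \<le> 1"
begin

lemma nonzero: "norm z \<le> 1 \<Longrightarrow> z \<noteq> 0 \<Longrightarrow> \<psi> z \<noteq> 0"
  using inj_onD[OF inj, of z 0] zero by auto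

lemma cross_sign: "norm z \<le> 1 \<Longrightarrow> z \<in> cross \<longleftrightarrow> sgn (Re z) = 0 \<or> sgn (Im z) = 0"
  by (auto simp: cross_def sgn_0_0)

text \<open>Cells are connected, and on the image of a cell other than the centre the sign vector is
  continuous with finitely many values, hence constant.\<close>

lemma sign_vector_const:
  assumes "norm z \<le> 1" "norm w \<le> 1" "sign_vector z = sign_vector w"
  shows "sign_vector (\<psi> z) = sign_vector (\<psi> w)"
proof (cases "z = 0")
  case True
  then have "w = 0" using assms(3) by (metis sign_vector_0_iff)
  then show ?thesis using True by simp
next
  case False
  define Q where "Q = {x \<in> cball 0 1. sign_vector x = sign_vector z}"
  have conn: "connected Q" unfolding Q_def by (rule convex_connected[OF convex_sign_class])
  have cQ: "continuous_on Q \<psi>" by (rule continuous_on_subset[OF cont]) (auto simp: Q_def)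
  have nz: "\<psi> x \<noteq> 0" if "x \<in> Q" for x
    using that False nonzero[of x] sign_vector_0_iff[of x] sign_vector_0_iff[of z] by (auto simp: Q_def)
  have "(\<lambda>x. sign_vector (\<psi> x)) constant_on Q"
  proof (rule continuous_finite_range_constant[OF conn])
    have "finite ((\<lambda>(a, b). Complex a b) ` ({-1, 0, 1} \<times> {-1, 0, 1}))" by simp
    moreover have "(\<lambda>x. sign_vector (\<psi> x)) ` Q \<subseteq> (\<lambda>(a, b). Complex a b) ` ({-1, 0, 1} \<times> {-1, 0, 1})"
    proof safe
      fix x
      have "sgn y \<in> {-1, 0, 1}" for y :: real by (auto simp: sgn_real_def)
      then have "(sgn (Re (\<psi> x)), sgn (Im (\<psi> x))) \<in> {-1, 0, 1} \<times> {-1, 0, 1}" by blast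
      from imageI[OF this, of "\<lambda>(a, b). Complex a b"]
      show "sign_vector (\<psi> x) \<in> (\<lambda>(a, b). Complex a b) ` ({-1, 0, 1} \<times> {-1, 0, 1})"
        by (simp add: sign_vector_def)
    qed
    ultimately show "finite ((\<lambda>x. sign_vector (\<psi> x)) ` Q)" by (rule finite_subset[rotated])
    show "continuous_on Q (\<lambda>x. sign_vector (\<psi> x))"
    proof (cases "z \<in> cross")
      case True
      have "\<psi> x \<in> cross" if "x \<in> Q" for x
        using that True assms(1) cross[of x] cross_sign[of x] cross_sign[of z]
        by (auto simp: Q_def complex_eq_iff)
      \<comment> \<open>On a half axis the sign vector is the point divided by its norm, and the
        centre is avoided; off the cross both coordinates are nonzero and their signs are
        continuous.\<close>
      moreover have "sign_vector y = sgn y" if "y \<in> cross" for y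
      proof -
        have n: "norm y = \<bar>Re y\<bar> + \<bar>Im y\<bar>" using that by (auto simp: cross_def cmod_def)
        show ?thesis
          using that n by (cases "Re y = 0")
            (auto simp: complex_eq_iff Re_sgn Im_sgn cross_def sgn_real_def abs_if divide_simps split: if_splits)
      qed
      ultimately have "sign_vector (\<psi> x) = \<psi> x /\<^sub>R norm (\<psi> x)" if "x \<in> Q" for x
        using that by (simp add: sgn_div_norm)
      moreover have "continuous_on Q (\<lambda>x. \<psi> x /\<^sub>R norm (\<psi> x))"
        using nz by (intro continuous_intros cQ) auto
      ultimately show ?thesis by (simp cong: continuous_on_cong)
    next
      case False
      have "\<psi> x \<notin> cross" "norm (\<psi> x) \<le> 1" if "x \<in> Q" for x
        using that False assms(1) cross[of x] cross_sign[of x] cross_sign[of z] disk[of x]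
        by (auto simp: Q_def complex_eq_iff)
      then have "Re (\<psi> x) \<noteq> 0" "Im (\<psi> x) \<noteq> 0" if "x \<in> Q" for x
        using that by (auto simp: cross_def)
      then have "continuous_on Q (\<lambda>x. of_real (Re (\<psi> x) / \<bar>Re (\<psi> x)\<bar>) + \<i> * of_real (Im (\<psi> x) / \<bar>Im (\<psi> x)\<bar>))"
        by (intro continuous_intros cQ) auto
      moreover have "sign_vector y = of_real (Re y / \<bar>Re y\<bar>) + \<i> * of_real (Im y / \<bar>Im y\<bar>)" for y
        by (auto simp: complex_eq_iff sgn_real_def)
      ultimately show ?thesis by simp
    qed
  qed
  then obtain c where "\<And>x. x \<in> Q \<Longrightarrow> sign_vector (\<psi> x) = c" unfolding constant_on_def by blast
  moreover have "z \<in> Q" "w \<in> Q" using assms by (auto simp: Q_def)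
  ultimately show ?thesis by simp
qed

text \<open>The induced map on cells, with half the label as the sample point: labels of quadrants
  have norm \<open>sqrt 2\<close>, and halving brings all samples into the disk.\<close>

definition T :: "complex \<Rightarrow> complex" where
  "T d = sign_vector (\<psi> (d / 2))"

lemma T: 
  assumes "norm z \<le> 1"
  shows "sign_vector (\<psi> z) = T (sign_vector z)"
proof -
  have "norm (sign_vector z) \<le> \<bar>sgn (Re z)\<bar> + \<bar>sgn (Im z)\<bar>"
    using cmod_le[of "sign_vector z"] by simp
  also have "\<dots> \<le> 2" by (auto simp: sgn_real_def)
  finally have "norm (sign_vector z / 2) \<le> 1" by (simp add: norm_divide)
  moreover have "sign_vector (sign_vector z / 2) = sign_vector z"
    by (auto simp: complex_eq_iff sgn_real_def)
  ultimately show ?thesis unfolding T_def using sign_vector_const assms by metis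
qed

lemma T_axis: "u \<in> {1, -1, \<i>, -\<i>} \<Longrightarrow> T u \<in> {1, -1, \<i>, -\<i>}"
proof -
  assume u: "u \<in> {1, -1, \<i>, -\<i>}"
  then have "u / 2 \<in> cross" "norm (u / 2) \<le> 1" "u / 2 \<noteq> 0" by (auto simp: cross_def norm_divide)
  then have "\<psi> (u / 2) \<in> cross" "\<psi> (u / 2) \<noteq> 0" using cross nonzero by auto
  then show ?thesis
    by (auto simp: T_def complex_eq_iff cross_def sgn_real_def split: if_splits)
qed

text \<open>Points of a half axis that bounds a quadrant are limits of points of that quadrant, so
  the image lies in the closure of the image quadrant. The only half axes there are the two
  coordinate parts of its label.\<close>

lemma T_adjacent:
  assumes a: "a \<in> {1, -1}" and b: "b \<in> {1, -1}" and c: "z \<in> {of_real a, \<i> * of_real b}"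
  shows "T z \<in> {of_real (Re (T (Complex a b))), \<i> * of_real (Im (T (Complex a b)))}"
    and "\<bar>Re (T (Complex a b))\<bar> = 1" "\<bar>Im (T (Complex a b))\<bar> = 1"
proof -
  let ?d = "T (Complex a b)"
  have nd: "norm (Complex a b / 2) \<le> 1" using a b cmod_le[of "Complex a b"] by (auto simp: norm_divide)
  have "Complex a b / 2 \<notin> cross" using a b by (auto simp: cross_def)
  then have "\<psi> (Complex a b / 2) \<notin> cross" "norm (\<psi> (Complex a b / 2)) \<le> 1"
    using cross[OF nd] disk[OF nd] by blast+
  then show d: "\<bar>Re ?d\<bar> = 1" "\<bar>Im ?d\<bar> = 1"
    by (auto simp: T_def cross_def sgn_real_def)
  define y where "y n = z / 2 + (Complex a b - z) / 2 * of_real (1 / real (n + 2))" for n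
  have yd: "norm (y n) \<le> 1 \<and> sign_vector (y n) = Complex a b" for n
  proof -
    define q where "q = 1 / real (n + 2)"
    have p: "0 < q" "q \<le> 1" by (auto simp: q_def)
    have yq: "y n = z / 2 + (Complex a b - z) / 2 * of_real q" by (simp add: y_def q_def)
    have "sign_vector (y n) = Complex a b"
      using a b c p by (auto simp: yq complex_eq_iff)
    moreover have "\<bar>Re (y n)\<bar> + \<bar>Im (y n)\<bar> \<le> 1"
      using a b c p by (auto simp: yq)
    ultimately show ?thesis using norm_le_1_sum by auto
  qed
  have "(\<lambda>n. 1 / real (n + 2)) \<longlonglongrightarrow> 0"
    using LIMSEQ_ignore_initial_segment[OF lim_1_over_n, of 2] by simp
  then have "y \<longlonglongrightarrow> z / 2 + (Complex a b - z) / 2 * of_real 0"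
    unfolding y_def by (intro tendsto_intros)
  then have y: "y \<longlonglongrightarrow> z / 2" by simp
  have zd: "z / 2 \<in> cball 0 1" using a b c by (auto simp: norm_divide norm_mult)
  have lim: "(\<lambda>n. \<psi> (y n)) \<longlonglongrightarrow> \<psi> (z / 2)"
    by (rule continuous_on_tendsto_compose[OF cont y zd]) (use yd in auto)
  have sv: "sgn (Re (\<psi> (y n))) = Re ?d" "sgn (Im (\<psi> (y n))) = Im ?d" for n
    using T[of "y n"] yd[of n] by (metis sign_vector_simps)+
  have "0 \<le> sgn t * t" for t :: real by (auto simp: sgn_real_def)
  then have pos: "0 \<le> Re ?d * Re (\<psi> (y n))" "0 \<le> Im ?d * Im (\<psi> (y n))" for n
    by (metis sv)+
  have "0 \<le> Re ?d * Re (\<psi> (z / 2))"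
    by (rule tendsto_lowerbound[OF tendsto_mult_left[OF tendsto_Re[OF lim]]]) (simp_all add: pos)
  moreover have "0 \<le> Im ?d * Im (\<psi> (z / 2))"
    by (rule tendsto_lowerbound[OF tendsto_mult_left[OF tendsto_Im[OF lim]]]) (simp_all add: pos)
  moreover have "T z \<in> {1, -1, \<i>, -\<i>}" using a b c by (intro T_axis) auto
  ultimately show "T z \<in> {of_real (Re ?d), \<i> * of_real (Im ?d)}"
    using d unfolding T_def[of z] by (auto simp: complex_eq_iff sgn_real_def abs_if split: if_splits)
qed

text \<open>If two half axes went into the same one, the intermediate value theorem would give a
  point on each such that the images have a common norm. Points of one half axis with equal norm
  coincide, against injectivity.\<close>

lemma T_inj:
  assumes "u \<in> {1, -1, \<i>, -\<i>}" "v \<in> {1, -1, \<i>, -\<i>}" "T u = T v"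
  shows "u = v"
proof -
  have ray: "norm (of_real r * u) = r" "sign_vector (of_real r * u) = (if r = 0 then 0 else u)" "of_real r * u \<in> cross"
    if "0 \<le> r" "r \<le> 1" "u \<in> {1, -1, \<i>, -\<i>}" for r u
  proof -
    have "norm u = 1" using that(3) by auto
    then show n: "norm (of_real r * u) = r" using that(1) by (simp add: norm_mult)
    show "sign_vector (of_real r * u) = (if r = 0 then 0 else u)"
      using that by (auto simp: complex_eq_iff)
    show "of_real r * u \<in> cross"
      unfolding cross_def mem_Collect_eq n using that by auto
  qed
  have path: "continuous_on {0..1} (\<lambda>r. norm (\<psi> (of_real r * u)))" if u: "u \<in> {1, -1, \<i>, -\<i>}" for u
  proof -
    have "continuous_on {0..1} (\<lambda>r::real. of_real r * u)" by (intro continuous_intros)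
    then have "continuous_on {0..1} (\<lambda>r::real. \<psi> (of_real r * u))"
      by (rule continuous_on_compose2[OF cont]) (use ray u in auto)
    then show ?thesis by (rule continuous_on_norm)
  qed
  define m where "m = min (norm (\<psi> u)) (norm (\<psi> v))"
  have n: "norm u = 1" "norm v = 1" "u \<noteq> 0" "v \<noteq> 0" using assms by auto
  then have m: "0 < m" using nonzero[of u] nonzero[of v] by (simp add: m_def)
  have "\<exists>r\<ge>0. r \<le> 1 \<and> norm (\<psi> (of_real r * w)) = m" if "w \<in> {u, v}" for w
  proof (rule IVT')
    show "continuous_on {0..1} (\<lambda>r. norm (\<psi> (of_real r * w)))" using path that assms by blast
    show "norm (\<psi> (of_real 0 * w)) \<le> m" using m by (simp add: zero)
    show "m \<le> norm (\<psi> (of_real 1 * w))" using that by (auto simp: m_def)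
  qed simp
  then obtain r s where r: "0 \<le> r" "r \<le> 1" "norm (\<psi> (of_real r * u)) = m"
    and s: "0 \<le> s" "s \<le> 1" "norm (\<psi> (of_real s * v)) = m" by blast
  have r0: "r \<noteq> 0" "s \<noteq> 0" using r s m by (auto simp: zero)
  have val: "\<psi> (of_real r * w) = of_real m * T w" if "w \<in> {1, -1, \<i>, -\<i>}" "0 \<le> r" "r \<le> 1" "r \<noteq> 0" "norm (\<psi> (of_real r * w)) = m" for r w
  proof -
    have sv: "sign_vector (\<psi> (of_real r * w)) = T w" using T[of "of_real r * w"] ray[OF that(2,3,1)] that by simp
    have "\<psi> (of_real r * w) \<in> cross" using ray[OF that(2,3,1)] that by (simp add: cross)
    then have "\<psi> (of_real r * w) = of_real (norm (\<psi> (of_real r * w))) * sign_vector (\<psi> (of_real r * w))"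
      by (auto simp: complex_eq_iff cross_def cmod_def sgn_real_def)
    then show ?thesis using sv that by simp
  qed
  have "\<psi> (of_real r * u) = \<psi> (of_real s * v)"
    using val[OF assms(1) r(1,2) r0(1) r(3)] val[OF assms(2) s(1,2) r0(2) s(3)] assms(3) by simp
  then have "of_real r * u = of_real s * v"
    using inj_onD[OF inj] ray(1)[OF r(1,2) assms(1)] ray(1)[OF s(1,2) assms(2)] r s by simp
  then have "sign_vector (of_real r * u) = sign_vector (of_real s * v)" by simp
  then show "u = v" using ray(2)[OF r(1,2) assms(1)] ray(2)[OF s(1,2) assms(2)] r0 by simp
qed

text \<open>By injectivity the two half axes at a quadrant take both coordinate parts of the image
  label, so their images add up to it and stay perpendicular.\<close>

lemma T_sum:
  assumes "a \<in> {1, -1}" "b \<in> {1, -1}"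
  shows "T (Complex a b) = T (of_real a) + T (\<i> * of_real b)" "T (\<i> * of_real b) \<in> {\<i> * T (of_real a), - \<i> * T (of_real a)}"
proof -
  let ?d = "T (Complex a b)"
  have 1: "T (of_real a) \<in> {of_real (Re ?d), \<i> * of_real (Im ?d)}"
    "T (\<i> * of_real b) \<in> {of_real (Re ?d), \<i> * of_real (Im ?d)}"
    using T_adjacent(1)[OF assms] by blast+
  have ne: "T (of_real a) \<noteq> T (\<i> * of_real b)"
    using T_inj[of "of_real a" "\<i> * of_real b"] assms by (auto simp: complex_eq_iff)
  have d: "\<bar>Re ?d\<bar> = 1" "\<bar>Im ?d\<bar> = 1" using T_adjacent(2,3)[OF assms] by blast+
  show "?d = T (of_real a) + T (\<i> * of_real b)" using 1 ne by (auto simp: complex_eq_iff)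
  show "T (\<i> * of_real b) \<in> {\<i> * T (of_real a), - \<i> * T (of_real a)}"
  proof -
    have "Im ?d = Re ?d \<or> Im ?d = - Re ?d" using d by (auto simp: abs_if split: if_splits)
    then show ?thesis using 1 ne by (elim disjE) (auto simp: complex_i_mult_minus)
  qed
qed

lemma T_linear:
  shows "T (-1) = - T 1" "T (-\<i>) = - T \<i>" "T \<i> \<in> {\<i> * T 1, - \<i> * T 1}"
proof -
  show i: "T \<i> \<in> {\<i> * T 1, - \<i> * T 1}" using T_sum(2)[of 1 1] by simp
  have mi: "T (-\<i>) \<in> {\<i> * T 1, - \<i> * T 1}" using T_sum(2)[of 1 "-1"] by simp
  have "T \<i> \<noteq> T (-\<i>)" using T_inj[of \<i> "-\<i>"] by (auto simp: complex_eq_iff)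
  then show "T (-\<i>) = - T \<i>" using i mi by auto
  have "T \<i> \<in> {\<i> * T (-1), - \<i> * T (-1)}" using T_sum(2)[of "-1" 1] by simp
  moreover have "T 1 \<noteq> T (-1)" using T_inj[of 1 "-1"] by (auto simp: complex_eq_iff)
  ultimately show "T (-1) = - T 1" using i by (auto simp: complex_eq_iff)
qed

text \<open>Since \<open>T \<i>\<close> is \<open>T 1\<close> turned by a right angle, the
  transition map acts on the labels as one of the eight symmetries of the square.\<close>

lemma sign_vector_image:
  assumes "norm z \<le> 1"
  shows "sign_vector (\<psi> z) = of_real (sgn (Re z)) * T 1 + of_real (sgn (Im z)) * T \<i>"
proof -
  have T0: "T 0 = 0" by (simp add: T_def zero sign_vector_0_iff)
  have c: "T (Complex a b) = of_real a * T 1 + of_real b * T \<i>" if "a \<in> {-1, 0, 1}" "b \<in> {-1, 0, 1}" for a b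
  proof -
    have e: "Complex a 0 = of_real a" "Complex 0 b = \<i> * of_real b" for a b by (auto simp: complex_eq_iff)
    show ?thesis
      using that T_sum(1)[of a b] T_linear T0 by (auto simp: e)
  qed
  have "sgn x \<in> {-1, 0, 1}" for x :: real by (auto simp: sgn_real_def)
  then show ?thesis using T[OF assms] c by (simp add: sign_vector_def)
qed

end

section \<open>Isotopic resolutions from two charts of one crossing\<close>

lemma continuous_on_nonneg_cases:
  fixes f g :: "real \<Rightarrow> 'a::topological_space"
  assumes "continuous_on {0..1} f" "continuous_on {-1..0} g" "f 0 = g 0"
  shows "continuous_on {-1..1} (\<lambda>x. if 0 \<le> x then f x else g x)"
proof -
  have "continuous_on ({0..1} \<union> {-1..0}) (\<lambda>x. if 0 \<le> x then f x else g x)"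
    by (rule continuous_on_cases) (use assms in \<open>auto simp: order.antisym\<close>)
  moreover have "{0..1} \<union> {-1..0} = {-1..1::real}" by auto
  ultimately show ?thesis by simp
qed

lemma norm_coordinates_le: "norm z \<le> 1 \<Longrightarrow> Re z \<in> {-1..1} \<and> Im z \<in> {-1..1}"
  using abs_Re_le_cmod[of z] abs_Im_le_cmod[of z] by auto

text \<open>Products of sign preserving maps of the coordinates keep every cell. They serve to
  rescale a chart differently on its positive and its negative half axes.\<close>

locale axis_maps =
  fixes m1 m2 :: "real \<Rightarrow> real"
  assumes m1: "continuous_on {-1..1} m1" "inj_on m1 {-1..1}" "\<And>x. x \<in> {-1..1} \<Longrightarrow> sgn (m1 x) = sgn x"
    and m2: "continuous_on {-1..1} m2" "inj_on m2 {-1..1}" "\<And>x. x \<in> {-1..1} \<Longrightarrow> sgn (m2 x) = sgn x"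
begin

definition M :: "complex \<Rightarrow> complex" where "M z = Complex (m1 (Re z)) (m2 (Im z))"

lemma continuous_M: "continuous_on (cball 0 1) M"
proof -
  have "continuous_on (cball 0 1) (\<lambda>z. m1 (Re z))"
    by (rule continuous_on_compose2[OF m1(1) continuous_on_Re[OF continuous_on_id]])
      (use norm_coordinates_le in auto)
  moreover have "continuous_on (cball 0 1) (\<lambda>z. m2 (Im z))"
    by (rule continuous_on_compose2[OF m2(1) continuous_on_Im[OF continuous_on_id]])
      (use norm_coordinates_le in auto)
  ultimately show ?thesis unfolding M_def Complex_eq
    by (intro continuous_on_add continuous_on_mult continuous_on_const continuous_on_of_real)
qed

lemma inj_M: "inj_on M (cball 0 1)"
  using m1(2) m2(2) norm_coordinates_le by (auto simp: inj_on_def M_def complex_eq_iff)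

lemma sign_vector_M: "norm z \<le> 1 \<Longrightarrow> sign_vector (M z) = sign_vector z"
  using m1(3) m2(3) norm_coordinates_le[of z] by (simp add: sign_vector_def M_def)

end

lemma cross_iff_sign_vector:
  assumes "norm z \<le> 1" "norm w \<le> 1" "sign_vector z = sign_vector w"
  shows "z \<in> cross \<longleftrightarrow> w \<in> cross"
proof -
  have "Re z = 0 \<longleftrightarrow> Re w = 0" "Im z = 0 \<longleftrightarrow> Im w = 0"
    using assms(3) by (metis sgn_0_0 sign_vector_simps)+
  then show ?thesis using assms by (simp add: cross_def)
qed

text \<open>The identity on the incoming quadrant and multiplication by \<open>a\<close> on the
  outgoing one: it gives the intermediate chart between a chart and its rescaling.\<close>

definition shrink_out :: "real \<Rightarrow> complex \<Rightarrow> complex" where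
  "shrink_out a z = Complex (if 0 \<le> Re z then a * Re z else Re z) (if 0 \<le> Im z then a * Im z else Im z)"

lemma cross_disk_shrink_out:
  assumes c: "cross_disk S \<phi>" and a: "0 < a" "a \<le> 1"
  shows "cross_disk S (\<phi> \<circ> shrink_out a)"
proof -
  interpret axis_maps "\<lambda>x. if 0 \<le> x then a * x else x" "\<lambda>x. if 0 \<le> x then a * x else x"
    by unfold_locales (use a in \<open>auto intro!: continuous_on_nonneg_cases continuous_intros
      simp: inj_on_def sgn_mult zero_le_mult_iff split: if_splits\<close>)
  have M: "M = shrink_out a" by (auto simp: M_def shrink_out_def)
  have n: "norm (M z) \<le> norm z" for z
  proof -
    have "a * \<bar>x\<bar> \<le> \<bar>x\<bar>" for x :: real using a by (simp add: mult_left_le_one_le)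
    from this[of "Re z"] this[of "Im z"] have "\<bar>Re (M z)\<bar> \<le> \<bar>Re z\<bar>" "\<bar>Im (M z)\<bar> \<le> \<bar>Im z\<bar>" using a by (auto simp: M_def abs_mult)
    then show ?thesis unfolding cmod_def abs_le_square_iff by (intro real_sqrt_le_mono add_mono)
  qed
  have "cross_disk S (\<phi> \<circ> M)"
    by (rule cross_disk_reparametrize[OF c continuous_M inj_M])
      (use n sign_vector_M cross_iff_sign_vector in \<open>meson order_trans\<close>)
  then show ?thesis by (simp add: M)
qed

lemma cross_disk_scale:
  assumes c: "cross_disk S \<phi>" and a: "0 < a" "a \<le> 1"
  shows "cross_disk S (\<lambda>z. \<phi> (of_real a * z))"
proof -
  have "cross_disk S (\<phi> \<circ> (\<lambda>z. of_real a * z))"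
    by (rule cross_disk_reparametrize[OF c]) 
      (use a in \<open>auto intro!: continuous_intros mult_le_one simp: inj_on_def norm_mult cross_def\<close>)
  then show ?thesis by (simp add: o_def)
qed

lemma resolve_at_scale:
  assumes S: "S \<subseteq> S2" and c: "cross_disk S \<phi>" and a: "0 < a" "a \<le> 1"
  shows "isotopic (resolve_at S \<phi>) (resolve_at S (\<lambda>z. \<phi> (of_real a * z)))"
proof -
  have 1: "isotopic (resolve_at S \<phi>) (resolve_at S (\<phi> \<circ> shrink_out a))"
    by (rule resolve_at_in_quadrant[OF S c cross_disk_shrink_out[OF c a]])
      (auto simp: shrink_out_def complex_eq_iff intro!: arg_cong[of _ _ \<phi>])
  have 2: "isotopic (resolve_at S (\<phi> \<circ> shrink_out a)) (resolve_at S (\<lambda>z. \<phi> (of_real a * z)))"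
    by (rule resolve_at_out_quadrant[OF S cross_disk_shrink_out[OF c a] cross_disk_scale[OF c a]])
      (auto simp: shrink_out_def complex_eq_iff intro!: arg_cong[of _ _ \<phi>])
  show ?thesis by (rule isotopic_trans[OF resolve_at_subset[OF S c] 1 2])
qed

text \<open>Meant for the transition map restricted to an outgoing half axis; the inverse allows two
  charts to be glued along that half axis.\<close>

lemma continuous_right_inverse:
  fixes f :: "real \<Rightarrow> real"
  assumes f: "continuous_on {0..b} f" "inj_on f {0..b}" "f 0 = 0" and b: "0 \<le> b" "a \<le> f b" and a: "0 \<le> a"
  obtains k where "continuous_on {0..a} k" "\<And>y. y \<in> {0..a} \<Longrightarrow> k y \<in> {0..b} \<and> f (k y) = y" "k 0 = 0"
proof -
  obtain k where k: "homeomorphism {0..b} (f ` {0..b}) f k"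
    using homeomorphism_compact[OF compact_Icc f(1) refl f(2)] by blast
  have sub: "{0..a} \<subseteq> f ` {0..b}"
  proof
    fix y assume "y \<in> {0..a}"
    then have "\<exists>x\<ge>0. x \<le> b \<and> f x = y" using f b by (intro IVT') auto
    then show "y \<in> f ` {0..b}" by auto
  qed
  have "continuous_on {0..a} k" by (rule continuous_on_subset[OF homeomorphism_cont2[OF k] sub])
  moreover have 1: "k y \<in> {0..b} \<and> f (k y) = y" if "y \<in> {0..a}" for y
  proof -
    have y: "y \<in> f ` {0..b}" using sub that by (rule subsetD)
    have "k y \<in> k ` f ` {0..b}" using y by (rule imageI)
    then show ?thesis using homeomorphism_apply2[OF k y] homeomorphism_image2[OF k] by simp
  qed
  moreover have "k 0 = 0" using 1[of 0] inj_onD[OF f(2), of "k 0" 0] f(3) a b by auto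
  ultimately show ?thesis using that by blast
qed

text \<open>The chart \<open>\<phi>1 \<circ> \<rho>\<close> mediates: on the outgoing quadrant it is
  \<open>\<phi>1\<close> scaled by \<open>a\<close>, on the incoming one it is
  \<open>\<phi>2\<close> scaled by 1/2. On the other two quadrants it is \<open>\<phi>2\<close>
  after a change \<open>M\<close> of coordinates that makes the pieces fit along the outgoing half
  axes.\<close>

lemma resolve_at_refine_aligned:
  assumes S: "S \<subseteq> S2" and c1: "cross_disk S \<phi>1" and c2: "cross_disk S \<phi>2"
    and \<psi>: "continuous_on (cball 0 1) \<psi>" "inj_on \<psi> (cball 0 1)"
    and eq: "\<And>z. norm z \<le> 1 \<Longrightarrow> \<phi>1 (\<psi> z) = \<phi>2 z"
    and nm: "\<And>z. norm z \<le> 1 \<Longrightarrow> norm (\<psi> z) \<le> 1"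
    and sv: "\<And>z. norm z \<le> 1 \<Longrightarrow> sign_vector (\<psi> z) = sign_vector z"
  shows "isotopic (resolve_at S \<phi>1) (resolve_at S \<phi>2)"
proof -
  have \<psi>0: "\<psi> 0 = 0" using sv[of 0] by (simp add: sign_vector_def complex_eq_iff sgn_0_0)
  have real: "\<psi> (of_real x) = of_real (Re (\<psi> (of_real x)))" if "x \<in> {0..1/2}" for x
    using sv[of "of_real x"] that by (auto simp: sign_vector_def complex_eq_iff sgn_0_0)
  have imag: "\<psi> (\<i> * of_real x) = \<i> * of_real (Im (\<psi> (\<i> * of_real x)))" if "x \<in> {0..1/2}" for x
    using sv[of "\<i> * of_real x"] that by (auto simp: sign_vector_def complex_eq_iff sgn_0_0 norm_mult)
  have c: "continuous_on {0..1/2} (\<lambda>x. Re (\<psi> (of_real x)))" "continuous_on {0..1/2} (\<lambda>x. Im (\<psi> (\<i> * of_real x)))"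
    by (intro continuous_on_Re continuous_on_Im; rule continuous_on_compose2[OF \<psi>(1)];
        auto intro!: continuous_intros simp: norm_mult)+
  have i1: "inj_on (\<lambda>x. Re (\<psi> (of_real x))) {0..1/2}"
  proof (rule inj_onI)
    fix x y :: real assume xy: "x \<in> {0..1/2}" "y \<in> {0..1/2}" "Re (\<psi> (of_real x)) = Re (\<psi> (of_real y))"
    then have "\<psi> (of_real x) = \<psi> (of_real y)" using real by metis
    then have "complex_of_real x = of_real y" by (rule inj_onD[OF \<psi>(2)]) (use xy in auto)
    then show "x = y" by simp
  qed
  have i2: "inj_on (\<lambda>x. Im (\<psi> (\<i> * of_real x))) {0..1/2}"
  proof (rule inj_onI)
    fix x y :: real assume xy: "x \<in> {0..1/2}" "y \<in> {0..1/2}" "Im (\<psi> (\<i> * of_real x)) = Im (\<psi> (\<i> * of_real y))"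
    then have "\<psi> (\<i> * of_real x) = \<psi> (\<i> * of_real y)" using imag by metis
    then have "\<i> * complex_of_real x = \<i> * of_real y" by (rule inj_onD[OF \<psi>(2)]) (use xy in \<open>auto simp: norm_mult\<close>)
    then show "x = y" by simp
  qed
  \<comment> \<open>With this bound, the part [0, a] of each outgoing half axis is covered by the
    image of its inner half, as \<open>continuous_right_inverse\<close> requires.\<close>
  define a where "a = min (Re (\<psi> (of_real (1/2)))) (Im (\<psi> (\<i> * of_real (1/2))))"
  have a: "0 < a" "a \<le> Re (\<psi> (of_real (1/2)))" "a \<le> Im (\<psi> (\<i> * of_real (1/2)))"
    using sv[of "of_real (1/2)"] sv[of "\<i> * of_real (1/2)"]
    by (auto simp: a_def sign_vector_def norm_mult norm_divide sgn_1_pos)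
  have a1: "a \<le> 1" using a(2) nm[of "of_real (1/2)"] complex_Re_le_cmod[of "\<psi> (of_real (1/2))"] by (simp add: norm_divide)
  obtain k1 where k1: "continuous_on {0..a} k1"
    "\<And>y. y \<in> {0..a} \<Longrightarrow> k1 y \<in> {0..1/2} \<and> Re (\<psi> (of_real (k1 y))) = y" "k1 0 = 0"
    by (rule continuous_right_inverse[OF c(1) i1]) (use a \<psi>0 in auto)
  obtain k2 where k2: "continuous_on {0..a} k2"
    "\<And>y. y \<in> {0..a} \<Longrightarrow> k2 y \<in> {0..1/2} \<and> Im (\<psi> (\<i> * of_real (k2 y))) = y" "k2 0 = 0"
    by (rule continuous_right_inverse[OF c(2) i2]) (use a \<psi>0 in auto)
  have scale: "a * x \<in> {0..a}" if "0 \<le> x" "x \<le> 1" for x using that a by (simp add: mult_left_le)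
  \<comment> \<open>Positive coordinates go to the preimage of \<open>a * x\<close>, so that
    \<open>\<psi>\<close> after \<open>M\<close> is multiplication by \<open>a\<close> on the
    outgoing half axes; negative ones are halved.\<close>
  have m: "continuous_on {-1..1} (\<lambda>x. if 0 \<le> x then k (a * x) else x / 2) \<and>
    inj_on (\<lambda>x. if 0 \<le> x then k (a * x) else x / 2) {-1..1} \<and>
    (\<forall>x\<in>{-1..1}. sgn (if 0 \<le> x then k (a * x) else x / 2) = sgn x)"
    if k: "continuous_on {0..a} k" "\<And>y. y \<in> {0..a} \<Longrightarrow> k y \<in> {0..1/2} \<and> g (k y) = y" "k 0 = 0" "g 0 = 0"
    for k g :: "real \<Rightarrow> real"
  proof -
    have 1: "continuous_on {0..1} (\<lambda>x. k (a * x))"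
      by (rule continuous_on_compose2[OF k(1)]) (use scale in \<open>auto intro!: continuous_intros\<close>)
    have pos: "0 < k (a * x)" if "0 < x" "x \<le> 1" for x
    proof -
      have "k (a * x) \<noteq> 0" using k(2)[OF scale[of x]] k(4) that a by auto
      then show ?thesis using k(2)[OF scale[of x]] that by auto
    qed
    have "inj_on (\<lambda>x. if 0 \<le> x then k (a * x) else x / 2) {-1..1}"
    proof (rule inj_onI)
      fix x y :: real assume xy: "x \<in> {-1..1}" "y \<in> {-1..1}"
        "(if 0 \<le> x then k (a * x) else x / 2) = (if 0 \<le> y then k (a * y) else y / 2)"
      have n: "0 \<le> k (a * x)" if "0 \<le> x" "x \<le> 1" for x using k(2)[OF scale[OF that]] by auto
      consider "0 \<le> x" "0 \<le> y" | "x < 0" "y < 0" | "0 \<le> x" "y < 0" | "x < 0" "0 \<le> y" by linarith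
      then show "x = y"
      proof cases
        case 1
        then have "a * x = a * y" using xy k(2)[OF scale[of x]] k(2)[OF scale[of y]] by auto
        then show ?thesis using a by simp
      qed (use xy n[of x] n[of y] in auto)
    qed
    moreover have "continuous_on {-1..1} (\<lambda>x. if 0 \<le> x then k (a * x) else x / 2)"
      by (rule continuous_on_nonneg_cases[OF 1]) (use k in \<open>auto intro!: continuous_intros\<close>)
    moreover have "sgn (if 0 \<le> x then k (a * x) else x / 2) = sgn x" if "x \<in> {-1..1}" for x
      using pos[of x] that k(3) by (cases "x = 0") (auto simp: sgn_1_neg sgn_if)
    ultimately show ?thesis by blast
  qed
  interpret axis_maps "\<lambda>x. if 0 \<le> x then k1 (a * x) else x / 2" "\<lambda>x. if 0 \<le> x then k2 (a * x) else x / 2"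
    using m[of k1 "\<lambda>x. Re (\<psi> (of_real x))", OF k1] m[of k2 "\<lambda>x. Im (\<psi> (\<i> * of_real x))", OF k2] \<psi>0
    by unfold_locales auto
  \<comment> \<open>The preimages were also taken in [0, 1/2], so both coordinates are at most 1/2
    in absolute value and \<open>M\<close> maps into the disk.\<close>
  have M1: "norm (M z) \<le> 1" if z: "norm z \<le> 1" for z
  proof (rule norm_le_1_sum)
    have "\<bar>Re (M z)\<bar> \<le> 1/2" "\<bar>Im (M z)\<bar> \<le> 1/2"
      using norm_coordinates_le[OF z] k1(2)[OF scale[of "Re z"]] k2(2)[OF scale[of "Im z"]] by (auto simp: M_def)
    then show "\<bar>Re (M z)\<bar> + \<bar>Im (M z)\<bar> \<le> 1" by simp
  qed
  define \<rho> where "\<rho> z = (if 0 \<le> Re z \<and> 0 \<le> Im z then of_real a * z else \<psi> (M z))" for z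
  have axis: "\<psi> (M z) = of_real a * z" if "norm z \<le> 1" "0 \<le> Re z" "0 \<le> Im z" "Re z = 0 \<or> Im z = 0" for z
  proof (cases "Im z = 0")
    case True
    have Mz: "M z = of_real (k1 (a * Re z))" using True that k2(3) by (simp add: M_def complex_eq_iff)
    show ?thesis unfolding Mz
      using k1(2)[OF scale[of "Re z"]] real[of "k1 (a * Re z)"] norm_coordinates_le[OF that(1)] that True
      by (simp add: complex_eq_iff)
  next
    case False
    then have "Re z = 0" using that by simp
    then have Mz: "M z = \<i> * of_real (k2 (a * Im z))" using that k1(3) by (simp add: M_def complex_eq_iff)
    show ?thesis unfolding Mz
      using k2(2)[OF scale[of "Im z"]] imag[of "k2 (a * Im z)"] norm_coordinates_le[OF that(1)] that \<open>Re z = 0\<close>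
      by (simp add: complex_eq_iff)
  qed
  have \<rho>sv: "sign_vector (\<rho> z) = sign_vector z" "norm (\<rho> z) \<le> 1" if z: "norm z \<le> 1" for z
  proof -
    show "sign_vector (\<rho> z) = sign_vector z"
      using sv[OF M1[OF z]] sign_vector_M[OF z] a by (auto simp: \<rho>_def sign_vector_def sgn_mult)
    show "norm (\<rho> z) \<le> 1"
      using nm[OF M1[OF z]] a a1 z by (auto simp: \<rho>_def norm_mult intro!: mult_le_one)
  qed
  have \<rho>cont: "continuous_on (cball 0 1) \<rho>"
  proof -
    let ?A = "{z \<in> cball 0 1. 0 \<le> Re z \<and> 0 \<le> Im z}" and ?B = "{z \<in> cball 0 1. Re z \<le> 0 \<or> Im z \<le> 0}"
    have \<psi>M: "continuous_on (cball 0 1) (\<lambda>z. \<psi> (M z))"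
      by (rule continuous_on_compose2[OF \<psi>(1) continuous_M]) (use M1 in auto)
    have A: "closed ?A" "closed ?B"
    proof -
      have "?A = cball 0 1 \<inter> ({z. 0 \<le> Re z} \<inter> {z. 0 \<le> Im z})"
        "?B = cball 0 1 \<inter> ({z. Re z \<le> 0} \<union> {z. Im z \<le> 0})" by auto
      then show "closed ?A" "closed ?B"
        using closed_halfspace_Re_ge closed_halfspace_Im_ge closed_halfspace_Re_le closed_halfspace_Im_le
        by (auto intro!: closed_Int closed_Un)
    qed
    have "continuous_on (?A \<union> ?B) (\<lambda>z. if 0 \<le> Re z \<and> 0 \<le> Im z then of_real a * z else \<psi> (M z))"
      by (rule continuous_on_cases[OF A]) (use axis in \<open>auto intro!: continuous_intros continuous_on_subset[OF \<psi>M]\<close>)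
    moreover have "?A \<union> ?B = cball 0 1" by auto
    ultimately show ?thesis by (simp add: \<rho>_def[abs_def])
  qed
  have \<rho>inj: "inj_on \<rho> (cball 0 1)"
  proof (rule inj_onI)
    fix z w assume zw: "z \<in> cball 0 1" "w \<in> cball 0 1" "\<rho> z = \<rho> w"
    then have s: "sign_vector z = sign_vector w" using \<rho>sv by (metis mem_cball_0)
    then have "sgn (Re z) = sgn (Re w)" "sgn (Im z) = sgn (Im w)" by (metis sign_vector_simps)+
    then have q: "(0 \<le> Re z \<and> 0 \<le> Im z) \<longleftrightarrow> (0 \<le> Re w \<and> 0 \<le> Im w)"
      by (auto simp: sgn_real_def split: if_splits)
    show "z = w"
    proof (cases "0 \<le> Re z \<and> 0 \<le> Im z")
      case True
      then show ?thesis using zw q a by (simp add: \<rho>_def)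
    next
      case False
      then have "\<psi> (M z) = \<psi> (M w)" using zw q by (simp add: \<rho>_def del: de_Morgan_conj)
      then have "M z = M w" using inj_onD[OF \<psi>(2)] M1 zw by simp
      then show ?thesis using inj_onD[OF inj_M] zw by blast
    qed
  qed
  have c\<rho>: "cross_disk S (\<phi>1 \<circ> \<rho>)"
    by (rule cross_disk_reparametrize[OF c1 \<rho>cont \<rho>inj]) (use \<rho>sv cross_iff_sign_vector in blast)
  have c\<rho>0: "cross_disk S (\<phi>1 \<circ> shrink_out a)" by (rule cross_disk_shrink_out[OF c1 a(1) a1])
  have h: "0 < (1/2::real)" "(1/2::real) \<le> 1" by auto
  note ch = cross_disk_scale[OF c2 h]
  have 1: "isotopic (resolve_at S \<phi>1) (resolve_at S (\<phi>1 \<circ> shrink_out a))"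
    by (rule resolve_at_in_quadrant[OF S c1 c\<rho>0])
      (auto simp: shrink_out_def complex_eq_iff intro!: arg_cong[of _ _ \<phi>1])
  have 2: "isotopic (resolve_at S (\<phi>1 \<circ> shrink_out a)) (resolve_at S (\<phi>1 \<circ> \<rho>))"
    by (rule resolve_at_out_quadrant[OF S c\<rho>0 c\<rho>])
      (auto simp: shrink_out_def \<rho>_def complex_eq_iff intro!: arg_cong[of _ _ \<phi>1])
  have 3: "isotopic (resolve_at S (\<phi>1 \<circ> \<rho>)) (resolve_at S (\<lambda>z. \<phi>2 (of_real (1/2) * z)))"
  proof (rule resolve_at_in_quadrant[OF S c\<rho> ch])
    fix z :: complex assume z: "norm z \<le> 1" "Re z \<le> 0" "Im z \<le> 0"
    have "\<rho> z = \<psi> (M z)" using axis[of z] z by (auto simp: \<rho>_def)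
    moreover have "M z = of_real (1/2) * z"
      using z k1(3) k2(3) by (auto simp: M_def complex_eq_iff)
    ultimately show "(\<phi>1 \<circ> \<rho>) z = \<phi>2 (of_real (1/2) * z)"
      using eq[of "of_real (1/2) * z"] z by (simp add: norm_mult norm_divide)
  qed
  have 4: "isotopic (resolve_at S (\<lambda>z. \<phi>2 (of_real (1/2) * z))) (resolve_at S \<phi>2)"
    by (rule isotopic_sym[OF resolve_at_subset[OF S c2] resolve_at_scale[OF S c2 h]])
  note sub = resolve_at_subset[OF S]
  show ?thesis
    by (rule isotopic_trans[OF sub[OF c1] 1 isotopic_trans[OF sub[OF c\<rho>0] 2 isotopic_trans[OF sub[OF c\<rho>] 3 4]]])
qed

lemma chart_transition:
  assumes c1: "cross_disk S \<phi>1" and c2: "cross_disk S \<phi>2"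
    and sub: "\<phi>2 ` cball 0 1 \<subseteq> \<phi>1 ` cball 0 1" and center: "\<phi>2 0 = \<phi>1 0"
  obtains \<psi> where "cross_embedding \<psi>" "\<And>z. norm z \<le> 1 \<Longrightarrow> \<phi>1 (\<psi> z) = \<phi>2 z"
proof -
  have d1: "continuous_on (cball 0 1) \<phi>1" "inj_on \<phi>1 (cball 0 1)"
    and d2: "continuous_on (cball 0 1) \<phi>2" "inj_on \<phi>2 (cball 0 1)"
    using c1 c2 by (auto simp: cross_disk_def disk_embedding_def)
  obtain g where g: "homeomorphism (cball 0 1) (\<phi>1 ` cball 0 1) \<phi>1 g"
    using homeomorphism_compact[OF compact_cball d1(1) refl d1(2)] by blast
  have gd: "norm (g (\<phi>2 z)) \<le> 1" "\<phi>1 (g (\<phi>2 z)) = \<phi>2 z" if "norm z \<le> 1" for z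
  proof -
    have z: "\<phi>2 z \<in> \<phi>1 ` cball 0 1" using sub that by auto
    show "\<phi>1 (g (\<phi>2 z)) = \<phi>2 z" by (rule homeomorphism_apply2[OF g z])
    have "g (\<phi>2 z) \<in> cball 0 1" using homeomorphism_image2[OF g] z by blast
    then show "norm (g (\<phi>2 z)) \<le> 1" by simp
  qed
  have "cross_embedding (\<lambda>z. g (\<phi>2 z))"
  proof
    show "continuous_on (cball 0 1) (\<lambda>z. g (\<phi>2 z))"
      by (rule continuous_on_compose2[OF homeomorphism_cont2[OF g] d2(1) sub])
    show "inj_on (\<lambda>z. g (\<phi>2 z)) (cball 0 1)"
      by (rule inj_onI) (metis gd(2) d2(2) inj_onD mem_cball_0)
    show "g (\<phi>2 0) = 0" using g by (simp add: center homeomorphism_def)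
    fix z :: complex assume z: "norm z \<le> 1"
    then show "norm (g (\<phi>2 z)) \<le> 1" by (rule gd)
    show "g (\<phi>2 z) \<in> cross \<longleftrightarrow> z \<in> cross"
      using cross_disk_mem[OF c1 gd(1)[OF z]] cross_disk_mem[OF c2 z] gd(2)[OF z] by simp
  qed
  then show ?thesis using gd(2) that by blast
qed

text \<open>Knowing one point on each outgoing half axis suffices, since the transition map permutes the
  half axes.\<close>

lemma resolve_at_refine:
  assumes S: "S \<subseteq> S2" and c1: "cross_disk S \<phi>1" and c2: "cross_disk S \<phi>2"
    and sub: "\<phi>2 ` cball 0 1 \<subseteq> \<phi>1 ` cball 0 1" and center: "\<phi>2 0 = \<phi>1 0"
    and r: "0 < r" "r \<le> 1" "\<phi>2 (of_real r) \<in> \<phi>1 ` {z \<in> cross. 0 \<le> Re z \<and> 0 \<le> Im z}"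
    and r': "0 < r'" "r' \<le> 1" "\<phi>2 (\<i> * of_real r') \<in> \<phi>1 ` {z \<in> cross. 0 \<le> Re z \<and> 0 \<le> Im z}"
  shows "isotopic (resolve_at S \<phi>1) (resolve_at S \<phi>2)"
proof -
  obtain \<psi> where "cross_embedding \<psi>" and eq: "\<And>z. norm z \<le> 1 \<Longrightarrow> \<phi>1 (\<psi> z) = \<phi>2 z"
    using chart_transition[OF c1 c2 sub center] by blast
  then interpret cross_embedding \<psi> by simp
  have inj1: "inj_on \<phi>1 (cball 0 1)" using c1 by (simp add: cross_disk_def disk_embedding_def)
  have out: "sign_vector (\<psi> z) \<in> {1, \<i>}"
    if z: "norm z \<le> 1" "z \<noteq> 0" "\<phi>2 z \<in> \<phi>1 ` {z \<in> cross. 0 \<le> Re z \<and> 0 \<le> Im z}" for z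
  proof -
    obtain w where w: "\<phi>2 z = \<phi>1 w" "w \<in> cross" "0 \<le> Re w" "0 \<le> Im w" using z(3) by blast
    have "\<psi> z = w"
      by (rule inj_onD[OF inj1]) (use w eq[OF z(1)] disk[OF z(1)] in \<open>auto simp: cross_def\<close>)
    then show ?thesis using w nonzero[OF z(1,2)]
      by (auto simp: cross_def complex_eq_iff sgn_real_def)
  qed
  have T1: "T 1 \<in> {1, \<i>}"
  proof -
    have "sign_vector (of_real r) = 1" using r by (simp add: complex_eq_iff)
    then show ?thesis using out[of "of_real r"] T[of "of_real r"] r by simp
  qed
  have Ti: "T \<i> \<in> {1, \<i>}"
  proof -
    have "sign_vector (\<i> * of_real r') = \<i>" using r' by (simp add: complex_eq_iff)
    then show ?thesis using out[of "\<i> * of_real r'"] T[of "\<i> * of_real r'"] r' by (simp add: norm_mult)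
  qed
  \<comment> \<open>Both positive half axes go to positive ones, so the cells are kept or reflected
    in the diagonal. In the second case the branches of \<open>\<phi>2\<close> are renamed, which
    leaves its resolution unchanged.\<close>
  consider "T 1 = 1" "T \<i> = \<i>" | "T 1 = \<i>" "T \<i> = 1" using T1 Ti T_linear(3) by (auto simp: complex_eq_iff)
  then show ?thesis
  proof cases
    case 1
    have "sign_vector (\<psi> z) = sign_vector z" if "norm z \<le> 1" for z
      using sign_vector_image[OF that] 1 by (simp add: complex_eq_iff)
    then show ?thesis using resolve_at_refine_aligned[OF S c1 c2 cont inj eq disk] by blast
  next
    case 2
    have ct: "continuous_on (cball 0 1) transpose_axes"
      unfolding transpose_axes_def[abs_def] Complex_eq by (intro continuous_intros)
    have "isotopic (resolve_at S \<phi>1) (resolve_at S (\<phi>2 \<circ> transpose_axes))"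
    proof (rule resolve_at_refine_aligned[OF S c1 cross_disk_transpose[OF c2], of "\<psi> \<circ> transpose_axes"])
      show "continuous_on (cball 0 1) (\<psi> \<circ> transpose_axes)"
        by (rule continuous_on_compose[OF ct continuous_on_subset[OF cont]]) auto
      show "inj_on (\<psi> \<circ> transpose_axes) (cball 0 1)"
        by (rule comp_inj_on[OF _ inj_on_subset[OF inj]])
          (auto simp: inj_on_def intro: transpose_axes_simps(3) dest: arg_cong[of _ _ transpose_axes])
      fix z :: complex assume z: "norm z \<le> 1"
      then show "\<phi>1 ((\<psi> \<circ> transpose_axes) z) = (\<phi>2 \<circ> transpose_axes) z"
        "norm ((\<psi> \<circ> transpose_axes) z) \<le> 1" using eq disk by auto
      show "sign_vector ((\<psi> \<circ> transpose_axes) z) = sign_vector z"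
        using sign_vector_image[of "transpose_axes z"] z 2 by (simp add: complex_eq_iff)
    qed
    then show ?thesis by (simp add: resolve_at_transpose)
  qed
qed

subsection \<open>Topological knot curves\<close>

lemma range_reverse: "range (\<lambda>t. \<gamma> (- t)) = range \<gamma>" for \<gamma> :: "real \<Rightarrow> 'a"
proof safe
  fix t show "\<gamma> t \<in> range (\<lambda>t. \<gamma> (- t))" by (rule image_eqI[of _ _ "- t"]) auto
qed auto

lemma runs_along_reverse:
  assumes r: "runs_along \<gamma> A p q"
  shows "runs_along (\<lambda>t. \<gamma> (- t)) A q p"
proof -
  obtain a b where "a < b" "\<gamma> a = p" "\<gamma> b = q" "\<gamma> ` {a..b} = A" using r by (auto simp: runs_along_def)
  moreover have "(\<lambda>t. \<gamma> (- t)) ` {-b..-a} = \<gamma> ` uminus ` {-b..-a}" by (simp only: image_image)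
  ultimately show ?thesis unfolding runs_along_def by (intro exI[of _ "-b"] exI[of _ "-a"]) simp
qed

lemma crossing_chart_reverse:
  assumes \<phi>: "crossing_chart \<gamma> v \<phi>"
  shows "crossing_chart (\<lambda>t. \<gamma> (- t)) v (\<phi> \<circ> uminus)"
proof -
  have "cross_disk (range \<gamma>) \<phi>" using \<phi> by (simp add: crossing_chart_def cross_disk_def cross_eq)
  then have "cross_disk (range \<gamma>) (\<phi> \<circ> uminus)" by (rule cross_disk_uminus)
  moreover have "uminus ` closed_segment (-1) (1::complex) = closed_segment (-1) 1"
    "uminus ` closed_segment (-\<i>) \<i> = closed_segment (-\<i>) \<i>"
    using closed_segment_linear_image[of uminus "-1" "1::complex"] closed_segment_linear_image[of uminus "-\<i>" \<i>]
    by (auto simp: linear_uminus closed_segment_commute)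
  then have "(\<phi> \<circ> uminus) ` closed_segment (-1) 1 = \<phi> ` closed_segment (-1) 1"
    "(\<phi> \<circ> uminus) ` closed_segment (-\<i>) \<i> = \<phi> ` closed_segment (-\<i>) \<i>"
    by (metis image_comp)+
  ultimately show "crossing_chart (\<lambda>t. \<gamma> (- t)) v (\<phi> \<circ> uminus)"
    using \<phi> runs_along_reverse unfolding crossing_chart_def cross_disk_def range_reverse cross_eq by simp
qed

locale closed_curve =
  fixes \<gamma> :: "real \<Rightarrow> real^3"
  assumes cont: "continuous_on UNIV \<gamma>" and sphere: "range \<gamma> \<subseteq> S2"
    and periodic: "\<And>t. \<gamma> (t + 1) = \<gamma> t" and finite_double: "finite (double_points \<gamma>)"
    and no_triple: "\<And>r s t. r \<in> {0..<1} \<Longrightarrow> s \<in> {0..<1} \<Longrightarrow> t \<in> {0..<1} \<Longrightarrow>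
        \<gamma> r = \<gamma> s \<Longrightarrow> \<gamma> s = \<gamma> t \<Longrightarrow> r = s \<or> s = t \<or> r = t"
begin

lemma periodic_nat: "\<gamma> (t + real n) = \<gamma> t"
proof (induction n)
  case (Suc n)
  then show ?case using periodic[of "t + real n"] by (simp add: algebra_simps)
qed simp

lemma periodic_int: "\<gamma> (t + of_int n) = \<gamma> t"
proof (cases "0 \<le> n")
  case True
  then show ?thesis using periodic_nat[of t "nat n"] by simp
next
  case False
  then show ?thesis using periodic_nat[of "t + of_int n" "nat (- n)"] by simp
qed

lemma periodic_Ints: "s - t \<in> \<int> \<Longrightarrow> \<gamma> s = \<gamma> t"
  by (elim Ints_cases) (metis add.commute diff_add_cancel periodic_int)

lemma frac_value: "\<gamma> (frac t) = \<gamma> t"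
  by (rule periodic_Ints) (simp add: frac_def)

lemma frac_eq_frac_iff: "frac s = frac t \<longleftrightarrow> s - t \<in> \<int>" for s t :: real
  by (metis frac_eq_0_iff frac_diff_zero frac_diff_eq)

lemma unit_interval_Ints:
  "s \<in> {0..<1} \<Longrightarrow> t \<in> {0..<1} \<Longrightarrow> s - t \<in> \<int> \<Longrightarrow> s = t" for s t :: real
  using frac_eq_frac_iff[of s t] by (simp add: frac_eq)

lemma frac_in: "frac (t::real) \<in> {0..<1}"
  by (simp add: frac_lt_1)

lemma double_pointI: "\<gamma> s = \<gamma> t \<Longrightarrow> s - t \<notin> \<int> \<Longrightarrow> \<gamma> s \<in> double_points \<gamma>"
  unfolding double_points_def using frac_in frac_eq_frac_iff frac_value
  by (intro CollectI bexI[of _ "frac s"] bexI[of _ "frac t"]) auto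

lemma Ints_small: "x \<in> \<int> \<Longrightarrow> \<bar>x\<bar> < 1 \<Longrightarrow> x = 0" for x :: real
  by (elim Ints_cases) simp

lemma double_pointE:
  assumes "v \<in> double_points \<gamma>"
  obtains s t where "\<gamma> s = v" "\<gamma> t = v" "s - t \<notin> \<int>"
proof -
  obtain s t where st: "s \<in> {0..<1}" "t \<in> {0..<1}" "s \<noteq> t" "\<gamma> s = v" "\<gamma> t = v"
    using assms by (auto simp: double_points_def)
  have "s - t \<notin> \<int>" using st unit_interval_Ints by blast
  then show ?thesis using that st by blast
qed

lemma two_parameters:
  assumes "\<gamma> r = \<gamma> s" "\<gamma> s = \<gamma> t"
  shows "r - s \<in> \<int> \<or> s - t \<in> \<int> \<or> r - t \<in> \<int>"
  using no_triple[of "frac r" "frac s" "frac t"] assms frac_in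
  by (simp add: frac_value frac_eq_frac_iff)

text \<open>A point has at most two parameters in a period, and a bounded interval meets finitely
  many periods.\<close>

lemma finite_preimage: "finite {t \<in> {a..b}. \<gamma> t = v}"
proof -
  have "finite {t \<in> {0..<1}. \<gamma> t = v}"
  proof (cases "\<exists>r\<in>{0..<1}. \<exists>s\<in>{0..<1}. r \<noteq> s \<and> \<gamma> r = v \<and> \<gamma> s = v")
    case True
    then obtain r s where rs: "r \<in> {0..<1}" "s \<in> {0..<1}" "r \<noteq> s" "\<gamma> r = v" "\<gamma> s = v" by blast
    have "{t \<in> {0..<1}. \<gamma> t = v} \<subseteq> {r, s}"
    proof
      fix t assume "t \<in> {t \<in> {0..<1}. \<gamma> t = v}"
      then show "t \<in> {r, s}" using no_triple[of r s t] rs by auto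
    qed
    then show ?thesis by (rule finite_subset) simp
  next
    case False
    then have "\<And>x y. x \<in> {t \<in> {0..<1}. \<gamma> t = v} \<Longrightarrow> y \<in> {t \<in> {0..<1}. \<gamma> t = v} \<Longrightarrow> x = y" by blast
    then show ?thesis by (metis (no_types, lifting) finite.simps is_singletonI' is_singleton_def)
  qed
  then have "finite ((\<lambda>(x, n). x + of_int n) ` ({t \<in> {0..<1}. \<gamma> t = v} \<times> {\<lfloor>a\<rfloor>..\<lfloor>b\<rfloor>}))" by simp
  moreover have "{t \<in> {a..b}. \<gamma> t = v} \<subseteq> (\<lambda>(x, n). x + of_int n) ` ({t \<in> {0..<1}. \<gamma> t = v} \<times> {\<lfloor>a\<rfloor>..\<lfloor>b\<rfloor>})"
  proof
    fix t assume t: "t \<in> {t \<in> {a..b}. \<gamma> t = v}"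
    have "t = frac t + of_int \<lfloor>t\<rfloor>" by (simp add: frac_def)
    then show "t \<in> (\<lambda>(x, n). x + of_int n) ` ({t \<in> {0..<1}. \<gamma> t = v} \<times> {\<lfloor>a\<rfloor>..\<lfloor>b\<rfloor>})"
      using t frac_in[of t] frac_value[of t]
      by (intro image_eqI[of _ _ "(frac t, \<lfloor>t\<rfloor>)"]) (auto intro: floor_mono)
  qed
  ultimately show ?thesis by (rule finite_subset[rotated])
qed

lemma finite_preimage_set:
  assumes "finite F"
  shows "finite {t \<in> {a..b}. \<gamma> t \<in> F}"
proof -
  have "{t \<in> {a..b}. \<gamma> t \<in> F} = (\<Union>v\<in>F. {t \<in> {a..b}. \<gamma> t = v})" by auto
  then show ?thesis using assms finite_preimage by simp
qed

text \<open>Near \<open>t0\<close> only finitely many parameters have double points as values, so on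
  a small interval at most \<open>t0\<close> does. A coincidence of two values there would give
  another one, since the parameters differ by less than a period.\<close>

lemma locally_injective:
  obtains \<epsilon> where "0 < \<epsilon>" "\<epsilon> < 1/2" "inj_on \<gamma> {t0 - \<epsilon>..t0 + \<epsilon>}"
    "\<And>t. t \<in> {t0 - \<epsilon>..t0 + \<epsilon>} \<Longrightarrow> t \<noteq> t0 \<Longrightarrow> \<gamma> t \<notin> double_points \<gamma>"
proof -
  obtain d where d: "d > 0" "\<And>t. t \<in> {t \<in> {t0 - 1..t0 + 1}. \<gamma> t \<in> double_points \<gamma>} \<Longrightarrow> t \<noteq> t0 \<Longrightarrow> d \<le> dist t0 t"
    using finite_set_avoid[OF finite_preimage_set[OF finite_double]] by blast
  define \<epsilon> where "\<epsilon> = min (d / 2) (1/4)"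
  have e: "0 < \<epsilon>" "\<epsilon> < 1/2" "\<epsilon> < d" using d(1) by (auto simp: \<epsilon>_def min_def)
  have 1: "\<gamma> t \<notin> double_points \<gamma>" if "t \<in> {t0 - \<epsilon>..t0 + \<epsilon>}" "t \<noteq> t0" for t
    using d(2)[of t] that e by (auto simp: dist_real_def)
  have "inj_on \<gamma> {t0 - \<epsilon>..t0 + \<epsilon>}"
  proof (rule inj_onI)
    fix s t assume st: "s \<in> {t0 - \<epsilon>..t0 + \<epsilon>}" "t \<in> {t0 - \<epsilon>..t0 + \<epsilon>}" "\<gamma> s = \<gamma> t"
    show "s = t"
    proof (rule ccontr)
      assume "s \<noteq> t"
      then have "\<gamma> s \<notin> double_points \<gamma>" using 1[of s] 1[of t] st by metis
      then have "s - t \<in> \<int>" using double_pointI st(3) by blast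
      moreover have "\<bar>s - t\<bar> < 1" using st e by auto
      ultimately show False using Ints_small[of "s - t"] \<open>s \<noteq> t\<close> by simp
    qed
  qed
  then show ?thesis using that e 1 by blast
qed

text \<open>The parameters of one period at distance at least \<open>\<epsilon>\<close> from all
  parameters of \<open>v\<close> form a compact set, whose image misses \<open>v\<close> and hence a
  ball around it.\<close>

lemma near_preimage:
  assumes "0 < \<epsilon>"
  obtains \<delta> where "0 < \<delta>" "\<And>t. dist (\<gamma> t) v < \<delta> \<Longrightarrow> \<exists>s. \<gamma> s = v \<and> \<bar>t - s\<bar> < \<epsilon>"
proof -
  define K where "K = {0..1} - (\<Union>s\<in>{s. \<gamma> s = v}. {s - \<epsilon><..<s + \<epsilon>})"
  have "compact K" unfolding K_def by (intro compact_diff open_UN) auto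
  then have "compact (\<gamma> ` K)" using cont by (meson compact_continuous_image continuous_on_subset subset_UNIV)
  note closed = compact_imp_closed[OF this]
  have "v \<notin> \<gamma> ` K" using assms by (auto simp: K_def)
  from separate_point_closed[OF closed this]
  obtain \<delta> where \<delta>: "0 < \<delta>" "\<And>y. y \<in> \<gamma> ` K \<Longrightarrow> \<delta> \<le> dist v y" by auto
  have "\<exists>s. \<gamma> s = v \<and> \<bar>t - s\<bar> < \<epsilon>" if "dist (\<gamma> t) v < \<delta>" for t
  proof -
    have "frac t \<notin> K"
    proof
      assume "frac t \<in> K"
      then have "\<gamma> (frac t) \<in> \<gamma> ` K" by (rule imageI)
      from \<delta>(2)[OF this] show False using that by (simp add: frac_value dist_commute)
    qed
    then obtain s where s: "\<gamma> s = v" "\<bar>frac t - s\<bar> < \<epsilon>" using frac_in[of t] by (auto simp: K_def)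
    then show ?thesis
      using periodic_int[of s "\<lfloor>t\<rfloor>"] by (intro exI[of _ "s + of_int \<lfloor>t\<rfloor>"]) (simp add: frac_def algebra_simps)
  qed
  then show ?thesis using that \<delta>(1) by blast
qed

end

text \<open>The topological part of a generic immersion: transversality is replaced by the existence of
  crossing charts. Unlike generic immersions, these curves can be modified inside disks.\<close>

locale knot_curve = closed_curve +
  assumes chart_ex: "\<And>v. v \<in> double_points \<gamma> \<Longrightarrow> \<exists>\<phi>. crossing_chart \<gamma> v \<phi>"
begin

lemma reverse: "knot_curve (\<lambda>t. \<gamma> (- t))" "double_points (\<lambda>t. \<gamma> (- t)) = double_points \<gamma>"
proof -
  have neg: "(- s) - (- t) \<in> \<int> \<longleftrightarrow> s - t \<in> \<int>" for s t :: real
    by (metis Ints_minus minus_diff_commute minus_diff_eq minus_minus)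
  have 1: "\<exists>s'\<in>{0..<1}. \<gamma> (- s') = \<gamma> s \<and> frac (- s') = s" if "s \<in> {0..<1}" for s
  proof
    have i: "- frac (- s) - s \<in> \<int>" by (simp add: frac_def)
    then have "frac (- frac (- s)) = s" using that frac_eq_frac_iff[of "- frac (- s)" s] by (simp add: frac_eq)
    then show "\<gamma> (- frac (- s)) = \<gamma> s \<and> frac (- frac (- s)) = s" using periodic_Ints[OF i] by simp
  qed (rule frac_in)
  show dp: "double_points (\<lambda>t. \<gamma> (- t)) = double_points \<gamma>"
  proof safe
    fix v assume "v \<in> double_points (\<lambda>t. \<gamma> (- t))"
    then obtain s t where st: "s \<in> {0..<1}" "t \<in> {0..<1}" "s \<noteq> t" "\<gamma> (- s) = v" "\<gamma> (- t) = v"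
      by (auto simp: double_points_def)
    then have "s - t \<notin> \<int>" using unit_interval_Ints by blast
    then show "v \<in> double_points \<gamma>" using st double_pointI[of "- s" "- t"] neg by auto
  next
    fix v assume "v \<in> double_points \<gamma>"
    then obtain s t where st: "s \<in> {0..<1}" "t \<in> {0..<1}" "s \<noteq> t" "\<gamma> s = v" "\<gamma> t = v"
      by (auto simp: double_points_def)
    then obtain s' t' where s': "s' \<in> {0..<1}" "t' \<in> {0..<1}" "\<gamma> (- s') = v" "\<gamma> (- t') = v" "frac (- s') = s" "frac (- t') = t"
      using 1 by metis
    then have "s' \<noteq> t'" using st(3) by auto
    then show "v \<in> double_points (\<lambda>t. \<gamma> (- t))"
      unfolding double_points_def using s' by (intro CollectI bexI[of _ s'] bexI[of _ t']) auto
  qed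
  show "knot_curve (\<lambda>t. \<gamma> (- t))"
  proof
    show "continuous_on UNIV (\<lambda>t. \<gamma> (- t))"
      by (rule continuous_on_compose2[OF cont]) (auto intro!: continuous_intros)
    show "range (\<lambda>t. \<gamma> (- t)) \<subseteq> S2" using sphere by auto
    show "\<gamma> (- (t + 1)) = \<gamma> (- t)" for t using periodic[of "- (t + 1)"] by simp
    show "finite (double_points (\<lambda>t. \<gamma> (- t)))" using dp finite_double by simp
  next
    fix r s t :: real assume a: "r \<in> {0..<1}" "s \<in> {0..<1}" "t \<in> {0..<1}" "\<gamma> (- r) = \<gamma> (- s)" "\<gamma> (- s) = \<gamma> (- t)"
    then have "r - s \<in> \<int> \<or> s - t \<in> \<int> \<or> r - t \<in> \<int>" using two_parameters neg by blast
    then show "r = s \<or> s = t \<or> r = t" using a unit_interval_Ints by blast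
  next
    fix v assume "v \<in> double_points (\<lambda>t. \<gamma> (- t))"
    then obtain \<phi> where \<phi>: "crossing_chart \<gamma> v \<phi>" using dp chart_ex by auto
    then have "crossing_chart (\<lambda>t. \<gamma> (- t)) v (\<phi> \<circ> uminus)" by (rule crossing_chart_reverse)
    then show "\<exists>\<phi>. crossing_chart (\<lambda>t. \<gamma> (- t)) v \<phi>" by blast
  qed
qed

end

subsection \<open>Curves traversing arcs\<close>

text \<open>Without the finiteness assumptions a continuous surjection of an interval onto an arc need
  not be monotone.\<close>

lemma strict_mono_on_if_almost_injective:
  fixes f :: "real \<Rightarrow> real"
  assumes cont: "continuous_on {a..b} f" and "a \<le> b"
    and range: "\<And>t. t \<in> {a..b} \<Longrightarrow> f a \<le> f t" and D: "finite D"
    and inj: "\<And>s t. s \<in> {a..b} \<Longrightarrow> t \<in> {a..b} \<Longrightarrow> f s = f t \<Longrightarrow> f s \<notin> D \<Longrightarrow> s = t"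
    and fin: "\<And>w. finite {t \<in> {a..b}. f t = w}"
  shows "strict_mono_on {a..b} f"
proof (rule strict_mono_onI)
  have mono: "f s \<le> f t" if st: "s \<in> {a..b}" "t \<in> {a..b}" "s < t" for s t
  proof (rule ccontr)
    assume "\<not> f s \<le> f t"
    then have lt: "f t < f s" by simp
    then have "infinite ({f t<..<f s} - D)" using D by (simp add: infinite_Ioo)
    \<comment> \<open>A level outside \<open>D\<close> within the drop is taken once before and once
      after \<open>s\<close>, although \<open>inj\<close> allows it only once.\<close>
    then obtain w where w: "f t < w" "w < f s" "w \<notin> D"
      by (metis DiffE greaterThanLessThan_iff infinite_imp_nonempty ex_in_conv)
    have c: "continuous_on {a..s} f" "continuous_on {s..t} f"
      using st by (auto intro!: continuous_on_subset[OF cont])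
    have "f a \<le> w" using range[OF st(2)] w by simp
    then obtain x where x: "a \<le> x" "x \<le> s" "f x = w"
      using IVT'[of f a w s] w c st by auto
    obtain y where y: "s \<le> y" "y \<le> t" "f y = w"
      using IVT2'[of f t w s] w c st by auto
    have "x = y" using inj[of x y] x y w st by auto
    then have "f s = w" using x y by auto
    then show False using w by simp
  qed
  fix s t assume st: "s \<in> {a..b}" "t \<in> {a..b}" "s < t"
  have "f s \<noteq> f t"
  proof
    assume e: "f s = f t"
    have "f x = f s" if "x \<in> {s<..<t}" for x
      using mono[of s x] mono[of x t] that st e by auto
    then have "{s<..<t} \<subseteq> {t \<in> {a..b}. f t = f s}" using st by auto
    then show False using fin finite_subset st(3) infinite_Ioo by blast
  qed
  then show "f s < f t" using mono[OF st] by simp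
qed

text \<open>A monotone passage, in contrast to \<open>runs_along\<close>, which fixes only the end
  points and the image; it gives a direction at every point of the arc and restricts to
  subarcs.\<close>

definition traverses :: "(real \<Rightarrow> real^3) \<Rightarrow> (real \<Rightarrow> real^3) \<Rightarrow> bool" where
  "traverses \<gamma> \<alpha> \<longleftrightarrow> (\<exists>a b f. a < b \<and> continuous_on {a..b} f \<and> strict_mono_on {a..b} f \<and>
     f a = -1 \<and> f b = 1 \<and> (\<forall>t\<in>{a..b}. \<gamma> t = \<alpha> (f t)))"

lemma traverses_runs_along:
  assumes "traverses \<gamma> \<alpha>" and xy: "-1 \<le> x" "x < y" "y \<le> 1"
  shows "runs_along \<gamma> (\<alpha> ` {x..y}) (\<alpha> x) (\<alpha> y)"
proof -
  obtain a b f where f: "a < b" "continuous_on {a..b} f" "strict_mono_on {a..b} f" "f a = -1" "f b = 1"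
    "\<And>t. t \<in> {a..b} \<Longrightarrow> \<gamma> t = \<alpha> (f t)"
    using assms(1) by (auto simp: traverses_def)
  have surj: "\<exists>t\<in>{a..b}. f t = z" if "-1 \<le> z" "z \<le> 1" for z
    using IVT'[of f a z b] that f by auto
  obtain p q where p: "p \<in> {a..b}" "f p = x" and q: "q \<in> {a..b}" "f q = y"
    using surj[of x] surj[of y] xy by auto
  have le: "f s \<le> f t \<longleftrightarrow> s \<le> t" if "s \<in> {a..b}" "t \<in> {a..b}" for s t
    using strict_mono_on_leD[OF f(3) that] strict_mono_onD[OF f(3) that(2,1)] by (meson leD leI)
  have "p < q" using le[OF q(1) p(1)] p q xy by auto
  have "f ` {p..q} = {x..y}"
  proof safe
    fix t assume "t \<in> {p..q}"
    then show "f t \<in> {x..y}" using le[of p t] le[of t q] p q by auto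
  next
    fix z assume z: "z \<in> {x..y}"
    then obtain t where t: "t \<in> {a..b}" "f t = z" using surj[of z] xy by auto
    then show "z \<in> f ` {p..q}" using le[of p t] le[of t q] p q z by auto
  qed
  moreover have "\<gamma> ` {p..q} = \<alpha> ` f ` {p..q}"
    unfolding image_image by (rule image_cong) (use f(6) p q in auto)
  ultimately show ?thesis
    unfolding runs_along_def using \<open>p < q\<close> f(6) p q by (intro exI[of _ p] exI[of _ q]) auto
qed

context knot_curve
begin

text \<open>A stretch of length at least one period would contain the whole curve. The point
  \<open>x\<close> off the arc excludes this, so distinct parameters of the stretch with a common
  value come from double points, of which there are finitely many.\<close>

lemma runs_along_imp_traverses:
  assumes \<alpha>: "continuous_on {-1..1} \<alpha>" "inj_on \<alpha> {-1..1}"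
    and proper: "x \<in> range \<gamma>" "x \<notin> \<alpha> ` {-1..1}"
    and runs: "runs_along \<gamma> (\<alpha> ` {-1..1}) (\<alpha> (-1)) (\<alpha> 1)"
  shows "traverses \<gamma> \<alpha>"
proof -
  obtain a b where ab: "a < b" "\<gamma> a = \<alpha> (-1)" "\<gamma> b = \<alpha> 1" "\<gamma> ` {a..b} = \<alpha> ` {-1..1}"
    using runs by (auto simp: runs_along_def)
  obtain g where g: "homeomorphism {-1..1} (\<alpha> ` {-1..1}) \<alpha> g"
    using homeomorphism_compact[OF compact_Icc \<alpha>(1) refl \<alpha>(2)] by blast
  define f where "f t = g (\<gamma> t)" for t
  have f: "f t \<in> {-1..1}" "\<alpha> (f t) = \<gamma> t" if "t \<in> {a..b}" for t
  proof -
    have t: "\<gamma> t \<in> \<alpha> ` {-1..1}" using ab(4) that by blast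
    show "\<alpha> (f t) = \<gamma> t" unfolding f_def by (rule homeomorphism_apply2[OF g t])
    show "f t \<in> {-1..1}" unfolding f_def using homeomorphism_image2[OF g] t by blast
  qed
  have fab: "f a = -1" "f b = 1" using homeomorphism_apply1[OF g] ab by (auto simp: f_def)
  have cf: "continuous_on {a..b} f"
    unfolding f_def by (rule continuous_on_compose2[OF homeomorphism_cont2[OF g] continuous_on_subset[OF cont]])
      (use ab in auto)
  have "b - a < 1"
  proof (rule ccontr)
    assume "\<not> b - a < 1"
    obtain t where t: "x = \<gamma> t" using proper(1) by blast
    define s where "s = a + frac (t - a)"
    have "s \<in> {a..b}" using frac_in[of "t - a"] \<open>\<not> b - a < 1\<close> by (auto simp: s_def)
    moreover have "s - t \<in> \<int>" by (simp add: s_def frac_def)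
    ultimately have "x \<in> \<gamma> ` {a..b}" using periodic_Ints[of s t] t by (metis imageI)
    then show False using proper(2) ab(4) by simp
  qed
  have "strict_mono_on {a..b} f"
  proof (rule strict_mono_on_if_almost_injective[OF cf])
    show "finite {z \<in> {-1..1}. \<alpha> z \<in> double_points \<gamma>}"
    proof (rule finite_imageD)
      show "finite (\<alpha> ` {z \<in> {-1..1}. \<alpha> z \<in> double_points \<gamma>})"
        by (rule finite_subset[OF _ finite_double]) auto
      show "inj_on \<alpha> {z \<in> {-1..1}. \<alpha> z \<in> double_points \<gamma>}"
        by (rule inj_on_subset[OF \<alpha>(2)]) auto
    qed
    fix s t assume st: "s \<in> {a..b}" "t \<in> {a..b}" "f s = f t" "f s \<notin> {z \<in> {-1..1}. \<alpha> z \<in> double_points \<gamma>}"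
    then have "\<gamma> s = \<gamma> t" "\<gamma> s \<notin> double_points \<gamma>" using f by (metis, metis (mono_tags, lifting) mem_Collect_eq)
    then have "s - t \<in> \<int>" using double_pointI by blast
    then show "s = t" using Ints_small[of "s - t"] st \<open>b - a < 1\<close> by auto
  next
    fix w
    have "{t \<in> {a..b}. f t = w} \<subseteq> {t \<in> {a..b}. \<gamma> t = \<alpha> w}" using f by force
    then show "finite {t \<in> {a..b}. f t = w}" using finite_preimage finite_subset by blast
  qed (use ab f fab in auto)
  then show ?thesis unfolding traverses_def using ab(1) cf fab f by metis
qed

end

section \<open>Passages of a curve through the arcs of a disk\<close>

lemma no_return_to_top:
  fixes f :: "real \<Rightarrow> real"
  assumes cont: "continuous_on {a..b} f" and c: "a < c" "c < b" "f c < 1" and ends: "f a = 1" "f b = 1"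
    and D: "finite D"
    and inj: "\<And>s t. s \<in> {a<..<b} \<Longrightarrow> t \<in> {a<..<b} \<Longrightarrow> f s = f t \<Longrightarrow> f s \<notin> D \<Longrightarrow> s = t"
  shows False
proof -
  have "infinite ({f c<..<1} - D)" using D c by (simp add: infinite_Ioo)
  then obtain w where w: "f c < w" "w < 1" "w \<notin> D"
    by (metis DiffE greaterThanLessThan_iff infinite_imp_nonempty ex_in_conv)
  have cs: "continuous_on {a..c} f" "continuous_on {c..b} f"
    using c by (auto intro!: continuous_on_subset[OF cont])
  obtain x where x: "a \<le> x" "x \<le> c" "f x = w"
    using IVT2'[of f c w a] w c cs ends by auto
  obtain y where y: "c \<le> y" "y \<le> b" "f y = w"
    using IVT'[of f c w b] w c cs ends by auto
  have ne: "x \<noteq> a" "x \<noteq> c" "y \<noteq> b" using x y w ends by auto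
  then have "x = y" using inj[of x y] x y w c by auto
  then show False using x y ne by auto
qed

text \<open>A return to the starting end would repeat a level outside \<open>D\<close>, on the way
  out and on the way back. So the ends are opposite, and
  \<open>strict_mono_on_if_almost_injective\<close> applies to \<open>f\<close> or to its
  negative.\<close>

lemma monotone_between_ends:
  fixes f :: "real \<Rightarrow> real"
  assumes cont: "continuous_on {a..b} f" and ab: "a < b" and ends: "\<bar>f a\<bar> = 1" "\<bar>f b\<bar> = 1"
    and inside: "\<And>t. t \<in> {a<..<b} \<Longrightarrow> \<bar>f t\<bar> < 1" and D: "finite D"
    and inj: "\<And>s t. s \<in> {a<..<b} \<Longrightarrow> t \<in> {a<..<b} \<Longrightarrow> f s = f t \<Longrightarrow> f s \<notin> D \<Longrightarrow> s = t"
    and fin: "\<And>w. finite {t \<in> {a..b}. f t = w}"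
  shows "f a = -1 \<and> f b = 1 \<and> strict_mono_on {a..b} f \<or>
     f a = 1 \<and> f b = -1 \<and> strict_mono_on {a..b} (\<lambda>t. - f t)"
proof -
  have up: "strict_mono_on {a..b} g"
    if g: "continuous_on {a..b} g" "g a = -1" "g b = 1" "\<And>t. t \<in> {a<..<b} \<Longrightarrow> \<bar>g t\<bar> < 1" "finite D"
      "\<And>s t. s \<in> {a<..<b} \<Longrightarrow> t \<in> {a<..<b} \<Longrightarrow> g s = g t \<Longrightarrow> g s \<notin> D \<Longrightarrow> s = t"
      "\<And>w. finite {t \<in> {a..b}. g t = w}" for g :: "real \<Rightarrow> real" and D
  proof (rule strict_mono_on_if_almost_injective[OF g(1) less_imp_le[OF ab] _ g(5)])
    fix t assume "t \<in> {a..b}"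
    then have "t = a \<or> t = b \<or> t \<in> {a<..<b}" by auto
    then show "g a \<le> g t" using g(2,3) g(4)[of t] by auto
  next
    fix s t assume st: "s \<in> {a..b}" "t \<in> {a..b}" "g s = g t" "g s \<notin> D"
    then have "s = a \<or> s = b \<or> s \<in> {a<..<b}" "t = a \<or> t = b \<or> t \<in> {a<..<b}" by auto
    then show "s = t" using g(2,3) g(4)[of s] g(4)[of t] g(6)[of s t] st by auto
  next
    fix w show "finite {t \<in> {a..b}. g t = w}" by (rule g(7))
  qed
  obtain c where c: "a < c" "c < b" using ab dense by blast
  have neg: "finite (uminus ` D)" "\<And>s t. s \<in> {a<..<b} \<Longrightarrow> t \<in> {a<..<b} \<Longrightarrow> - f s = - f t \<Longrightarrow> - f s \<notin> uminus ` D \<Longrightarrow> s = t"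
    "continuous_on {a..b} (\<lambda>t. - f t)"
    using D inj cont by (auto intro: continuous_on_minus)
  have fin': "finite {t \<in> {a..b}. - f t = w}" for w
  proof -
    have "{t \<in> {a..b}. - f t = w} = {t \<in> {a..b}. f t = - w}" by auto
    then show ?thesis using fin by simp
  qed
  have fc: "\<bar>f c\<bar> < 1" using inside[of c] c by simp
  have "\<not> (f a = 1 \<and> f b = 1)"
  proof
    assume e: "f a = 1 \<and> f b = 1"
    show False
    proof (rule no_return_to_top[OF cont c _ _ _ D])
      fix s t assume "s \<in> {a<..<b}" "t \<in> {a<..<b}" "f s = f t" "f s \<notin> D"
      then show "s = t" by (rule inj)
    qed (use fc e in auto)
  qed
  moreover have "\<not> (f a = -1 \<and> f b = -1)"
  proof
    assume e: "f a = -1 \<and> f b = -1"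
    show False
    proof (rule no_return_to_top[OF neg(3) c _ _ _ neg(1)])
      fix s t assume "s \<in> {a<..<b}" "t \<in> {a<..<b}" "- f s = - f t" "- f s \<notin> uminus ` D"
      then show "s = t" by (rule neg(2))
    qed (use fc e in auto)
  qed
  ultimately have "f a = -1 \<and> f b = 1 \<or> f a = 1 \<and> f b = -1" using ends by (auto simp: abs_if split: if_splits)
  then show ?thesis
  proof
    assume e: "f a = -1 \<and> f b = 1"
    have "strict_mono_on {a..b} f"
      by (rule up[of f D]) (use e cont inside D inj fin in auto)
    then show ?thesis using e by simp
  next
    assume e: "f a = 1 \<and> f b = -1"
    have "strict_mono_on {a..b} (\<lambda>t. - f t)"
      by (rule up[of _ "uminus ` D"]) (use e neg inside fin' in auto)
    then show ?thesis using e by simp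
  qed
qed

lemma real_axis_eq: "closed_segment (-1) 1 = complex_of_real ` {-1..1}"
  and imag_axis_eq: "closed_segment (-\<i>) \<i> = (\<lambda>x. \<i> * complex_of_real x) ` {-1..1}"
proof -
  have "closed_segment (-1) 1 = complex_of_real ` closed_segment (-1) 1"
    using closed_segment_linear_image[of complex_of_real "-1" 1] by (simp add: bounded_linear.linear[OF bounded_linear_of_real])
  then show "closed_segment (-1) 1 = complex_of_real ` {-1..1}" by (simp add: closed_segment_eq_real_ivl)
  have "linear (\<lambda>x. \<i> * complex_of_real x)"
    by (intro bounded_linear.linear bounded_linear_mult_right[THEN bounded_linear_compose] bounded_linear_of_real)
  then have "closed_segment (-\<i>) \<i> = (\<lambda>x. \<i> * complex_of_real x) ` closed_segment (-1) 1"
    using closed_segment_linear_image[of "\<lambda>x. \<i> * complex_of_real x" "-1" 1] by simp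
  then show "closed_segment (-\<i>) \<i> = (\<lambda>x. \<i> * complex_of_real x) ` {-1..1}" by (simp add: closed_segment_eq_real_ivl)
qed

context knot_curve
begin

text \<open>The parameters over the open arc form an open set \<open>U\<close>. On a component of
  \<open>U\<close> the coordinate along the arc goes monotonically from one end to the other, so the
  whole arc is passed. A second visit to an inner point would persist on an interval of parameters
  and produce infinitely many double points.\<close>

lemma traverses_disk_arc:
  assumes \<phi>: "disk_embedding \<phi>" and P: "range \<gamma> \<inter> \<phi> ` cball 0 1 = \<phi> ` X" and X: "X \<subseteq> cball 0 1"
    and \<alpha>: "continuous_on {-1..1} \<alpha>" "inj_on \<alpha> {-1..1}" "\<alpha> ` {-1..1} \<subseteq> X"
    and ends: "norm (\<alpha> (-1)) = 1" "norm (\<alpha> 1) = 1" and inside: "\<And>x. x \<in> {-1<..<1} \<Longrightarrow> norm (\<alpha> x) < 1"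
    and rest: "closed (X - \<alpha> ` {-1..1})"
  shows "traverses \<gamma> (\<lambda>x. \<phi> (\<alpha> x)) \<or> traverses \<gamma> (\<lambda>x. \<phi> (\<alpha> (- x)))"
    and "\<And>x. x \<in> {-1<..<1} \<Longrightarrow> \<phi> (\<alpha> x) \<notin> double_points \<gamma>"
proof -
  have emb: "continuous_on (cball 0 1) \<phi>" "inj_on \<phi> (cball 0 1)"
    using \<phi> by (auto simp: disk_embedding_def)
  define \<beta> where "\<beta> x = \<phi> (\<alpha> x)" for x
  have disk: "\<alpha> ` {-1..1} \<subseteq> cball 0 1" using \<alpha>(3) X by blast
  have c\<beta>: "continuous_on {-1..1} \<beta>" unfolding \<beta>_def by (rule continuous_on_compose2[OF emb(1) \<alpha>(1) disk])
  have i\<beta>: "inj_on \<beta> {-1..1}"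
    using comp_inj_on[OF \<alpha>(2) inj_on_subset[OF emb(2) disk]] by (simp add: o_def \<beta>_def[abs_def])
  obtain g where g: "homeomorphism {-1..1} (\<beta> ` {-1..1}) \<beta> g"
    using homeomorphism_compact[OF compact_Icc c\<beta> refl i\<beta>] by blast
  have on_curve: "\<beta> x \<in> range \<gamma>" if "x \<in> {-1..1}" for x 
  proof -
    have "\<phi> (\<alpha> x) \<in> \<phi> ` X" using \<alpha>(3) that by blast
    then show ?thesis using P by (auto simp: \<beta>_def)
  qed
  \<comment> \<open>That \<open>U\<close> is open rests on two facts: the open disk is relatively
    open in the sphere, and the other strands in the disk form a closed set.\<close>
  define U where "U = {t. \<gamma> t \<in> \<beta> ` {-1<..<1}}"
  have openU: "open U"
  proof -
    obtain W where W: "open W" "\<phi> ` ball 0 1 = S2 \<inter> W"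
      using disk_embedding_openin[OF \<phi>] by (auto simp: openin_open)
    let ?R = "\<phi> ` (X - \<alpha> ` {-1..1})"
    have "compact (X - \<alpha> ` {-1..1})" using rest X by (meson bounded_cball bounded_subset compact_eq_bounded_closed Diff_subset order_trans)
    moreover have "continuous_on (X - \<alpha> ` {-1..1}) \<phi>" by (rule continuous_on_subset[OF emb(1)]) (use X in auto)
    ultimately have "closed ?R" by (intro compact_imp_closed compact_continuous_image)
    have "\<gamma> t \<in> \<beta> ` {-1<..<1} \<longleftrightarrow> \<gamma> t \<in> W \<and> \<gamma> t \<notin> ?R" for t
    proof
      assume "\<gamma> t \<in> \<beta> ` {-1<..<1}"
      then obtain x where x: "x \<in> {-1<..<1}" "\<gamma> t = \<phi> (\<alpha> x)" by (auto simp: \<beta>_def)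
      then have "\<gamma> t \<in> \<phi> ` ball 0 1" using inside by auto
      moreover have "\<gamma> t \<notin> ?R"
      proof
        assume "\<gamma> t \<in> ?R"
        then obtain z where z: "z \<in> X" "z \<notin> \<alpha> ` {-1..1}" "\<phi> (\<alpha> x) = \<phi> z" using x by auto
        moreover have "\<alpha> x = z"
          by (rule inj_onD[OF emb(2) z(3)]) (use disk X z(1) x(1) in \<open>auto simp: image_subset_iff\<close>)
        ultimately show False using x(1) by auto
      qed
      ultimately show "\<gamma> t \<in> W \<and> \<gamma> t \<notin> ?R" using W by blast
    next
      assume t: "\<gamma> t \<in> W \<and> \<gamma> t \<notin> ?R"
      moreover have "\<gamma> t \<in> S2" using sphere by blast
      ultimately have "\<gamma> t \<in> \<phi> ` ball 0 1" using W by blast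
      then obtain z where z: "norm z < 1" "\<gamma> t = \<phi> z" by auto
      moreover have "\<gamma> t \<in> range \<gamma>" by (rule rangeI)
      ultimately have "\<gamma> t \<in> range \<gamma> \<inter> \<phi> ` cball 0 1" by auto
      then have "\<phi> z \<in> \<phi> ` X" using P z by simp
      then have "z \<in> X" using inj_on_image_mem_iff[OF emb(2) _ X] z by auto
      then have "z \<in> \<alpha> ` {-1..1}" using t z by blast
      then obtain x where x: "x \<in> {-1..1}" "z = \<alpha> x" by blast
      then have "x \<noteq> -1" "x \<noteq> 1" using z ends by auto
      then have "x \<in> {-1<..<1}" using x by auto
      then show "\<gamma> t \<in> \<beta> ` {-1<..<1}" using z x by (auto simp: \<beta>_def)
    qed
    then have "U = \<gamma> -` W \<inter> \<gamma> -` (- ?R)" by (auto simp: U_def)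
    then show ?thesis using W(1) \<open>closed ?R\<close> cont
      by (metis open_Compl open_Int open_vimage)
  qed
  have endU: "\<gamma> t \<notin> \<beta> ` {-1<..<1}" if "\<gamma> t = \<beta> 1 \<or> \<gamma> t = \<beta> (-1)" for t
    using that inj_onD[OF i\<beta>, of 1] inj_onD[OF i\<beta>, of "-1"] by fastforce
  have Uper: "t + of_int n \<in> U \<longleftrightarrow> t \<in> U" for t n by (simp add: U_def periodic_int)
  obtain c where c: "\<gamma> c = \<beta> 0" using on_curve[of 0] by auto
  then have cU: "c \<in> U" by (auto simp: U_def)
  obtain e where "\<gamma> e = \<beta> 1" using on_curve[of 1] by auto
  then have eU: "e \<notin> U" using endU[of e] by (simp add: U_def)
  have clA: "closed ({..c} - U)" "closed ({c..} - U)" using openU by (auto intro: closed_Diff)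
  have e1: "e + of_int \<lfloor>c - e\<rfloor> \<in> {..c} - U" "e + of_int \<lceil>c - e\<rceil> \<in> {c..} - U"
  proof -
    have "e + of_int \<lfloor>c - e\<rfloor> \<le> c" using of_int_floor_le[of "c - e"] by linarith
    moreover have "c \<le> e + of_int \<lceil>c - e\<rceil>" using le_of_int_ceiling[of "c - e"] by linarith
    ultimately show "e + of_int \<lfloor>c - e\<rfloor> \<in> {..c} - U" "e + of_int \<lceil>c - e\<rceil> \<in> {c..} - U"
      using eU Uper by auto
  qed
  \<comment> \<open>The component of \<open>U\<close> around \<open>c\<close>; it is bounded because
    integer translates of \<open>e\<close> lie outside \<open>U\<close> on both sides of
    \<open>c\<close>.\<close>
  define a where "a = Sup ({..c} - U)"
  define b where "b = Inf ({c..} - U)"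
  have bd: "bdd_above ({..c} - U)" "bdd_below ({c..} - U)" by (auto intro: bdd_aboveI[of _ c] bdd_belowI[of _ c])
  have a: "a \<le> c" "a \<notin> U" using closed_contains_Sup[OF _ bd(1) clA(1)] e1 by (auto simp: a_def)
  have b: "c \<le> b" "b \<notin> U" using closed_contains_Inf[OF _ bd(2) clA(2)] e1 by (auto simp: b_def)
  have ac: "a < c" "c < b" using a b cU by (auto simp: less_le)
  have abU: "t \<in> U" if "t \<in> {a<..<b}" for t
  proof (rule ccontr)
    assume t: "t \<notin> U"
    show False
    proof (cases "t \<le> c")
      case True
      then have "t \<le> a" unfolding a_def using t by (intro cSup_upper bd) auto
      then show False using that by simp
    next
      case False
      then have "b \<le> t" unfolding b_def using t by (intro cInf_lower bd) auto
      then show False using that by simp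
    qed
  qed
  \<comment> \<open>\<open>U\<close> is invariant under integer translations and misses
    \<open>a\<close>, hence also \<open>a + 1\<close>; the component is not longer than a
    period.\<close>
  have "b \<le> a + 1"
  proof (rule ccontr)
    assume "\<not> b \<le> a + 1"
    then have "a + 1 \<in> U" using abU by auto
    then show False using Uper[of a 1] a by simp
  qed
  have im: "\<gamma> t \<in> \<beta> ` {-1..1}" if t: "t \<in> {a..b}" for t
  proof -
    have "closed (\<gamma> -` (\<beta> ` {-1..1}))"
      using cont c\<beta> by (intro closed_vimage compact_imp_closed compact_continuous_image) auto
    moreover have "{a<..<b} \<subseteq> \<gamma> -` (\<beta> ` {-1..1})" using abU by (force simp: U_def)
    ultimately have "closure {a<..<b} \<subseteq> \<gamma> -` (\<beta> ` {-1..1})" by (rule closure_minimal[rotated])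
    then show ?thesis using t ac by auto
  qed
  define f where "f t = g (\<gamma> t)" for t
  have f: "f t \<in> {-1..1}" "\<beta> (f t) = \<gamma> t" if "t \<in> {a..b}" for t
  proof -
    have t: "\<gamma> t \<in> \<beta> ` {-1..1}" using im that by blast
    show "\<beta> (f t) = \<gamma> t" unfolding f_def by (rule homeomorphism_apply2[OF g t])
    show "f t \<in> {-1..1}" unfolding f_def using homeomorphism_image2[OF g] t by blast
  qed
  have cf: "continuous_on {a..b} f"
    unfolding f_def by (rule continuous_on_compose2[OF homeomorphism_cont2[OF g] continuous_on_subset[OF cont]])
      (use im in auto)
  have fin: "\<bar>f t\<bar> < 1" if t: "t \<in> {a<..<b}" for t
  proof -
    obtain x where x: "x \<in> {-1<..<1}" "\<gamma> t = \<beta> x" using abU[OF t] by (auto simp: U_def)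
    then have "f t = x" using homeomorphism_apply1[OF g, of x] by (simp add: f_def)
    then show ?thesis using x by auto
  qed
  have fend: "\<bar>f t\<bar> = 1" if "t \<in> {a..b}" "t \<notin> U" for t
  proof (rule ccontr)
    assume "\<bar>f t\<bar> \<noteq> 1"
    then have "f t \<in> {-1<..<1}" using f(1)[OF that(1)] by (auto simp: abs_if split: if_splits)
    then have "\<beta> (f t) \<in> \<beta> ` {-1<..<1}" by (rule imageI)
    then show False using f(2)[OF that(1)] that(2) by (simp add: U_def)
  qed
  have finD: "finite {z \<in> {-1..1}. \<beta> z \<in> double_points \<gamma>}"
  proof (rule finite_imageD)
    show "finite (\<beta> ` {z \<in> {-1..1}. \<beta> z \<in> double_points \<gamma>})"
      by (rule finite_subset[OF _ finite_double]) auto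
    show "inj_on \<beta> {z \<in> {-1..1}. \<beta> z \<in> double_points \<gamma>}"
      by (rule inj_on_subset[OF i\<beta>]) auto
  qed
  have dich: "f a = -1 \<and> f b = 1 \<and> strict_mono_on {a..b} f \<or>
     f a = 1 \<and> f b = -1 \<and> strict_mono_on {a..b} (\<lambda>t. - f t)"
  proof (rule monotone_between_ends[OF cf _ _ _ fin finD])
    show "\<bar>f a\<bar> = 1" "\<bar>f b\<bar> = 1" using fend a b ac by auto
    fix s t assume st: "s \<in> {a<..<b}" "t \<in> {a<..<b}" "f s = f t" "f s \<notin> {z \<in> {-1..1}. \<beta> z \<in> double_points \<gamma>}"
    have st': "s \<in> {a..b}" "t \<in> {a..b}" using st by auto
    have "\<gamma> s = \<gamma> t" using f(2)[OF st'(1)] f(2)[OF st'(2)] st(3) by simp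
    moreover have "\<gamma> s \<notin> double_points \<gamma>" using f[OF st'(1)] st(4) by auto
    ultimately have "s - t \<in> \<int>" using double_pointI by blast
    then show "s = t" using Ints_small[of "s - t"] st \<open>b \<le> a + 1\<close> by auto
  next
    fix w
    have "{t \<in> {a..b}. f t = w} \<subseteq> {t \<in> {a..b}. \<gamma> t = \<beta> w}" using f by force
    then show "finite {t \<in> {a..b}. f t = w}" using finite_preimage finite_subset by blast
  qed (use ac in auto)
  then show "traverses \<gamma> (\<lambda>x. \<phi> (\<alpha> x)) \<or> traverses \<gamma> (\<lambda>x. \<phi> (\<alpha> (- x)))"
  proof
    assume "f a = -1 \<and> f b = 1 \<and> strict_mono_on {a..b} f"
    then have "traverses \<gamma> (\<lambda>x. \<phi> (\<alpha> x))"
      unfolding traverses_def using ac cf f(2)[unfolded \<beta>_def] by (intro exI[of _ a] exI[of _ b] exI[of _ f]) auto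
    then show ?thesis ..
  next
    assume "f a = 1 \<and> f b = -1 \<and> strict_mono_on {a..b} (\<lambda>t. - f t)"
    then have "traverses \<gamma> (\<lambda>x. \<phi> (\<alpha> (- x)))"
      unfolding traverses_def using ac cf f(2)[unfolded \<beta>_def]
      by (intro exI[of _ a] exI[of _ b] exI[of _ "\<lambda>t. - f t"]) (auto intro: continuous_on_minus)
    then show ?thesis ..
  qed
  have surj: "\<exists>t\<in>{a<..<b}. \<gamma> t = \<beta> x" if x: "x \<in> {-1<..<1}" for x
  proof -
    have "\<exists>t. a \<le> t \<and> t \<le> b \<and> f t = x"
      using dich IVT'[of f a x b] IVT2'[of f b x a] cf ac x by auto
    then obtain t where t: "a \<le> t" "t \<le> b" "f t = x" by blast
    moreover have "t \<noteq> a" "t \<noteq> b" using t dich x by auto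
    ultimately show ?thesis using f(2)[of t] by (intro bexI[of _ t]) auto
  qed
  have finj: "s = t" if "s \<in> {a<..<b}" "t \<in> {a<..<b}" "\<gamma> s = \<gamma> t" for s t
  proof -
    have "f s = f t" using that by (simp add: f_def)
    moreover have "inj_on f {a..b}"
      using dich strict_mono_on_imp_inj_on[of "{a..b}" f] strict_mono_on_imp_inj_on[of "{a..b}" "\<lambda>t. - f t"]
      by (auto simp: inj_on_def)
    ultimately show ?thesis using that by (auto dest: inj_onD)
  qed
  fix x :: real assume x: "x \<in> {-1<..<1}"
  show "\<phi> (\<alpha> x) \<notin> double_points \<gamma>"
  proof
    assume "\<phi> (\<alpha> x) \<in> double_points \<gamma>"
    then have dp: "\<beta> x \<in> double_points \<gamma>" by (simp add: \<beta>_def)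
    obtain t1 where t1: "t1 \<in> {a<..<b}" "\<gamma> t1 = \<beta> x" using surj[OF x] by blast
    obtain s where s: "\<gamma> s = \<beta> x" "s - t1 \<notin> \<int>"
    proof -
      obtain p q where pq: "\<gamma> p = \<beta> x" "\<gamma> q = \<beta> x" "p - q \<notin> \<int>" by (rule double_pointE[OF dp])
      have "p - t1 \<notin> \<int> \<or> q - t1 \<notin> \<int>" using pq(3) by (metis Ints_diff diff_diff_eq2 diff_add_cancel)
      then show ?thesis using that pq by blast
    qed
    have nab: "s - of_int n \<notin> {a<..<b}" for n
    proof
      assume "s - of_int n \<in> {a<..<b}"
      moreover have "\<gamma> (s - of_int n) = \<gamma> t1" using periodic_int[of s "- n"] s t1 by simp
      ultimately have "s - of_int n = t1" using finj t1 by blast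
      then have "s - t1 = of_int n" by simp
      then show False using s(2) by simp
    qed
    \<comment> \<open>The second parameter \<open>s\<close> lies in \<open>U\<close>, but no integer
      translate of it lies in the component. The same holds for all parameters near
      \<open>s\<close>, since entering the component would mean crossing one of its ends, which are
      not in \<open>U\<close>. All values near \<open>s\<close> are thus taken a second time in the
      component.\<close>
    have "s \<in> U" using s x by (auto simp: U_def)
    then obtain d where d: "0 < d" "\<And>y. \<bar>y - s\<bar> < d \<Longrightarrow> y \<in> U"
      using openU unfolding open_dist dist_real_def by blast
    have out: "y - of_int n \<notin> {a<..<b}" if y: "\<bar>y - s\<bar> < d" for y n
    proof
      assume yn: "y - of_int n \<in> {a<..<b}"
      have ends: "a + of_int n \<notin> U" "b + of_int n \<notin> U" using a b Uper by auto
      have "s - of_int n \<le> a \<or> b \<le> s - of_int n" using nab[of n] by auto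
      then show False
      proof
        assume "s - of_int n \<le> a"
        then have "\<bar>a + of_int n - s\<bar> < d" using yn y by auto
        then show False using d(2) ends by blast
      next
        assume "b \<le> s - of_int n"
        then have "\<bar>b + of_int n - s\<bar> < d" using yn y by auto
        then show False using d(2) ends by blast
      qed
    qed
    have "\<gamma> y \<in> double_points \<gamma>" if y: "\<bar>y - s\<bar> < d" for y
    proof -
      obtain x' where "x' \<in> {-1<..<1}" "\<gamma> y = \<beta> x'" using d(2)[OF y] by (auto simp: U_def)
      then obtain t where t: "t \<in> {a<..<b}" "\<gamma> y = \<gamma> t" using surj by metis
      have "y - t \<notin> \<int>"
      proof
        assume "y - t \<in> \<int>"
        then obtain n where "y - t = of_int n" by (elim Ints_cases)
        then have "y - of_int n = t" by simp
        then show False using out[OF y, of n] t by simp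
      qed
      then show ?thesis using double_pointI t(2) by blast
    qed
    then have "{s - d/2<..<s + d/2} \<subseteq> {y \<in> {s - d..s + d}. \<gamma> y \<in> double_points \<gamma>}" using d(1) by auto
    then have "finite {s - d/2<..<s + d/2}" using finite_preimage_set[OF finite_double] finite_subset by blast
    then show False using d(1) infinite_Ioo[of "s - d/2" "s + d/2"] by simp
  qed
qed

lemma crossing_chart_cross_disk: "crossing_chart \<gamma> v \<phi> \<Longrightarrow> cross_disk (range \<gamma>) \<phi>"
  by (simp add: crossing_chart_def cross_disk_def cross_eq)

lemma crossing_chart_iff:
  "crossing_chart \<gamma> v \<phi> \<longleftrightarrow> cross_disk (range \<gamma>) \<phi> \<and> \<phi> 0 = v \<and>
     traverses \<gamma> (\<lambda>x. \<phi> (of_real x)) \<and> traverses \<gamma> (\<lambda>x. \<phi> (\<i> * of_real x))"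
proof
  assume c: "crossing_chart \<gamma> v \<phi>"
  then have cd: "cross_disk (range \<gamma>) \<phi>" by (rule crossing_chart_cross_disk)
  have emb: "continuous_on (cball 0 1) \<phi>" "inj_on \<phi> (cball 0 1)"
    using cd by (auto simp: cross_disk_def disk_embedding_def)
  \<comment> \<open>Each axis supplies the point off the other axis that
    \<open>runs_along_imp_traverses\<close> asks for.\<close>
  have on: "\<phi> 1 \<in> range \<gamma>" "\<phi> \<i> \<in> range \<gamma>" using cross_disk_mem[OF cd] by (auto simp: cross_def)
  have "traverses \<gamma> (\<lambda>x. \<phi> (of_real x))"
  proof (rule runs_along_imp_traverses[OF _ _ on(2)])
    show "continuous_on {-1..1} (\<lambda>x. \<phi> (of_real x))"
      by (rule continuous_on_compose2[OF emb(1)]) (auto intro!: continuous_intros)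
    show "inj_on (\<lambda>x. \<phi> (of_real x)) {-1..1}"
      by (auto intro!: inj_onI dest!: inj_onD[OF emb(2)])
    show "\<phi> \<i> \<notin> (\<lambda>x. \<phi> (of_real x)) ` {-1..1}"
      by (auto dest!: inj_onD[OF emb(2)] simp: complex_eq_iff)
    show "runs_along \<gamma> ((\<lambda>x. \<phi> (of_real x)) ` {-1..1}) (\<phi> (of_real (-1))) (\<phi> (of_real 1))"
      using c by (simp add: crossing_chart_def real_axis_eq image_image)
  qed
  moreover have "traverses \<gamma> (\<lambda>x. \<phi> (\<i> * of_real x))"
  proof (rule runs_along_imp_traverses[OF _ _ on(1)])
    show "continuous_on {-1..1} (\<lambda>x. \<phi> (\<i> * of_real x))"
      by (rule continuous_on_compose2[OF emb(1)]) (auto intro!: continuous_intros simp: norm_mult)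
    show "inj_on (\<lambda>x. \<phi> (\<i> * of_real x)) {-1..1}"
      by (auto intro!: inj_onI dest!: inj_onD[OF emb(2)] simp: norm_mult)
    show "\<phi> 1 \<notin> (\<lambda>x. \<phi> (\<i> * of_real x)) ` {-1..1}"
      by (auto dest!: inj_onD[OF emb(2)] simp: complex_eq_iff norm_mult)
    show "runs_along \<gamma> ((\<lambda>x. \<phi> (\<i> * of_real x)) ` {-1..1}) (\<phi> (\<i> * of_real (-1))) (\<phi> (\<i> * of_real 1))"
      using c by (simp add: crossing_chart_def imag_axis_eq image_image)
  qed
  ultimately show "cross_disk (range \<gamma>) \<phi> \<and> \<phi> 0 = v \<and>
     traverses \<gamma> (\<lambda>x. \<phi> (of_real x)) \<and> traverses \<gamma> (\<lambda>x. \<phi> (\<i> * of_real x))"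
    using c cd by (simp add: crossing_chart_def)
next
  assume c: "cross_disk (range \<gamma>) \<phi> \<and> \<phi> 0 = v \<and>
     traverses \<gamma> (\<lambda>x. \<phi> (of_real x)) \<and> traverses \<gamma> (\<lambda>x. \<phi> (\<i> * of_real x))"
  then show "crossing_chart \<gamma> v \<phi>"
    using traverses_runs_along[of \<gamma> "\<lambda>x. \<phi> (of_real x)" "-1" 1]
      traverses_runs_along[of \<gamma> "\<lambda>x. \<phi> (\<i> * of_real x)" "-1" 1]
    unfolding crossing_chart_def cross_eq by (simp add: cross_disk_def real_axis_eq imag_axis_eq image_image)
qed

end

section \<open>Strands through a crossing and small charts\<close>

lemma traverses_scale:
  assumes "traverses \<gamma> \<alpha>" and c: "0 < c" "c \<le> 1"
  shows "traverses \<gamma> (\<lambda>x. \<alpha> (c * x))"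
proof -
  obtain a b f where f: "a < b" "continuous_on {a..b} f" "strict_mono_on {a..b} f" "f a = -1" "f b = 1"
    "\<And>t. t \<in> {a..b} \<Longrightarrow> \<gamma> t = \<alpha> (f t)"
    using assms(1) by (auto simp: traverses_def)
  obtain p q where p: "a \<le> p" "p \<le> b" "f p = - c" and q: "a \<le> q" "q \<le> b" "f q = c"
    using IVT'[of f a "- c" b] IVT'[of f a c b] f c by auto
  have "p < q"
  proof (rule ccontr)
    assume "\<not> p < q"
    then have "f q \<le> f p" using strict_mono_on_leD[OF f(3), of q p] p q by auto
    then show False using p q c by simp
  qed
  moreover have "strict_mono_on {p..q} (\<lambda>t. f t / c)"
    using strict_mono_onD[OF f(3)] p q c by (intro strict_mono_onI) (auto simp: divide_strict_right_mono)
  moreover have "continuous_on {p..q} (\<lambda>t. f t / c)"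
    using c p q by (intro continuous_intros continuous_on_subset[OF f(2)]) auto
  ultimately show ?thesis
    unfolding traverses_def using p q c f(6) by (intro exI[of _ p] exI[of _ q] exI[of _ "\<lambda>t. f t / c"]) auto
qed

text \<open>A passage with the parameter of the centre marked: a double point has two parameters in
  each period, and this records which branch passes at which of them.\<close>

definition strand :: "(real \<Rightarrow> real^3) \<Rightarrow> real \<Rightarrow> (real \<Rightarrow> real^3) \<Rightarrow> bool" where
  "strand \<gamma> s \<alpha> \<longleftrightarrow> (\<exists>a b f. a < s \<and> s < b \<and> continuous_on {a..b} f \<and> strict_mono_on {a..b} f \<and>
     f a = -1 \<and> f s = 0 \<and> f b = 1 \<and> (\<forall>t\<in>{a..b}. \<gamma> t = \<alpha> (f t)))"

lemma traverses_strand: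
  assumes "traverses \<gamma> \<alpha>"
  obtains s where "strand \<gamma> s \<alpha>" "\<gamma> s = \<alpha> 0"
proof -
  obtain a b f where f: "a < b" "continuous_on {a..b} f" "strict_mono_on {a..b} f" "f a = -1" "f b = 1"
    "\<And>t. t \<in> {a..b} \<Longrightarrow> \<gamma> t = \<alpha> (f t)"
    using assms(1) by (auto simp: traverses_def)
  obtain p where p: "a \<le> p" "p \<le> b" "f p = 0" using IVT'[of f a 0 b] f by auto
  then have "a < p" "p < b" using f by (auto simp: less_le)
  then have "strand \<gamma> p \<alpha>" unfolding strand_def using f p by blast
  then show ?thesis using that f(6)[of p] p by auto
qed

context knot_curve
begin

lemma strand_shift:
  assumes "strand \<gamma> p \<alpha>" "s - p \<in> \<int>"
  shows "strand \<gamma> s \<alpha>"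
proof -
  obtain n where n: "s = p + of_int n" using assms(2) by (elim Ints_cases) (simp add: algebra_simps)
  obtain a b f where f: "a < p" "p < b" "continuous_on {a..b} f" "strict_mono_on {a..b} f"
    "f a = -1" "f p = 0" "f b = 1" "\<And>t. t \<in> {a..b} \<Longrightarrow> \<gamma> t = \<alpha> (f t)"
    using assms(1) by (auto simp: strand_def)
  have "continuous_on {a + of_int n..b + of_int n} (\<lambda>t. f (t - of_int n))"
    by (rule continuous_on_compose2[OF f(3)]) (auto intro!: continuous_intros)
  moreover have "strict_mono_on {a + of_int n..b + of_int n} (\<lambda>t. f (t - of_int n))"
    using strict_mono_onD[OF f(4)] by (intro strict_mono_onI) auto
  moreover have "\<gamma> t = \<alpha> (f (t - of_int n))" if "t \<in> {a + of_int n..b + of_int n}" for t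
    using f(8)[of "t - of_int n"] periodic_int[of t "- n"] that by auto
  ultimately show ?thesis unfolding strand_def n using f
    by (intro exI[of _ "a + of_int n"] exI[of _ "b + of_int n"] exI[of _ "\<lambda>t. f (t - of_int n)"]) auto
qed

text \<open>The two axes are passed at parameters that do not differ by an integer, for otherwise
  both axes would share points after the centre. Without triple points every parameter of
  \<open>v\<close> is equivalent to one of these two.\<close>

lemma crossing_chart_strands:
  assumes c: "crossing_chart \<gamma> v \<phi>"
  shows "v \<in> double_points \<gamma>"
    and "\<gamma> s = v \<Longrightarrow> strand \<gamma> s (\<lambda>x. \<phi> (of_real x)) \<or> strand \<gamma> s (\<lambda>x. \<phi> (\<i> * of_real x))"
proof -
  have cd: "cross_disk (range \<gamma>) \<phi>" and v: "\<phi> 0 = v" using c by (auto simp: crossing_chart_iff)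
  have inj: "inj_on \<phi> (cball 0 1)" using cd by (simp add: cross_disk_def disk_embedding_def)
  obtain p where p: "strand \<gamma> p (\<lambda>x. \<phi> (of_real x))" "\<gamma> p = v"
    using traverses_strand[of \<gamma> "\<lambda>x. \<phi> (of_real x)"] c v unfolding crossing_chart_iff by auto
  obtain q where q: "strand \<gamma> q (\<lambda>x. \<phi> (\<i> * of_real x))" "\<gamma> q = v"
    using traverses_strand[of \<gamma> "\<lambda>x. \<phi> (\<i> * of_real x)"] c v unfolding crossing_chart_iff by auto
  have pq: "p - q \<notin> \<int>"
  proof
    assume "p - q \<in> \<int>"
    then have q': "strand \<gamma> p (\<lambda>x. \<phi> (\<i> * of_real x))" by (rule strand_shift[OF q(1)])
    obtain a b f where f: "p < b" "strict_mono_on {a..b} f" "a < p"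
      "f a = -1" "f p = 0" "f b = 1" "\<And>t. t \<in> {a..b} \<Longrightarrow> \<gamma> t = \<phi> (of_real (f t))"
      using p(1) by (auto simp: strand_def)
    obtain a' b' g where g: "p < b'" "strict_mono_on {a'..b'} g" "a' < p"
      "g a' = -1" "g p = 0" "g b' = 1" "\<And>t. t \<in> {a'..b'} \<Longrightarrow> \<gamma> t = \<phi> (\<i> * of_real (g t))"
      using q' by (auto simp: strand_def)
    define t where "t = min b b'"
    have t: "p < t" "t \<le> b" "t \<le> b'" using f g by (auto simp: t_def)
    have ft: "0 < f t" "f t \<le> 1"
      using strict_mono_onD[OF f(2), of p t] strict_mono_on_leD[OF f(2), of t b] f t by auto
    have gt: "0 < g t" "g t \<le> 1"
      using strict_mono_onD[OF g(2), of p t] strict_mono_on_leD[OF g(2), of t b'] g t by auto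
    have "\<phi> (of_real (f t)) = \<phi> (\<i> * of_real (g t))" using f(7)[of t] g(7)[of t] f g t by auto
    then have "complex_of_real (f t) = \<i> * of_real (g t)"
      by (rule inj_onD[OF inj]) (use ft gt in \<open>auto simp: norm_mult\<close>)
    then show False using ft by (simp add: complex_eq_iff)
  qed
  show "v \<in> double_points \<gamma>" using double_pointI[of p q] pq p q by simp
  assume "\<gamma> s = v"
  then have "s - p \<in> \<int> \<or> p - q \<in> \<int> \<or> s - q \<in> \<int>" using two_parameters[of s p q] p q by simp
  then show "strand \<gamma> s (\<lambda>x. \<phi> (of_real x)) \<or> strand \<gamma> s (\<lambda>x. \<phi> (\<i> * of_real x))"
    using pq strand_shift[OF p(1)] strand_shift[OF q(1)] by blast
qed

lemma crossing_chart_scale: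
  assumes c: "crossing_chart \<gamma> v \<phi>" and a: "0 < a" "a \<le> 1"
  shows "crossing_chart \<gamma> v (\<lambda>z. \<phi> (of_real a * z))"
  using c traverses_scale[of \<gamma> "\<lambda>x. \<phi> (of_real x)" a] traverses_scale[of \<gamma> "\<lambda>x. \<phi> (\<i> * of_real x)" a] a
  unfolding crossing_chart_iff
  by (auto intro: cross_disk_scale simp: mult.left_commute)

lemma crossing_chart_small:
  assumes c: "crossing_chart \<gamma> v \<phi>" and W: "open W" "v \<in> W"
  obtains a where "0 < a" "a \<le> 1" "(\<lambda>z. \<phi> (of_real a * z)) ` cball 0 1 \<subseteq> W"
proof -
  have d: "continuous_on (cball 0 1) \<phi>" "\<phi> 0 = v"
    using c by (auto simp: crossing_chart_def disk_embedding_def)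
  obtain e where e: "0 < e" "ball v e \<subseteq> W" using W openE by blast
  obtain \<delta> where \<delta>: "0 < \<delta>" "\<And>z. z \<in> cball 0 1 \<Longrightarrow> dist z 0 < \<delta> \<Longrightarrow> dist (\<phi> z) (\<phi> 0) < e"
    using d(1) e(1) unfolding continuous_on_iff by (metis centre_in_cball zero_le_one)
  define a where "a = min 1 (\<delta> / 2)"
  have a: "0 < a" "a \<le> 1" "a < \<delta>" using \<delta> by (auto simp: a_def min_def)
  have "\<phi> (of_real a * z) \<in> W" if "norm z \<le> 1" for z
  proof -
    have "norm (of_real a * z) \<le> a" using that a by (simp add: norm_mult mult_left_le)
    then have "dist (\<phi> (of_real a * z)) (\<phi> 0) < e" using \<delta>(2)[of "of_real a * z"] a by auto
    then show ?thesis using e d by (auto simp: dist_commute)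
  qed
  then have "(\<lambda>z. \<phi> (of_real a * z)) ` cball 0 1 \<subseteq> W" by auto
  then show ?thesis using that a(1,2) by blast
qed

end

section \<open>Resolving all crossings at once\<close>

definition charts :: "(real \<Rightarrow> real^3) \<Rightarrow> (real^3 \<Rightarrow> complex \<Rightarrow> real^3) \<Rightarrow> bool" where
  "charts \<gamma> \<phi> \<longleftrightarrow> (\<forall>v\<in>double_points \<gamma>. crossing_chart \<gamma> v (\<phi> v)) \<and>
     (\<forall>v\<in>double_points \<gamma>. \<forall>w\<in>double_points \<gamma>. v \<noteq> w \<longrightarrow> \<phi> v ` cball 0 1 \<inter> \<phi> w ` cball 0 1 = {})"

definition resolve_on :: "(real^3) set \<Rightarrow> (real^3) set \<Rightarrow> (real^3 \<Rightarrow> complex \<Rightarrow> real^3) \<Rightarrow> (real^3) set" where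
  "resolve_on P V \<phi> = (P - (\<Union>v\<in>V. \<phi> v ` cball 0 1)) \<union> (\<Union>v\<in>V. \<phi> v ` nonseifert_chords)"

lemma cross_disk_chords: "cross_disk S \<phi> \<Longrightarrow> \<phi> ` nonseifert_chords \<subseteq> S2"
  using image_mono[OF chords_subset, of \<phi>] by (auto simp: cross_disk_def disk_embedding_def)

lemma resolve_on_subset:
  "P \<subseteq> S2 \<Longrightarrow> (\<And>v. v \<in> V \<Longrightarrow> cross_disk P (\<phi> v)) \<Longrightarrow> resolve_on P V \<phi> \<subseteq> S2"
  using cross_disk_chords unfolding resolve_on_def by blast

lemma circle_arrangement_iff:
  "circle_arrangement P C \<longleftrightarrow> (\<exists>\<gamma> \<phi>. generic_immersion \<gamma> \<and> P = range \<gamma> \<and> charts \<gamma> \<phi> \<and>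
     C = resolve_on P (double_points \<gamma>) \<phi>)"
  unfolding circle_arrangement_def charts_def resolve_on_def by blast

text \<open>Charts are shrunk into balls so small that those of distinct double points are disjoint.
  The closed set \<open>F\<close> is later the part of a disk in which the curve is
  modified.\<close>

lemma (in knot_curve) charts_exist:
  assumes F: "closed F" "F \<inter> double_points \<gamma> = {}"
  obtains \<phi> where "charts \<gamma> \<phi>" "\<And>v. v \<in> double_points \<gamma> \<Longrightarrow> \<phi> v ` cball 0 1 \<inter> F = {}"
proof -
  have "\<exists>d>0. \<forall>w\<in>double_points \<gamma>. w \<noteq> v \<longrightarrow> d \<le> dist v w" for v
    using finite_set_avoid[OF finite_double] by blast
  then obtain d where d: "\<And>v. 0 < d v" "\<And>v w. w \<in> double_points \<gamma> \<Longrightarrow> w \<noteq> v \<Longrightarrow> d v \<le> dist v w"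
    by metis
  have "\<exists>\<phi>. crossing_chart \<gamma> v \<phi> \<and> \<phi> ` cball 0 1 \<subseteq> ball v (d v / 2) - F" if v: "v \<in> double_points \<gamma>" for v
  proof -
    obtain \<phi> where \<phi>: "crossing_chart \<gamma> v \<phi>" using chart_ex[OF v] by blast
    have "open (ball v (d v / 2) - F)" "v \<in> ball v (d v / 2) - F" using F v d(1)[of v] by (auto intro: open_Diff)
    then obtain a where a: "0 < a" "a \<le> 1" "(\<lambda>z. \<phi> (of_real a * z)) ` cball 0 1 \<subseteq> ball v (d v / 2) - F"
      by (rule crossing_chart_small[OF \<phi>])
    then show ?thesis using crossing_chart_scale[OF \<phi> a(1,2)] by blast
  qed
  then obtain \<phi> where \<phi>: "\<And>v. v \<in> double_points \<gamma> \<Longrightarrow> crossing_chart \<gamma> v (\<phi> v)"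
    "\<And>v. v \<in> double_points \<gamma> \<Longrightarrow> \<phi> v ` cball 0 1 \<subseteq> ball v (d v / 2) - F" by metis
  have "\<phi> v ` cball 0 1 \<inter> \<phi> w ` cball 0 1 = {}"
    if vw: "v \<in> double_points \<gamma>" "w \<in> double_points \<gamma>" "v \<noteq> w" for v w
  proof (rule ccontr)
    assume "\<phi> v ` cball 0 1 \<inter> \<phi> w ` cball 0 1 \<noteq> {}"
    then obtain x where "x \<in> \<phi> v ` cball 0 1" "x \<in> \<phi> w ` cball 0 1" by blast
    then have "dist v x < d v / 2" "dist w x < d w / 2" using \<phi>(2)[OF vw(1)] \<phi>(2)[OF vw(2)] by auto
    then have "dist v w < d v / 2 + d w / 2" using dist_triangle2[of v w x] by simp
    moreover have "d v \<le> dist v w" "d w \<le> dist v w" using d(2)[of w v] d(2)[of v w] vw by (auto simp: dist_commute)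
    ultimately show False by simp
  qed
  then have "charts \<gamma> \<phi>" using \<phi>(1) by (auto simp: charts_def)
  then show ?thesis using that \<phi>(2) by blast
qed

text \<open>The charts are exchanged one at a time. When one is exchanged the other crossings are
  resolved already, which is why \<open>step\<close> speaks about arbitrary sets \<open>S'\<close>
  with a cross in the disk.\<close>

lemma resolve_on_replace:
  assumes V: "finite V" and S: "S \<subseteq> S2"
    and c: "\<And>v. v \<in> V \<Longrightarrow> cross_disk S (\<phi> v)" and c': "\<And>v. v \<in> V \<Longrightarrow> cross_disk S (\<phi>' v)"
    and sub: "\<And>v. v \<in> V \<Longrightarrow> \<phi>' v ` cball 0 1 \<subseteq> \<phi> v ` cball 0 1"
    and disj: "\<And>v w. v \<in> V \<Longrightarrow> w \<in> V \<Longrightarrow> v \<noteq> w \<Longrightarrow> \<phi> v ` cball 0 1 \<inter> \<phi> w ` cball 0 1 = {}"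
    and step: "\<And>v S'. v \<in> V \<Longrightarrow> S' \<subseteq> S2 \<Longrightarrow> cross_disk S' (\<phi> v) \<Longrightarrow> cross_disk S' (\<phi>' v) \<Longrightarrow>
      isotopic (resolve_at S' (\<phi> v)) (resolve_at S' (\<phi>' v))"
  shows "isotopic (resolve_on S V \<phi>) (resolve_on S V \<phi>')"
proof -
  define mix where "mix W v = (if v \<in> W then \<phi>' v else \<phi> v)" for W v
  have subset: "resolve_on S V \<psi> \<subseteq> S2" if "\<And>v. v \<in> V \<Longrightarrow> cross_disk S (\<psi> v)" for \<psi>
  proof -
    have "\<psi> v ` nonseifert_chords \<subseteq> S2" if "v \<in> V" for v
      using \<open>\<And>v. v \<in> V \<Longrightarrow> cross_disk S (\<psi> v)\<close>[OF that] chords_subset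
      by (auto simp: cross_disk_def disk_embedding_def)
    then show ?thesis using S unfolding resolve_on_def by blast
  qed
  have "isotopic (resolve_on S V \<phi>) (resolve_on S V (mix W))" if "W \<subseteq> V" for W
  proof -
    have "finite W" using that V finite_subset by blast
    then show ?thesis using that
    proof (induction W rule: finite_induct)
      case empty
      have "mix {} = \<phi>" by (auto simp: mix_def)
      then show ?case using isotopic_refl subset c by auto
    next
      case (insert w W)
      have w: "w \<in> V" "w \<notin> W" "W \<subseteq> V" using insert by auto
      \<comment> \<open>Everything is resolved except at \<open>w\<close>; inside the disk of
        \<open>w\<close> this set is still \<open>S\<close>.\<close>
      define S' where "S' = resolve_on S (V - {w}) (mix W)"
      have mixsub: "mix W v ` cball 0 1 \<subseteq> \<phi> v ` cball 0 1" if "v \<in> V" for v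
        using sub[OF that] by (auto simp: mix_def)
      have mc: "cross_disk S (mix W v)" if "v \<in> V" for v using c[OF that] c'[OF that] by (simp add: mix_def)
      have off: "mix W v ` cball 0 1 \<inter> \<phi> w ` cball 0 1 = {}" if "v \<in> V - {w}" for v
        using mixsub[of v] disj[of v w] that w by blast
      have offc: "mix W v ` nonseifert_chords \<inter> \<phi> w ` cball 0 1 = {}" if "v \<in> V - {w}" for v
        using off[OF that] chords_subset by blast
      have S'w: "S' \<inter> \<phi> w ` cball 0 1 = S \<inter> \<phi> w ` cball 0 1"
        unfolding S'_def resolve_on_def using off offc by blast
      have "S' \<subseteq> S2"
      proof -
        have "mix W v ` nonseifert_chords \<subseteq> S2" if "v \<in> V" for v
          using mc[OF that] chords_subset by (auto simp: cross_disk_def disk_embedding_def)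
        then show ?thesis using S unfolding S'_def resolve_on_def by blast
      qed
      moreover have "cross_disk S' (\<phi> w)" using c[OF w(1)] S'w by (simp add: cross_disk_def)
      moreover have "S' \<inter> \<phi>' w ` cball 0 1 = S \<inter> \<phi>' w ` cball 0 1" using S'w sub[OF w(1)] by blast
      then have "cross_disk S' (\<phi>' w)" using c'[OF w(1)] by (simp add: cross_disk_def)
      ultimately have "isotopic (resolve_at S' (\<phi> w)) (resolve_at S' (\<phi>' w))" by (rule step[OF w(1)])
      moreover have "resolve_at S' (\<phi> w) = resolve_on S V (mix W)"
      proof -
        have B: "(\<Union>v\<in>V - {w}. mix W v ` nonseifert_chords) \<inter> \<phi> w ` cball 0 1 = {}"
          using offc by blast
        have "mix W w = \<phi> w" using w by (simp add: mix_def)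
        moreover have "V = insert w (V - {w})" using w by blast
        moreover have "resolve_on S (insert w (V - {w})) (mix W) = (S' - mix W w ` cball 0 1) \<union> mix W w ` nonseifert_chords"
          unfolding S'_def resolve_on_def UN_insert \<open>mix W w = \<phi> w\<close> using B by blast
        ultimately show ?thesis by (simp add: resolve_at_def)
      qed
      moreover have "resolve_at S' (\<phi>' w) = resolve_on S V (mix (insert w W))"
      proof -
        have 1: "mix (insert w W) w = \<phi>' w" by (simp add: mix_def)
        have 2: "mix (insert w W) v = mix W v" if "v \<in> V - {w}" for v using that by (simp add: mix_def)
        have 3: "V = insert w (V - {w})" using w by blast
        have "resolve_on S V (mix (insert w W)) = resolve_on S (insert w (V - {w})) (mix (insert w W))" using 3 by simp
        also have "\<dots> = (S' - \<phi>' w ` cball 0 1) \<union> \<phi>' w ` nonseifert_chords"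
        proof -
          have "S' = (S - (\<Union>v\<in>V - {w}. mix (insert w W) v ` cball 0 1)) \<union> (\<Union>v\<in>V - {w}. mix (insert w W) v ` nonseifert_chords)"
            unfolding S'_def resolve_on_def using 2 by simp
          moreover have "(\<Union>v\<in>V - {w}. mix (insert w W) v ` nonseifert_chords) \<inter> \<phi>' w ` cball 0 1 = {}"
          proof -
            have "(\<Union>v\<in>V - {w}. mix (insert w W) v ` nonseifert_chords) = (\<Union>v\<in>V - {w}. mix W v ` nonseifert_chords)"
              using 2 by simp
            moreover have "(\<Union>v\<in>V - {w}. mix W v ` nonseifert_chords) \<inter> \<phi> w ` cball 0 1 = {}"
              using offc by blast
            ultimately show ?thesis using sub[OF w(1)] by (metis (no_types, lifting) inf_mono subset_empty subset_refl)
          qed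
          ultimately show ?thesis unfolding resolve_on_def UN_insert 1 by blast
        qed
        finally show ?thesis by (simp add: resolve_at_def)
      qed
      ultimately have "isotopic (resolve_on S V (mix W)) (resolve_on S V (mix (insert w W)))" by simp
      then show ?case using insert.IH w(3) isotopic_trans subset c by meson
    qed
  qed
  from this[of V] have "isotopic (resolve_on S V \<phi>) (resolve_on S V (mix V))" by simp
  moreover have "resolve_on S V (mix V) = resolve_on S V \<phi>'" by (simp add: resolve_on_def mix_def)
  ultimately show ?thesis by simp
qed

subsection \<open>Comparing two curves with the same image\<close>

definition lifts_at :: "(real \<Rightarrow> real^3) \<Rightarrow> (real \<Rightarrow> real^3) \<Rightarrow> real \<Rightarrow> bool" where
  "lifts_at \<gamma>1 \<gamma>2 t0 \<longleftrightarrow> (\<exists>\<epsilon> h. 0 < \<epsilon> \<and> continuous_on {t0 - \<epsilon>..t0 + \<epsilon>} h \<and>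
     (\<forall>t\<in>{t0 - \<epsilon>..t0 + \<epsilon>}. \<gamma>2 t = \<gamma>1 (h t)))"

definition lifts_up_at :: "(real \<Rightarrow> real^3) \<Rightarrow> (real \<Rightarrow> real^3) \<Rightarrow> real \<Rightarrow> bool" where
  "lifts_up_at \<gamma>1 \<gamma>2 t0 \<longleftrightarrow> (\<exists>\<epsilon> h. 0 < \<epsilon> \<and> continuous_on {t0 - \<epsilon>..t0 + \<epsilon>} h \<and>
     strict_mono_on {t0 - \<epsilon>..t0 + \<epsilon>} h \<and> (\<forall>t\<in>{t0 - \<epsilon>..t0 + \<epsilon>}. \<gamma>2 t = \<gamma>1 (h t)))"

text \<open>A local condition at each parameter, crossings included; no global change of parameter
  between the two curves has to be constructed.\<close>

definition same_direction :: "(real \<Rightarrow> real^3) \<Rightarrow> (real \<Rightarrow> real^3) \<Rightarrow> bool" where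
  "same_direction \<gamma>1 \<gamma>2 \<longleftrightarrow> (\<forall>t. lifts_up_at \<gamma>1 \<gamma>2 t)"

locale same_image = c1: knot_curve \<gamma>1 + c2: knot_curve \<gamma>2 for \<gamma>1 \<gamma>2 +
  assumes image: "range \<gamma>1 = range \<gamma>2"

lemma same_image_swap: "same_image \<gamma>1 \<gamma>2 \<Longrightarrow> same_image \<gamma>2 \<gamma>1"
  unfolding same_image_def same_image_axioms_def by auto

context same_image
begin

text \<open>Off its double points \<open>\<gamma>1\<close> is locally an embedding, and points of
  the curve near \<open>\<gamma>1 s0\<close> have parameters near \<open>s0\<close> up to integers.
  So \<open>\<gamma>2\<close> can be followed by a local inverse of
  \<open>\<gamma>1\<close>.\<close>

lemma lift_regular:
  assumes reg: "\<gamma>2 t0 \<notin> double_points \<gamma>1" and s0: "\<gamma>1 s0 = \<gamma>2 t0"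
  shows "\<exists>\<epsilon> h. 0 < \<epsilon> \<and> h t0 = s0 \<and> continuous_on {t0 - \<epsilon>..t0 + \<epsilon>} h \<and>
    (\<forall>t\<in>{t0 - \<epsilon>..t0 + \<epsilon>}. \<gamma>2 t = \<gamma>1 (h t))"
proof -
  obtain e where e: "0 < e" "e < 1/2" "inj_on \<gamma>1 {s0 - e..s0 + e}"
    by (rule c1.locally_injective[of s0])
  obtain \<delta> where \<delta>: "0 < \<delta>" "\<And>t. dist (\<gamma>1 t) (\<gamma>2 t0) < \<delta> \<Longrightarrow> \<exists>s. \<gamma>1 s = \<gamma>2 t0 \<and> \<bar>t - s\<bar> < e"
    using c1.near_preimage[OF e(1)] by blast
  obtain g where g: "homeomorphism {s0 - e..s0 + e} (\<gamma>1 ` {s0 - e..s0 + e}) \<gamma>1 g"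
    using homeomorphism_compact[OF compact_Icc continuous_on_subset[OF c1.cont] refl e(3)] by blast
  obtain d where d: "0 < d" "\<And>t. dist t t0 < d \<Longrightarrow> dist (\<gamma>2 t) (\<gamma>2 t0) < \<delta>"
    using c2.cont \<delta>(1) unfolding continuous_on_iff by (metis UNIV_I)
  have im: "\<gamma>2 t \<in> \<gamma>1 ` {s0 - e..s0 + e}" if t: "t \<in> {t0 - d/2..t0 + d/2}" for t
  proof -
    obtain r where r: "\<gamma>2 t = \<gamma>1 r" using image by (metis rangeE rangeI)
    have "dist (\<gamma>1 r) (\<gamma>2 t0) < \<delta>" using d(2)[of t] d(1) t r by (auto simp: dist_real_def)
    then obtain s where s: "\<gamma>1 s = \<gamma>2 t0" "\<bar>r - s\<bar> < e" using \<delta>(2) by blast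
    then have "s - s0 \<in> \<int>" using c1.double_pointI[of s s0] reg s0 by auto
    then have "- (s - s0) \<in> \<int>" by (rule Ints_minus)
    then have "(r - (s - s0)) - r \<in> \<int>" by simp
    then have "\<gamma>1 (r - (s - s0)) = \<gamma>1 r" by (rule c1.periodic_Ints)
    moreover have "r - (s - s0) \<in> {s0 - e..s0 + e}" using s(2) by auto
    ultimately show ?thesis using r by (metis imageI)
  qed
  have "continuous_on {t0 - d/2..t0 + d/2} (\<lambda>t. g (\<gamma>2 t))"
    by (rule continuous_on_compose2[OF homeomorphism_cont2[OF g] continuous_on_subset[OF c2.cont]]) (use im in auto)
  moreover have "\<gamma>2 t = \<gamma>1 (g (\<gamma>2 t))" if "t \<in> {t0 - d/2..t0 + d/2}" for t
    by (rule homeomorphism_apply2[OF g im[OF that], symmetric])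
  moreover have "g (\<gamma>2 t0) = s0" using homeomorphism_apply1[OF g, of s0] s0 e(1) by auto
  ultimately show ?thesis using d(1)
    by (intro exI[of _ "d/2"] exI[of _ "\<lambda>t. g (\<gamma>2 t)"]) auto
qed

text \<open>\<open>\<gamma>2\<close> is injective near \<open>t0\<close>, hence so is its lift, and
  a continuous injective function on an interval is monotone.\<close>

lemma lift_monotone:
  assumes l: "0 < \<epsilon>" "continuous_on {t0 - \<epsilon>..t0 + \<epsilon>} h" "\<And>t. t \<in> {t0 - \<epsilon>..t0 + \<epsilon>} \<Longrightarrow> \<gamma>2 t = \<gamma>1 (h t)"
    and \<delta>: "0 < \<delta>"
  obtains \<epsilon>' where "0 < \<epsilon>'" "\<epsilon>' \<le> \<epsilon>" "\<epsilon>' \<le> \<delta>"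
    "strict_mono_on {t0 - \<epsilon>'..t0 + \<epsilon>'} h \<or> strict_antimono_on {t0 - \<epsilon>'..t0 + \<epsilon>'} h"
proof -
  obtain e where e: "0 < e" "inj_on \<gamma>2 {t0 - e..t0 + e}" by (rule c2.locally_injective[of t0])
  define \<epsilon>' where "\<epsilon>' = min (min \<epsilon> e) \<delta>"
  have e': "0 < \<epsilon>'" "\<epsilon>' \<le> \<epsilon>" "\<epsilon>' \<le> e" "\<epsilon>' \<le> \<delta>" using l(1) e(1) \<delta> by (auto simp: \<epsilon>'_def)
  have "inj_on h {t0 - \<epsilon>'..t0 + \<epsilon>'}"
  proof (rule inj_onI)
    fix s t assume st: "s \<in> {t0 - \<epsilon>'..t0 + \<epsilon>'}" "t \<in> {t0 - \<epsilon>'..t0 + \<epsilon>'}" "h s = h t"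
    then have "\<gamma>2 s = \<gamma>2 t" using l(3)[of s] l(3)[of t] e' by auto
    then show "s = t" by (rule inj_onD[OF e(2)]) (use st e' in auto)
  qed
  moreover have "continuous_on {t0 - \<epsilon>'..t0 + \<epsilon>'} h" by (rule continuous_on_subset[OF l(2)]) (use e' in auto)
  ultimately have "strict_mono_on {t0 - \<epsilon>'..t0 + \<epsilon>'} h \<or> strict_antimono_on {t0 - \<epsilon>'..t0 + \<epsilon>'} h"
    using injective_eq_monotone_map[of "{t0 - \<epsilon>'..t0 + \<epsilon>'}" h] is_interval_cc by blast
  then show ?thesis using that e' by blast
qed

lemma lift_covers:
  assumes l: "0 < \<epsilon>" "continuous_on {t0 - \<epsilon>..t0 + \<epsilon>} h" "\<And>t. t \<in> {t0 - \<epsilon>..t0 + \<epsilon>} \<Longrightarrow> \<gamma>2 t = \<gamma>1 (h t)"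
    and \<delta>: "0 < \<delta>"
  shows "\<exists>\<eta>>0. \<forall>s. \<bar>s - h t0\<bar> < \<eta> \<longrightarrow> (\<exists>t. \<bar>t - t0\<bar> \<le> \<delta> \<and> \<bar>t - t0\<bar> \<le> \<epsilon> \<and> h t = s)"
proof -
  obtain e where e: "0 < e" "e \<le> \<epsilon>" "e \<le> \<delta>"
    "strict_mono_on {t0 - e..t0 + e} h \<or> strict_antimono_on {t0 - e..t0 + e} h"
    by (rule lift_monotone[OF l \<delta>])
  define \<eta> where "\<eta> = min \<bar>h (t0 - e) - h t0\<bar> \<bar>h (t0 + e) - h t0\<bar>"
  have c: "continuous_on {t0 - e..t0 + e} h" by (rule continuous_on_subset[OF l(2)]) (use e in auto)
  have mem: "t0 - e \<in> {t0 - e..t0 + e}" "t0 \<in> {t0 - e..t0 + e}" "t0 + e \<in> {t0 - e..t0 + e}" using e by auto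
  have alt: "h (t0 - e) < h t0 \<and> h t0 < h (t0 + e) \<or> h t0 < h (t0 - e) \<and> h (t0 + e) < h t0"
    using e(4)
  proof
    assume m: "strict_mono_on {t0 - e..t0 + e} h"
    show ?thesis using strict_mono_onD[OF m mem(1,2)] strict_mono_onD[OF m mem(2,3)] e(1) by simp
  next
    assume m: "strict_antimono_on {t0 - e..t0 + e} h"
    show ?thesis using monotone_onD[OF m mem(1,2)] monotone_onD[OF m mem(2,3)] e(1) by simp
  qed
  then have "0 < \<eta>" by (auto simp: \<eta>_def)
  moreover have "\<exists>t. \<bar>t - t0\<bar> \<le> \<delta> \<and> \<bar>t - t0\<bar> \<le> \<epsilon> \<and> h t = s" if s: "\<bar>s - h t0\<bar> < \<eta>" for s
  proof -
    have "\<exists>t. t0 - e \<le> t \<and> t \<le> t0 + e \<and> h t = s"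
      using alt
    proof
      assume a: "h (t0 - e) < h t0 \<and> h t0 < h (t0 + e)"
      then have "h (t0 - e) \<le> s" "s \<le> h (t0 + e)" using s unfolding \<eta>_def by linarith+
      then show ?thesis using IVT'[of h "t0 - e" s "t0 + e"] c e(1) by auto
    next
      assume a: "h t0 < h (t0 - e) \<and> h (t0 + e) < h t0"
      then have "h (t0 + e) \<le> s" "s \<le> h (t0 - e)" using s unfolding \<eta>_def by linarith+
      then show ?thesis using IVT2'[of h "t0 + e" s "t0 - e"] c e(1) by auto
    qed
    then obtain t where t: "t0 - e \<le> t" "t \<le> t0 + e" "h t = s" by blast
    then have "\<bar>t - t0\<bar> \<le> e" by auto
    then have "\<bar>t - t0\<bar> \<le> \<delta>" "\<bar>t - t0\<bar> \<le> \<epsilon>" using e by linarith+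
    then show ?thesis using t(3) by blast
  qed
  ultimately show ?thesis by blast
qed

end

text \<open>Where only the second curve is double, both of its strands lift to the one strand of the first
  curve, so the second curve has infinitely many double points.\<close>

lemma (in same_image) double_points_le: "double_points \<gamma>2 \<subseteq> double_points \<gamma>1"
proof
  fix v assume v: "v \<in> double_points \<gamma>2"
  show "v \<in> double_points \<gamma>1"
  proof (rule ccontr)
    assume reg: "v \<notin> double_points \<gamma>1"
    obtain t1 t2 where t: "\<gamma>2 t1 = v" "\<gamma>2 t2 = v" "t1 - t2 \<notin> \<int>" by (rule c2.double_pointE[OF v])
    obtain s0 where s0: "\<gamma>1 s0 = v" using image t(1) by (metis rangeE rangeI)
    have r: "\<gamma>2 t1 \<notin> double_points \<gamma>1" "\<gamma>2 t2 \<notin> double_points \<gamma>1"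
      and s0': "\<gamma>1 s0 = \<gamma>2 t1" "\<gamma>1 s0 = \<gamma>2 t2" using reg t s0 by auto
    obtain e1 h1 where h1: "0 < e1" "h1 t1 = s0" "continuous_on {t1 - e1..t1 + e1} h1"
      "\<And>t. t \<in> {t1 - e1..t1 + e1} \<Longrightarrow> \<gamma>2 t = \<gamma>1 (h1 t)"
      using lift_regular[OF r(1) s0'(1)] by blast
    obtain e2 h2 where h2: "0 < e2" "h2 t2 = s0" "continuous_on {t2 - e2..t2 + e2} h2"
      "\<And>t. t \<in> {t2 - e2..t2 + e2} \<Longrightarrow> \<gamma>2 t = \<gamma>1 (h2 t)"
      using lift_regular[OF r(2) s0'(2)] by blast
    have "open (- \<int> :: real set)" using closed_Ints by (rule open_Compl)
    then obtain d where d: "0 < d" "\<And>x. \<bar>x - (t1 - t2)\<bar> < d \<Longrightarrow> x \<notin> \<int>"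
      using t(3) unfolding open_dist dist_real_def by (metis ComplD ComplI)
    have d3: "0 < d / 3" using d by simp
    obtain n1 where n1: "0 < n1" "\<And>s. \<bar>s - h1 t1\<bar> < n1 \<Longrightarrow> \<exists>t. \<bar>t - t1\<bar> \<le> d/3 \<and> \<bar>t - t1\<bar> \<le> e1 \<and> h1 t = s"
      using lift_covers[OF h1(1,3,4) d3] by blast
    obtain n2 where n2: "0 < n2" "\<And>s. \<bar>s - h2 t2\<bar> < n2 \<Longrightarrow> \<exists>t. \<bar>t - t2\<bar> \<le> d/3 \<and> \<bar>t - t2\<bar> \<le> e2 \<and> h2 t = s"
      using lift_covers[OF h2(1,3,4) d3] by blast
    define n where "n = min n1 n2"
    have n: "0 < n" "n \<le> n1" "n \<le> n2" using n1 n2 by (auto simp: n_def)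
    have "\<gamma>1 s \<in> double_points \<gamma>2" if s: "\<bar>s - s0\<bar> < n" for s
    proof -
      have "\<bar>s - h1 t1\<bar> < n1" "\<bar>s - h2 t2\<bar> < n2" using s n h1(2) h2(2) by auto
      then obtain p q where p: "\<bar>p - t1\<bar> \<le> d/3" "\<bar>p - t1\<bar> \<le> e1" "h1 p = s"
        and q: "\<bar>q - t2\<bar> \<le> d/3" "\<bar>q - t2\<bar> \<le> e2" "h2 q = s" using n1(2) n2(2) by metis
      have "t1 - e1 \<le> p" "p \<le> t1 + e1" "t2 - e2 \<le> q" "q \<le> t2 + e2" using p(2) q(2) by linarith+
      then have "\<gamma>2 p = \<gamma>1 s" "\<gamma>2 q = \<gamma>1 s" using h1(4)[of p] h2(4)[of q] p(3) q(3) by auto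
      moreover have "\<bar>(p - q) - (t1 - t2)\<bar> < d" using p(1) q(1) d(1) by linarith
      then have "p - q \<notin> \<int>" by (rule d(2))
      ultimately show ?thesis using c2.double_pointI[of p q] by simp
    qed
    then have "{s0 - n/2<..<s0 + n/2} \<subseteq> {s \<in> {s0 - n..s0 + n}. \<gamma>1 s \<in> double_points \<gamma>2}" using n by auto
    then have "finite {s0 - n/2<..<s0 + n/2}"
      using c1.finite_preimage_set[OF c2.finite_double] finite_subset by blast
    then show False using n(1) infinite_Ioo[of "s0 - n/2" "s0 + n/2"] by simp
  qed
qed

lemma (in same_image) double_points_eq: "double_points \<gamma>1 = double_points \<gamma>2"
proof -
  interpret swap: same_image \<gamma>2 \<gamma>1 by (rule same_image_swap) unfold_locales
  show ?thesis using double_points_le swap.double_points_le by blast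
qed

context same_image
begin

text \<open>The transition map takes an axis of the second chart into an axis of the first.
  \<open>\<gamma>2\<close> runs along the former and \<open>\<gamma>1\<close> along all of the
  latter, so the coordinate on the image axis, followed by the inverse of the passage of
  \<open>\<gamma>1\<close>, is a lift.\<close>

lemma lift_crossing:
  assumes v: "\<gamma>2 t0 \<in> double_points \<gamma>1"
  shows "lifts_at \<gamma>1 \<gamma>2 t0"
proof -
  let ?v = "\<gamma>2 t0"
  obtain \<phi>1 where \<phi>1: "crossing_chart \<gamma>1 ?v \<phi>1" using c1.chart_ex[OF v] by blast
  obtain \<phi>0 where \<phi>0: "crossing_chart \<gamma>2 ?v \<phi>0" using c2.chart_ex v double_points_eq by blast
  have cd1: "cross_disk (range \<gamma>1) \<phi>1" "\<phi>1 0 = ?v" using \<phi>1 unfolding c1.crossing_chart_iff by auto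
  obtain W where W: "open W" "\<phi>1 ` ball 0 1 = S2 \<inter> W"
    using disk_embedding_openin[of \<phi>1] cd1 by (auto simp: openin_open cross_disk_def)
  have "?v \<in> \<phi>1 ` ball 0 1" using cd1(2) by (auto intro!: image_eqI[of _ _ 0])
  then have "?v \<in> W" using W by blast
  then obtain a where a: "0 < a" "a \<le> 1" "(\<lambda>z. \<phi>0 (of_real a * z)) ` cball 0 1 \<subseteq> W"
    by (rule c2.crossing_chart_small[OF \<phi>0 W(1)])
  define \<phi>2 where "\<phi>2 z = \<phi>0 (of_real a * z)" for z
  have \<phi>2: "crossing_chart \<gamma>2 ?v \<phi>2"
    using c2.crossing_chart_scale[OF \<phi>0 a(1,2)] by (simp add: \<phi>2_def[abs_def])
  have cd2: "cross_disk (range \<gamma>1) \<phi>2" "\<phi>2 0 = ?v" using \<phi>2 unfolding c2.crossing_chart_iff image by auto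
  have "\<phi>2 ` cball 0 1 \<subseteq> S2" using cd2 by (simp add: cross_disk_def disk_embedding_def)
  then have "\<phi>2 ` cball 0 1 \<subseteq> \<phi>1 ` ball 0 1" using a(3) W by (simp add: \<phi>2_def[abs_def])
  then have sub: "\<phi>2 ` cball 0 1 \<subseteq> \<phi>1 ` cball 0 1" using ball_subset_cball by blast
  obtain \<psi> where "cross_embedding \<psi>" and eq: "\<And>z. norm z \<le> 1 \<Longrightarrow> \<phi>1 (\<psi> z) = \<phi>2 z"
    using chart_transition[OF cd1(1) cd2(1) sub] cd1(2) cd2(2) by auto
  then interpret \<psi>: cross_embedding \<psi> by simp
  have "strand \<gamma>2 t0 (\<lambda>x. \<phi>2 (1 * of_real x)) \<or> strand \<gamma>2 t0 (\<lambda>x. \<phi>2 (\<i> * of_real x))"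
    using c2.crossing_chart_strands(2)[OF \<phi>2 refl] by simp
  then obtain u where u: "u \<in> {1, \<i>}" "strand \<gamma>2 t0 (\<lambda>x. \<phi>2 (u * of_real x))" by blast
  obtain a2 b2 f2 where f2: "a2 < t0" "t0 < b2" "continuous_on {a2..b2} f2" "strict_mono_on {a2..b2} f2"
    "f2 a2 = -1" "f2 b2 = 1" "\<And>t. t \<in> {a2..b2} \<Longrightarrow> \<gamma>2 t = \<phi>2 (u * of_real (f2 t))"
    using u(2) by (auto simp: strand_def)
  have f2r: "f2 t \<in> {-1..1}" if "t \<in> {a2..b2}" for t
    using strict_mono_on_leD[OF f2(4), of a2 t] strict_mono_on_leD[OF f2(4), of t b2] that f2 by auto
  have un: "norm (u * of_real x) \<le> 1" if "x \<in> {-1..1}" for x using u(1) that by (auto simp: norm_mult)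
  have Tu: "\<psi>.T u \<in> {1, -1, \<i>, -\<i>}" using \<psi>.T_axis u(1) by auto
  then obtain w where w: "w \<in> {1, \<i>}" "\<psi>.T u = w \<or> \<psi>.T u = - w" by auto
  define y where "y x = (if w = 1 then Re (\<psi> (u * of_real x)) else Im (\<psi> (u * of_real x)))" for x
  have yw: "\<psi> (u * of_real x) = w * of_real (y x)" if x: "x \<in> {-1..1}" for x
  proof -
    have "sign_vector (\<psi> (u * of_real x)) = of_real (sgn x) * \<psi>.T u"
      using \<psi>.sign_vector_image[OF un[OF x]] u(1) by auto
    then have "sgn (Re (\<psi> (u * of_real x))) = sgn x * Re (\<psi>.T u)" "sgn (Im (\<psi> (u * of_real x))) = sgn x * Im (\<psi>.T u)"
      by (simp_all add: complex_eq_iff)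
    then show ?thesis using w by (auto simp: y_def complex_eq_iff sgn_0_0)
  qed
  have yr: "y x \<in> {-1..1}" if x: "x \<in> {-1..1}" for x
    using \<psi>.disk[OF un[OF x]] norm_coordinates_le[of "\<psi> (u * of_real x)"] by (auto simp: y_def)
  have cy: "continuous_on {-1..1} y"
  proof -
    have c: "continuous_on {-1..1} (\<lambda>x. \<psi> (u * of_real x))"
      by (rule continuous_on_compose2[OF \<psi>.cont]) (use un in \<open>auto intro!: continuous_intros\<close>)
    show ?thesis unfolding y_def[abs_def]
      using continuous_on_Re[OF c] continuous_on_Im[OF c] by (cases "w = 1") auto
  qed
  have "traverses \<gamma>1 (\<lambda>x. \<phi>1 (w * of_real x))" using \<phi>1 w(1) unfolding c1.crossing_chart_iff by auto
  then obtain a1 b1 f1 where f1: "a1 < b1" "continuous_on {a1..b1} f1" "strict_mono_on {a1..b1} f1"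
    "f1 a1 = -1" "f1 b1 = 1" "\<And>t. t \<in> {a1..b1} \<Longrightarrow> \<gamma>1 t = \<phi>1 (w * of_real (f1 t))"
    by (auto simp: traverses_def)
  obtain k where k: "homeomorphism {a1..b1} (f1 ` {a1..b1}) f1 k"
    using homeomorphism_compact[OF compact_Icc f1(2) refl strict_mono_on_imp_inj_on[OF f1(3)]] by blast
  have f1im: "{-1..1} \<subseteq> f1 ` {a1..b1}"
  proof
    fix x :: real assume "x \<in> {-1..1}"
    then show "x \<in> f1 ` {a1..b1}" using IVT'[of f1 a1 x b1] f1 by auto
  qed
  define h where "h t = k (y (f2 t))" for t
  have hc: "continuous_on {a2..b2} h"
  proof -
    have "continuous_on {a2..b2} (\<lambda>t. y (f2 t))"
      by (rule continuous_on_compose2[OF cy f2(3)]) (use f2r in blast)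
    then show ?thesis unfolding h_def
      by (rule continuous_on_compose2[OF homeomorphism_cont2[OF k]]) (use f1im yr f2r in blast)
  qed
  have hl: "\<gamma>2 t = \<gamma>1 (h t)" if t: "t \<in> {a2..b2}" for t
  proof -
    have m: "y (f2 t) \<in> f1 ` {a1..b1}" using f1im yr f2r[OF t] by blast
    have "f1 (h t) = y (f2 t)" unfolding h_def by (rule homeomorphism_apply2[OF k m])
    moreover have "h t \<in> {a1..b1}" unfolding h_def using homeomorphism_image2[OF k] m by blast
    ultimately have "\<gamma>1 (h t) = \<phi>1 (w * of_real (y (f2 t)))" using f1(6) by simp
    also have "\<dots> = \<phi>2 (u * of_real (f2 t))" using yw[OF f2r[OF t]] eq[OF un[OF f2r[OF t]]] by simp
    finally show ?thesis using f2(7)[OF t] by simp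
  qed
  define \<epsilon> where "\<epsilon> = min (t0 - a2) (b2 - t0)"
  have e: "0 < \<epsilon>" "{t0 - \<epsilon>..t0 + \<epsilon>} \<subseteq> {a2..b2}" using f2 by (auto simp: \<epsilon>_def)
  then show ?thesis unfolding lifts_at_def
    using hl continuous_on_subset[OF hc e(2)] by (intro exI[of _ \<epsilon>] exI[of _ h]) auto
qed

lemma lifts: "lifts_at \<gamma>1 \<gamma>2 t"
proof (cases "\<gamma>2 t \<in> double_points \<gamma>1")
  case False
  obtain s where "\<gamma>1 s = \<gamma>2 t" using image by (metis rangeE rangeI)
  then show ?thesis using lift_regular[OF False] unfolding lifts_at_def by blast
qed (rule lift_crossing)

lemma lifts_up_or_down: "lifts_up_at \<gamma>1 \<gamma>2 t \<or> lifts_up_at (\<lambda>s. \<gamma>1 (- s)) \<gamma>2 t"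
proof -
  obtain \<epsilon> h where h: "0 < \<epsilon>" "continuous_on {t - \<epsilon>..t + \<epsilon>} h" "\<And>s. s \<in> {t - \<epsilon>..t + \<epsilon>} \<Longrightarrow> \<gamma>2 s = \<gamma>1 (h s)"
    using lifts unfolding lifts_at_def by blast
  obtain e where e: "0 < e" "e \<le> \<epsilon>" "strict_mono_on {t - e..t + e} h \<or> strict_antimono_on {t - e..t + e} h"
    using lift_monotone[OF h zero_less_one] by blast
  have c: "continuous_on {t - e..t + e} h" by (rule continuous_on_subset[OF h(2)]) (use e in auto)
  have l: "\<gamma>2 s = \<gamma>1 (h s)" if "s \<in> {t - e..t + e}" for s using h(3)[of s] that e by auto
  show ?thesis using e(3)
  proof
    assume "strict_mono_on {t - e..t + e} h"
    then show ?thesis unfolding lifts_up_at_def using e(1) c l by blast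
  next
    assume "strict_antimono_on {t - e..t + e} h"
    then have "strict_mono_on {t - e..t + e} (\<lambda>s. - h s)" by (auto simp: monotone_on_def)
    moreover have "continuous_on {t - e..t + e} (\<lambda>s. - h s)" using c by (rule continuous_on_minus)
    ultimately have "lifts_up_at (\<lambda>s. \<gamma>1 (- s)) \<gamma>2 t" unfolding lifts_up_at_def using e(1) l
      by (intro exI[of _ e] exI[of _ "\<lambda>s. - h s"]) auto
    then show ?thesis ..
  qed
qed

text \<open>Off the double points \<open>h1 s\<close> and \<open>- h2 s\<close> are parameters of
  the same simple point, so \<open>h1 + h2\<close> has an integer value. A strictly increasing
  function cannot be integer valued at all but finitely many points of a bounded interval.\<close>

lemma not_both_up: "\<not> (lifts_up_at \<gamma>1 \<gamma>2 t \<and> lifts_up_at (\<lambda>s. \<gamma>1 (- s)) \<gamma>2 t)"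
proof
  assume "lifts_up_at \<gamma>1 \<gamma>2 t \<and> lifts_up_at (\<lambda>s. \<gamma>1 (- s)) \<gamma>2 t"
  then obtain e1 h1 e2 h2 where h1: "0 < e1" "strict_mono_on {t - e1..t + e1} h1" "\<And>s. s \<in> {t - e1..t + e1} \<Longrightarrow> \<gamma>2 s = \<gamma>1 (h1 s)"
    and h2: "0 < e2" "strict_mono_on {t - e2..t + e2} h2" "\<And>s. s \<in> {t - e2..t + e2} \<Longrightarrow> \<gamma>2 s = \<gamma>1 (- h2 s)"
    unfolding lifts_up_at_def by blast
  define e where "e = min e1 e2"
  have e: "0 < e" "e \<le> e1" "e \<le> e2" using h1 h2 by (auto simp: e_def)
  define g where "g s = h1 s + h2 s" for s
  have mono: "g r < g s" if "r \<in> {t - e..t + e}" "s \<in> {t - e..t + e}" "r < s" for r s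
    using strict_mono_onD[OF h1(2), of r s] strict_mono_onD[OF h2(2), of r s] that e by (auto simp: g_def)
  let ?R = "{t - e<..<t + e} - {s \<in> {t - e..t + e}. \<gamma>2 s \<in> double_points \<gamma>1}"
  have "g ` ?R \<subseteq> of_int ` {\<lfloor>g (t - e)\<rfloor>..\<lceil>g (t + e)\<rceil>}"
  proof
    fix y assume "y \<in> g ` ?R"
    then obtain s where y: "y = g s" and s: "s \<in> {t - e<..<t + e}" "\<not> (s \<in> {t - e..t + e} \<and> \<gamma>2 s \<in> double_points \<gamma>1)"
      by blast
    then have "\<gamma>2 s \<notin> double_points \<gamma>1" by auto
    moreover have "\<gamma>2 s = \<gamma>1 (h1 s)" "\<gamma>2 s = \<gamma>1 (- h2 s)" using h1(3)[of s] h2(3)[of s] s e by auto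
    ultimately have "h1 s - (- h2 s) \<in> \<int>" using c1.double_pointI[of "h1 s" "- h2 s"] by metis
    then obtain n where n: "g s = of_int n" unfolding g_def by (elim Ints_cases) simp
    have "g (t - e) \<le> g s" "g s \<le> g (t + e)" using mono[of "t - e" s] mono[of s "t + e"] s by auto
    then have "\<lfloor>g (t - e)\<rfloor> \<le> n" "n \<le> \<lceil>g (t + e)\<rceil>"
      using n floor_mono[of "g (t - e)" "g s"] ceiling_mono[of "g s" "g (t + e)"] by auto
    then show "y \<in> of_int ` {\<lfloor>g (t - e)\<rfloor>..\<lceil>g (t + e)\<rceil>}"
      unfolding y n by (intro imageI) auto
  qed
  then have "finite (g ` ?R)" by (rule finite_subset) simp
  moreover have "inj_on g ?R"
  proof (rule inj_onI)
    fix r s assume rs: "r \<in> ?R" "s \<in> ?R" "g r = g s"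
    then show "r = s" using mono[of r s] mono[of s r] by (cases r s rule: linorder_cases) auto
  qed
  ultimately have "finite ?R" by (rule finite_imageD)
  then have "finite (?R \<union> {s \<in> {t - e..t + e}. \<gamma>2 s \<in> double_points \<gamma>1})"
    using c2.finite_preimage_set[OF c1.finite_double] by simp
  then have "finite {t - e<..<t + e}" by (rule finite_subset[rotated]) auto
  then show False using e(1) infinite_Ioo[of "t - e" "t + e"] by simp
qed

lemma open_lifts_up: "open {t. lifts_up_at \<alpha> \<gamma>2 t}" for \<alpha>
  unfolding open_dist
proof safe
  fix t assume "lifts_up_at \<alpha> \<gamma>2 t"
  then obtain \<epsilon> h where h: "0 < \<epsilon>" "continuous_on {t - \<epsilon>..t + \<epsilon>} h" "strict_mono_on {t - \<epsilon>..t + \<epsilon>} h"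
    "\<And>s. s \<in> {t - \<epsilon>..t + \<epsilon>} \<Longrightarrow> \<gamma>2 s = \<alpha> (h s)"
    unfolding lifts_up_at_def by blast
  have "lifts_up_at \<alpha> \<gamma>2 s" if s: "dist s t < \<epsilon> / 2" for s
  proof -
    have "s - t < \<epsilon> / 2" "t - s < \<epsilon> / 2" using s unfolding dist_real_def by linarith+
    then have sub: "{s - \<epsilon>/2..s + \<epsilon>/2} \<subseteq> {t - \<epsilon>..t + \<epsilon>}" by auto
    show ?thesis unfolding lifts_up_at_def
      using h(1,4) sub continuous_on_subset[OF h(2) sub] monotone_on_subset[OF h(3) sub]
      by (intro exI[of _ "\<epsilon>/2"] exI[of _ h]) auto
  qed
  then show "\<exists>e>0. \<forall>s. dist s t < e \<longrightarrow> s \<in> {t. lifts_up_at \<alpha> \<gamma>2 t}"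
    using h(1) by (intro exI[of _ "\<epsilon>/2"]) auto
qed

text \<open>The two directions are open conditions that exclude each other and cover the connected
  line of parameters.\<close>

lemma same_or_opposite_direction:
  "same_direction \<gamma>1 \<gamma>2 \<or> same_direction (\<lambda>s. \<gamma>1 (- s)) \<gamma>2"
proof -
  let ?U = "{t. lifts_up_at \<gamma>1 \<gamma>2 t}" and ?D = "{t. lifts_up_at (\<lambda>s. \<gamma>1 (- s)) \<gamma>2 t}"
  have "connected (UNIV :: real set)" by simp
  moreover have "?U \<inter> ?D \<inter> UNIV = {}" "UNIV \<subseteq> ?U \<union> ?D" using not_both_up lifts_up_or_down by auto
  ultimately have "?U \<inter> UNIV = {} \<or> ?D \<inter> UNIV = {}"
    using open_lifts_up by (intro connectedD) auto
  then show ?thesis using lifts_up_or_down unfolding same_direction_def by blast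
qed

end

subsection \<open>Uniqueness of the circle arrangement\<close>

text \<open>The arrangement in the class of topological curves. It includes the arrangements of
  immersions, and it is stable under homeomorphisms of the sphere and modifications in disks, which
  need not preserve smoothness.\<close>

definition curve_arrangement :: "(real^3) set \<Rightarrow> (real^3) set \<Rightarrow> bool" where
  "curve_arrangement P C \<longleftrightarrow> (\<exists>\<gamma> \<phi>. knot_curve \<gamma> \<and> P = range \<gamma> \<and> charts \<gamma> \<phi> \<and>
     C = resolve_on P (double_points \<gamma>) \<phi>)"

lemma (in knot_curve) strand_outgoing:
  assumes c: "crossing_chart \<gamma> v \<phi>" and s: "\<gamma> s = v"
  obtains \<epsilon> where "0 < \<epsilon>" "\<And>t. s < t \<Longrightarrow> t < s + \<epsilon> \<Longrightarrow> \<gamma> t \<in> \<phi> ` {z \<in> cross. 0 \<le> Re z \<and> 0 \<le> Im z}"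
proof -
  have "strand \<gamma> s (\<lambda>x. \<phi> (1 * of_real x)) \<or> strand \<gamma> s (\<lambda>x. \<phi> (\<i> * of_real x))"
    using crossing_chart_strands(2)[OF c s] by simp
  then obtain u where u: "u \<in> {1, \<i>}" "strand \<gamma> s (\<lambda>x. \<phi> (u * of_real x))" by blast
  obtain a b f where f: "a < s" "s < b" "strict_mono_on {a..b} f" "f s = 0" "f b = 1"
    "\<And>t. t \<in> {a..b} \<Longrightarrow> \<gamma> t = \<phi> (u * of_real (f t))"
    using u(2) by (auto simp: strand_def)
  have "\<gamma> t \<in> \<phi> ` {z \<in> cross. 0 \<le> Re z \<and> 0 \<le> Im z}" if t: "s < t" "t < s + (b - s)" for t
  proof -
    have "0 < f t" "f t \<le> 1"
      using strict_mono_onD[OF f(3), of s t] strict_mono_onD[OF f(3), of t b] t f by auto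
    then have "u * of_real (f t) \<in> {z \<in> cross. 0 \<le> Re z \<and> 0 \<le> Im z}"
      using u(1) by (auto simp: cross_def norm_mult)
    then show ?thesis using f(6)[of t] t f by auto
  qed
  then show ?thesis using that[of "b - s"] f by auto
qed

text \<open>As the lift is increasing, just after the crossing \<open>\<gamma>2\<close> takes values
  that \<open>\<gamma>1\<close> takes just after it, and these lie on the outgoing half axes. This
  yields the points required by \<open>resolve_at_refine\<close>.\<close>

lemma (in same_image) outgoing_strand:
  assumes dir: "same_direction \<gamma>1 \<gamma>2" and c: "crossing_chart \<gamma>1 v \<phi>"
    and s: "strand \<gamma>2 s \<alpha>" "\<gamma>2 s = v"
  obtains r where "0 < r" "r \<le> 1" "\<alpha> r \<in> \<phi> ` {z \<in> cross. 0 \<le> Re z \<and> 0 \<le> Im z}"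
proof -
  obtain e h where h: "0 < e" "continuous_on {s - e..s + e} h" "strict_mono_on {s - e..s + e} h"
    "\<And>t. t \<in> {s - e..s + e} \<Longrightarrow> \<gamma>2 t = \<gamma>1 (h t)"
    using dir unfolding same_direction_def lifts_up_at_def by blast
  have "\<gamma>1 (h s) = v" using h(1) h(4)[of s] s(2) by simp
  then obtain \<epsilon> where \<epsilon>: "0 < \<epsilon>" "\<And>t. h s < t \<Longrightarrow> t < h s + \<epsilon> \<Longrightarrow> \<gamma>1 t \<in> \<phi> ` {z \<in> cross. 0 \<le> Re z \<and> 0 \<le> Im z}"
    using c1.strand_outgoing[OF c] by blast
  obtain d where d: "0 < d" "\<And>t. t \<in> {s - e..s + e} \<Longrightarrow> dist t s < d \<Longrightarrow> dist (h t) (h s) < \<epsilon>"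
    using h(1,2) \<epsilon>(1) unfolding continuous_on_iff by (metis add_increasing2 atLeastAtMost_iff diff_le_eq less_imp_le order_refl)
  obtain a b f where f: "a < s" "s < b" "strict_mono_on {a..b} f" "f s = 0" "f b = 1"
    "\<And>t. t \<in> {a..b} \<Longrightarrow> \<gamma>2 t = \<alpha> (f t)"
    using s(1) by (auto simp: strand_def)
  define t where "t = min (min (s + e) (s + d / 2)) b"
  have t: "s < t" "t \<le> s + e" "t < s + d" "t \<le> b" using h(1) d(1) f(2) by (auto simp: t_def)
  have "h s < h t" using strict_mono_onD[OF h(3), of s t] t h(1) by auto
  moreover have "h t < h s + \<epsilon>" using d(2)[of t] t h(1) by (auto simp: dist_real_def)
  ultimately have "\<alpha> (f t) \<in> \<phi> ` {z \<in> cross. 0 \<le> Re z \<and> 0 \<le> Im z}"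
    using \<epsilon>(2)[of "h t"] h(4)[of t] f(6)[of t] t f h(1) by auto
  moreover have "0 < f t" "f t \<le> 1"
    using strict_mono_onD[OF f(3), of s t] strict_mono_on_leD[OF f(3), of t b] t f by auto
  ultimately show ?thesis using that by blast
qed

lemma (in same_image) isotopic_resolve_on:
  assumes dir: "same_direction \<gamma>1 \<gamma>2" and 1: "charts \<gamma>1 \<phi>1" and 2: "charts \<gamma>2 \<phi>2"
  shows "isotopic (resolve_on (range \<gamma>1) (double_points \<gamma>1) \<phi>1) (resolve_on (range \<gamma>2) (double_points \<gamma>2) \<phi>2)"
proof -
  let ?P = "range \<gamma>1" and ?V = "double_points \<gamma>1"
  have P: "?P \<subseteq> S2" by (rule c1.sphere)
  have V: "double_points \<gamma>2 = ?V" using double_points_eq by simp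
  have ch1: "crossing_chart \<gamma>1 v (\<phi>1 v)" if "v \<in> ?V" for v using 1 that by (simp add: charts_def)
  have ch2: "crossing_chart \<gamma>2 v (\<phi>2 v)" if "v \<in> ?V" for v using 2 that V by (simp add: charts_def)
  have "\<exists>a. 0 < a \<and> a \<le> 1 \<and> (\<lambda>z. \<phi>2 v (of_real a * z)) ` cball 0 1 \<subseteq> \<phi>1 v ` cball 0 1" if v: "v \<in> ?V" for v
  proof -
    have e: "disk_embedding (\<phi>1 v)" "\<phi>1 v 0 = v" using ch1[OF v] by (auto simp: crossing_chart_def)
    obtain W where W: "open W" "\<phi>1 v ` ball 0 1 = S2 \<inter> W"
      using disk_embedding_openin[OF e(1)] by (auto simp: openin_open)
    have "v \<in> \<phi>1 v ` ball 0 1" using e(2) by (auto intro!: image_eqI[of _ _ 0])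
    then have "v \<in> W" using W by blast
    then obtain a where a: "0 < a" "a \<le> 1" "(\<lambda>z. \<phi>2 v (of_real a * z)) ` cball 0 1 \<subseteq> W"
      by (rule c2.crossing_chart_small[OF ch2[OF v] W(1)])
    moreover have "(\<lambda>z. \<phi>2 v (of_real a * z)) ` cball 0 1 \<subseteq> S2"
      using c2.crossing_chart_scale[OF ch2[OF v] a(1,2)] by (simp add: crossing_chart_def disk_embedding_def)
    ultimately have "(\<lambda>z. \<phi>2 v (of_real a * z)) ` cball 0 1 \<subseteq> \<phi>1 v ` ball 0 1" using W by blast
    then show ?thesis using a(1,2) ball_subset_cball by blast
  qed
  then obtain a where a: "\<And>v. v \<in> ?V \<Longrightarrow> 0 < a v \<and> a v \<le> 1"
    and sub: "\<And>v. v \<in> ?V \<Longrightarrow> (\<lambda>z. \<phi>2 v (of_real (a v) * z)) ` cball 0 1 \<subseteq> \<phi>1 v ` cball 0 1" by metis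
  \<comment> \<open>The second chart, rescaled into the disk of the first, is compared with both:
    with \<open>\<phi>1\<close> by \<open>resolve_at_refine\<close>, with \<open>\<phi>2\<close> by
    \<open>resolve_at_scale\<close>.\<close>
  define \<phi> where "\<phi> v z = \<phi>2 v (of_real (a v) * z)" for v z
  have ch: "crossing_chart \<gamma>2 v (\<phi> v)" if "v \<in> ?V" for v
    using c2.crossing_chart_scale[OF ch2[OF that], of "a v"] a[OF that] by (simp add: \<phi>_def[abs_def])
  have cd1: "cross_disk ?P (\<phi>1 v)" if "v \<in> ?V" for v using ch1[OF that] by (simp add: c1.crossing_chart_iff)
  have cd2: "cross_disk ?P (\<phi>2 v)" if "v \<in> ?V" for v using ch2[OF that] by (simp add: c2.crossing_chart_iff image)
  have cd: "cross_disk ?P (\<phi> v)" if "v \<in> ?V" for v using ch[OF that] by (simp add: c2.crossing_chart_iff image)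
  have "isotopic (resolve_on ?P ?V \<phi>1) (resolve_on ?P ?V \<phi>)"
  proof (rule resolve_on_replace[OF c1.finite_double P cd1 cd])
    show "\<phi> v ` cball 0 1 \<subseteq> \<phi>1 v ` cball 0 1" if "v \<in> ?V" for v using sub[OF that] by (simp add: \<phi>_def[abs_def])
    show "\<phi>1 v ` cball 0 1 \<inter> \<phi>1 w ` cball 0 1 = {}" if "v \<in> ?V" "w \<in> ?V" "v \<noteq> w" for v w
      using 1 that by (simp add: charts_def)
    fix v S' assume v: "v \<in> ?V" and S': "S' \<subseteq> S2" "cross_disk S' (\<phi>1 v)" "cross_disk S' (\<phi> v)"
    have z: "\<phi> v 0 = v" "\<phi>1 v 0 = v" using ch[OF v] ch1[OF v] by (auto simp: crossing_chart_def)
    obtain p where p: "strand \<gamma>2 p (\<lambda>x. \<phi> v (of_real x))" "\<gamma>2 p = v"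
      using traverses_strand[of \<gamma>2 "\<lambda>x. \<phi> v (of_real x)"] ch[OF v] z unfolding c2.crossing_chart_iff by auto
    obtain q where q: "strand \<gamma>2 q (\<lambda>x. \<phi> v (\<i> * of_real x))" "\<gamma>2 q = v"
      using traverses_strand[of \<gamma>2 "\<lambda>x. \<phi> v (\<i> * of_real x)"] ch[OF v] z unfolding c2.crossing_chart_iff by auto
    obtain r where r: "0 < r" "r \<le> 1" "\<phi> v (of_real r) \<in> \<phi>1 v ` {z \<in> cross. 0 \<le> Re z \<and> 0 \<le> Im z}"
      by (rule outgoing_strand[OF dir ch1[OF v] p])
    obtain r' where r': "0 < r'" "r' \<le> 1" "\<phi> v (\<i> * of_real r') \<in> \<phi>1 v ` {z \<in> cross. 0 \<le> Re z \<and> 0 \<le> Im z}"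
      by (rule outgoing_strand[OF dir ch1[OF v] q])
    have "\<phi> v ` cball 0 1 \<subseteq> \<phi>1 v ` cball 0 1" using sub[OF v] by (simp add: \<phi>_def[abs_def])
    then show "isotopic (resolve_at S' (\<phi>1 v)) (resolve_at S' (\<phi> v))"
      using resolve_at_refine[OF S' _ _ r r'] z by simp
  qed
  moreover have "isotopic (resolve_on ?P ?V \<phi>2) (resolve_on ?P ?V \<phi>)"
  proof (rule resolve_on_replace[OF c1.finite_double P cd2 cd])
    show "\<phi> v ` cball 0 1 \<subseteq> \<phi>2 v ` cball 0 1" if "v \<in> ?V" for v
      using a[OF that] by (auto simp: \<phi>_def norm_mult mult_le_one intro!: image_eqI[of _ "\<phi>2 v"])
    show "\<phi>2 v ` cball 0 1 \<inter> \<phi>2 w ` cball 0 1 = {}" if "v \<in> ?V" "w \<in> ?V" "v \<noteq> w" for v w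
      using 2 V that by (simp add: charts_def)
    fix v S' assume v: "v \<in> ?V" and S': "S' \<subseteq> S2" "cross_disk S' (\<phi>2 v)"
    then show "isotopic (resolve_at S' (\<phi>2 v)) (resolve_at S' (\<phi> v))"
      using resolve_at_scale[OF S', of "a v"] a[OF v] by (simp add: \<phi>_def[abs_def])
  qed
  moreover have "resolve_on ?P ?V \<phi>2 \<subseteq> S2" "resolve_on ?P ?V \<phi>1 \<subseteq> S2"
    using resolve_on_subset[OF P] cd1 cd2 by blast+
  ultimately have "isotopic (resolve_on ?P ?V \<phi>1) (resolve_on ?P ?V \<phi>2)"
    using isotopic_trans isotopic_sym by meson
  then show ?thesis by (simp add: V image)
qed

lemma charts_reverse:
  assumes "knot_curve \<gamma>" "charts \<gamma> \<phi>"
  shows "charts (\<lambda>t. \<gamma> (- t)) (\<lambda>v. \<phi> v \<circ> uminus)" "resolve_on P V (\<lambda>v. \<phi> v \<circ> uminus) = resolve_on P V \<phi>"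
proof -
  have u: "uminus ` cball (0::complex) 1 = cball 0 1"
    by (intro set_eqI, unfold mem_uminus_image) auto
  then have im: "(\<phi> v \<circ> uminus) ` cball 0 1 = \<phi> v ` cball 0 1"
    "(\<phi> v \<circ> uminus) ` nonseifert_chords = \<phi> v ` nonseifert_chords" for v
    by (metis image_comp, metis image_comp nonseifert_chords_uminus)
  show "charts (\<lambda>t. \<gamma> (- t)) (\<lambda>v. \<phi> v \<circ> uminus)"
    using assms(2) crossing_chart_reverse unfolding charts_def im knot_curve.reverse(2)[OF assms(1)] by blast
  show "resolve_on P V (\<lambda>v. \<phi> v \<circ> uminus) = resolve_on P V \<phi>"
    unfolding resolve_on_def im ..
qed

lemma curve_arrangement_unique:
  assumes "curve_arrangement P C" "curve_arrangement P C'"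
  shows "isotopic C C'"
proof -
  obtain \<gamma>1 \<phi>1 where 1: "knot_curve \<gamma>1" "P = range \<gamma>1" "charts \<gamma>1 \<phi>1" "C = resolve_on P (double_points \<gamma>1) \<phi>1"
    using assms(1) unfolding curve_arrangement_def by blast
  obtain \<gamma>2 \<phi>2 where 2: "knot_curve \<gamma>2" "P = range \<gamma>2" "charts \<gamma>2 \<phi>2" "C' = resolve_on P (double_points \<gamma>2) \<phi>2"
    using assms(2) unfolding curve_arrangement_def by blast
  interpret same_image \<gamma>1 \<gamma>2
    unfolding same_image_def same_image_axioms_def using 1 2 by simp
  show ?thesis using same_or_opposite_direction
  proof
    assume "same_direction \<gamma>1 \<gamma>2"
    then show ?thesis using isotopic_resolve_on 1 2 by simp
  next
    assume d: "same_direction (\<lambda>s. \<gamma>1 (- s)) \<gamma>2"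
    interpret rev: same_image "\<lambda>s. \<gamma>1 (- s)" \<gamma>2
      unfolding same_image_def same_image_axioms_def
      using knot_curve.reverse(1)[OF 1(1)] 2 1(2) range_reverse[of \<gamma>1] by simp
    show ?thesis
      using rev.isotopic_resolve_on[OF d charts_reverse(1)[OF 1(1,3)] 2(3)] 1 2
      by (simp add: charts_reverse(2)[OF 1(1,3)] knot_curve.reverse(2)[OF 1(1)] range_reverse)
  qed
qed

subsection \<open>Charts of generic immersions\<close>

lemma generic_immersion_D:
  assumes "generic_immersion \<gamma>"
  obtains D where "\<And>t. (\<gamma> has_vector_derivative D t) (at t)" "continuous_on UNIV D"
    "\<And>s t. s \<in> {0..<1} \<Longrightarrow> t \<in> {0..<1} \<Longrightarrow> s \<noteq> t \<Longrightarrow> \<gamma> s = \<gamma> t \<Longrightarrow> \<not> collinear {0, D s, D t}"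
proof -
  obtain D where D: "\<And>t. (\<gamma> has_vector_derivative D t) (at t)" "continuous_on UNIV D"
    using assms by (auto simp: generic_immersion_def C1_differentiable_on_def)
  have "vector_derivative \<gamma> (at t) = D t" for t by (rule vector_derivative_at[OF D(1)])
  then show ?thesis using that[OF D] assms by (simp add: generic_immersion_def)
qed

lemma generic_immersion_closed_curve:
  assumes "generic_immersion \<gamma>"
  shows "closed_curve \<gamma>"
proof
  obtain D where "\<And>t. (\<gamma> has_vector_derivative D t) (at t)"
    using generic_immersion_D[OF assms] by metis
  then show "continuous_on UNIV \<gamma>"
    by (meson continuous_at_imp_continuous_on has_vector_derivative_continuous)
qed (use assms in \<open>auto simp: generic_immersion_def\<close>)

text \<open>Differentiate \<open>\<gamma> t \<bullet> \<gamma> t = 1\<close>.\<close>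

lemma sphere_curve_orthogonal:
  fixes \<gamma> :: "real \<Rightarrow> real^3"
  assumes "range \<gamma> \<subseteq> S2" "(\<gamma> has_vector_derivative d) (at t)"
  shows "\<gamma> t \<bullet> d = 0"
proof -
  have d: "(\<gamma> has_derivative (\<lambda>h. h *\<^sub>R d)) (at t)" using assms(2) by (simp add: has_vector_derivative_def)
  have "((\<lambda>t. \<gamma> t \<bullet> \<gamma> t) has_derivative (\<lambda>h. \<gamma> t \<bullet> (h *\<^sub>R d) + (h *\<^sub>R d) \<bullet> \<gamma> t)) (at t)"
    by (rule has_derivative_inner[OF d d])
  moreover have "(\<lambda>t. \<gamma> t \<bullet> \<gamma> t) = (\<lambda>t. 1)"
  proof
    fix t
    have "norm (\<gamma> t) = 1" using assms(1) by (auto simp: image_subset_iff)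
    then show "\<gamma> t \<bullet> \<gamma> t = 1" by (simp add: dot_square_norm)
  qed
  ultimately have "((\<lambda>t. 1::real) has_derivative (\<lambda>h. \<gamma> t \<bullet> (h *\<^sub>R d) + (h *\<^sub>R d) \<bullet> \<gamma> t)) (at t)" by simp
  then have "(\<lambda>h. \<gamma> t \<bullet> (h *\<^sub>R d) + (h *\<^sub>R d) \<bullet> \<gamma> t) = (\<lambda>h. 0)"
    by (rule has_derivative_unique) (rule has_derivative_const)
  from fun_cong[OF this, of 1] show ?thesis by (simp add: inner_commute)
qed

text \<open>The sum of the two branches, with a scaling factor as third coordinate, is a local
  diffeomorphism; projecting it radially to the sphere gives a chart whose coordinate axes are the
  branches.\<close>

lemma sum_of_branches_injective:
  fixes \<gamma> D :: "real \<Rightarrow> real^3"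
  assumes S: "range \<gamma> \<subseteq> S2" and D: "\<And>t. (\<gamma> has_vector_derivative D t) (at t)" and cD: "continuous_on UNIV D"
    and v: "\<gamma> s0 = v" "\<gamma> t0 = v" and ncol: "\<not> collinear {0, D s0, D t0}"
  obtains r where "0 < r"
    "inj_on (\<lambda>p::(real \<times> real) \<times> real. snd p *\<^sub>R (\<gamma> (s0 + fst (fst p)) + \<gamma> (t0 + snd (fst p)) - v)) (ball ((0, 0), 1) r)"
proof -
  have c\<gamma>: "continuous_on UNIV \<gamma>" using D by (meson continuous_at_imp_continuous_on has_vector_derivative_continuous)
  define K where "K p = \<gamma> (s0 + fst (fst p)) + \<gamma> (t0 + snd (fst p)) - v" for p :: "(real \<times> real) \<times> real"
  define H' where "H' p q = snd p *\<^sub>R (fst (fst q) *\<^sub>R D (s0 + fst (fst p)) + snd (fst q) *\<^sub>R D (t0 + snd (fst p))) + snd q *\<^sub>R K p"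
    for p q :: "(real \<times> real) \<times> real"
  let ?a = "((0, 0), 1) :: (real \<times> real) \<times> real"
  have vn: "norm v = 1" using S v(1) by (auto simp: image_subset_iff)
  have Ka: "K ?a = v" by (simp add: K_def v)
  have lin: "linear (H' p)" for p by (auto simp: H'_def linear_iff algebra_simps)
  have inj: "inj (H' ?a)"
  proof (subst linear_injective_0[OF lin], intro allI impI)
    fix q assume "H' ?a q = 0"
    then have z: "fst (fst q) *\<^sub>R D s0 + snd (fst q) *\<^sub>R D t0 + snd q *\<^sub>R v = 0" by (simp add: H'_def Ka)
    \<comment> \<open>Pairing with \<open>v\<close>, which is orthogonal to both velocities,
      eliminates the radial coefficient; transversality eliminates the other two.\<close>
    have o: "v \<bullet> D s0 = 0" "v \<bullet> D t0 = 0"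
      using sphere_curve_orthogonal[OF S D, of s0] sphere_curve_orthogonal[OF S D, of t0] v by auto
    have "v \<bullet> (fst (fst q) *\<^sub>R D s0 + snd (fst q) *\<^sub>R D t0 + snd q *\<^sub>R v) = snd q"
      using o vn by (simp add: inner_add_right dot_square_norm)
    then have q3: "snd q = 0" using z by simp
    then have z2: "fst (fst q) *\<^sub>R D s0 + snd (fst q) *\<^sub>R D t0 = 0" using z by simp
    have q2: "snd (fst q) = 0"
    proof (rule ccontr)
      assume n: "snd (fst q) \<noteq> 0"
      have "snd (fst q) *\<^sub>R D t0 = (- fst (fst q)) *\<^sub>R D s0" using z2 by (simp add: add_eq_0_iff)
      then have "D t0 = (- fst (fst q) / snd (fst q)) *\<^sub>R D s0"
        using n by (metis (no_types, lifting) divideR_right divide_inverse_commute scaleR_scaleR)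
      then have "\<exists>c. D t0 = c *\<^sub>R D s0" by blast
      then show False using ncol by (simp add: collinear_lemma)
    qed
    have q1: "fst (fst q) = 0" using z2 q2 ncol by (auto simp: collinear_lemma)
    show "q = 0" using q1 q2 q3 by (simp add: prod_eq_iff)
  qed
  obtain g where g: "linear g" "g \<circ> H' ?a = id" using linear_injective_left_inverse[OF lin inj] by blast
  have der: "((\<lambda>p. snd p *\<^sub>R K p) has_derivative H' p) (at p)" for p
  proof -
    have d: "(\<gamma> has_derivative (\<lambda>h. h *\<^sub>R D t)) (at t)" for t using D by (simp add: has_vector_derivative_def)
    have "((\<lambda>p::(real \<times> real) \<times> real. s0 + fst (fst p)) has_derivative (\<lambda>q. fst (fst q))) (at p)"
      by (auto intro!: derivative_eq_intros)
    from has_derivative_compose[OF this d]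
    have 1: "((\<lambda>p::(real \<times> real) \<times> real. \<gamma> (s0 + fst (fst p))) has_derivative (\<lambda>q. fst (fst q) *\<^sub>R D (s0 + fst (fst p)))) (at p)" .
    have "((\<lambda>p::(real \<times> real) \<times> real. t0 + snd (fst p)) has_derivative (\<lambda>q. snd (fst q))) (at p)"
      by (auto intro!: derivative_eq_intros)
    from has_derivative_compose[OF this d]
    have 2: "((\<lambda>p::(real \<times> real) \<times> real. \<gamma> (t0 + snd (fst p))) has_derivative (\<lambda>q. snd (fst q) *\<^sub>R D (t0 + snd (fst p)))) (at p)" .
    have "(K has_derivative (\<lambda>q. fst (fst q) *\<^sub>R D (s0 + fst (fst p)) + snd (fst q) *\<^sub>R D (t0 + snd (fst p)) - 0)) (at p)"
      unfolding K_def by (intro has_derivative_diff has_derivative_add 1 2 has_derivative_const)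
    from has_derivative_scaleR[OF has_derivative_snd[OF has_derivative_ident] this]
    show ?thesis by (simp add: H'_def[abs_def])
  qed
  \<comment> \<open>Continuity of the derivative in the operator norm, with \<open>N\<close> as an
    explicit bound; together with the left inverse at the centre it gives local injectivity.\<close>
  have cont_onorm: "\<exists>d>0. \<forall>p. dist ?a p < d \<longrightarrow> onorm (\<lambda>q. H' p q - H' ?a q) < e" if e: "0 < e" for e
  proof -
    define N where "N p = norm (snd p *\<^sub>R D (s0 + fst (fst p)) - D s0) + norm (snd p *\<^sub>R D (t0 + snd (fst p)) - D t0)
      + norm (K p - v)" for p :: "(real \<times> real) \<times> real"
    have c1: "continuous_on UNIV (\<lambda>p::(real \<times> real) \<times> real. s0 + fst (fst p))"
      "continuous_on UNIV (\<lambda>p::(real \<times> real) \<times> real. t0 + snd (fst p))"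
      by (intro continuous_intros)+
    have c2: "continuous_on UNIV (\<lambda>p::(real \<times> real) \<times> real. D (s0 + fst (fst p)))"
      "continuous_on UNIV (\<lambda>p::(real \<times> real) \<times> real. D (t0 + snd (fst p)))"
      "continuous_on UNIV (\<lambda>p::(real \<times> real) \<times> real. \<gamma> (s0 + fst (fst p)))"
      "continuous_on UNIV (\<lambda>p::(real \<times> real) \<times> real. \<gamma> (t0 + snd (fst p)))"
      using continuous_on_compose2[OF cD c1(1)] continuous_on_compose2[OF cD c1(2)]
        continuous_on_compose2[OF c\<gamma> c1(1)] continuous_on_compose2[OF c\<gamma> c1(2)] by auto
    have "continuous_on UNIV N" unfolding N_def K_def by (intro continuous_intros c2)
    moreover have "N ?a = 0" by (simp add: N_def Ka)
    ultimately obtain d where d: "0 < d" "\<And>p. dist p ?a < d \<Longrightarrow> dist (N p) 0 < e"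
      using e unfolding continuous_on_iff by (metis UNIV_I)
    have "onorm (\<lambda>q. H' p q - H' ?a q) < e" if p: "dist ?a p < d" for p
    proof -
      have "norm (H' p q - H' ?a q) \<le> N p * norm q" for q
      proof -
        have "H' p q - H' ?a q = fst (fst q) *\<^sub>R (snd p *\<^sub>R D (s0 + fst (fst p)) - D s0)
          + snd (fst q) *\<^sub>R (snd p *\<^sub>R D (t0 + snd (fst p)) - D t0) + snd q *\<^sub>R (K p - v)"
          by (simp add: H'_def Ka algebra_simps)
        also have "norm \<dots> \<le> norm (fst (fst q)) * norm (snd p *\<^sub>R D (s0 + fst (fst p)) - D s0)
          + norm (snd (fst q)) * norm (snd p *\<^sub>R D (t0 + snd (fst p)) - D t0) + norm (snd q) * norm (K p - v)"
          by (intro norm_triangle_le add_mono) (simp_all add: norm_triangle_le)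
        also have "\<dots> \<le> norm q * norm (snd p *\<^sub>R D (s0 + fst (fst p)) - D s0)
          + norm q * norm (snd p *\<^sub>R D (t0 + snd (fst p)) - D t0) + norm q * norm (K p - v)"
        proof -
          have "norm (fst (fst q)) \<le> norm q" "norm (snd (fst q)) \<le> norm q" "norm (snd q) \<le> norm q"
            using norm_fst_le[of "fst (fst q)" "snd (fst q)"] norm_snd_le[of "snd (fst q)" "fst (fst q)"]
              norm_fst_le[of "fst q" "snd q"] norm_snd_le[of "snd q" "fst q"] by simp_all
          then show ?thesis by (intro add_mono mult_right_mono) simp_all
        qed
        finally show ?thesis by (simp add: N_def algebra_simps)
      qed
      then have "onorm (\<lambda>q. H' p q - H' ?a q) \<le> N p" by (intro onorm_bound) (auto simp: N_def)
      also have "\<dots> < e" using d(2)[of p] p by (simp add: dist_commute)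
      finally show ?thesis .
    qed
    then show ?thesis using d(1) by blast
  qed
  obtain r where "0 < r" "inj_on (\<lambda>p. snd p *\<^sub>R K p) (ball ?a r)"
    by (rule has_derivative_locally_injective[of ?a UNIV g H', OF _ _ _ g(2) der cont_onorm])
      (use g(1) linear_conv_bounded_linear in auto)
  then show ?thesis using that by (simp add: K_def)
qed

text \<open>\<open>F\<close> is a square chart whose axes are the two branches. In a small disk
  every point of the curve has a parameter within \<open>\<delta>\<close> of a parameter of
  \<open>v\<close>, so it lies on one of the branches, and by injectivity of \<open>F\<close> on an
  axis.\<close>

lemma (in closed_curve) crossing_chart_from_branches:
  assumes F: "continuous_on ({-\<delta>..\<delta>} \<times> {-\<delta>..\<delta>}) F" "inj_on F ({-\<delta>..\<delta>} \<times> {-\<delta>..\<delta>})"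
      "F ` ({-\<delta>..\<delta>} \<times> {-\<delta>..\<delta>}) \<subseteq> S2" and \<delta>: "0 < \<delta>"
    and branch: "\<And>x. x \<in> {-\<delta>..\<delta>} \<Longrightarrow> F (x, 0) = \<gamma> (s0 + x)" "\<And>x. x \<in> {-\<delta>..\<delta>} \<Longrightarrow> F (0, x) = \<gamma> (t0 + x)"
    and v: "\<gamma> s0 = v" "\<gamma> t0 = v" and st: "s0 - t0 \<notin> \<int>"
  shows "\<exists>\<phi>. crossing_chart \<gamma> v \<phi>"
proof -
  let ?Q = "{-\<delta>..\<delta>} \<times> {-\<delta>..\<delta>}"
  obtain \<eta> where \<eta>: "0 < \<eta>" "\<And>t. dist (\<gamma> t) v < \<eta> \<Longrightarrow> \<exists>s. \<gamma> s = v \<and> \<bar>t - s\<bar> < \<delta>"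
    using near_preimage[OF \<delta>] by blast
  have F0: "F (0, 0) = v" using branch(1)[of 0] v \<delta> by simp
  have "(0, 0) \<in> ?Q" using \<delta> by simp
  then obtain d where d: "0 < d" "\<And>p. p \<in> ?Q \<Longrightarrow> dist p (0, 0) < d \<Longrightarrow> dist (F p) v < \<eta>"
    using F(1) \<eta>(1) F0 unfolding continuous_on_iff by metis
  \<comment> \<open>Points of the disk have coordinates at most \<open>c\<close> in absolute value,
    hence distance at most \<open>2 * c < d\<close> from the centre.\<close>
  define c where "c = min \<delta> (d / 3)"
  have c: "0 < c" "c \<le> \<delta>" "c \<le> d / 3" using d(1) \<delta> by (auto simp: c_def)
  define \<phi> where "\<phi> z = F (c * Re z, c * Im z)" for z
  have Q: "(c * Re z, c * Im z) \<in> ?Q" if z: "norm z \<le> 1" for z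
  proof -
    have "\<bar>c * x\<bar> \<le> \<delta>" if "\<bar>x\<bar> \<le> 1" for x
      using mult_mono[of c \<delta> "\<bar>x\<bar>" 1] that c by (simp add: abs_mult)
    from this[of "Re z"] this[of "Im z"] show ?thesis
      using abs_Re_le_cmod[of z] abs_Im_le_cmod[of z] z by auto
  qed
  have emb: "disk_embedding \<phi>"
    unfolding disk_embedding_def
  proof (intro conjI)
    have "continuous_on (cball 0 1) (\<lambda>z. (c * Re z, c * Im z))" by (intro continuous_intros)
    then show "continuous_on (cball 0 1) \<phi>" unfolding \<phi>_def
      by (rule continuous_on_compose2[OF F(1)]) (use Q in auto)
    show "inj_on \<phi> (cball 0 1)"
    proof (rule inj_onI)
      fix z w assume zw: "z \<in> cball 0 1" "w \<in> cball 0 1" "\<phi> z = \<phi> w"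
      have "(c * Re z, c * Im z) = (c * Re w, c * Im w)"
        by (rule inj_onD[OF F(2) zw(3)[unfolded \<phi>_def]]) (use zw Q in auto)
      then show "z = w" using c by (simp add: complex_eq_iff)
    qed
    show "\<phi> ` cball 0 1 \<subseteq> S2" using F(3) Q by (force simp: \<phi>_def)
  qed
  have axis: "\<phi> (of_real x) = \<gamma> (s0 + c * x)" "\<phi> (\<i> * of_real x) = \<gamma> (t0 + c * x)" if "x \<in> {-1..1}" for x
    using branch(1)[of "c * x"] branch(2)[of "c * x"] Q[of "of_real x"] that by (auto simp: \<phi>_def)
  have seg: "closed_segment (-1) 1 = complex_of_real ` {-1..1}"
    "closed_segment (-\<i>) \<i> = (\<lambda>x. \<i> * complex_of_real x) ` {-1..1}"
    by (rule real_axis_eq, rule imag_axis_eq)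
  have scale: "(\<lambda>x. s + c * x) ` {-1..1} = {s - c..s + c}" for s
    using image_affinity_atLeastAtMost[of c s "-1" 1] c by (simp add: add.commute)
  have img: "\<phi> ` closed_segment (-1) 1 = \<gamma> ` {s0 - c..s0 + c}" "\<phi> ` closed_segment (-\<i>) \<i> = \<gamma> ` {t0 - c..t0 + c}"
    unfolding seg image_image scale[symmetric] using axis by (auto intro!: image_cong)
  have near: "dist (\<phi> z) v < \<eta>" if z: "norm z \<le> 1" for z
  proof -
    have "dist (c * Re z, c * Im z) (0, 0) \<le> \<bar>c * Re z\<bar> + \<bar>c * Im z\<bar>"
      using norm_Pair_le[of "c * Re z" "c * Im z"] by (simp add: dist_norm)
    also have "\<dots> \<le> c * 1 + c * 1"
      using abs_Re_le_cmod[of z] abs_Im_le_cmod[of z] z c by (intro add_mono) (auto simp: abs_mult)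
    also have "\<dots> < d" using c d(1) by simp
    finally show ?thesis unfolding \<phi>_def using d(2)[OF Q[OF z]] by blast
  qed
  have cross: "range \<gamma> \<inter> \<phi> ` cball 0 1 = \<phi> ` cross"
  proof (intro equalityI subsetI)
    fix x assume "x \<in> range \<gamma> \<inter> \<phi> ` cball 0 1"
    then obtain t z where x: "x = \<phi> z" and z: "z \<in> cball 0 1" and e: "\<gamma> t = \<phi> z" by auto
    then have zn: "norm z \<le> 1" by simp
    obtain s where s: "\<gamma> s = v" "\<bar>t - s\<bar> < \<delta>" using \<eta>(2)[of t] near[OF zn] e by auto
    have "s - s0 \<in> \<int> \<or> s - t0 \<in> \<int>" using two_parameters[of s s0 t0] s v st by auto
    then have "Im z = 0 \<or> Re z = 0"
    proof
      assume "s - s0 \<in> \<int>"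
      then have "t - (s0 + (t - s)) \<in> \<int>" by (simp add: algebra_simps)
      then have "\<gamma> t = \<gamma> (s0 + (t - s))" by (rule periodic_Ints)
      moreover have "t - s \<in> {-\<delta>..\<delta>}" using s(2) by (simp, linarith)
      ultimately have "\<gamma> t = F (t - s, 0)" using branch(1) by simp
      then have "(t - s, 0) = (c * Re z, c * Im z)"
        using e s(2) \<delta> by (intro inj_onD[OF F(2) _ _ Q[OF zn]]) (auto simp: \<phi>_def)
      then show ?thesis using c by simp
    next
      assume "s - t0 \<in> \<int>"
      then have "t - (t0 + (t - s)) \<in> \<int>" by (simp add: algebra_simps)
      then have "\<gamma> t = \<gamma> (t0 + (t - s))" by (rule periodic_Ints)
      moreover have "t - s \<in> {-\<delta>..\<delta>}" using s(2) by (simp, linarith)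
      ultimately have "\<gamma> t = F (0, t - s)" using branch(2) by simp
      then have "(0, t - s) = (c * Re z, c * Im z)"
        using e s(2) \<delta> by (intro inj_onD[OF F(2) _ _ Q[OF zn]]) (auto simp: \<phi>_def)
      then show ?thesis using c by simp
    qed
    then show "x \<in> \<phi> ` cross" using zn x by (auto simp: cross_def)
  next
    fix x assume "x \<in> \<phi> ` cross"
    then obtain z where x: "x = \<phi> z" and z: "z \<in> cross" by auto
    then have 1: "\<phi> z \<in> \<phi> ` cball 0 1" using cross_subset by blast
    have "\<phi> z \<in> \<phi> ` closed_segment (-1) 1 \<or> \<phi> z \<in> \<phi> ` closed_segment (-\<i>) \<i>"
      using z unfolding cross_eq[symmetric] by auto
    then have "\<phi> z \<in> range \<gamma>" unfolding img by auto
    then show "x \<in> range \<gamma> \<inter> \<phi> ` cball 0 1" using 1 x by simp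
  qed
  have "runs_along \<gamma> (\<phi> ` closed_segment (-1) 1) (\<phi> (-1)) (\<phi> 1)"
    unfolding runs_along_def img using c axis(1)[of "-1"] axis(1)[of 1]
    by (intro exI[of _ "s0 - c"] exI[of _ "s0 + c"]) auto
  moreover have "runs_along \<gamma> (\<phi> ` closed_segment (-\<i>) \<i>) (\<phi> (-\<i>)) (\<phi> \<i>)"
    unfolding runs_along_def img using c axis(2)[of "-1"] axis(2)[of 1]
    by (intro exI[of _ "t0 - c"] exI[of _ "t0 + c"]) auto
  ultimately have "crossing_chart \<gamma> v \<phi>"
    using emb cross F0 unfolding crossing_chart_def cross_eq by (simp add: \<phi>_def)
  then show ?thesis by blast
qed

text \<open>The chart is the radial projection \<open>sgn (K p)\<close> of the sum of the branches.
  On an axis one of the branches contributes the constant \<open>v\<close>, which cancels, so the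
  axes are the branches themselves.\<close>

lemma knot_curve_generic_immersion:
  assumes "generic_immersion \<gamma>"
  shows "knot_curve \<gamma>"
proof -
  interpret closed_curve \<gamma> by (rule generic_immersion_closed_curve[OF assms])
  obtain D where D: "\<And>t. (\<gamma> has_vector_derivative D t) (at t)" "continuous_on UNIV D"
    "\<And>s t. s \<in> {0..<1} \<Longrightarrow> t \<in> {0..<1} \<Longrightarrow> s \<noteq> t \<Longrightarrow> \<gamma> s = \<gamma> t \<Longrightarrow> \<not> collinear {0, D s, D t}"
    using generic_immersion_D[OF assms] by blast
  show ?thesis
  proof
    fix v assume "v \<in> double_points \<gamma>"
    then obtain s0 t0 where st: "s0 \<in> {0..<1}" "t0 \<in> {0..<1}" "s0 \<noteq> t0" "\<gamma> s0 = v" "\<gamma> t0 = v"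
      by (auto simp: double_points_def)
    then have nI: "s0 - t0 \<notin> \<int>" using unit_interval_Ints by blast
    have vn: "norm v = 1" using sphere st(4) by (auto simp: image_subset_iff)
    obtain r where r: "0 < r"
      "inj_on (\<lambda>p::(real \<times> real) \<times> real. snd p *\<^sub>R (\<gamma> (s0 + fst (fst p)) + \<gamma> (t0 + snd (fst p)) - v)) (ball ((0, 0), 1) r)"
      using sum_of_branches_injective[OF sphere D(1,2) st(4,5)] D(3)[of s0 t0] st by auto
    define K where "K p = \<gamma> (s0 + fst p) + \<gamma> (t0 + snd p) - v" for p :: "real \<times> real"
    have cK: "continuous_on UNIV K"
    proof -
      have "continuous_on UNIV (\<lambda>p::real \<times> real. s0 + fst p)" "continuous_on UNIV (\<lambda>p::real \<times> real. t0 + snd p)"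
        by (intro continuous_intros)+
      then have "continuous_on UNIV (\<lambda>p::real \<times> real. \<gamma> (s0 + fst p))" "continuous_on UNIV (\<lambda>p::real \<times> real. \<gamma> (t0 + snd p))"
        using continuous_on_compose2[OF cont] by auto
      then show ?thesis unfolding K_def by (intro continuous_intros)
    qed
    have "continuous_on UNIV (\<lambda>p. norm (K p))" by (rule continuous_on_norm[OF cK])
    moreover have "norm (K (0, 0)) = 1" by (simp add: K_def st vn)
    moreover have e0: "0 < min (1/2) (r/8)" using r by simp
    ultimately obtain d where d: "0 < d" "\<And>p. dist p (0, 0) < d \<Longrightarrow> dist (norm (K p)) 1 < min (1/2) (r/8)"
      unfolding continuous_on_iff by (metis UNIV_I)
    \<comment> \<open>The margins add up: on the square \<open>\<mu>\<close> will differ from 1 by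
      less than \<open>r / 2\<close>, and a point from the centre by at most
      \<open>2 * \<delta> \<le> r / 4\<close>, which stays within the radius
      \<open>r\<close>.\<close>
    define \<delta> where "\<delta> = min (d / 3) (r / 8)"
    have \<delta>: "0 < \<delta>" "\<delta> \<le> d / 3" "\<delta> \<le> r / 8" using d(1) r(1) by (auto simp: \<delta>_def)
    let ?Q = "{-\<delta>..\<delta>} \<times> {-\<delta>..\<delta>}"
    have Kn: "1/2 < norm (K p)" "\<bar>norm (K p) - 1\<bar> < r / 8" if p: "p \<in> ?Q" for p
    proof -
      have "dist p (0, 0) \<le> \<bar>fst p\<bar> + \<bar>snd p\<bar>" using norm_Pair_le[of "fst p" "snd p"] by (simp add: dist_norm zero_prod_def[symmetric])
      also have "\<dots> \<le> \<delta> + \<delta>" using p by (intro add_mono) (auto simp: abs_le_iff)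
      also have "\<dots> < d" using \<delta> d(1) by simp
      finally have "\<bar>norm (K p) - 1\<bar> < min (1/2) (r/8)" using d(2)[of p] by (simp add: dist_real_def)
      then have "\<bar>norm (K p) - 1\<bar> < 1/2" "\<bar>norm (K p) - 1\<bar> < r / 8" by auto
      then show "1/2 < norm (K p)" "\<bar>norm (K p) - 1\<bar> < r / 8" by linarith+
    qed
    have inj: "inj_on (\<lambda>p. sgn (K p)) ?Q"
    proof (rule inj_onI)
      fix p q assume pq: "p \<in> ?Q" "q \<in> ?Q" "sgn (K p) = sgn (K q)"
      \<comment> \<open>Two points with the same projection satisfy
        \<open>K p = \<mu> *\<^sub>R K q\<close>; the factor plays the part of the third coordinate
        of the map that is injective near \<open>((0, 0), 1)\<close>.\<close>
      define \<mu> where "\<mu> = norm (K p) / norm (K q)"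
      have "norm (K p) \<noteq> 0" using Kn(1)[OF pq(1)] by auto
      then have "K p = norm (K p) *\<^sub>R sgn (K p)" by (simp add: sgn_div_norm)
      then have "K p = norm (K p) *\<^sub>R sgn (K q)" using pq(3) by simp
      then have eq: "K p = \<mu> *\<^sub>R K q" by (simp add: sgn_div_norm \<mu>_def divide_inverse)
      have "\<bar>\<mu> - 1\<bar> = \<bar>norm (K p) - norm (K q)\<bar> / norm (K q)"
      proof -
        have "0 < norm (K q)" using Kn(1)[OF pq(2)] by linarith
        then show ?thesis by (simp add: \<mu>_def field_simps)
      qed
      also have "\<dots> \<le> \<bar>norm (K p) - norm (K q)\<bar> / (1/2)"
        using Kn(1)[OF pq(2)] by (intro divide_left_mono) auto
      also have "\<dots> < r / 2" using Kn(2)[OF pq(1)] Kn(2)[OF pq(2)] by (simp add: abs_if split: if_splits)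
      finally have \<mu>: "\<bar>\<mu> - 1\<bar> < r / 2" .
      have ball: "(x, c) \<in> ball ((0, 0), 1) r" if "x \<in> ?Q" "\<bar>c - 1\<bar> < r / 2" for x c
      proof -
        have "dist (x, c) ((0, 0), 1) \<le> dist x (0, 0) + \<bar>c - 1\<bar>"
          using norm_Pair_le[of "x" "c - 1"] by (simp add: dist_norm zero_prod_def[symmetric])
        also have "dist x (0, 0) \<le> \<bar>fst x\<bar> + \<bar>snd x\<bar>"
          using norm_Pair_le[of "fst x" "snd x"] by (simp add: dist_norm zero_prod_def[symmetric])
        also have "\<bar>fst x\<bar> + \<bar>snd x\<bar> \<le> \<delta> + \<delta>" using that(1) by (intro add_mono) (auto simp: abs_le_iff)
        finally show ?thesis using \<delta> that(2) r(1) by (simp add: dist_commute)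
      qed
      have "(p, 1) = (q, \<mu>)"
        by (rule inj_onD[OF r(2)]) (use eq ball[OF pq(1), of 1] ball[OF pq(2) \<mu>] r(1) in \<open>auto simp: K_def\<close>)
      then show "p = q" by simp
    qed
    have sg: "sgn (\<gamma> t) = \<gamma> t" for t
    proof -
      have "norm (\<gamma> t) = 1" using sphere by (auto simp: image_subset_iff)
      then show ?thesis by (simp add: sgn_div_norm)
    qed
    show "\<exists>\<phi>. crossing_chart \<gamma> v \<phi>"
    proof (rule crossing_chart_from_branches[OF _ inj _ \<delta>(1) _ _ st(4,5) nI])
      have "K p \<noteq> 0" if "p \<in> ?Q" for p using Kn(1)[OF that] by auto
      then show "continuous_on ?Q (\<lambda>p. sgn (K p))"
        by (intro continuous_on_sgn continuous_on_subset[OF cK]) auto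
      show "(\<lambda>p. sgn (K p)) ` ?Q \<subseteq> S2"
        using \<open>\<And>p. p \<in> ?Q \<Longrightarrow> K p \<noteq> 0\<close> by (force simp: norm_sgn)
    qed (simp_all add: K_def st sg)
  qed
qed

subsection \<open>Curves under homeomorphisms and disk modifications\<close>

lemma crossing_chart_homeomorphism:
  assumes h: "homeomorphism S2 S2 \<Gamma> K" and S: "range \<gamma> \<subseteq> S2" and c: "crossing_chart \<gamma> v \<phi>"
  shows "crossing_chart (\<Gamma> \<circ> \<gamma>) (\<Gamma> v) (\<Gamma> \<circ> \<phi>)"
proof -
  have \<phi>: "continuous_on (cball 0 1) \<phi>" "inj_on \<phi> (cball 0 1)" "\<phi> ` cball 0 1 \<subseteq> S2"
    using c by (auto simp: crossing_chart_def disk_embedding_def)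
  have inj: "inj_on \<Gamma> S2" using h by (metis homeomorphism_apply1 inj_on_inverseI)
  have "disk_embedding (\<Gamma> \<circ> \<phi>)"
    unfolding disk_embedding_def
  proof (intro conjI)
    show "continuous_on (cball 0 1) (\<Gamma> \<circ> \<phi>)"
      by (rule continuous_on_compose[OF \<phi>(1) continuous_on_subset[OF homeomorphism_cont1[OF h] \<phi>(3)]])
    show "inj_on (\<Gamma> \<circ> \<phi>) (cball 0 1)" by (rule comp_inj_on[OF \<phi>(2) inj_on_subset[OF inj \<phi>(3)]])
    show "(\<Gamma> \<circ> \<phi>) ` cball 0 1 \<subseteq> S2"
      using image_mono[OF \<phi>(3), of \<Gamma>] homeomorphism_image1[OF h] by (simp add: image_comp)
  qed
  moreover have "range (\<Gamma> \<circ> \<gamma>) \<inter> (\<Gamma> \<circ> \<phi>) ` cball 0 1 = (\<Gamma> \<circ> \<phi>) ` (closed_segment (-1) 1 \<union> closed_segment (-\<i>) \<i>)"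
  proof -
    have "range (\<Gamma> \<circ> \<gamma>) \<inter> (\<Gamma> \<circ> \<phi>) ` cball 0 1 = \<Gamma> ` (range \<gamma> \<inter> \<phi> ` cball 0 1)"
      unfolding image_comp[symmetric] by (rule inj_on_image_Int[OF inj S \<phi>(3), symmetric])
    also have "range \<gamma> \<inter> \<phi> ` cball 0 1 = \<phi> ` (closed_segment (-1) 1 \<union> closed_segment (-\<i>) \<i>)"
      using c by (simp add: crossing_chart_def)
    finally show ?thesis by (simp add: image_comp)
  qed
  moreover have "runs_along (\<Gamma> \<circ> \<gamma>) ((\<Gamma> \<circ> \<phi>) ` A) ((\<Gamma> \<circ> \<phi>) p) ((\<Gamma> \<circ> \<phi>) q)"
    if r: "runs_along \<gamma> (\<phi> ` A) (\<phi> p) (\<phi> q)" for A p q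
  proof -
    obtain a b where ab: "a < b" "\<gamma> a = \<phi> p" "\<gamma> b = \<phi> q" "\<gamma> ` {a..b} = \<phi> ` A" using r by (auto simp: runs_along_def)
    then have "(\<Gamma> \<circ> \<gamma>) ` {a..b} = (\<Gamma> \<circ> \<phi>) ` A" by (metis image_comp)
    then show ?thesis unfolding runs_along_def using ab by (intro exI[of _ a] exI[of _ b]) simp
  qed
  ultimately show ?thesis using c unfolding crossing_chart_def by simp
qed

lemma double_points_subset: "double_points \<gamma> \<subseteq> range \<gamma>"
  by (auto simp: double_points_def)

lemma double_points_memI:
  "s \<in> {0..<1} \<Longrightarrow> t \<in> {0..<1} \<Longrightarrow> s \<noteq> t \<Longrightarrow> \<gamma> s = v \<Longrightarrow> \<gamma> t = v \<Longrightarrow> v \<in> double_points \<gamma>"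
  unfolding double_points_def by (intro CollectI bexI[of _ s] bexI[of _ t]) simp_all

lemma double_points_homeomorphism:
  assumes inj: "inj_on \<Gamma> S2" and S: "range \<gamma> \<subseteq> S2"
  shows "double_points (\<Gamma> \<circ> \<gamma>) = \<Gamma> ` double_points \<gamma>"
proof -
  have "\<Gamma> (\<gamma> s) = \<Gamma> (\<gamma> t) \<longleftrightarrow> \<gamma> s = \<gamma> t" for s t
    using inj_on_eq_iff[OF inj] S by blast
  note eq = this
  show ?thesis
  proof (intro equalityI subsetI)
    fix v assume "v \<in> double_points (\<Gamma> \<circ> \<gamma>)"
    then obtain s t where st: "s \<in> {0..<1}" "t \<in> {0..<1}" "s \<noteq> t" "\<Gamma> (\<gamma> s) = v" "\<Gamma> (\<gamma> t) = v"
      by (auto simp: double_points_def)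
    have "\<gamma> s \<in> double_points \<gamma>"
      by (rule double_points_memI[OF st(1-3)]) (use st(4,5) eq in auto)
    then show "v \<in> \<Gamma> ` double_points \<gamma>" using st(4) by blast
  next
    fix v assume "v \<in> \<Gamma> ` double_points \<gamma>"
    then obtain s t where st: "s \<in> {0..<1}" "t \<in> {0..<1}" "s \<noteq> t" "v = \<Gamma> (\<gamma> s)" "\<gamma> t = \<gamma> s"
      by (auto simp: double_points_def)
    show "v \<in> double_points (\<Gamma> \<circ> \<gamma>)"
      by (rule double_points_memI[OF st(1-3)]) (use st(4,5) in auto)
  qed
qed

lemma knot_curve_homeomorphism:
  assumes "knot_curve \<gamma>" and h: "homeomorphism S2 S2 \<Gamma> K"
  shows "knot_curve (\<Gamma> \<circ> \<gamma>)"
proof -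
  interpret knot_curve \<gamma> by fact
  have inj: "inj_on \<Gamma> S2" using h by (metis homeomorphism_apply1 inj_on_inverseI)
  have eq: "\<Gamma> (\<gamma> s) = \<Gamma> (\<gamma> t) \<longleftrightarrow> \<gamma> s = \<gamma> t" for s t
    using inj_on_eq_iff[OF inj] sphere by blast
  note dp = double_points_homeomorphism[OF inj sphere]
  show ?thesis
  proof
    show "continuous_on UNIV (\<Gamma> \<circ> \<gamma>)"
      by (rule continuous_on_compose[OF cont continuous_on_subset[OF homeomorphism_cont1[OF h] sphere]])
    show "range (\<Gamma> \<circ> \<gamma>) \<subseteq> S2"
      using image_mono[OF sphere, of \<Gamma>] homeomorphism_image1[OF h] by (simp add: image_comp)
    show "(\<Gamma> \<circ> \<gamma>) (t + 1) = (\<Gamma> \<circ> \<gamma>) t" for t using periodic by simp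
    show "finite (double_points (\<Gamma> \<circ> \<gamma>))" using finite_double dp by simp
    show "r = s \<or> s = t \<or> r = t" if "r \<in> {0..<1}" "s \<in> {0..<1}" "t \<in> {0..<1}"
      "(\<Gamma> \<circ> \<gamma>) r = (\<Gamma> \<circ> \<gamma>) s" "(\<Gamma> \<circ> \<gamma>) s = (\<Gamma> \<circ> \<gamma>) t" for r s t
      using no_triple[of r s t] that eq by simp
    show "\<exists>\<phi>. crossing_chart (\<Gamma> \<circ> \<gamma>) v \<phi>" if "v \<in> double_points (\<Gamma> \<circ> \<gamma>)" for v
    proof -
      obtain u where u: "u \<in> double_points \<gamma>" "v = \<Gamma> u" using \<open>v \<in> double_points (\<Gamma> \<circ> \<gamma>)\<close> dp by blast
      then show ?thesis using chart_ex[OF u(1)] crossing_chart_homeomorphism[OF h sphere] by blast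
    qed
  qed
qed

lemma curve_arrangement_homeomorphism:
  assumes "curve_arrangement P C" and h: "homeomorphism S2 S2 \<Gamma> K"
  shows "curve_arrangement (\<Gamma> ` P) (\<Gamma> ` C)"
proof -
  obtain \<gamma> \<phi> where g: "knot_curve \<gamma>" and P: "P = range \<gamma>" and ch: "charts \<gamma> \<phi>"
    and C: "C = resolve_on P (double_points \<gamma>) \<phi>"
    using assms(1) unfolding curve_arrangement_def by blast
  interpret knot_curve \<gamma> by fact
  have inj: "inj_on \<Gamma> S2" using h by (metis homeomorphism_apply1 inj_on_inverseI)
  note dp = double_points_homeomorphism[OF inj sphere]
  have dpS: "v \<in> S2" if "v \<in> double_points \<gamma>" for v using that sphere double_points_subset by blast
  have K\<Gamma>: "K (\<Gamma> v) = v" if "v \<in> double_points \<gamma>" for v by (rule homeomorphism_apply1[OF h dpS[OF that]])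
  have disk: "\<phi> v ` cball 0 1 \<subseteq> S2" if "v \<in> double_points \<gamma>" for v
    using ch that by (auto simp: charts_def crossing_chart_def disk_embedding_def)
  have ch': "charts (\<Gamma> \<circ> \<gamma>) (\<lambda>w. \<Gamma> \<circ> \<phi> (K w))"
    unfolding charts_def dp
  proof (intro conjI ballI impI)
    fix w assume "w \<in> \<Gamma> ` double_points \<gamma>"
    then show "crossing_chart (\<Gamma> \<circ> \<gamma>) w (\<Gamma> \<circ> \<phi> (K w))"
      using ch crossing_chart_homeomorphism[OF h sphere] K\<Gamma> by (auto simp: charts_def)
  next
    fix w w' assume w: "w \<in> \<Gamma> ` double_points \<gamma>" "w' \<in> \<Gamma> ` double_points \<gamma>" "w \<noteq> w'"
    then obtain v v' where v: "w = \<Gamma> v" "w' = \<Gamma> v'" "v \<in> double_points \<gamma>" "v' \<in> double_points \<gamma>" "v \<noteq> v'" by auto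
    have "\<Gamma> ` (\<phi> v ` cball 0 1) \<inter> \<Gamma> ` (\<phi> v' ` cball 0 1) = \<Gamma> ` (\<phi> v ` cball 0 1 \<inter> \<phi> v' ` cball 0 1)"
      by (rule inj_on_image_Int[OF inj disk[OF v(3)] disk[OF v(4)], symmetric])
    also have "\<phi> v ` cball 0 1 \<inter> \<phi> v' ` cball 0 1 = {}" using ch v by (simp add: charts_def)
    finally show "(\<Gamma> \<circ> \<phi> (K w)) ` cball 0 1 \<inter> (\<Gamma> \<circ> \<phi> (K w')) ` cball 0 1 = {}"
      using v K\<Gamma> by (simp add: image_comp)
  qed
  have PS: "P \<subseteq> S2" using P sphere by simp
  have "resolve_on (\<Gamma> ` P) (double_points (\<Gamma> \<circ> \<gamma>)) (\<lambda>w. \<Gamma> \<circ> \<phi> (K w)) = \<Gamma> ` C"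
  proof -
    have 1: "(\<Union>w\<in>\<Gamma> ` double_points \<gamma>. (\<Gamma> \<circ> \<phi> (K w)) ` A) = \<Gamma> ` (\<Union>v\<in>double_points \<gamma>. \<phi> v ` A)" for A
      using K\<Gamma> by (simp add: image_UN image_comp)
    have "(\<Union>v\<in>double_points \<gamma>. \<phi> v ` cball 0 1) \<subseteq> S2" using disk by blast
    then have "\<Gamma> ` (P - (\<Union>v\<in>double_points \<gamma>. \<phi> v ` cball 0 1)) = \<Gamma> ` P - \<Gamma> ` (\<Union>v\<in>double_points \<gamma>. \<phi> v ` cball 0 1)"
      using PS by (intro inj_on_image_set_diff[OF inj]) auto
    then show ?thesis unfolding C resolve_on_def dp 1 image_Un by simp
  qed
  moreover have "\<Gamma> ` P = range (\<Gamma> \<circ> \<gamma>)" by (simp add: P image_comp)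
  ultimately show ?thesis
    unfolding curve_arrangement_def using knot_curve_homeomorphism[OF g h] ch' by metis
qed

text \<open>The strands \<open>X\<close> in the disk are changed in two ways: by
  \<open>\<tau>\<close>, which may create crossings at the points of \<open>E\<close>, and by the
  homeomorphism \<open>G\<close>, which will lead to the resolved picture. Where they differ, both
  values lie in the disk of radius \<open>r < 1\<close>, so outside it the two new curves
  coincide.\<close>

locale disk_modification = knot_curve +
  fixes \<phi> :: "complex \<Rightarrow> real^3" and X :: "complex set" and G \<tau> :: "complex \<Rightarrow> complex"
    and r :: real and E :: "complex set"
  assumes \<phi>: "disk_embedding \<phi>" and X: "X \<subseteq> cball 0 1" and inside: "range \<gamma> \<inter> \<phi> ` cball 0 1 = \<phi> ` X"
    and no_double: "double_points \<gamma> \<inter> \<phi> ` ball 0 1 = {}"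
    and G: "disk_homeo G"
    and \<tau>: "continuous_on X \<tau>" "\<And>z. z \<in> X \<Longrightarrow> norm z = 1 \<Longrightarrow> \<tau> z = z" "\<And>z. z \<in> X \<Longrightarrow> norm z < 1 \<Longrightarrow> norm (\<tau> z) < 1"
    and r: "r < 1" "\<And>z. z \<in> X \<Longrightarrow> \<tau> z \<noteq> G z \<Longrightarrow> norm (\<tau> z) \<le> r \<and> norm (G z) \<le> r"
    and E: "finite E" "E \<subseteq> cball 0 r" "\<And>w. w \<in> E \<longleftrightarrow> (\<exists>z\<in>X. \<exists>z'\<in>X. z \<noteq> z' \<and> \<tau> z = w \<and> \<tau> z' = w)"
    and two: "\<And>x y z. x \<in> X \<Longrightarrow> y \<in> X \<Longrightarrow> z \<in> X \<Longrightarrow> \<tau> x = \<tau> y \<Longrightarrow> \<tau> y = \<tau> z \<Longrightarrow> x = y \<or> y = z \<or> x = z"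
begin

definition \<psi> :: "real^3 \<Rightarrow> complex" where "\<psi> = the_inv_into (cball 0 1) \<phi>"

definition modified :: "real \<Rightarrow> real^3" where
  "modified t = (if \<gamma> t \<in> \<phi> ` cball 0 1 then \<phi> (\<tau> (\<psi> (\<gamma> t))) else \<gamma> t)"

lemma emb: "continuous_on (cball 0 1) \<phi>" "inj_on \<phi> (cball 0 1)" "\<phi> ` cball 0 1 \<subseteq> S2"
  using \<phi> by (auto simp: disk_embedding_def)

lemma \<psi>: "norm z \<le> 1 \<Longrightarrow> \<psi> (\<phi> z) = z"
  unfolding \<psi>_def by (rule the_inv_into_f_f[OF emb(2)]) simp

lemma Xn: "z \<in> X \<Longrightarrow> norm z \<le> 1" using X by auto

lemma \<tau>n: "z \<in> X \<Longrightarrow> norm (\<tau> z) \<le> 1" using \<tau>(2,3)[of z] Xn[of z] by (cases "norm z = 1") auto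

lemma modified_in: "z \<in> X \<Longrightarrow> \<gamma> t = \<phi> z \<Longrightarrow> modified t = \<phi> (\<tau> z)"
  using Xn[of z] \<psi>[of z] by (simp add: modified_def)

lemma modified_out: "\<gamma> t \<notin> \<phi> ` cball 0 1 \<Longrightarrow> modified t = \<gamma> t"
  by (simp add: modified_def)

lemma in_or_out: "(\<exists>z\<in>X. \<gamma> t = \<phi> z) \<or> \<gamma> t \<notin> \<phi> ` cball 0 1"
  using inside by blast

lemma phi_eq: "norm z \<le> 1 \<Longrightarrow> norm w \<le> 1 \<Longrightarrow> \<phi> z = \<phi> w \<longleftrightarrow> z = w"
  using inj_onD[OF emb(2)] by auto

lemma continuous_modified: "continuous_on UNIV modified"
proof -
  obtain W where W: "open W" "\<phi> ` ball 0 1 = S2 \<inter> W"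
    using disk_embedding_openin[OF \<phi>] by (auto simp: openin_open)
  let ?A = "\<gamma> -` (\<phi> ` cball 0 1)" and ?B = "\<gamma> -` (- W)"
  have A: "closed ?A" using disk_embedding_compact[OF \<phi>] cont
    by (intro closed_vimage compact_imp_closed) auto
  have B: "closed ?B" using W(1) cont by (intro closed_vimage) auto
  have \<psi>X: "\<psi> (\<gamma> t) \<in> X" "\<phi> (\<psi> (\<gamma> t)) = \<gamma> t" if t: "\<gamma> t \<in> \<phi> ` cball 0 1" for t
  proof -
    obtain z where "z \<in> X" "\<gamma> t = \<phi> z" using in_or_out t by blast
    then show "\<psi> (\<gamma> t) \<in> X" "\<phi> (\<psi> (\<gamma> t)) = \<gamma> t" using \<psi> Xn by simp_all
  qed
  obtain g where g: "homeomorphism (cball 0 1) (\<phi> ` cball 0 1) \<phi> g"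
    using homeomorphism_compact[OF compact_cball emb(1) refl emb(2)] by blast
  have "continuous_on (\<phi> ` cball 0 1) \<psi>"
    using homeomorphism_cont2[OF g] by (rule continuous_on_eq) (use homeomorphism_apply1[OF g] \<psi> in auto)
  then have "continuous_on ?A (\<lambda>t. \<psi> (\<gamma> t))"
    by (rule continuous_on_compose2[OF _ continuous_on_subset[OF cont]]) auto
  then have "continuous_on ?A (\<lambda>t. \<tau> (\<psi> (\<gamma> t)))"
    by (rule continuous_on_compose2[OF \<tau>(1)]) (use \<psi>X(1) in blast)
  then have cA: "continuous_on ?A (\<lambda>t. \<phi> (\<tau> (\<psi> (\<gamma> t))))"
    by (rule continuous_on_compose2[OF emb(1)], intro image_subsetI) (simp add: \<tau>n \<psi>X(1))
  \<comment> \<open>The two closed pieces overlap only over the boundary circle, where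
    \<open>\<tau>\<close> is the identity.\<close>
  have "continuous_on (?A \<union> ?B) (\<lambda>t. if \<gamma> t \<in> \<phi> ` cball 0 1 then \<phi> (\<tau> (\<psi> (\<gamma> t))) else \<gamma> t)"
  proof (rule continuous_on_cases[OF A B cA continuous_on_subset[OF cont]], simp, intro allI impI)
    fix t assume "t \<in> ?A \<and> \<gamma> t \<notin> \<phi> ` cball 0 1 \<or> t \<in> ?B \<and> \<gamma> t \<in> \<phi> ` cball 0 1"
    then have t: "\<gamma> t \<notin> W" "\<gamma> t \<in> \<phi> ` cball 0 1" by auto
    then obtain z where z: "z \<in> X" "\<gamma> t = \<phi> z" using in_or_out by blast
    have "\<gamma> t \<notin> \<phi> ` ball 0 1" using t(1) W by auto
    then have "\<not> norm z < 1" using z(2) by auto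
    then have "\<tau> z = z" using \<tau>(2)[OF z(1)] Xn[OF z(1)] by simp
    then show "\<phi> (\<tau> (\<psi> (\<gamma> t))) = \<gamma> t" using z \<psi>[OF Xn[OF z(1)]] by simp
  qed
  moreover have "?A \<union> ?B = UNIV"
  proof -
    have "\<gamma> t \<in> \<phi> ` cball 0 1" if "\<gamma> t \<in> W" for t
    proof -
      have "\<gamma> t \<in> S2" using sphere by blast
      then have "\<gamma> t \<in> \<phi> ` ball 0 1" using W that by blast
      then show ?thesis by auto
    qed
    then show ?thesis by auto
  qed
  ultimately show ?thesis by (simp add: modified_def[abs_def])
qed

definition \<Gamma> :: "real^3 \<Rightarrow> real^3" where
  "\<Gamma> = (SOME \<Gamma>. isotopic_to_id \<Gamma> \<and> (\<forall>z\<in>cball 0 1. \<Gamma> (\<phi> z) = \<phi> (G z)) \<and> (\<forall>x. x \<notin> \<phi> ` cball 0 1 \<longrightarrow> \<Gamma> x = x))"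

lemma \<Gamma>: "isotopic_to_id \<Gamma>" "norm z \<le> 1 \<Longrightarrow> \<Gamma> (\<phi> z) = \<phi> (G z)" "x \<notin> \<phi> ` cball 0 1 \<Longrightarrow> \<Gamma> x = x"
proof -
  have "\<exists>\<Gamma>. isotopic_to_id \<Gamma> \<and> (\<forall>z\<in>cball 0 1. \<Gamma> (\<phi> z) = \<phi> (G z)) \<and> (\<forall>x. x \<notin> \<phi> ` cball 0 1 \<longrightarrow> \<Gamma> x = x)"
    using isotopy_extension[OF \<phi> G] by metis
  from someI_ex[OF this, folded \<Gamma>_def]
  show "isotopic_to_id \<Gamma>" "norm z \<le> 1 \<Longrightarrow> \<Gamma> (\<phi> z) = \<phi> (G z)" "x \<notin> \<phi> ` cball 0 1 \<Longrightarrow> \<Gamma> x = x" by auto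
qed

lemma knot_moved: "knot_curve (\<Gamma> \<circ> \<gamma>)"
  using isotopic_to_id_homeomorphism[OF \<Gamma>(1)] knot_curve_homeomorphism knot_curve_axioms by metis

text \<open>Wherever the two curves have different values at a parameter, both values lie in the
  small disk.\<close>

lemma same_off_small_disk:
  assumes "x \<notin> \<phi> ` cball 0 r"
  shows "modified t = x \<longleftrightarrow> (\<Gamma> \<circ> \<gamma>) t = x"
proof (cases "\<gamma> t \<in> \<phi> ` cball 0 1")
  case True
  then obtain z where z: "z \<in> X" "\<gamma> t = \<phi> z" using in_or_out by blast
  then have v: "modified t = \<phi> (\<tau> z)" "(\<Gamma> \<circ> \<gamma>) t = \<phi> (G z)" using modified_in \<Gamma>(2) Xn by auto
  show ?thesis
  proof (cases "\<tau> z = G z")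
    case False
    then have "norm (\<tau> z) \<le> r" "norm (G z) \<le> r" using r(2) z by auto
    then show ?thesis using v assms by auto
  qed (use v in simp)
qed (simp add: modified_out \<Gamma>(3))

text \<open>\<open>\<Gamma>\<close> maps the open disk onto itself, and \<open>\<gamma>\<close> has
  no double point there.\<close>

lemma moved_not_double:
  assumes "norm w \<le> r"
  shows "\<phi> w \<notin> double_points (\<Gamma> \<circ> \<gamma>)"
proof
  assume w: "\<phi> w \<in> double_points (\<Gamma> \<circ> \<gamma>)"
  obtain K where K: "homeomorphism S2 S2 \<Gamma> K" using isotopic_to_id_homeomorphism[OF \<Gamma>(1)] by blast
  have inj: "inj_on \<Gamma> S2" using K by (metis homeomorphism_apply1 inj_on_inverseI)
  obtain x where x: "x \<in> double_points \<gamma>" "\<phi> w = \<Gamma> x"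
    using w double_points_homeomorphism[OF inj sphere] by auto
  have wn: "norm w < 1" using assms r(1) by simp
  then obtain z where z: "norm z \<le> 1" "G z = w"
    using G unfolding disk_homeo_def bij_betw_def by (metis imageE less_imp_le mem_cball_0)
  have "norm z \<noteq> 1" using G z wn by (auto simp: disk_homeo_def)
  then have zb: "norm z < 1" using z by simp
  have "x \<in> S2" using x(1) sphere double_points_subset by blast
  moreover have "\<phi> z \<in> S2" using emb(3) z(1) by (auto simp: image_subset_iff)
  moreover have "\<Gamma> (\<phi> z) = \<Gamma> x" using x(2) z \<Gamma>(2) by simp
  ultimately have "\<phi> z = x" using inj by (auto dest: inj_onD)
  then show False using no_double x(1) zb by auto
qed

text \<open>Values outside the small disk are taken by both curves at the same parameters. Inside it
  the moved curve has no double points, and \<open>\<gamma>\<close> takes no value of the open disk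
  twice in a period, so the coincidences are exactly those of \<open>\<tau>\<close>.\<close>

lemma double_modified: "double_points modified = double_points (\<Gamma> \<circ> \<gamma>) \<union> \<phi> ` E"
proof (intro equalityI subsetI)
  fix v assume v: "v \<in> double_points modified"
  then obtain s t where st: "s \<in> {0..<1}" "t \<in> {0..<1}" "s \<noteq> t" "modified s = v" "modified t = v"
    by (auto simp: double_points_def)
  show "v \<in> double_points (\<Gamma> \<circ> \<gamma>) \<union> \<phi> ` E"
  proof (cases "v \<in> \<phi> ` cball 0 r")
    case False
    then have "(\<Gamma> \<circ> \<gamma>) s = v" "(\<Gamma> \<circ> \<gamma>) t = v" using st same_off_small_disk by blast+
    then have "v \<in> double_points (\<Gamma> \<circ> \<gamma>)"
      by (intro double_points_memI[OF st(1-3)])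
    then show ?thesis ..
  next
    case True
    then obtain w where w: "v = \<phi> w" "norm w \<le> r" by auto
    have "\<exists>z\<in>X. \<gamma> p = \<phi> z \<and> \<tau> z = w" if "modified p = v" for p
    proof -
      have "\<gamma> p \<in> \<phi> ` cball 0 1"
      proof (rule ccontr)
        assume "\<gamma> p \<notin> \<phi> ` cball 0 1"
        then have "\<phi> w \<notin> \<phi> ` cball 0 1" using modified_out that w by metis
        then show False using w r by auto
      qed
      then obtain z where z: "z \<in> X" "\<gamma> p = \<phi> z" using in_or_out by blast
      then have "\<phi> (\<tau> z) = \<phi> w" using modified_in that w by simp
      then have "\<tau> z = w" using phi_eq[OF \<tau>n[OF z(1)]] w r by simp
      then show ?thesis using z by blast
    qed
    then obtain z z' where z: "z \<in> X" "\<gamma> s = \<phi> z" "\<tau> z = w" "z' \<in> X" "\<gamma> t = \<phi> z'" "\<tau> z' = w"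
      using st by metis
    have "z \<noteq> z'"
    proof
      assume "z = z'"
      then have "\<phi> z \<in> double_points \<gamma>" using z by (intro double_points_memI[OF st(1-3)]) simp_all
      then have "norm z = 1" using no_double Xn[OF z(1)] by (cases "norm z < 1") auto
      then show False using \<tau>(2)[OF z(1)] z(3) w(2) r(1) by auto
    qed
    then have "w \<in> E" using E(3) z by blast
    then show ?thesis using w by blast
  qed
next
  fix v assume "v \<in> double_points (\<Gamma> \<circ> \<gamma>) \<union> \<phi> ` E"
  then show "v \<in> double_points modified"
  proof
    assume v: "v \<in> double_points (\<Gamma> \<circ> \<gamma>)"
    then have "v \<notin> \<phi> ` cball 0 r" using moved_not_double by auto
    then show ?thesis using v same_off_small_disk unfolding double_points_def by blast
  next
    assume "v \<in> \<phi> ` E"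
    then obtain w where w: "v = \<phi> w" "w \<in> E" by blast
    then obtain z z' where z: "z \<in> X" "z' \<in> X" "z \<noteq> z'" "\<tau> z = w" "\<tau> z' = w" using E(3) by blast
    have "\<exists>s\<in>{0..<1}. \<gamma> s = \<phi> x" if "x \<in> X" for x
    proof -
      have "\<phi> x \<in> range \<gamma>" using inside that by blast
      then obtain s where "\<gamma> s = \<phi> x" by auto
      then show ?thesis using frac_in[of s] frac_value[of s] by metis
    qed
    then obtain s t where st: "s \<in> {0..<1}" "t \<in> {0..<1}" "\<gamma> s = \<phi> z" "\<gamma> t = \<phi> z'" using z by metis
    then have "s \<noteq> t" using z phi_eq Xn by metis
    moreover have "modified s = v" "modified t = v" using modified_in st z w by auto
    ultimately show ?thesis using st unfolding double_points_def by blast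
  qed
qed

lemma modified_chart:
  assumes c: "crossing_chart (\<Gamma> \<circ> \<gamma>) v \<theta>" and off: "\<theta> ` cball 0 1 \<inter> \<phi> ` cball 0 r = {}"
  shows "crossing_chart modified v \<theta>"
proof -
  have seg: "closed_segment (-1) 1 \<subseteq> cball (0::complex) 1" "closed_segment (-\<i>) \<i> \<subseteq> cball (0::complex) 1"
    using cross_eq cross_subset by blast+
  have 1: "range modified \<inter> \<theta> ` cball 0 1 = range (\<Gamma> \<circ> \<gamma>) \<inter> \<theta> ` cball 0 1"
  proof -
    have "x \<in> range modified \<longleftrightarrow> x \<in> range (\<Gamma> \<circ> \<gamma>)" if "x \<in> \<theta> ` cball 0 1" for x
    proof -
      have "x \<notin> \<phi> ` cball 0 r" using off that by blast
      note same_off_small_disk[OF this]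
      then have "(\<exists>t. modified t = x) \<longleftrightarrow> (\<exists>t. (\<Gamma> \<circ> \<gamma>) t = x)" by simp
      moreover have "x \<in> range f \<longleftrightarrow> (\<exists>t. f t = x)" for f :: "real \<Rightarrow> real^3" by auto
      ultimately show ?thesis by simp
    qed
    then show ?thesis by blast
  qed
  have 2: "runs_along modified A p q" if r: "runs_along (\<Gamma> \<circ> \<gamma>) A p q" and A: "A \<subseteq> \<theta> ` cball 0 1" for A p q
  proof -
    obtain a b where ab: "a < b" "(\<Gamma> \<circ> \<gamma>) a = p" "(\<Gamma> \<circ> \<gamma>) b = q" "(\<Gamma> \<circ> \<gamma>) ` {a..b} = A"
      using r by (auto simp: runs_along_def)
    have "modified t = (\<Gamma> \<circ> \<gamma>) t" if "t \<in> {a..b}" for t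
    proof -
      have "(\<Gamma> \<circ> \<gamma>) t \<in> A" using ab(4) that by blast
      then have "(\<Gamma> \<circ> \<gamma>) t \<notin> \<phi> ` cball 0 r" using A off by blast
      then show ?thesis using same_off_small_disk by blast
    qed
    then have "modified a = p" "modified b = q" "modified ` {a..b} = A" using ab by auto
    then show ?thesis unfolding runs_along_def using ab(1) by blast
  qed
  have "\<theta> ` closed_segment (-1) 1 \<subseteq> \<theta> ` cball 0 1" "\<theta> ` closed_segment (-\<i>) \<i> \<subseteq> \<theta> ` cball 0 1"
    using seg by blast+
  then show ?thesis using c 1 2 unfolding crossing_chart_def by simp
qed

lemma range_modified: "range modified = (range \<gamma> - \<phi> ` cball 0 1) \<union> \<phi> ` \<tau> ` X"
  and range_moved: "range (\<Gamma> \<circ> \<gamma>) = (range \<gamma> - \<phi> ` cball 0 1) \<union> \<phi> ` G ` X"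
proof -
  have hit: "\<exists>t. \<gamma> t = \<phi> z" if z: "z \<in> X" for z
  proof -
    have "\<phi> z \<in> range \<gamma>" using inside z by blast
    then show ?thesis by auto
  qed
  show "range modified = (range \<gamma> - \<phi> ` cball 0 1) \<union> \<phi> ` \<tau> ` X"
  proof (intro equalityI subsetI)
    fix x assume "x \<in> range modified"
    then obtain t where x: "x = modified t" by blast
    show "x \<in> (range \<gamma> - \<phi> ` cball 0 1) \<union> \<phi> ` \<tau> ` X"
      using in_or_out[of t]
    proof
      assume "\<exists>z\<in>X. \<gamma> t = \<phi> z"
      then obtain z where z: "z \<in> X" "\<gamma> t = \<phi> z" by blast
      have "x = \<phi> (\<tau> z)" using modified_in[OF z] x by simp
      then show ?thesis using z(1) by blast
    next
      assume "\<gamma> t \<notin> \<phi> ` cball 0 1"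
      then show ?thesis using modified_out x by simp
    qed
  next
    fix x assume "x \<in> (range \<gamma> - \<phi> ` cball 0 1) \<union> \<phi> ` \<tau> ` X"
    then show "x \<in> range modified"
    proof
      assume "x \<in> range \<gamma> - \<phi> ` cball 0 1"
      then obtain t where "x = \<gamma> t" "\<gamma> t \<notin> \<phi> ` cball 0 1" by blast
      then show ?thesis using modified_out by (metis rangeI)
    next
      assume "x \<in> \<phi> ` \<tau> ` X"
      then obtain z where "z \<in> X" "x = \<phi> (\<tau> z)" by blast
      then show ?thesis using hit modified_in by (metis rangeI)
    qed
  qed
  show "range (\<Gamma> \<circ> \<gamma>) = (range \<gamma> - \<phi> ` cball 0 1) \<union> \<phi> ` G ` X"
  proof -
    have "range \<gamma> = (range \<gamma> - \<phi> ` cball 0 1) \<union> \<phi> ` X" using inside by blast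
    then have "\<Gamma> ` range \<gamma> = \<Gamma> ` (range \<gamma> - \<phi> ` cball 0 1) \<union> \<Gamma> ` \<phi> ` X" by (metis image_Un)
    moreover have "\<Gamma> ` (range \<gamma> - \<phi> ` cball 0 1) = range \<gamma> - \<phi> ` cball 0 1"
    proof -
      have "\<Gamma> ` (range \<gamma> - \<phi> ` cball 0 1) = (\<lambda>x. x) ` (range \<gamma> - \<phi> ` cball 0 1)"
        by (rule image_cong) (use \<Gamma>(3) in auto)
      then show ?thesis by simp
    qed
    moreover have "\<Gamma> ` \<phi> ` X = \<phi> ` G ` X"
      unfolding image_image by (rule image_cong) (use \<Gamma>(2) Xn in auto)
    ultimately show ?thesis by (simp add: image_comp)
  qed
qed

lemma knot_curve_modified:
  assumes c: "\<And>w. w \<in> E \<Longrightarrow> \<exists>\<theta>. crossing_chart modified (\<phi> w) \<theta>"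
  shows "knot_curve modified"
proof
  interpret m: knot_curve "\<Gamma> \<circ> \<gamma>" by (rule knot_moved)
  show "continuous_on UNIV modified" by (rule continuous_modified)
  show "range modified \<subseteq> S2"
    unfolding range_modified using sphere emb(3) \<tau>n by (force simp: image_subset_iff)
  show "modified (t + 1) = modified t" for t using periodic by (simp add: modified_def)
  show "finite (double_points modified)" using m.finite_double E(1) by (simp add: double_modified)
  show "x = y \<or> y = z \<or> x = z" if xyz: "x \<in> {0..<1}" "y \<in> {0..<1}" "z \<in> {0..<1}"
    "modified x = modified y" "modified y = modified z" for x y z
  proof (cases "modified x \<in> \<phi> ` cball 0 r")
    case False
    then have "(\<Gamma> \<circ> \<gamma>) x = modified x" "(\<Gamma> \<circ> \<gamma>) y = modified x" "(\<Gamma> \<circ> \<gamma>) z = modified x"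
      using same_off_small_disk[OF False] xyz by metis+
    then show ?thesis using m.no_triple[OF xyz(1-3)] by simp
  next
    case True
    then obtain w where w: "modified x = \<phi> w" "norm w \<le> r" by auto
    have ex: "\<exists>u\<in>X. \<gamma> p = \<phi> u \<and> \<tau> u = w" if p: "modified p = \<phi> w" for p
    proof -
      have "\<gamma> p \<in> \<phi> ` cball 0 1"
      proof (rule ccontr)
        assume "\<gamma> p \<notin> \<phi> ` cball 0 1"
        then have "\<phi> w \<notin> \<phi> ` cball 0 1" using modified_out p by metis
        then show False using w r by auto
      qed
      then obtain u where u: "u \<in> X" "\<gamma> p = \<phi> u" using in_or_out by blast
      then have "\<phi> (\<tau> u) = \<phi> w" using modified_in p by simp
      then have "\<tau> u = w" using phi_eq[OF \<tau>n[OF u(1)]] w r by simp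
      then show ?thesis using u by blast
    qed
    have eq: "p = q" if "p \<in> {0..<1}" "q \<in> {0..<1}" "u \<in> X" "\<gamma> p = \<phi> u" "\<gamma> q = \<phi> u" "\<tau> u = w" for p q u
    proof (rule ccontr)
      assume "p \<noteq> q"
      then have "\<phi> u \<in> double_points \<gamma>" using that unfolding double_points_def by blast
      then have "norm u = 1" using no_double Xn[OF that(3)] by (cases "norm u < 1") auto
      then show False using \<tau>(2)[OF that(3)] that(6) w(2) r(1) by auto
    qed
    obtain a b c where a: "a \<in> X" "\<gamma> x = \<phi> a" "\<tau> a = w" "b \<in> X" "\<gamma> y = \<phi> b" "\<tau> b = w" "c \<in> X" "\<gamma> z = \<phi> c" "\<tau> c = w"
      using ex[of x] ex[of y] ex[of z] w xyz by metis
    then have "a = b \<or> b = c \<or> a = c" using two[of a b c] by simp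
    then show ?thesis using eq a xyz by metis
  qed
  fix v assume "v \<in> double_points modified"
  then have "v \<in> double_points (\<Gamma> \<circ> \<gamma>) \<or> v \<in> \<phi> ` E" by (simp add: double_modified)
  then show "\<exists>\<theta>. crossing_chart modified v \<theta>"
  proof
    assume v: "v \<in> double_points (\<Gamma> \<circ> \<gamma>)"
    have "closed (\<phi> ` cball 0 r)"
      using emb(1) r(1) by (intro compact_imp_closed compact_continuous_image continuous_on_subset[OF emb(1)]) auto
    moreover have "\<phi> ` cball 0 r \<inter> double_points (\<Gamma> \<circ> \<gamma>) = {}" using moved_not_double by auto
    ultimately obtain \<theta> where "charts (\<Gamma> \<circ> \<gamma>) \<theta>"
      "\<And>v. v \<in> double_points (\<Gamma> \<circ> \<gamma>) \<Longrightarrow> \<theta> v ` cball 0 1 \<inter> \<phi> ` cball 0 r = {}"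
      using m.charts_exist by blast
    note \<theta> = this
    have "crossing_chart (\<Gamma> \<circ> \<gamma>) v (\<theta> v)" using \<theta>(1) v by (simp add: charts_def)
    from modified_chart[OF this \<theta>(2)[OF v]] show ?thesis by blast
  qed (use c in auto)
qed

text \<open>By \<open>res\<close>, resolving the new crossings turns the image of \<open>X\<close>
  under \<open>\<tau>\<close> into its image under \<open>G\<close>. So the modified and the moved
  curve have the same resolution \<open>C'\<close> as a set, and moving it back by \<open>K\<close>
  gives an arrangement of the original curve.\<close>

lemma modified_arrangement:
  assumes c: "\<And>w. w \<in> E \<Longrightarrow> crossing_chart modified (\<phi> w) (\<phi> \<circ> \<kappa> w)"
    and small: "\<And>w. w \<in> E \<Longrightarrow> \<kappa> w ` cball 0 1 \<subseteq> cball 0 r"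
    and disj: "\<And>w w'. w \<in> E \<Longrightarrow> w' \<in> E \<Longrightarrow> w \<noteq> w' \<Longrightarrow> \<kappa> w ` cball 0 1 \<inter> \<kappa> w' ` cball 0 1 = {}"
    and res: "G ` X = (\<tau> ` X - (\<Union>w\<in>E. \<kappa> w ` cball 0 1)) \<union> (\<Union>w\<in>E. \<kappa> w ` nonseifert_chords)"
  shows "\<exists>C C'. curve_arrangement (range \<gamma>) C \<and> curve_arrangement (range modified) C' \<and> isotopic C C'"
proof -
  interpret m: knot_curve "\<Gamma> \<circ> \<gamma>" by (rule knot_moved)
  have small1: "\<kappa> w ` cball 0 1 \<subseteq> cball 0 1" if "w \<in> E" for w
    using small[OF that] r(1) by (meson cball_subset_cball_iff less_imp_le norm_ge_zero order_trans subset_cball)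
  have "closed (\<phi> ` cball 0 r)"
    using emb(1) r(1) by (intro compact_imp_closed compact_continuous_image continuous_on_subset[OF emb(1)]) auto
  moreover have "\<phi> ` cball 0 r \<inter> double_points (\<Gamma> \<circ> \<gamma>) = {}" using moved_not_double by auto
  ultimately obtain \<theta> where \<theta>: "charts (\<Gamma> \<circ> \<gamma>) \<theta>"
    "\<And>v. v \<in> double_points (\<Gamma> \<circ> \<gamma>) \<Longrightarrow> \<theta> v ` cball 0 1 \<inter> \<phi> ` cball 0 r = {}"
    using m.charts_exist by blast
  define \<eta> where "\<eta> v = (if v \<in> \<phi> ` E then \<phi> \<circ> \<kappa> (\<psi> v) else \<theta> v)" for v
  have En: "norm w \<le> 1" if "w \<in> E" for w using E(2) r(1) that by force
  have \<eta>E: "\<eta> (\<phi> w) = \<phi> \<circ> \<kappa> w" if "w \<in> E" for w using that \<psi>[OF En[OF that]] by (simp add: \<eta>_def)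
  have notE: "v \<notin> \<phi> ` E" if "v \<in> double_points (\<Gamma> \<circ> \<gamma>)" for v
    using moved_not_double E(2) that by force
  have \<eta>V: "\<eta> v = \<theta> v" if "v \<in> double_points (\<Gamma> \<circ> \<gamma>)" for v using notE[OF that] by (simp add: \<eta>_def)
  have im: "(\<phi> \<circ> \<kappa> w) ` cball 0 1 \<subseteq> \<phi> ` cball 0 r" if "w \<in> E" for w
    using small[OF that] by (auto simp: image_comp[symmetric])
  have ch: "charts modified \<eta>"
    unfolding charts_def double_modified
  proof (intro conjI ballI impI)
    fix v assume "v \<in> double_points (\<Gamma> \<circ> \<gamma>) \<union> \<phi> ` E"
    then show "crossing_chart modified v (\<eta> v)"
      using \<eta>E \<eta>V c modified_chart \<theta> unfolding charts_def by auto
  next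
    fix v v' assume v: "v \<in> double_points (\<Gamma> \<circ> \<gamma>) \<union> \<phi> ` E" "v' \<in> double_points (\<Gamma> \<circ> \<gamma>) \<union> \<phi> ` E" "v \<noteq> v'"
    have mixed: "\<eta> v ` cball 0 1 \<inter> \<eta> v' ` cball 0 1 = {}" if "v \<in> double_points (\<Gamma> \<circ> \<gamma>)" "v' \<in> \<phi> ` E" for v v'
      using \<theta>(2)[OF that(1)] \<eta>V[OF that(1)] that(2) \<eta>E im by fastforce
    show "\<eta> v ` cball 0 1 \<inter> \<eta> v' ` cball 0 1 = {}"
    proof (cases "v \<in> \<phi> ` E"; cases "v' \<in> \<phi> ` E")
      assume "v \<in> \<phi> ` E" "v' \<in> \<phi> ` E"
      then obtain w w' where w: "v = \<phi> w" "w \<in> E" "v' = \<phi> w'" "w' \<in> E" by blast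
      then have "w \<noteq> w'" using v(3) by auto
      have "\<phi> ` (\<kappa> w ` cball 0 1) \<inter> \<phi> ` (\<kappa> w' ` cball 0 1) = \<phi> ` (\<kappa> w ` cball 0 1 \<inter> \<kappa> w' ` cball 0 1)"
        by (rule inj_on_image_Int[OF emb(2) small1 small1, symmetric]) (use w in auto)
      then show ?thesis using disj[OF w(2,4) \<open>w \<noteq> w'\<close>] w \<eta>E by (simp add: image_comp)
    next
      assume "v \<in> \<phi> ` E" "v' \<notin> \<phi> ` E"
      then show ?thesis using mixed[of v' v] v by blast
    next
      assume "v \<notin> \<phi> ` E" "v' \<in> \<phi> ` E"
      then show ?thesis using mixed[of v v'] v by blast
    next
      assume "v \<notin> \<phi> ` E" "v' \<notin> \<phi> ` E"
      then have "v \<in> double_points (\<Gamma> \<circ> \<gamma>)" "v' \<in> double_points (\<Gamma> \<circ> \<gamma>)" using v by auto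
      then show ?thesis using \<eta>V \<theta>(1) v(3) unfolding charts_def by simp
    qed
  qed
  define A N B M where "A = (\<Union>v\<in>double_points (\<Gamma> \<circ> \<gamma>). \<theta> v ` cball 0 1)"
    and "N = (\<Union>v\<in>double_points (\<Gamma> \<circ> \<gamma>). \<theta> v ` nonseifert_chords)"
    and "B = \<phi> ` (\<Union>w\<in>E. \<kappa> w ` cball 0 1)" and "M = \<phi> ` (\<Union>w\<in>E. \<kappa> w ` nonseifert_chords)"
  have "resolve_on (range modified) (double_points modified) \<eta> = (range modified - (A \<union> B)) \<union> (N \<union> M)"
    unfolding resolve_on_def double_modified UN_Un A_def N_def B_def M_def
    using \<eta>E \<eta>V by (simp add: image_UN image_comp)
  also have "\<dots> = (((range modified - B) \<union> M) - A) \<union> N"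
  proof -
    have "M \<subseteq> \<phi> ` cball 0 r"
    proof -
      have "\<kappa> w ` nonseifert_chords \<subseteq> cball 0 r" if "w \<in> E" for w using small[OF that] chords_subset by blast
      then show ?thesis unfolding M_def by blast
    qed
    then have "M \<inter> A = {}" unfolding A_def using \<theta>(2) by blast
    then show ?thesis by blast
  qed
  also have "(range modified - B) \<union> M = range (\<Gamma> \<circ> \<gamma>)"
  proof -
    have s1: "(\<Union>w\<in>E. \<kappa> w ` cball 0 1) \<subseteq> cball 0 1" using small1 by blast
    have "B \<subseteq> \<phi> ` cball 0 1" unfolding B_def using s1 by blast
    then have "(range modified - B) \<union> M = (range \<gamma> - \<phi> ` cball 0 1) \<union> ((\<phi> ` \<tau> ` X - B) \<union> M)"
      unfolding range_modified by blast
    also have "\<phi> ` \<tau> ` X - B = \<phi> ` (\<tau> ` X - (\<Union>w\<in>E. \<kappa> w ` cball 0 1))"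
      unfolding B_def by (rule inj_on_image_set_diff[OF emb(2) _ s1, symmetric]) (use \<tau>n in auto)
    also have "\<dots> \<union> M = \<phi> ` G ` X" unfolding M_def res image_Un ..
    finally show ?thesis unfolding range_moved .
  qed
  also have "(range (\<Gamma> \<circ> \<gamma>) - A) \<union> N = resolve_on (range (\<Gamma> \<circ> \<gamma>)) (double_points (\<Gamma> \<circ> \<gamma>)) \<theta>"
    by (simp add: resolve_on_def A_def N_def)
  finally have eq: "resolve_on (range modified) (double_points modified) \<eta> =
    resolve_on (range (\<Gamma> \<circ> \<gamma>)) (double_points (\<Gamma> \<circ> \<gamma>)) \<theta>" .
  define C' where "C' = resolve_on (range modified) (double_points modified) \<eta>"
  have 1: "curve_arrangement (range modified) C'"
    unfolding curve_arrangement_def C'_def using knot_curve_modified c ch by blast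
  have 2: "curve_arrangement (range (\<Gamma> \<circ> \<gamma>)) C'"
    unfolding curve_arrangement_def C'_def eq using knot_moved \<theta>(1) by blast
  obtain K where K: "homeomorphism S2 S2 \<Gamma> K" using isotopic_to_id_homeomorphism[OF \<Gamma>(1)] by blast
  have "K ` range (\<Gamma> \<circ> \<gamma>) = range \<gamma>"
  proof -
    have "K (\<Gamma> (\<gamma> t)) = \<gamma> t" for t by (rule homeomorphism_apply1[OF K]) (use sphere in blast)
    then show ?thesis by (simp add: image_image)
  qed
  then have 3: "curve_arrangement (range \<gamma>) (K ` C')"
    using curve_arrangement_homeomorphism[OF 2 homeomorphism_symD[OF K]] by simp
  have S: "C' \<subseteq> S2"
    unfolding C'_def eq
  proof (rule resolve_on_subset[OF m.sphere])
    fix v assume "v \<in> double_points (\<Gamma> \<circ> \<gamma>)"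
    then show "cross_disk (range (\<Gamma> \<circ> \<gamma>)) (\<theta> v)"
      using \<theta>(1) m.crossing_chart_cross_disk unfolding charts_def by blast
  qed
  have "isotopic C' (K ` C')"
    using isotopic_to_id_inverse[OF \<Gamma>(1) K] isotopic_iff[OF S] by blast
  then have "isotopic (K ` C') C'" by (rule isotopic_sym[OF S])
  then show ?thesis using 1 3 by blast
qed

end

section \<open>Passages under reparametrization, reversal and modification\<close>

lemma crossing_chartI:
  assumes "cross_disk (range \<gamma>) \<phi>" "\<phi> 0 = v"
    "traverses \<gamma> (\<lambda>x. \<phi> (of_real x))" "traverses \<gamma> (\<lambda>x. \<phi> (\<i> * of_real x))"
  shows "crossing_chart \<gamma> v \<phi>"
  using assms traverses_runs_along[of \<gamma> "\<lambda>x. \<phi> (of_real x)" "-1" 1]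
    traverses_runs_along[of \<gamma> "\<lambda>x. \<phi> (\<i> * of_real x)" "-1" 1]
  unfolding crossing_chart_def cross_eq by (simp add: cross_disk_def real_axis_eq imag_axis_eq image_image)

lemma traverses_reparametrize:
  assumes "traverses \<gamma> \<alpha>" and g: "continuous_on {-1..1} g" "strict_mono_on {-1..1} g"
    and range: "-1 \<le> g (-1)" "g 1 \<le> 1"
  shows "traverses \<gamma> (\<lambda>x. \<alpha> (g x))"
proof -
  obtain a b f where f: "a < b" "continuous_on {a..b} f" "strict_mono_on {a..b} f" "f a = -1" "f b = 1"
    "\<And>t. t \<in> {a..b} \<Longrightarrow> \<gamma> t = \<alpha> (f t)"
    using assms(1) by (auto simp: traverses_def)
  have g11: "g (-1) < g 1" using strict_mono_onD[OF g(2), of "-1" 1] by simp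
  obtain p where p: "a \<le> p" "p \<le> b" "f p = g (-1)" using IVT'[of f a "g (-1)" b] f range g11 by auto
  obtain q where q: "a \<le> q" "q \<le> b" "f q = g 1" using IVT'[of f a "g 1" b] f range g11 by auto
  have "p < q"
  proof (rule ccontr)
    assume "\<not> p < q"
    then have "f q \<le> f p" using strict_mono_on_leD[OF f(3), of q p] p q by auto
    then show False using p q g11 by simp
  qed
  obtain k where k: "homeomorphism {-1..1} (g ` {-1..1}) g k"
    using homeomorphism_compact[OF compact_Icc g(1) refl strict_mono_on_imp_inj_on[OF g(2)]] by blast
  have im: "f t \<in> g ` {-1..1}" if t: "t \<in> {p..q}" for t
  proof -
    have "g (-1) \<le> f t" "f t \<le> g 1"
      using strict_mono_on_leD[OF f(3), of p t] strict_mono_on_leD[OF f(3), of t q] t p q by auto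
    then obtain x where "-1 \<le> x" "x \<le> 1" "g x = f t" using IVT'[of g "-1" "f t" 1] g(1) by auto
    then show ?thesis by (intro image_eqI[of _ _ x]) auto
  qed
  have gk: "g (k (f t)) = f t" "k (f t) \<in> {-1..1}" if t: "t \<in> {p..q}" for t
    using homeomorphism_apply2[OF k im[OF t]] homeomorphism_image2[OF k] im[OF t] by blast+
  have "continuous_on {p..q} (\<lambda>t. k (f t))"
    by (rule continuous_on_compose2[OF homeomorphism_cont2[OF k] continuous_on_subset[OF f(2)]])
      (use im p q in auto)
  moreover have "strict_mono_on {p..q} (\<lambda>t. k (f t))"
  proof (rule strict_mono_onI)
    fix s t assume st: "s \<in> {p..q}" "t \<in> {p..q}" "s < t"
    then have lt: "f s < f t" using strict_mono_onD[OF f(3), of s t] p q by auto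
    show "k (f s) < k (f t)"
    proof (rule ccontr)
      assume "\<not> k (f s) < k (f t)"
      then have "g (k (f t)) \<le> g (k (f s))" using strict_mono_on_leD[OF g(2)] gk(2) st by auto
      then show False using gk(1) st lt by simp
    qed
  qed
  moreover have "k (f p) = -1" "k (f q) = 1" using homeomorphism_apply1[OF k] p q by auto
  moreover have "\<gamma> t = \<alpha> (g (k (f t)))" if "t \<in> {p..q}" for t using f(6)[of t] gk(1)[OF that] that p q by auto
  ultimately show ?thesis unfolding traverses_def using \<open>p < q\<close> by blast
qed

lemma traverses_cong:
  assumes "traverses \<gamma> \<alpha>" and eq: "\<And>x. x \<in> {-1..1} \<Longrightarrow> \<alpha> x = \<beta> x"
  shows "traverses \<gamma> \<beta>"
proof -
  obtain a b f where f: "a < b" "continuous_on {a..b} f" "strict_mono_on {a..b} f" "f a = -1" "f b = 1"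
    "\<And>t. t \<in> {a..b} \<Longrightarrow> \<gamma> t = \<alpha> (f t)"
    using assms(1) by (auto simp: traverses_def)
  have "f t \<in> {-1..1}" if t: "t \<in> {a..b}" for t
    using strict_mono_on_leD[OF f(3), of a t] strict_mono_on_leD[OF f(3), of t b] t f by auto
  then show ?thesis unfolding traverses_def using f eq by metis
qed

lemma traverses_reverse:
  assumes "traverses \<gamma> (\<lambda>x. \<alpha> (- x))"
  shows "traverses (\<lambda>t. \<gamma> (- t)) \<alpha>"
proof -
  obtain a b f where f: "a < b" "continuous_on {a..b} f" "strict_mono_on {a..b} f" "f a = -1" "f b = 1"
    "\<And>t. t \<in> {a..b} \<Longrightarrow> \<gamma> t = \<alpha> (- f t)"
    using assms by (auto simp: traverses_def)
  have "continuous_on {-b..-a} (\<lambda>t. - f (- t))"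
    by (rule continuous_on_minus, rule continuous_on_compose2[OF f(2)]) (auto intro!: continuous_intros)
  moreover have "strict_mono_on {-b..-a} (\<lambda>t. - f (- t))"
  proof (rule strict_mono_onI)
    fix s t assume "s \<in> {-b..-a}" "t \<in> {-b..-a}" "s < t"
    then show "- f (- s) < - f (- t)" using strict_mono_onD[OF f(3), of "- t" "- s"] by auto
  qed
  ultimately show ?thesis unfolding traverses_def using f(1,4,5,6)
    by (intro exI[of _ "-b"] exI[of _ "-a"] exI[of _ "\<lambda>t. - f (- t)"]) auto
qed

lemma (in disk_modification) traverses_modified:
  assumes "traverses \<gamma> (\<lambda>x. \<phi> (\<alpha> x))" "\<And>x. x \<in> {-1..1} \<Longrightarrow> \<alpha> x \<in> X"
  shows "traverses modified (\<lambda>x. \<phi> (\<tau> (\<alpha> x)))"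
proof -
  obtain a b f where f: "a < b" "continuous_on {a..b} f" "strict_mono_on {a..b} f" "f a = -1" "f b = 1"
    "\<And>t. t \<in> {a..b} \<Longrightarrow> \<gamma> t = \<phi> (\<alpha> (f t))"
    using assms(1) by (auto simp: traverses_def)
  have "modified t = \<phi> (\<tau> (\<alpha> (f t)))" if t: "t \<in> {a..b}" for t
  proof (rule modified_in[OF _ f(6)[OF t]])
    have "f t \<in> {-1..1}"
      using strict_mono_on_leD[OF f(3), of a t] strict_mono_on_leD[OF f(3), of t b] t f by auto
    then show "\<alpha> (f t) \<in> X" by (rule assms(2))
  qed
  then show ?thesis unfolding traverses_def using f by blast
qed

lemma (in disk_modification) modified_chartI:
  assumes \<kappa>: "continuous_on (cball 0 1) \<kappa>" "inj_on \<kappa> (cball 0 1)" "\<kappa> ` cball 0 1 \<subseteq> cball 0 1"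
    and cross: "\<tau> ` X \<inter> \<kappa> ` cball 0 1 = \<kappa> ` cross"
    and t: "traverses modified (\<lambda>x. \<phi> (\<kappa> (of_real x)))" "traverses modified (\<lambda>x. \<phi> (\<kappa> (\<i> * of_real x)))"
  shows "crossing_chart modified (\<phi> (\<kappa> 0)) (\<phi> \<circ> \<kappa>)"
proof (rule crossing_chartI)
  have "disk_embedding (\<phi> \<circ> \<kappa>)"
    unfolding disk_embedding_def
  proof (intro conjI)
    show "continuous_on (cball 0 1) (\<phi> \<circ> \<kappa>)"
      by (rule continuous_on_compose[OF \<kappa>(1) continuous_on_subset[OF emb(1) \<kappa>(3)]])
    show "inj_on (\<phi> \<circ> \<kappa>) (cball 0 1)" by (rule comp_inj_on[OF \<kappa>(2) inj_on_subset[OF emb(2) \<kappa>(3)]])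
    show "(\<phi> \<circ> \<kappa>) ` cball 0 1 \<subseteq> S2"
      unfolding image_comp[symmetric] using emb(3) image_mono[OF \<kappa>(3), of \<phi>] by blast
  qed
  moreover have "range modified \<inter> (\<phi> \<circ> \<kappa>) ` cball 0 1 = (\<phi> \<circ> \<kappa>) ` cross"
  proof -
    have "range modified \<inter> \<phi> ` \<kappa> ` cball 0 1 = \<phi> ` \<tau> ` X \<inter> \<phi> ` \<kappa> ` cball 0 1"
      unfolding range_modified using image_mono[OF \<kappa>(3), of \<phi>] by blast
    also have "\<dots> = \<phi> ` (\<tau> ` X \<inter> \<kappa> ` cball 0 1)"
      by (rule inj_on_image_Int[OF emb(2) _ \<kappa>(3), symmetric]) (use \<tau>n in auto)
    finally show ?thesis by (simp add: cross image_comp)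
  qed
  ultimately show "cross_disk (range modified) (\<phi> \<circ> \<kappa>)" by (simp add: cross_disk_def)
qed (use t in \<open>simp_all add: o_def\<close>)

subsection \<open>The first Reidemeister move\<close>

definition kink_path :: "real \<Rightarrow> complex" where
  "kink_path x = Complex (2 * x ^ 3 - x) ((1 - x\<^sup>2) / 2)"

lemma kink_path_alt: "kink_path x = Complex (x * (2 * x\<^sup>2 - 1)) ((1 - x\<^sup>2) / 2)"
  by (simp add: kink_path_def power2_eq_square power3_eq_cube algebra_simps)

text \<open>In the coordinates \<open>q = 4 y - 1\<close> and \<open>p = x / sqrt (1 - 2 y)\<close> the kink is \<open>\<bar>p\<bar> = \<bar>q\<bar>\<close>; resolving
  its crossing by vertical chords gives \<open>\<bar>p\<bar> = max \<bar>q\<bar> (1/4)\<close>.\<close>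

definition resolved_kink_path :: "real \<Rightarrow> complex" where
  "resolved_kink_path x = Complex (x * max \<bar>2 * x\<^sup>2 - 1\<bar> (1/4)) ((1 - x\<^sup>2) / 2)"

text \<open>The inverse of the coordinates p, q above, with p and q read off along the diagonals of
  the \<open>w\<close> disk. The axes become \<open>\<bar>p\<bar> = \<bar>q\<bar>\<close>, and the
  chords, where \<open>Re w + Im w\<close> is 1 or -1, become p = 1/4 and p = -1/4.\<close>

definition kink_chart :: "complex \<Rightarrow> complex" where
  "kink_chart w = (let p = (Re w + Im w) / 4; q = (Re w - Im w) / 4
     in Complex (p * sqrt ((1 - q) / 2)) ((1 + q) / 4))"

lemma half_disk_bounds:
  assumes "norm w \<le> 1"
  shows "(Re w + Im w)\<^sup>2 \<le> 2" "(Re w - Im w)\<^sup>2 \<le> 2"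
proof -
  have "(Re w)\<^sup>2 + (Im w)\<^sup>2 \<le> 1" using assms by (simp add: cmod_def)
  moreover have "0 \<le> (Re w - Im w)\<^sup>2" "0 \<le> (Re w + Im w)\<^sup>2" by simp_all
  ultimately show "(Re w + Im w)\<^sup>2 \<le> 2" "(Re w - Im w)\<^sup>2 \<le> 2"
    by (simp_all add: power2_eq_square algebra_simps)
qed

lemma half_disk_abs_bounds:
  assumes "norm w \<le> 1"
  shows "\<bar>Re w + Im w\<bar> \<le> 3/2" "\<bar>Re w - Im w\<bar> \<le> 3/2"
proof -
  have "(Re w + Im w)\<^sup>2 \<le> (3/2)\<^sup>2" "(Re w - Im w)\<^sup>2 \<le> (3/2)\<^sup>2"
    using half_disk_bounds[OF assms] by (simp_all add: power2_eq_square)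
  then show "\<bar>Re w + Im w\<bar> \<le> 3/2" "\<bar>Re w - Im w\<bar> \<le> 3/2"
    unfolding abs_le_square_iff[symmetric] by simp_all
qed

lemma norm_le_if_squares: "(Re z)\<^sup>2 + (Im z)\<^sup>2 \<le> c\<^sup>2 \<Longrightarrow> 0 \<le> c \<Longrightarrow> norm z \<le> c"
  unfolding cmod_def by (rule real_le_lsqrt) auto

lemma norm_less_1_if_squares: "(Re z)\<^sup>2 + (Im z)\<^sup>2 < 1 \<Longrightarrow> norm z < 1"
  unfolding cmod_def by (rule real_sqrt_lt_1_iff[THEN iffD2])

lemma kink_chart_facts:
  shows "continuous_on (cball 0 1) kink_chart" "inj_on kink_chart (cball 0 1)"
    "kink_chart ` cball 0 1 \<subseteq> cball 0 (9/10)" "kink_chart 0 = \<i> / 4"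
proof -
  show "continuous_on (cball 0 1) kink_chart"
    unfolding kink_chart_def[abs_def] Let_def Complex_eq by (intro continuous_intros) auto
  show "kink_chart 0 = \<i> / 4" by (simp add: kink_chart_def complex_eq_iff)
  show "inj_on kink_chart (cball 0 1)"
  proof (rule inj_onI)
    fix z w assume zw: "z \<in> cball 0 1" "w \<in> cball 0 1" "kink_chart z = kink_chart w"
    have q: "Re z - Im z = Re w - Im w" using zw(3) by (simp add: kink_chart_def Let_def)
    have "\<bar>Re w - Im w\<bar> \<le> 3/2" using half_disk_abs_bounds(2)[of w] zw(2) by simp
    from abs_le_D1[OF this] have "0 < (1 - (Re w - Im w) / 4) / 2" by simp
    then have "0 < sqrt ((1 - (Re w - Im w) / 4) / 2)" by (rule real_sqrt_gt_zero)
    moreover have "(Re z + Im z) / 4 * sqrt ((1 - (Re w - Im w) / 4) / 2) = (Re w + Im w) / 4 * sqrt ((1 - (Re w - Im w) / 4) / 2)"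
      using zw(3) q by (simp add: kink_chart_def Let_def)
    ultimately have "Re z + Im z = Re w + Im w" by simp
    then show "z = w" using q by (simp add: complex_eq_iff)
  qed
  show "kink_chart ` cball 0 1 \<subseteq> cball 0 (9/10)"
  proof (intro image_subsetI)
    fix w :: complex assume "w \<in> cball 0 1"
    then have w: "norm w \<le> 1" by simp
    define p q where "p = (Re w + Im w) / 4" and "q = (Re w - Im w) / 4"
    have pq: "\<bar>p\<bar> \<le> 3/8" "\<bar>q\<bar> \<le> 3/8" using half_disk_abs_bounds[OF w] by (simp_all add: p_def q_def)
    have s: "0 \<le> (1 - q) / 2" "(1 - q) / 2 \<le> 1" using pq by auto
    have "\<bar>p * sqrt ((1 - q) / 2)\<bar> \<le> 3/8 * 1"
      unfolding abs_mult by (rule mult_mono) (use pq s in auto)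
    moreover have "\<bar>(1 + q) / 4\<bar> \<le> 3/8" using pq by auto
    ultimately have "\<bar>Re (kink_chart w)\<bar> + \<bar>Im (kink_chart w)\<bar> \<le> 3/4"
      by (simp add: kink_chart_def Let_def p_def q_def)
    then show "kink_chart w \<in> cball 0 (9/10)" using cmod_le[of "kink_chart w"] by simp
  qed
qed

text \<open>On the kink \<open>q = 1 - 2 * x\<^sup>2\<close>, and q is \<open>s / 4\<close> on the
  real and \<open>- s / 4\<close> on the imaginary axis; the two square roots are the two passages.
  With these signs both parameters increase with \<open>s\<close>, so the curve runs along both axes
  in the positive direction.\<close>

lemma kink_chart_real_axis:
  assumes "s \<in> {-1..1}"
  shows "kink_chart (of_real s) = kink_path (- sqrt ((1 - s / 4) / 2))"
    and "kink_chart (\<i> * of_real s) = kink_path (sqrt ((1 + s / 4) / 2))"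
proof -
  have n: "0 \<le> (1 - s / 4) / 2" "0 \<le> (1 + s / 4) / 2" using assms by auto
  show "kink_chart (of_real s) = kink_path (- sqrt ((1 - s / 4) / 2))"
    unfolding kink_path_alt power2_minus real_sqrt_pow2[OF n(1)]
    by (simp add: kink_chart_def Let_def complex_eq_iff field_simps)
  show "kink_chart (\<i> * of_real s) = kink_path (sqrt ((1 + s / 4) / 2))"
    unfolding kink_path_alt power2_minus real_sqrt_pow2[OF n(2)]
    by (simp add: kink_chart_def Let_def complex_eq_iff field_simps)
qed

lemma sqrt_range: "\<bar>s\<bar> \<le> 1 \<Longrightarrow> 0 < sqrt ((1 + s / 4) / 2) \<and> sqrt ((1 + s / 4) / 2) < 1" for s :: real
  by (auto simp: abs_le_iff)

lemma kink_chart_cross: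
  "kink_path ` {-1..1} \<inter> kink_chart ` cball 0 1 = kink_chart ` cross"
  and kink_chart_mem: "\<And>x. x \<in> {-1..1} \<Longrightarrow> kink_path x \<in> kink_chart ` cball 0 1 \<longleftrightarrow> \<bar>2 * x\<^sup>2 - 1\<bar> \<le> 1/4"
proof -
  \<comment> \<open>With q fixed by the height, the square root in the chart is
    \<open>\<bar>x\<bar>\<close>. It can be cancelled because \<open>x = 0\<close> would give q = 1,
    which does not occur in the chart.\<close>
  have pq: "\<bar>p\<bar> = \<bar>q\<bar> \<and> q = 1 - 2 * x\<^sup>2" if "kink_path x = kink_chart w" "norm w \<le> 1"
    "p = (Re w + Im w) / 4" "q = (Re w - Im w) / 4" for x w p q
  proof -
    have 1: "(1 - x\<^sup>2) / 2 = (1 + q) / 4" "x * (2 * x\<^sup>2 - 1) = p * sqrt ((1 - q) / 2)"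
      using that(1) by (simp_all add: kink_path_alt kink_chart_def Let_def that(3,4))
    have q: "q = 1 - 2 * x\<^sup>2" using 1(1) by simp
    then have "sqrt ((1 - q) / 2) = \<bar>x\<bar>" by simp
    moreover have "x \<noteq> 0"
    proof
      assume "x = 0"
      then show False using q that(4) half_disk_abs_bounds(2)[OF that(2)] by simp
    qed
    ultimately have "x * (2 * x\<^sup>2 - 1) = p * \<bar>x\<bar>" using 1 by simp
    then have "\<bar>x\<bar> * \<bar>2 * x\<^sup>2 - 1\<bar> = \<bar>x\<bar> * \<bar>p\<bar>" by (metis abs_mult abs_abs mult.commute)
    then have "\<bar>p\<bar> = \<bar>q\<bar>" using \<open>x \<noteq> 0\<close> q by (simp add: abs_minus_commute)
    then show ?thesis using q by simp
  qed
  have conv: "\<exists>w\<in>cross. kink_chart w = kink_path x" if x: "\<bar>2 * x\<^sup>2 - 1\<bar> \<le> 1/4" for x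
  proof -
    define s where "s = 4 * (1 - 2 * x\<^sup>2)"
    have s: "\<bar>s\<bar> \<le> 1" using x by (simp add: s_def abs_if split: if_splits)
    then have s1: "s \<in> {-1..1}" "- s \<in> {-1..1}" by (auto simp: abs_le_iff)
    show ?thesis
    proof (cases "0 \<le> x")
      case False
      have "(1 - s / 4) / 2 = x\<^sup>2" by (simp add: s_def field_simps)
      then have "- sqrt ((1 - s / 4) / 2) = x" using False by simp
      then have "kink_chart (of_real s) = kink_path x" using kink_chart_real_axis(1)[OF s1(1)] by simp
      then show ?thesis using s by (intro bexI[of _ "of_real s"]) (auto simp: cross_def)
    next
      case True
      have "(1 + (- s) / 4) / 2 = x\<^sup>2" by (simp add: s_def field_simps)
      then have "sqrt ((1 + (- s) / 4) / 2) = x" using True by simp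
      then have "kink_chart (\<i> * of_real (- s)) = kink_path x" using kink_chart_real_axis(2)[OF s1(2)] by simp
      then show ?thesis using s by (intro bexI[of _ "\<i> * of_real (- s)"]) (auto simp: cross_def norm_mult)
    qed
  qed
  have mem: "\<bar>2 * x\<^sup>2 - 1\<bar> \<le> 1/4 \<and> w \<in> cross" if "kink_path x = kink_chart w" "norm w \<le> 1" for x w
  proof -
    have e: "\<bar>Re w + Im w\<bar> = \<bar>Re w - Im w\<bar>" "(Re w - Im w) / 4 = 1 - 2 * x\<^sup>2"
      using pq[OF that refl refl] by auto
    then have "Re w = 0 \<or> Im w = 0" by (auto simp: abs_if split: if_splits)
    then have w: "w \<in> cross" using that(2) by (simp add: cross_def)
    have "\<bar>Re w - Im w\<bar> \<le> 1"
      using \<open>Re w = 0 \<or> Im w = 0\<close> abs_Re_le_cmod[of w] abs_Im_le_cmod[of w] that(2) by auto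
    moreover have "2 * x\<^sup>2 - 1 = - ((Re w - Im w) / 4)" using e(2) by linarith
    ultimately have "\<bar>2 * x\<^sup>2 - 1\<bar> \<le> 1/4" by (simp only: abs_minus_cancel abs_divide) simp
    then show ?thesis using w by simp
  qed
  show "kink_path ` {-1..1} \<inter> kink_chart ` cball 0 1 = kink_chart ` cross"
  proof (intro equalityI subsetI)
    fix y assume "y \<in> kink_path ` {-1..1} \<inter> kink_chart ` cball 0 1"
    then obtain x w where y: "y = kink_path x" "w \<in> cball 0 1" "y = kink_chart w" by blast
    then have "w \<in> cross" using mem[of x w] by auto
    then show "y \<in> kink_chart ` cross" using y(3) by blast
  next
    fix y assume "y \<in> kink_chart ` cross"
    then obtain w where w: "w \<in> cross" "y = kink_chart w" by blast
    have "\<exists>s\<in>{-1..1}. w = of_real s \<or> w = \<i> * of_real s"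
      using w(1) real_axis_eq imag_axis_eq cross_eq by auto
    then obtain s where s: "s \<in> {-1..1}" "w = of_real s \<or> w = \<i> * of_real s" by blast
    have s': "\<bar>s\<bar> \<le> 1" "\<bar>- s\<bar> \<le> 1" using s(1) by auto
    have "\<exists>x\<in>{-1..1}. y = kink_path x"
      using s(2)
    proof
      assume "w = of_real s"
      then show ?thesis using kink_chart_real_axis(1)[OF s(1)] sqrt_range[OF s'(2)] w
        by (intro bexI[of _ "- sqrt ((1 - s / 4) / 2)"]) (auto intro: order_trans[of "-1" 0])
    next
      assume "w = \<i> * of_real s"
      then show ?thesis using kink_chart_real_axis(2)[OF s(1)] sqrt_range[OF s'(1)] w
        by (intro bexI[of _ "sqrt ((1 + s / 4) / 2)"]) (auto intro: order_trans[of "-1" 0])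
    qed
    then show "y \<in> kink_path ` {-1..1} \<inter> kink_chart ` cball 0 1" using w cross_subset by auto
  qed
  show "\<And>x. x \<in> {-1..1} \<Longrightarrow> kink_path x \<in> kink_chart ` cball 0 1 \<longleftrightarrow> \<bar>2 * x\<^sup>2 - 1\<bar> \<le> 1/4"
  proof
    fix x assume "kink_path x \<in> kink_chart ` cball 0 1"
    then show "\<bar>2 * x\<^sup>2 - 1\<bar> \<le> 1/4" using mem by auto
  next
    fix x :: real assume "\<bar>2 * x\<^sup>2 - 1\<bar> \<le> 1/4"
    from conv[OF this] show "kink_path x \<in> kink_chart ` cball 0 1" using cross_subset by (metis imageI subsetD)
  qed
qed

text \<open>On the chords \<open>\<bar>p\<bar>\<close> is 1/4, the second argument of the maximum in
  \<open>resolved_kink_path\<close>; the sign of p is the sign of \<open>x\<close>.\<close>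

lemma kink_chart_chords:
  "kink_chart ` nonseifert_chords = resolved_kink_path ` {x. \<bar>2 * x\<^sup>2 - 1\<bar> \<le> 1/4}"
proof (intro equalityI subsetI)
  fix y assume "y \<in> kink_chart ` nonseifert_chords"
  then obtain w where w: "w \<in> nonseifert_chords" "y = kink_chart w" by blast
  define q where "q = (Re w - Im w) / 4"
  define \<sigma> where "\<sigma> = Re w + Im w"
  have "\<bar>Re w - Im w\<bar> \<le> 1" "\<sigma> = 1 \<or> \<sigma> = -1"
    using w(1) by (auto simp: nonseifert_chords_eq in_chord_def out_chord_def \<sigma>_def)
  then have \<sigma>: "\<sigma> \<in> {1, -1}" "Re w + Im w = \<sigma>" "\<bar>q\<bar> \<le> 1/4" by (auto simp: \<sigma>_def q_def)
  define x where "x = \<sigma> * sqrt ((1 - q) / 2)"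
  have nn: "0 \<le> (1 - q) / 2" using \<sigma>(3) by auto
  have x2: "x\<^sup>2 = (1 - q) / 2" using \<sigma>(1) nn by (auto simp: x_def power_mult_distrib)
  then have "2 * x\<^sup>2 - 1 = - q" by simp
  then have b: "\<bar>2 * x\<^sup>2 - 1\<bar> \<le> 1/4" using \<sigma>(3) by simp
  have "y = Complex (\<sigma> / 4 * sqrt ((1 - q) / 2)) ((1 + q) / 4)"
    using w(2) \<sigma>(2) by (simp add: kink_chart_def Let_def q_def)
  also have "\<dots> = resolved_kink_path x"
    unfolding resolved_kink_path_def using b x2 by (simp add: max_def x_def complex_eq_iff)
  finally show "y \<in> resolved_kink_path ` {x. \<bar>2 * x\<^sup>2 - 1\<bar> \<le> 1/4}" using b by blast
next
  fix y assume "y \<in> resolved_kink_path ` {x. \<bar>2 * x\<^sup>2 - 1\<bar> \<le> 1/4}"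
  then obtain x where x: "\<bar>2 * x\<^sup>2 - 1\<bar> \<le> 1/4" "y = resolved_kink_path x" by blast
  define \<sigma> where "\<sigma> = (if 0 \<le> x then 1 else -1 :: real)"
  define d where "d = 4 * (1 - 2 * x\<^sup>2)"
  define w where "w = Complex ((\<sigma> + d) / 2) ((\<sigma> - d) / 2)"
  have d: "\<bar>d\<bar> \<le> 1" using x(1) by (simp add: d_def abs_if split: if_splits)
  moreover have "Re w + Im w = \<sigma>" by (simp add: w_def field_simps)
  ultimately have "w \<in> nonseifert_chords"
    by (simp add: nonseifert_chords_eq in_chord_def out_chord_def) (auto simp: w_def \<sigma>_def)
  moreover have "kink_chart w = y"
  proof -
    have e: "(Re w - Im w) / 4 = 1 - 2 * x\<^sup>2" "(Re w + Im w) / 4 = \<sigma> / 4" by (simp_all add: w_def d_def field_simps)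
    have "sqrt ((1 - (1 - 2 * x\<^sup>2)) / 2) = \<bar>x\<bar>" by simp
    then have "kink_chart w = Complex (\<sigma> / 4 * \<bar>x\<bar>) ((1 + (1 - 2 * x\<^sup>2)) / 4)"
      by (simp only: kink_chart_def Let_def e)
    also have "\<dots> = y" using x by (simp add: resolved_kink_path_def max_def \<sigma>_def complex_eq_iff)
    finally show ?thesis .
  qed
  ultimately show "y \<in> kink_chart ` nonseifert_chords" by blast
qed

section \<open>The homeomorphism of the disk for the first move\<close>

lemma unit_sqrt_facts:
  fixes x :: real
  assumes "-1 \<le> x" "x \<le> 1"
  shows "0 \<le> sqrt (1 - x\<^sup>2)" "sqrt (1 - x\<^sup>2) * sqrt (1 - x\<^sup>2) = 1 - x\<^sup>2" "sqrt (1 - x\<^sup>2) \<le> 1"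
proof -
  have "0 \<le> 1 - x\<^sup>2" using assms by (auto simp: abs_square_le_1)
  then show "0 \<le> sqrt (1 - x\<^sup>2)" "sqrt (1 - x\<^sup>2) * sqrt (1 - x\<^sup>2) = 1 - x\<^sup>2" "sqrt (1 - x\<^sup>2) \<le> 1" by auto
qed

lemma lift_segment:
  obtains G where "disk_homeo G" "\<And>x. x \<in> {-1..1} \<Longrightarrow> G (of_real x) = Complex x ((1 - x\<^sup>2) / 2)"
proof -
  interpret F: fibre_nodes "\<lambda>x. - sqrt (1 - x\<^sup>2)" "\<lambda>x. 0" "\<lambda>x. (1 - x\<^sup>2) / 2" "\<lambda>x. sqrt (1 - x\<^sup>2)"
  proof
    fix x :: real assume x: "-1 \<le> x" "x \<le> 1"
    define R where "R = sqrt (1 - x\<^sup>2)"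
    have R: "0 \<le> R" "R * R = 1 - x\<^sup>2" "R \<le> 1" using unit_sqrt_facts[OF x] by (simp_all add: R_def)
    \<comment> \<open>Half the square of the height \<open>R \<le> 1\<close> of the circle: strictly
      between \<open>- R\<close> and \<open>R\<close> unless \<open>R = 0\<close>.\<close>
    have m: "(1 - x\<^sup>2) / 2 = R * R / 2" using R by simp
    have RR: "R * R \<le> R" by (rule mult_left_le[OF R(3,1)])
    show "- sqrt (1 - x\<^sup>2) \<le> 0 \<and> 0 \<le> sqrt (1 - x\<^sup>2) \<and> - sqrt (1 - x\<^sup>2) \<le> (1 - x\<^sup>2) / 2 \<and> (1 - x\<^sup>2) / 2 \<le> sqrt (1 - x\<^sup>2)"
      unfolding R_def[symmetric] m(1) using R(1) RR by (auto intro: order_trans[of _ 0])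
    have "- R = R * R / 2 \<longleftrightarrow> R = 0"
      using R by (metis add.inverse_neutral divide_eq_0_iff divide_nonneg_nonneg le_minus_iff minus_equation_iff mult_zero_left order_antisym zero_le_mult_iff zero_le_numeral)
    moreover have "R = R * R / 2 \<longleftrightarrow> R = 0"
      using R(3) by auto
    ultimately show "(- sqrt (1 - x\<^sup>2) = 0 \<longleftrightarrow> - sqrt (1 - x\<^sup>2) = (1 - x\<^sup>2) / 2) \<and>
      (sqrt (1 - x\<^sup>2) = 0 \<longleftrightarrow> sqrt (1 - x\<^sup>2) = (1 - x\<^sup>2) / 2)"
      unfolding R_def[symmetric] m(1) by auto
  qed (auto intro!: continuous_intros)
  have "F.fibre_map (of_real x) = Complex x ((1 - x\<^sup>2) / 2)" if "x \<in> {-1..1}" for x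
    using F.fibre_map_node[of x] that by (simp add: complex_of_real_def)
  then show ?thesis using that F.disk_homeo_fibre_map by blast
qed

text \<open>The arch and the resolved kink have the same height at each parameter, so a horizontal
  displacement suffices, and conjugation by \<open>\<i>\<close> makes it vertical. The two halves of
  the arch are moved by separate fibre maps.\<close>

lemma widen_arch:
  obtains G where "disk_homeo G"
    "\<And>x. x \<in> {-1..1} \<Longrightarrow> G (Complex x ((1 - x\<^sup>2) / 2)) = resolved_kink_path x"
proof -
  define R where "R y = sqrt (1 - y\<^sup>2)" for y :: real
  \<comment> \<open>After the turn the arch has first coordinate
    \<open>y = - ((1 - x\<^sup>2) / 2)\<close>, whence \<open>1 + 2 * y = x\<^sup>2\<close> and
    \<open>4 * y + 1 = 2 * x\<^sup>2 - 1\<close>. The minima and the maximum with 0 extend both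
    nodes to all of [-1, 1].\<close>
  define n where "n y = min (R y) (sqrt (max 0 (1 + 2 * y)))" for y :: real
  define m where "m y = n y * min 1 (max \<bar>4 * y + 1\<bar> (1/4))" for y :: real
  have R: "0 \<le> R y" "R y * R y = 1 - y\<^sup>2" if "-1 \<le> y" "y \<le> 1" for y
    using unit_sqrt_facts[OF that] by (simp_all add: R_def)
  have n: "0 \<le> n y" "n y \<le> R y" if "-1 \<le> y" "y \<le> 1" for y using R(1)[OF that] by (auto simp: n_def)
  have m: "0 \<le> m y" "m y \<le> n y" "m y = 0 \<longleftrightarrow> n y = 0" if "-1 \<le> y" "y \<le> 1" for y
    using n[OF that] by (auto simp: m_def intro: mult_left_le)
  \<comment> \<open>For \<open>y \<ge> 0\<close> the factor in \<open>m\<close> is 1, so the nodes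
    agree; for \<open>y < 0\<close> the node \<open>n\<close> reaches the circle only where
    \<open>R y = 0\<close>.\<close>
  have full: "m y = R y" if y: "-1 \<le> y" "y \<le> 1" and e: "n y = R y" for y
  proof -
    have le: "R y \<le> sqrt (max 0 (1 + 2 * y))" using e by (auto simp: n_def min_def split: if_splits)
    then have "(R y)\<^sup>2 \<le> (sqrt (max 0 (1 + 2 * y)))\<^sup>2" using R(1)[OF y] by (intro power_mono)
    then have sq: "1 - y\<^sup>2 \<le> max 0 (1 + 2 * y)" using R(2)[OF y] by (simp add: power2_eq_square)
    show ?thesis
    proof (cases "0 \<le> y")
      case True
      then show ?thesis using e by (simp add: m_def)
    next
      case False
      have "R y = 0"
      proof (cases "1 + 2 * y \<le> 0")
        case True
        then have "R y * R y \<le> 0" using sq R(2)[OF y] by simp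
        then show ?thesis by (metis mult_eq_0_iff order_antisym zero_le_square)
      next
        case F: False
        have "1 - y\<^sup>2 \<le> 1 + 2 * y" using sq F by simp
        then have "0 \<le> y * (2 + y)" by (simp add: power2_eq_square algebra_simps)
        then have False using False y by (simp add: zero_le_mult_iff)
        then show ?thesis ..
      qed
      then show ?thesis using e by (simp add: m_def)
    qed
  qed
  have cont: "continuous_on {-1..1} R" "continuous_on {-1..1} n" "continuous_on {-1..1} m"
  proof -
    show R: "continuous_on {-1..1} R" unfolding R_def[abs_def] by (intro continuous_intros)
    show n: "continuous_on {-1..1} n" unfolding n_def[abs_def] by (intro continuous_intros R)
    show "continuous_on {-1..1} m" unfolding m_def[abs_def] by (intro continuous_intros n)
  qed
  interpret P: fibre_nodes "\<lambda>y. 0" n m R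
  proof
    fix y :: real assume y: "-1 \<le> y" "y \<le> 1"
    show "- sqrt (1 - y\<^sup>2) \<le> 0 \<and> R y \<le> sqrt (1 - y\<^sup>2)" using R(1)[OF y] by (simp add: R_def)
    show "0 \<le> n y \<and> n y \<le> R y \<and> 0 \<le> m y \<and> m y \<le> R y" using n[OF y] m[OF y] by auto
    show "(0 = n y \<longleftrightarrow> 0 = m y) \<and> (R y = n y \<longleftrightarrow> R y = m y)"
      using n[OF y] m[OF y] full[OF y] by (metis order_antisym)
  qed (auto intro: cont)
  interpret N: fibre_nodes "\<lambda>y. - R y" "\<lambda>y. - n y" "\<lambda>y. - m y" "\<lambda>y. 0"
  proof
    fix y :: real assume y: "-1 \<le> y" "y \<le> 1"
    show "- sqrt (1 - y\<^sup>2) \<le> - R y \<and> 0 \<le> sqrt (1 - y\<^sup>2)" using R(1)[OF y] by (simp add: R_def)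
    show "- R y \<le> - n y \<and> - n y \<le> 0 \<and> - R y \<le> - m y \<and> - m y \<le> 0" using n[OF y] m[OF y] by auto
    show "(- R y = - n y \<longleftrightarrow> - R y = - m y) \<and> (0 = - n y \<longleftrightarrow> 0 = - m y)"
      using n[OF y] m[OF y] full[OF y] by (metis neg_equal_0_iff_equal neg_equal_iff_equal order_antisym)
  qed (auto intro: cont continuous_on_minus)
  define F where "F = P.fibre_map \<circ> N.fibre_map"
  have dF: "disk_homeo F" unfolding F_def by (rule disk_homeo_compose[OF P.disk_homeo_fibre_map N.disk_homeo_fibre_map])
  have "F (Complex x ((1 - x\<^sup>2) / 2) * \<i>) / \<i> = resolved_kink_path x" if x: "x \<in> {-1..1}" for x
  proof -
    define y where "y = - ((1 - x\<^sup>2) / 2)"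
    have x2: "x\<^sup>2 \<le> 1" using x by (auto simp: abs_square_le_1)
    have y: "-1 \<le> y" "y \<le> 1" "y \<le> 0" using x2 by (auto simp: y_def intro: order_trans[of _ 0])
    have y1: "1 + 2 * y = x\<^sup>2" by (simp add: y_def field_simps)
    have sx: "sqrt (max 0 (1 + 2 * y)) = \<bar>x\<bar>" unfolding y1 by simp
    have "\<bar>x\<bar> \<le> R y"
    proof -
      have "y * y \<le> - y * 1" using y by (metis minus_mult_minus mult_left_mono neg_0_le_iff_le minus_le_iff)
      then have "\<bar>x\<bar>\<^sup>2 \<le> 1 - y\<^sup>2" using y y1 by (simp add: power2_eq_square)
      then show ?thesis unfolding R_def by (rule real_le_rsqrt)
    qed
    then have nx: "n y = \<bar>x\<bar>" unfolding n_def sx by simp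
    have y4: "4 * y + 1 = 2 * x\<^sup>2 - 1" by (simp add: y_def field_simps)
    have "\<bar>2 * x\<^sup>2 - 1\<bar> \<le> 1" using x2 zero_le_power2[of x] by linarith
    then have mx: "m y = \<bar>x\<bar> * max \<bar>2 * x\<^sup>2 - 1\<bar> (1/4)" unfolding m_def nx y4 by simp
    have z: "Complex x ((1 - x\<^sup>2) / 2) * \<i> = Complex y x" by (simp add: y_def complex_eq_iff)
    have "F (Complex y x) = Complex y (x * max \<bar>2 * x\<^sup>2 - 1\<bar> (1/4))"
    proof (cases "0 \<le> x")
      case True
      then have "N.fibre_map (Complex y x) = Complex y (n y)" using y nx by (simp add: N.fibre_map_outside)
      then show ?thesis using P.fibre_map_node[OF y(1,2)] True mx by (simp add: F_def)
    next
      case False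
      then have "N.fibre_map (Complex y x) = Complex y (- m y)" using N.fibre_map_node[OF y(1,2)] nx by simp
      moreover have "P.fibre_map (Complex y (- m y)) = Complex y (- m y)"
        using y m(1)[OF y(1,2)] by (intro P.fibre_map_outside) auto
      ultimately show ?thesis using False mx by (simp add: F_def)
    qed
    then show ?thesis unfolding z by (simp add: resolved_kink_path_def complex_eq_iff y_def)
  qed
  then show ?thesis using that[OF disk_homeo_conjugate[OF dF, of \<i>]] by simp
qed

lemma segment_to_resolved_kink:
  obtains G where "disk_homeo G" "\<And>x. x \<in> {-1..1} \<Longrightarrow> G (of_real x) = resolved_kink_path x"
proof -
  obtain F where F: "disk_homeo F" "\<And>x. x \<in> {-1..1} \<Longrightarrow> F (of_real x) = Complex x ((1 - x\<^sup>2) / 2)"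
    by (rule lift_segment) blast
  obtain H where H: "disk_homeo H" "\<And>x. x \<in> {-1..1} \<Longrightarrow> H (Complex x ((1 - x\<^sup>2) / 2)) = resolved_kink_path x"
    by (rule widen_arch) blast
  show ?thesis using that[OF disk_homeo_compose[OF H(1) F(1)]] F(2) H(2) by simp
qed

lemma kink_path_norm:
  assumes "\<bar>x\<bar> < 1"
  shows "norm (kink_path x) < 1"
proof (rule norm_less_1_if_squares)
  define u where "u = x\<^sup>2"
  have u: "0 \<le> u" "u < 1" using assms by (simp_all add: u_def abs_square_less_1)
  have "(2 * u - 1)\<^sup>2 \<le> 1" using u by (simp add: abs_square_le_1 abs_le_iff)
  then have "u * (2 * u - 1)\<^sup>2 \<le> u * 1" using u by (intro mult_left_mono)
  moreover have "(1 - u)\<^sup>2 < 1 - u + 3 * (1 - u)" using u by (simp add: power2_eq_square algebra_simps)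
    (smt (verit) mult_left_le mult_nonneg_nonneg)
  moreover have "(Re (kink_path x))\<^sup>2 = u * (2 * u - 1)\<^sup>2" "(Im (kink_path x))\<^sup>2 = (1 - u)\<^sup>2 / 4"
    by (simp_all add: kink_path_alt u_def power_mult_distrib power_divide)
  ultimately show "(Re (kink_path x))\<^sup>2 + (Im (kink_path x))\<^sup>2 < 1" by simp
qed

text \<open>For other \<open>x\<close> the two paths agree. In this range
  \<open>x\<^sup>2 < 5/8\<close>, and the squared norms are at most \<open>5/8 + 3/32\<close>, which
  is below \<open>(9/10)\<^sup>2\<close>.\<close>

lemma kink_path_small:
  assumes "2 * x\<^sup>2 - 1 < 1/4"
  shows "norm (kink_path x) \<le> 9/10" "norm (resolved_kink_path x) \<le> 9/10"
proof -
  define u where "u = x\<^sup>2"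
  have u: "0 \<le> u" "u < 5/8" using assms by (auto simp: u_def)
  have b: "u * c\<^sup>2 + ((1 - u) / 2)\<^sup>2 \<le> (9/10)\<^sup>2" if c: "\<bar>c\<bar> \<le> 1" for c
  proof -
    have "c\<^sup>2 \<le> 1" using c by (simp add: abs_square_le_1)
    then have "u * c\<^sup>2 \<le> u" using u(1) by (simp add: mult_left_le)
    moreover have "(1 - u)\<^sup>2 \<le> 1 - u" using u by (simp add: power2_eq_square mult_left_le)
    ultimately have "u * c\<^sup>2 + (1 - u)\<^sup>2 / 4 \<le> u + (1 - u) / 4" by (intro add_mono divide_right_mono) simp_all
    also have "\<dots> \<le> 81/100" using u(2) by (simp add: field_simps)
    also have "81/100 = (9/10::real)\<^sup>2" by (simp add: power2_eq_square)
    finally show ?thesis by (simp add: power_divide)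
  qed
  have c: "\<bar>2 * u - 1\<bar> \<le> 1" using u by auto
  show "norm (kink_path x) \<le> 9/10" using b[OF c]
    by (intro norm_le_if_squares) (simp_all add: kink_path_alt u_def power_mult_distrib)
  have "\<bar>max \<bar>2 * u - 1\<bar> (1/4)\<bar> \<le> 1" using c by auto
  from b[OF this] show "norm (resolved_kink_path x) \<le> 9/10"
    by (intro norm_le_if_squares) (simp_all add: resolved_kink_path_def u_def power_mult_distrib)
qed

text \<open>In the loop the resolved path follows the kink backwards: smoothing against the
  orientation reverses the loop and keeps a single arc.\<close>

lemma resolved_kink_path_eq:
  "1/4 \<le> 2 * x\<^sup>2 - 1 \<Longrightarrow> resolved_kink_path x = kink_path x"
  "2 * x\<^sup>2 - 1 \<le> - (1/4) \<Longrightarrow> resolved_kink_path x = kink_path (- x)"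
  by (simp_all add: resolved_kink_path_def kink_path_alt algebra_simps)

lemma resolved_kink_eq:
  "resolved_kink_path ` {-1..1} = (kink_path ` {-1..1} - kink_chart ` cball 0 1) \<union> kink_chart ` nonseifert_chords"
proof (intro equalityI subsetI)
  fix y assume "y \<in> resolved_kink_path ` {-1..1}"
  then obtain x where x: "x \<in> {-1..1}" "y = resolved_kink_path x" by blast
  show "y \<in> (kink_path ` {-1..1} - kink_chart ` cball 0 1) \<union> kink_chart ` nonseifert_chords"
  proof (cases "\<bar>2 * x\<^sup>2 - 1\<bar> \<le> 1/4")
    case True
    then show ?thesis unfolding kink_chart_chords using x by blast
  next
    case False
    then have "1/4 \<le> 2 * x\<^sup>2 - 1 \<or> 2 * x\<^sup>2 - 1 \<le> - (1/4)" by linarith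
    then have "\<exists>x'. (x' = x \<or> x' = - x) \<and> y = kink_path x'" using resolved_kink_path_eq x(2) by blast
    then obtain x' where "x' = x \<or> x' = - x" "y = kink_path x'" by blast
    then show ?thesis using x(1) False kink_chart_mem[of x'] by auto
  qed
next
  fix y assume "y \<in> (kink_path ` {-1..1} - kink_chart ` cball 0 1) \<union> kink_chart ` nonseifert_chords"
  then show "y \<in> resolved_kink_path ` {-1..1}"
  proof
    assume "y \<in> kink_path ` {-1..1} - kink_chart ` cball 0 1"
    then obtain x where x: "x \<in> {-1..1}" "y = kink_path x" "\<not> \<bar>2 * x\<^sup>2 - 1\<bar> \<le> 1/4"
      using kink_chart_mem by auto
    then have "1/4 \<le> 2 * x\<^sup>2 - 1 \<or> 2 * x\<^sup>2 - 1 \<le> - (1/4)" by linarith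
    then have "y = resolved_kink_path x \<or> y = resolved_kink_path (- x)"
      using resolved_kink_path_eq(1)[of x] resolved_kink_path_eq(2)[of "- x"] x(2) by auto
    then show ?thesis
    proof
      assume "y = resolved_kink_path x"
      then show ?thesis using x(1) by blast
    next
      assume "y = resolved_kink_path (- x)"
      then show ?thesis using x(1) by (intro image_eqI[of _ _ "- x"]) auto
    qed
  next
    assume "y \<in> kink_chart ` nonseifert_chords"
    then obtain x where x: "\<bar>2 * x\<^sup>2 - 1\<bar> \<le> 1/4" "y = resolved_kink_path x" unfolding kink_chart_chords by blast
    have "x\<^sup>2 \<le> 1" using x(1) by linarith
    then have "x \<in> {-1..1}" by (simp add: abs_square_le_1 abs_le_iff)
    then show ?thesis using x(2) by blast
  qed
qed

lemma kink_path_at_double: "x\<^sup>2 = 1/2 \<Longrightarrow> kink_path x = \<i> / 4"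
  unfolding kink_path_alt by (simp add: complex_eq_iff)

lemma kink_path_double:
  assumes "s \<noteq> t" "kink_path s = w" "kink_path t = w"
  shows "w = \<i> / 4"
proof -
  have "s\<^sup>2 = t\<^sup>2" using assms by (auto simp: kink_path_def)
  then have t: "t = - s" using assms(1) by (auto simp: power2_eq_iff)
  then have "s \<noteq> 0" using assms(1) by auto
  have "s * (2 * s\<^sup>2 - 1) = t * (2 * t\<^sup>2 - 1)" using assms(2,3) by (auto simp: kink_path_alt)
  then have "s * (2 * s\<^sup>2 - 1) = 0" using t by simp
  then have "s\<^sup>2 = 1/2" using \<open>s \<noteq> 0\<close> by simp
  from kink_path_at_double[OF this] show ?thesis using assms(2) by simp
qed

lemma RI_move_arrangements:
  assumes "knot_curve \<gamma>" and "RI_move (range \<gamma>) P'"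
  shows "\<exists>C C'. curve_arrangement (range \<gamma>) C \<and> curve_arrangement P' C' \<and> isotopic C C'"
proof -
  obtain \<phi> where hP: "disk_embedding \<phi>" "range \<gamma> \<inter> \<phi> ` cball 0 1 = \<phi> ` closed_segment (-1) 1"
    "P' \<inter> \<phi> ` cball 0 1 = \<phi> ` kink" "range \<gamma> - \<phi> ` cball 0 1 = P' - \<phi> ` cball 0 1"
    using assms(2) unfolding RI_move_def replaces_in_disk_def by (elim exE conjE)
  define X where "X = complex_of_real ` {-1..1}"
  \<comment> \<open>It is enough to treat a curve that runs along the segment from -1 to 1; one that
    runs the other way is reversed.\<close>
  have main: ?thesis if "knot_curve \<gamma>'" and rg: "range \<gamma>' = range \<gamma>" and dir: "traverses \<gamma>' (\<lambda>x. \<phi> (of_real x))"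
    and nd: "\<And>x. x \<in> {-1<..<1} \<Longrightarrow> \<phi> (of_real x) \<notin> double_points \<gamma>'" for \<gamma>'
  proof -
    interpret knot_curve \<gamma>' by fact
    obtain G where hG: "disk_homeo G" "\<And>x. x \<in> {-1..1} \<Longrightarrow> G (of_real x) = resolved_kink_path x"
      by (rule segment_to_resolved_kink) blast
    have sq: "x\<^sup>2 = y\<^sup>2 \<longleftrightarrow> x = y \<or> x = - y" for x y :: real by (rule power2_eq_iff)
    interpret disk_modification \<gamma>' \<phi> X G "\<lambda>z. kink_path (Re z)" "9/10" "{\<i> / 4}"
    proof
      show "disk_embedding \<phi>" "disk_homeo G" by (fact hP(1), fact hG(1))
      show "X \<subseteq> cball 0 1" by (auto simp: X_def)
      show in': "range \<gamma>' \<inter> \<phi> ` cball 0 1 = \<phi> ` X" using hP(2) rg by (simp add: X_def real_axis_eq)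
      show "double_points \<gamma>' \<inter> \<phi> ` ball 0 1 = {}"
      proof (rule ccontr)
        assume "double_points \<gamma>' \<inter> \<phi> ` ball 0 1 \<noteq> {}"
        then obtain z where z: "\<phi> z \<in> double_points \<gamma>'" "norm z < 1" by auto
        then have "\<phi> z \<in> \<phi> ` X" using in' double_points_subset[of \<gamma>'] by auto
        then obtain x where x: "x \<in> {-1..1}" "\<phi> z = \<phi> (of_real x)" by (auto simp: X_def)
        have "z = of_real x"
          using hP(1) x z(2) by (auto simp: disk_embedding_def dest!: inj_onD)
        then have "x \<in> {-1<..<1}" using z(2) by auto
        then show False using nd x z by auto
      qed
      show "continuous_on X (\<lambda>z. kink_path (Re z))"
        unfolding kink_path_def Complex_eq by (intro continuous_intros) auto
      fix z assume z: "z \<in> X"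
      then obtain x where x: "x \<in> {-1..1}" "z = of_real x" by (auto simp: X_def)
      show "kink_path (Re z) = z" if "norm z = 1"
        using that x by (auto simp: kink_path_def complex_eq_iff abs_if split: if_splits)
      show "norm (kink_path (Re z)) < 1" if "norm z < 1" using that x kink_path_norm by simp
      show "norm (kink_path (Re z)) \<le> 9/10 \<and> norm (G z) \<le> 9/10" if ne: "kink_path (Re z) \<noteq> G z"
      proof -
        have "2 * x\<^sup>2 - 1 < 1/4"
        proof (rule ccontr)
          assume "\<not> 2 * x\<^sup>2 - 1 < 1/4"
          then show False using ne hG(2)[OF x(1)] x resolved_kink_path_eq(1)[of x] by simp
        qed
        then show ?thesis using kink_path_small hG(2)[OF x(1)] x by simp
      qed
    next
      fix w
      show "w \<in> {\<i> / 4} \<longleftrightarrow> (\<exists>z\<in>X. \<exists>z'\<in>X. z \<noteq> z' \<and> kink_path (Re z) = w \<and> kink_path (Re z') = w)"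
      proof
        assume w: "w \<in> {\<i> / 4}"
        define s :: real where "s = sqrt (1/2)"
        have s: "s\<^sup>2 = 1/2" "(- s)\<^sup>2 = 1/2" "0 < s" "s \<le> 1" by (simp_all add: s_def)
        have "w = \<i> / 4" using w by blast
        then have kw: "kink_path s = w" "kink_path (- s) = w"
          using kink_path_at_double[OF s(1)] kink_path_at_double[OF s(2)] by (simp_all only:)
        have "of_real s \<in> X" "of_real (- s) \<in> X" unfolding X_def using s(3,4) by (auto simp del: of_real_minus)
        moreover have "complex_of_real s \<noteq> of_real (- s)" using s(3) by (simp add: complex_eq_iff)
        ultimately show "\<exists>z\<in>X. \<exists>z'\<in>X. z \<noteq> z' \<and> kink_path (Re z) = w \<and> kink_path (Re z') = w"
          using kw by (intro bexI[of _ "of_real s"] bexI[of _ "of_real (- s)"]) simp_all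
      next
        assume "\<exists>z\<in>X. \<exists>z'\<in>X. z \<noteq> z' \<and> kink_path (Re z) = w \<and> kink_path (Re z') = w"
        then obtain s t where "s \<noteq> t" "kink_path s = w" "kink_path t = w" by (auto simp: X_def)
        then show "w \<in> {\<i> / 4}" using kink_path_double by blast
      qed
    next
      fix x y z assume xyz: "x \<in> X" "y \<in> X" "z \<in> X" "kink_path (Re x) = kink_path (Re y)" "kink_path (Re y) = kink_path (Re z)"
      then have "(Re x)\<^sup>2 = (Re y)\<^sup>2" "(Re y)\<^sup>2 = (Re z)\<^sup>2" by (simp_all add: kink_path_def)
      then show "x = y \<or> y = z \<or> x = z" using xyz(1-3) by (auto simp: sq X_def)
    qed (auto simp: norm_divide)
    have \<tau>X: "(\<lambda>z. kink_path (Re z)) ` X = kink_path ` {-1..1}" by (simp add: X_def image_image)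
    have GX: "G ` X = resolved_kink_path ` {-1..1}"
      unfolding X_def image_image by (rule image_cong) (use hG(2) in auto)
    have path: "traverses modified (\<lambda>x. \<phi> (kink_path x))"
      using traverses_modified[OF dir] by (simp add: X_def)
    \<comment> \<open>Both axes of the kink chart are stretches of the kink with increasing
      parameter, so the chart has the orientation that a crossing chart demands.\<close>
    have sm: "strict_mono_on {-1..1} (\<lambda>s. - sqrt ((1 - s / 4) / 2))" "strict_mono_on {-1..1} (\<lambda>s. sqrt ((1 + s / 4) / 2))"
      by (auto intro!: strict_mono_onI)
    have ct: "continuous_on {-1..1} (\<lambda>s::real. - sqrt ((1 - s / 4) / 2))" "continuous_on {-1..1} (\<lambda>s::real. sqrt ((1 + s / 4) / 2))"
      by (auto intro!: continuous_intros)
    have t1: "traverses modified (\<lambda>s. \<phi> (kink_chart (of_real s)))"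
      by (rule traverses_cong[OF traverses_reparametrize[OF path ct(1) sm(1)]]) (auto simp: kink_chart_real_axis intro: real_le_lsqrt order_trans[of "-1" 0])
    have t2: "traverses modified (\<lambda>s. \<phi> (kink_chart (\<i> * of_real s)))"
      by (rule traverses_cong[OF traverses_reparametrize[OF path ct(2) sm(2)]]) (auto simp: kink_chart_real_axis intro: real_le_lsqrt order_trans[of "-1" 0])
    have inc: "kink_chart ` cball 0 1 \<subseteq> cball 0 1"
      using kink_chart_facts(3) by (rule order_trans) (rule subset_cball, simp)
    have "crossing_chart modified (\<phi> (kink_chart 0)) (\<phi> \<circ> kink_chart)"
      by (rule modified_chartI[OF kink_chart_facts(1,2) inc _ t1 t2]) (simp only: \<tau>X kink_chart_cross)
    then have "\<exists>C C'. curve_arrangement (range \<gamma>') C \<and> curve_arrangement (range modified) C' \<and> isotopic C C'"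
    proof (intro modified_arrangement[of "\<lambda>_. kink_chart"])
      assume c: "crossing_chart modified (\<phi> (kink_chart 0)) (\<phi> \<circ> kink_chart)"
      fix w assume "w \<in> {\<i> / 4}"
      then have "w = kink_chart 0" unfolding kink_chart_facts(4) by blast
      then show "crossing_chart modified (\<phi> w) (\<phi> \<circ> kink_chart)" using c by simp
    next
      fix w w' assume "w \<in> {\<i> / 4}" "w' \<in> {\<i> / 4}" "w \<noteq> w'"
      then show "kink_chart ` cball 0 1 \<inter> kink_chart ` cball 0 1 = {}" by blast
    next
      show "kink_chart ` cball 0 1 \<subseteq> cball 0 (9/10)" by (fact kink_chart_facts(3))
      show "G ` X = (\<lambda>z. kink_path (Re z)) ` X - (\<Union>w\<in>{\<i> / 4}. kink_chart ` cball 0 1) \<union>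
          (\<Union>w\<in>{\<i> / 4}. kink_chart ` nonseifert_chords)"
        by (simp add: \<tau>X GX resolved_kink_eq)
    qed
    moreover have "range modified = P'"
    proof -
      have "kink = kink_path ` {-1..1}" by (simp add: kink_def kink_path_def[abs_def])
      then have "range modified = (P' - \<phi> ` cball 0 1) \<union> (P' \<inter> \<phi> ` cball 0 1)"
        unfolding range_modified \<tau>X rg using hP(3,4) by simp
      then show ?thesis by blast
    qed
    ultimately show ?thesis using rg by simp
  qed
  interpret knot_curve \<gamma> by fact
  have seg: "closed_segment (-1) 1 \<subseteq> cball (0::complex) 1" "complex_of_real ` {-1..1} \<subseteq> closed_segment (-1) 1"
    "closed (closed_segment (-1) 1 - complex_of_real ` {-1..1})"
    by (auto simp: real_axis_eq)
  have "inj_on complex_of_real {-1..1}" "continuous_on {-1..1} complex_of_real"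
    "norm (complex_of_real (-1)) = 1" "norm (complex_of_real 1) = 1"
    "\<And>x. x \<in> {-1<..<1} \<Longrightarrow> norm (complex_of_real x) < 1"
    by (auto simp: inj_on_def intro!: continuous_intros)
  note arc = traverses_disk_arc[OF hP(1,2) seg(1) this(2,1) seg(2) this(3,4,5) seg(3)]
  from arc(1) show ?thesis
  proof
    assume "traverses \<gamma> (\<lambda>x. \<phi> (of_real x))"
    then show ?thesis by (rule main[OF assms(1) refl _ arc(2)])
  next
    assume "traverses \<gamma> (\<lambda>x. \<phi> (of_real (- x)))"
    then have "traverses (\<lambda>t. \<gamma> (- t)) (\<lambda>x. \<phi> (of_real x))" by (rule traverses_reverse)
    then show ?thesis by (rule main[OF reverse(1) range_reverse]) (use arc(2) reverse(2) in auto)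
  qed
qed

subsection \<open>The second Reidemeister move\<close>

text \<open>Both maps act on the chords \<open>Im z = \<plusminus> 1/2\<close>. In the coordinate \<open>q = (Re z)\<^sup>2 - 1/4\<close> the
  crossing arcs are \<open>\<bar>y\<bar> = \<bar>q\<bar>\<close>; resolving both crossings by horizontal chords gives
  \<open>\<bar>y\<bar> = max \<bar>q\<bar> (1/8)\<close>, that is two disjoint arcs again.\<close>

definition cross_over :: "complex \<Rightarrow> complex" where
  "cross_over z = Complex (Re z) (2 * Im z * ((Re z)\<^sup>2 - 1/4))"

definition squeeze :: "complex \<Rightarrow> complex" where
  "squeeze z = Complex (Re z) (2 * Im z * max \<bar>(Re z)\<^sup>2 - 1/4\<bar> (1/8))"

text \<open>The signs \<open>j\<close> and \<open>\<sigma>\<close> select the crossing \<open>j / 2\<close> and the direction of the lower chord.\<close>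

definition bigon_chart :: "real \<Rightarrow> real \<Rightarrow> complex \<Rightarrow> complex" where
  "bigon_chart j \<sigma> w = Complex (j * sqrt (1/4 + j * (Re w + \<sigma> * Im w) / 8)) (j * (Re w - \<sigma> * Im w) / 8)"

text \<open>Half the length of a chord of the unit circle at distance 1/2 from the centre.\<close>

definition half_chord :: real where "half_chord = sqrt (3/4)"

lemma half_chord: "0 < half_chord" "half_chord\<^sup>2 = 3/4"
  by (simp_all add: half_chord_def)

lemma parallel_arcs_iff: "z \<in> parallel_arcs \<longleftrightarrow> (Re z)\<^sup>2 \<le> 3/4 \<and> \<bar>Im z\<bar> = 1/2"
proof -
  have "norm z \<le> 1 \<longleftrightarrow> (Re z)\<^sup>2 + (Im z)\<^sup>2 \<le> 1" by (simp add: cmod_def)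
  moreover have "(Im z)\<^sup>2 = 1/4" if "\<bar>Im z\<bar> = 1/2"
  proof -
    have "(Im z)\<^sup>2 = (1/2)\<^sup>2" using that by (metis power2_abs)
    then show ?thesis by (simp add: power_divide)
  qed
  ultimately show ?thesis by (auto simp: parallel_arcs_def)
qed

lemma parallel_arcs_norm: "z \<in> parallel_arcs \<Longrightarrow> norm z = 1 \<longleftrightarrow> (Re z)\<^sup>2 = 3/4"
proof -
  assume "z \<in> parallel_arcs"
  then have "\<bar>Im z\<bar> = 1/2" by (simp add: parallel_arcs_iff)
  then have "(Im z)\<^sup>2 = (1/2)\<^sup>2" by (metis power2_abs)
  then have "(Im z)\<^sup>2 = 1/4" by (simp add: power_divide)
  then show ?thesis by (auto simp: cmod_def)
qed

lemma square_bounds: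
  fixes x :: real
  shows "x\<^sup>2 \<le> 3/4 \<Longrightarrow> \<bar>x\<^sup>2 - 1/4\<bar> \<le> 1/2" "x\<^sup>2 < 3/8 \<Longrightarrow> \<bar>x\<^sup>2 - 1/4\<bar> \<le> 1/4"
proof -
  have "0 \<le> x\<^sup>2" by simp
  note nonneg = this
  show "\<bar>x\<^sup>2 - 1/4\<bar> \<le> 1/2" if "x\<^sup>2 \<le> 3/4" using that nonneg by linarith
  show "\<bar>x\<^sup>2 - 1/4\<bar> \<le> 1/4" if "x\<^sup>2 < 3/8" using that nonneg by linarith
qed

lemma sign_abs: "j \<in> {1, -1} \<Longrightarrow> \<bar>j * p / 8\<bar> = \<bar>p\<bar> / 8" for j p :: real
  by (auto simp: abs_mult)

lemma cross_over_image: "z \<in> cross_over ` parallel_arcs \<longleftrightarrow> (Re z)\<^sup>2 \<le> 3/4 \<and> \<bar>Im z\<bar> = \<bar>(Re z)\<^sup>2 - 1/4\<bar>"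
proof
  assume "z \<in> cross_over ` parallel_arcs"
  then show "(Re z)\<^sup>2 \<le> 3/4 \<and> \<bar>Im z\<bar> = \<bar>(Re z)\<^sup>2 - 1/4\<bar>"
    by (auto simp: parallel_arcs_iff cross_over_def abs_mult)
next
  assume z: "(Re z)\<^sup>2 \<le> 3/4 \<and> \<bar>Im z\<bar> = \<bar>(Re z)\<^sup>2 - 1/4\<bar>"
  define c :: real where "c = (if Im z = (Re z)\<^sup>2 - 1/4 then 1/2 else -1/2)"
  have "Im z = (Re z)\<^sup>2 - 1/4 \<or> Im z = - ((Re z)\<^sup>2 - 1/4)" using z by linarith
  then have "z = cross_over (Complex (Re z) c)" by (auto simp: cross_over_def complex_eq_iff c_def)
  moreover have "Complex (Re z) c \<in> parallel_arcs" using z by (simp add: parallel_arcs_iff c_def)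
  ultimately show "z \<in> cross_over ` parallel_arcs" by blast
qed

lemma squeeze_image: "z \<in> squeeze ` parallel_arcs \<longleftrightarrow> (Re z)\<^sup>2 \<le> 3/4 \<and> \<bar>Im z\<bar> = max \<bar>(Re z)\<^sup>2 - 1/4\<bar> (1/8)"
proof
  assume "z \<in> squeeze ` parallel_arcs"
  then show "(Re z)\<^sup>2 \<le> 3/4 \<and> \<bar>Im z\<bar> = max \<bar>(Re z)\<^sup>2 - 1/4\<bar> (1/8)"
    by (auto simp: parallel_arcs_iff squeeze_def abs_mult)
next
  assume z: "(Re z)\<^sup>2 \<le> 3/4 \<and> \<bar>Im z\<bar> = max \<bar>(Re z)\<^sup>2 - 1/4\<bar> (1/8)"
  define c :: real where "c = (if 0 \<le> Im z then 1/2 else -1/2)"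
  have "z = squeeze (Complex (Re z) c)" using z by (auto simp: squeeze_def complex_eq_iff c_def)
  moreover have "Complex (Re z) c \<in> parallel_arcs" using z by (simp add: parallel_arcs_iff c_def)
  ultimately show "z \<in> squeeze ` parallel_arcs" by blast
qed

text \<open>The difference to 1 factors as \<open>(3/4 - s) * (5/4 + s)\<close>. With
  \<open>s = x\<^sup>2\<close> this says that the parabolic arcs reach the circle exactly where the
  chords do.\<close>

lemma parabola_bound:
  fixes s :: real
  assumes "0 \<le> s"
  shows "s + (s - 1/4)\<^sup>2 \<le> 1 \<longleftrightarrow> s \<le> 3/4" "s + (s - 1/4)\<^sup>2 < 1 \<longleftrightarrow> s < 3/4"
proof -
  have e: "1 - (s + (s - 1/4)\<^sup>2) = (3/4 - s) * (5/4 + s)" by (simp add: power2_eq_square algebra_simps)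
  have "0 \<le> (3/4 - s) * (5/4 + s) \<longleftrightarrow> s \<le> 3/4" "0 < (3/4 - s) * (5/4 + s) \<longleftrightarrow> s < 3/4"
    using assms by (auto simp: zero_le_mult_iff zero_less_mult_iff)
  then show "s + (s - 1/4)\<^sup>2 \<le> 1 \<longleftrightarrow> s \<le> 3/4" "s + (s - 1/4)\<^sup>2 < 1 \<longleftrightarrow> s < 3/4"
    unfolding e[symmetric] by linarith+
qed

lemma crossing_arcs_eq: "crossing_arcs = cross_over ` parallel_arcs"
proof (rule set_eqI)
  fix z
  have "norm z \<le> 1 \<longleftrightarrow> (Re z)\<^sup>2 \<le> 3/4" if "\<bar>Im z\<bar> = \<bar>(Re z)\<^sup>2 - 1/4\<bar>"
  proof -
    have "(Im z)\<^sup>2 = ((Re z)\<^sup>2 - 1/4)\<^sup>2" using that by (metis power2_abs)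
    then show ?thesis using parabola_bound(1)[of "(Re z)\<^sup>2"] by (simp add: cmod_def)
  qed
  then show "z \<in> crossing_arcs \<longleftrightarrow> z \<in> cross_over ` parallel_arcs"
    unfolding cross_over_image crossing_arcs_def by auto
qed

text \<open>The squeezed arcs stay off the real axis, so the upper and the lower chord can be moved
  separately in their half disks.\<close>

lemma squeeze_disk_homeo:
  obtains G where "disk_homeo G" "\<And>z. z \<in> parallel_arcs \<Longrightarrow> G z = squeeze z"
proof -
  define R where "R x = sqrt (1 - x\<^sup>2)" for x :: real
  define n where "n x = min (R x) (1/2)" for x :: real
  define m where "m x = min (R x) (max \<bar>x\<^sup>2 - 1/4\<bar> (1/8))" for x :: real
  have R: "0 \<le> R x" "R x * R x = 1 - x\<^sup>2" if "-1 \<le> x" "x \<le> 1" for x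
    using unit_sqrt_facts[OF that] by (simp_all add: R_def)
  have small: "R x \<le> 1/2 \<longleftrightarrow> 3/4 \<le> x\<^sup>2" if "-1 \<le> x" "x \<le> 1" for x
  proof -
    have "R x \<le> 1/2 \<longleftrightarrow> (R x)\<^sup>2 \<le> (1/2)\<^sup>2" using R(1)[OF that] by (simp add: abs_le_square_iff[symmetric])
    then show ?thesis using R(2)[OF that] by (auto simp: power2_eq_square)
  qed
  \<comment> \<open>Chord and squeezed arc reach the circle over the same points: if
    \<open>x\<^sup>2 \<ge> 3/4\<close>, both heights are at least \<open>R x\<close>, and otherwise
    both are below it.\<close>
  have full: "R x = n x \<longleftrightarrow> R x = m x" if x: "-1 \<le> x" "x \<le> 1" for x
  proof (cases "3/4 \<le> x\<^sup>2")
    case True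
    then have "R x \<le> 1/2" "1/2 \<le> max \<bar>x\<^sup>2 - 1/4\<bar> (1/8)" using small[OF x] by auto
    moreover from this have "R x \<le> max \<bar>x\<^sup>2 - 1/4\<bar> (1/8)" by (rule order_trans)
    ultimately show ?thesis by (simp only: n_def m_def min_absorb1)
  next
    case False
    then have "\<bar>x\<^sup>2 - 1/4\<bar> < 1/2" using zero_le_power2[of x] by linarith
    then have "1/2 < R x" "max \<bar>x\<^sup>2 - 1/4\<bar> (1/8) < 1/2" using False small[OF x] by auto
    then show ?thesis by (auto simp: n_def m_def min_def)
  qed
  have nm: "0 \<le> n x" "n x \<le> R x" "0 \<le> m x" "m x \<le> R x" "n x = 0 \<longleftrightarrow> m x = 0" if x: "-1 \<le> x" "x \<le> 1" for x
    using R(1)[OF x] by (auto simp: n_def m_def min_def max_def)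
  have cont: "continuous_on {-1..1} R" "continuous_on {-1..1} n" "continuous_on {-1..1} m"
  proof -
    show R: "continuous_on {-1..1} R" unfolding R_def[abs_def] by (intro continuous_intros)
    show "continuous_on {-1..1} n" unfolding n_def[abs_def] by (intro continuous_intros R)
    show "continuous_on {-1..1} m" unfolding m_def[abs_def] by (intro continuous_intros R)
  qed
  interpret P: fibre_nodes "\<lambda>y. 0" n m R
  proof
    fix y :: real assume y: "-1 \<le> y" "y \<le> 1"
    show "- sqrt (1 - y\<^sup>2) \<le> 0 \<and> R y \<le> sqrt (1 - y\<^sup>2)" using R(1)[OF y] by (simp add: R_def)
    show "0 \<le> n y \<and> n y \<le> R y \<and> 0 \<le> m y \<and> m y \<le> R y" using nm[OF y] by auto
    show "(0 = n y \<longleftrightarrow> 0 = m y) \<and> (R y = n y \<longleftrightarrow> R y = m y)" using nm(5)[OF y] full[OF y] by auto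
  qed (auto intro: cont)
  interpret N: fibre_nodes "\<lambda>y. - R y" "\<lambda>y. - n y" "\<lambda>y. - m y" "\<lambda>y. 0"
  proof
    fix y :: real assume y: "-1 \<le> y" "y \<le> 1"
    show "- sqrt (1 - y\<^sup>2) \<le> - R y \<and> 0 \<le> sqrt (1 - y\<^sup>2)" using R(1)[OF y] by (simp add: R_def)
    show "- R y \<le> - n y \<and> - n y \<le> 0 \<and> - R y \<le> - m y \<and> - m y \<le> 0" using nm[OF y] by auto
    show "(- R y = - n y \<longleftrightarrow> - R y = - m y) \<and> (0 = - n y \<longleftrightarrow> 0 = - m y)" using nm(5)[OF y] full[OF y] by auto
  qed (auto intro: cont continuous_on_minus)
  define F where "F = P.fibre_map \<circ> N.fibre_map"
  have dF: "disk_homeo F" unfolding F_def by (rule disk_homeo_compose[OF P.disk_homeo_fibre_map N.disk_homeo_fibre_map])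
  have "F z = squeeze z" if z: "z \<in> parallel_arcs" for z
  proof -
    define x where "x = Re z"
    have x: "x\<^sup>2 \<le> 3/4" "\<bar>Im z\<bar> = 1/2" using z by (simp_all add: parallel_arcs_iff x_def)
    then have "x\<^sup>2 \<le> 1" by simp
    then have x1: "-1 \<le> x" "x \<le> 1" by (simp_all add: abs_square_le_1 abs_le_iff)
    have "1/2 \<le> R x" unfolding R_def by (rule real_le_rsqrt) (use x(1) in \<open>simp add: power2_eq_square\<close>)
    moreover have "max \<bar>x\<^sup>2 - 1/4\<bar> (1/8) \<le> 1/2" using square_bounds(1)[OF x(1)] by simp
    ultimately have "max \<bar>x\<^sup>2 - 1/4\<bar> (1/8) \<le> R x" by (rule order_trans[rotated])
    then have n: "n x = 1/2" and m: "m x = max \<bar>x\<^sup>2 - 1/4\<bar> (1/8)"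
      using \<open>1/2 \<le> R x\<close> by (simp_all only: n_def m_def min_absorb2)
    have "Im z = 1/2 \<or> Im z = - (1/2)" using x(2) by linarith
    then show ?thesis
    proof
      assume "Im z = 1/2"
      then have ze: "z = Complex x (n x)" unfolding n by (simp add: complex_eq_iff x_def)
      have "N.fibre_map z = z" unfolding ze by (rule N.fibre_map_outside) (use x1 n in auto)
      then have "F z = Complex x (m x)" using P.fibre_map_node[OF x1] ze by (simp add: F_def)
      then show ?thesis unfolding m squeeze_def x_def[symmetric] \<open>Im z = 1/2\<close> by simp
    next
      assume "Im z = - (1/2)"
      then have ze: "z = Complex x (- n x)" unfolding n by (simp add: complex_eq_iff x_def)
      have "N.fibre_map z = Complex x (- m x)" unfolding ze by (rule N.fibre_map_node[OF x1])
      moreover have "P.fibre_map (Complex x (- m x)) = Complex x (- m x)"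
        by (rule P.fibre_map_outside) (use x1 nm[OF x1] in auto)
      ultimately have "F z = Complex x (- m x)" by (simp add: F_def)
      then show ?thesis unfolding m squeeze_def x_def[symmetric] \<open>Im z = - (1/2)\<close> by simp
    qed
  qed
  then show ?thesis using that dF by blast
qed

text \<open>The square root is replaced by the coordinates \<open>(Re z)\<^sup>2 - 1/4\<close> and
  \<open>Im z\<close>, while the sign of \<open>j * Re z\<close> selects the side of the crossing.
  On the unit disk the radicand is at least \<open>1/4 - 3/16\<close>, hence positive.\<close>

lemma bigon_chart_eq_iff:
  assumes "j \<in> {1, -1}" "\<sigma> \<in> {1, -1}" "norm w \<le> 1"
  shows "bigon_chart j \<sigma> w = z \<longleftrightarrow>
    0 < j * Re z \<and> (Re z)\<^sup>2 - 1/4 = j * (Re w + \<sigma> * Im w) / 8 \<and> Im z = j * (Re w - \<sigma> * Im w) / 8"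
proof -
  define u where "u = 1/4 + j * (Re w + \<sigma> * Im w) / 8"
  have "\<bar>Re w + \<sigma> * Im w\<bar> \<le> 3/2" using half_disk_abs_bounds[OF assms(3)] assms(2) by auto
  then have "\<bar>j * (Re w + \<sigma> * Im w) / 8\<bar> \<le> 3/16" unfolding sign_abs[OF assms(1)] by simp
  then have u: "0 < u" unfolding u_def by linarith
  have jj: "j * j = 1" using assms(1) by auto
  have "j * sqrt u = Re z \<longleftrightarrow> 0 < j * Re z \<and> (Re z)\<^sup>2 = u"
  proof
    assume "j * sqrt u = Re z"
    then have e: "Re z = j * sqrt u" ..
    have "j * Re z = sqrt u" unfolding e using jj by (simp add: mult.assoc[symmetric])
    moreover have "(Re z)\<^sup>2 = u" unfolding e using jj u by (simp add: power2_eq_square algebra_simps)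
    ultimately show "0 < j * Re z \<and> (Re z)\<^sup>2 = u" using u by simp
  next
    assume a: "0 < j * Re z \<and> (Re z)\<^sup>2 = u"
    have "j\<^sup>2 = 1" using jj by (simp add: power2_eq_square)
    then have "(j * Re z)\<^sup>2 = u" using a by (simp add: power_mult_distrib)
    then have "sqrt u = j * Re z" using a by (metis abs_of_pos real_sqrt_abs)
    then show "j * sqrt u = Re z" using jj by (simp add: mult.assoc[symmetric])
  qed
  then show ?thesis unfolding bigon_chart_def u_def by (auto simp: complex_eq_iff)
qed

lemma bigon_chart_facts:
  assumes j: "j \<in> {1, -1}" and \<sigma>: "\<sigma> \<in> {1, -1}"
  shows "continuous_on (cball 0 1) (bigon_chart j \<sigma>)" "inj_on (bigon_chart j \<sigma>) (cball 0 1)"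
    "bigon_chart j \<sigma> ` cball 0 1 \<subseteq> cball 0 (9/10)" "bigon_chart j \<sigma> 0 = of_real (j / 2)"
proof -
  show "continuous_on (cball 0 1) (bigon_chart j \<sigma>)"
    unfolding bigon_chart_def[abs_def] Complex_eq by (intro continuous_intros) auto
  show "inj_on (bigon_chart j \<sigma>) (cball 0 1)"
  proof (rule inj_onI)
    fix z w assume zw: "z \<in> cball 0 1" "w \<in> cball 0 1" "bigon_chart j \<sigma> z = bigon_chart j \<sigma> w"
    then have n: "norm z \<le> 1" "norm w \<le> 1" by auto
    have "j * (Re z + \<sigma> * Im z) / 8 = j * (Re w + \<sigma> * Im w) / 8" "j * (Re z - \<sigma> * Im z) / 8 = j * (Re w - \<sigma> * Im w) / 8"
      using bigon_chart_eq_iff[OF j \<sigma> n(1)] bigon_chart_eq_iff[OF j \<sigma> n(2)] zw(3) by metis+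
    then have "Re z + \<sigma> * Im z = Re w + \<sigma> * Im w" "Re z - \<sigma> * Im z = Re w - \<sigma> * Im w" using j by auto
    then show "z = w" using \<sigma> by (auto simp: complex_eq_iff)
  qed
  show "bigon_chart j \<sigma> ` cball 0 1 \<subseteq> cball 0 (9/10)"
  proof (intro image_subsetI)
    fix w :: complex assume "w \<in> cball 0 1"
    then have w: "norm w \<le> 1" by simp
    have b: "\<bar>Re w + \<sigma> * Im w\<bar> \<le> 3/2" "\<bar>Re w - \<sigma> * Im w\<bar> \<le> 3/2"
      using half_disk_abs_bounds[OF w] \<sigma> by auto
    define z where "z = bigon_chart j \<sigma> w"
    have z: "(Re z)\<^sup>2 - 1/4 = j * (Re w + \<sigma> * Im w) / 8" "Im z = j * (Re w - \<sigma> * Im w) / 8"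
      using bigon_chart_eq_iff[OF j \<sigma> w, of z] z_def by auto
    have "\<bar>(Re z)\<^sup>2 - 1/4\<bar> \<le> 3/16" unfolding z(1) sign_abs[OF j] using b(1) by simp
    then have "(Re z)\<^sup>2 \<le> 7/16" by linarith
    moreover have "\<bar>Im z\<bar> \<le> 3/16" unfolding z(2) sign_abs[OF j] using b(2) by simp
    then have "(Im z)\<^sup>2 \<le> (3/16)\<^sup>2" by (simp add: abs_le_square_iff[symmetric])
    ultimately have "(Re z)\<^sup>2 + (Im z)\<^sup>2 \<le> (9/10)\<^sup>2" by (simp add: power2_eq_square)
    then show "bigon_chart j \<sigma> w \<in> cball 0 (9/10)" using norm_le_if_squares[of z "9/10"] by (simp add: z_def)
  qed
  show "bigon_chart j \<sigma> 0 = of_real (j / 2)"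
    by (subst bigon_chart_eq_iff[OF j \<sigma>]) (use j in \<open>auto simp: power2_eq_square\<close>)
qed

text \<open>On the crossing arcs the two coordinates have equal absolute value, hence so do
  \<open>Re w + \<sigma> * Im w\<close> and \<open>Re w - \<sigma> * Im w\<close>, and
  \<open>w\<close> lies on the cross.\<close>

lemma bigon_chart_mem:
  assumes j: "j \<in> {1, -1}" and \<sigma>: "\<sigma> \<in> {1, -1}" and z: "\<bar>Im z\<bar> = \<bar>(Re z)\<^sup>2 - 1/4\<bar>"
  shows "z \<in> bigon_chart j \<sigma> ` cball 0 1 \<longleftrightarrow> \<bar>(Re z)\<^sup>2 - 1/4\<bar> \<le> 1/8 \<and> 0 < j * Re z"
    and "z \<in> bigon_chart j \<sigma> ` cball 0 1 \<longleftrightarrow> z \<in> bigon_chart j \<sigma> ` cross"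
proof -
  let ?B = "\<bar>(Re z)\<^sup>2 - 1/4\<bar> \<le> 1/8 \<and> 0 < j * Re z"
  have 1: "?B" if w: "bigon_chart j \<sigma> w = z" "norm w \<le> 1" for w
  proof -
    have e: "0 < j * Re z" "(Re z)\<^sup>2 - 1/4 = j * (Re w + \<sigma> * Im w) / 8" "Im z = j * (Re w - \<sigma> * Im w) / 8"
      using w bigon_chart_eq_iff[OF j \<sigma> w(2)] by auto
    have "\<bar>Re w + \<sigma> * Im w\<bar> = \<bar>Re w - \<sigma> * Im w\<bar>" using z e(2,3) j by (auto simp: abs_mult)
    then have "Re w = 0 \<or> Im w = 0" using \<sigma> by (auto simp: abs_if split: if_splits)
    then have "\<bar>Re w + \<sigma> * Im w\<bar> \<le> 1"
      using abs_Re_le_cmod[of w] abs_Im_le_cmod[of w] w(2) \<sigma> by auto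
    then show ?thesis using e(1) unfolding e(2) sign_abs[OF j] by simp
  qed
  have 2: "z \<in> bigon_chart j \<sigma> ` cross" if B: "?B"
  proof -
    define d where "d = 8 * ((Re z)\<^sup>2 - 1/4)"
    have q: "\<bar>d\<bar> \<le> 1" using B by (simp only: abs_mult d_def) simp
    have d: "(Re z)\<^sup>2 - 1/4 = d / 8" by (simp add: d_def)
    have "Im z = (Re z)\<^sup>2 - 1/4 \<or> Im z = - ((Re z)\<^sup>2 - 1/4)" using z by linarith
    then show ?thesis
    proof
      assume "Im z = (Re z)\<^sup>2 - 1/4"
      then have i: "Im z = d / 8" by (simp only: d)
      define w where "w = complex_of_real (j * d)"
      have "norm w \<le> 1" unfolding w_def norm_of_real using j q by (auto simp: abs_minus_commute)
      moreover have "Im w = 0" "Re w = j * d" by (simp_all only: w_def Re_complex_of_real Im_complex_of_real)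
      ultimately show ?thesis
        using bigon_chart_eq_iff[OF j \<sigma>, of w z, unfolded d] B i j by (intro image_eqI[of _ _ w]) (auto simp: cross_def)
    next
      assume "Im z = - ((Re z)\<^sup>2 - 1/4)"
      then have i: "Im z = - (d / 8)" by (simp only: d)
      define w where "w = Complex 0 (\<sigma> * j * d)"
      have "norm w \<le> 1" unfolding w_def complex_norm using j \<sigma> q by (auto simp: abs_minus_commute)
      moreover have "Re w = 0" "Im w = \<sigma> * j * d" by (simp_all only: w_def complex.sel)
      ultimately show ?thesis
        using bigon_chart_eq_iff[OF j \<sigma>, of w z, unfolded d] B i j \<sigma> by (intro image_eqI[of _ _ w]) (auto simp: cross_def)
    qed
  qed
  have 3: "bigon_chart j \<sigma> ` cross \<subseteq> bigon_chart j \<sigma> ` cball 0 1" using cross_subset by blast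
  show "z \<in> bigon_chart j \<sigma> ` cball 0 1 \<longleftrightarrow> ?B" using 1 2 3 by auto
  then show "z \<in> bigon_chart j \<sigma> ` cball 0 1 \<longleftrightarrow> z \<in> bigon_chart j \<sigma> ` cross" using 2 3 by blast
qed

lemma bigon_chart_cross:
  assumes j: "j \<in> {1, -1}" and \<sigma>: "\<sigma> \<in> {1, -1}"
  shows "cross_over ` parallel_arcs \<inter> bigon_chart j \<sigma> ` cball 0 1 = bigon_chart j \<sigma> ` cross"
proof (intro equalityI subsetI)
  fix z assume "z \<in> cross_over ` parallel_arcs \<inter> bigon_chart j \<sigma> ` cball 0 1"
  then show "z \<in> bigon_chart j \<sigma> ` cross" using bigon_chart_mem(2)[OF j \<sigma>, of z] by (auto simp: cross_over_image)
next
  fix z assume "z \<in> bigon_chart j \<sigma> ` cross"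
  then obtain w where w: "w \<in> cross" "bigon_chart j \<sigma> w = z" by blast
  then have n: "norm w \<le> 1" "Re w = 0 \<or> Im w = 0" by (auto simp: cross_def)
  have e: "(Re z)\<^sup>2 - 1/4 = j * (Re w + \<sigma> * Im w) / 8" "Im z = j * (Re w - \<sigma> * Im w) / 8"
    using w bigon_chart_eq_iff[OF j \<sigma> n(1)] by auto
  have a: "\<bar>Im z\<bar> = \<bar>(Re z)\<^sup>2 - 1/4\<bar>" unfolding e using n(2) by auto
  have in': "z \<in> bigon_chart j \<sigma> ` cball 0 1" using w n(1) by auto
  then have "\<bar>(Re z)\<^sup>2 - 1/4\<bar> \<le> 1/8" using bigon_chart_mem(1)[OF j \<sigma> a] by blast
  then have "(Re z)\<^sup>2 \<le> 3/4" by linarith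
  then show "z \<in> cross_over ` parallel_arcs \<inter> bigon_chart j \<sigma> ` cball 0 1"
    using a in' by (simp add: cross_over_image)
qed

text \<open>For \<open>\<sigma> = -1\<close> the sum \<open>Re w + Im w\<close>, which is 1 or -1 on
  the chords, determines \<open>Im z\<close>: the chords become horizontal and the resolved strands
  run side by side. For \<open>\<sigma> = 1\<close> it would determine
  \<open>(Re z)\<^sup>2\<close>; the chords would be vertical and the 2-gon would close up to a
  circle.\<close>

lemma bigon_chart_chords:
  assumes j: "j \<in> {1, -1}"
  shows "z \<in> bigon_chart j (-1) ` nonseifert_chords \<longleftrightarrow> \<bar>(Re z)\<^sup>2 - 1/4\<bar> \<le> 1/8 \<and> \<bar>Im z\<bar> = 1/8 \<and> 0 < j * Re z"
proof
  assume "z \<in> bigon_chart j (-1) ` nonseifert_chords"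
  then obtain w where w: "w \<in> nonseifert_chords" "bigon_chart j (-1) w = z" by blast
  then have n: "norm w \<le> 1" using chords_subset by auto
  have "\<bar>Re w + Im w\<bar> = 1" "\<bar>Re w - Im w\<bar> \<le> 1"
    using w(1) by (auto simp: nonseifert_chords_eq in_chord_def out_chord_def)
  moreover have e: "0 < j * Re z" "(Re z)\<^sup>2 - 1/4 = j * (Re w + -1 * Im w) / 8" "Im z = j * (Re w - -1 * Im w) / 8"
    using w(2) bigon_chart_eq_iff[OF j _ n, of "-1" z] by auto
  ultimately show "\<bar>(Re z)\<^sup>2 - 1/4\<bar> \<le> 1/8 \<and> \<bar>Im z\<bar> = 1/8 \<and> 0 < j * Re z"
    unfolding e(2,3) sign_abs[OF j] by simp
next
  assume z: "\<bar>(Re z)\<^sup>2 - 1/4\<bar> \<le> 1/8 \<and> \<bar>Im z\<bar> = 1/8 \<and> 0 < j * Re z"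
  define s d where "s = j * 8 * Im z" and "d = j * (8 * ((Re z)\<^sup>2 - 1/4))"
  have s: "s = 1 \<or> s = -1" using z j by (auto simp: s_def abs_if split: if_splits)
  have "\<bar>8 * ((Re z)\<^sup>2 - 1/4)\<bar> \<le> 1" using z by (simp only: abs_mult) simp
  then have d: "\<bar>d\<bar> \<le> 1" using j by (auto simp: d_def abs_minus_commute)
  define w where "w = Complex ((s + d) / 2) ((s - d) / 2)"
  have w: "w \<in> nonseifert_chords"
  proof -
    have "Re w + Im w = s" by (simp add: w_def field_simps)
    moreover have "0 \<le> s * Re w" "0 \<le> s * Im w" using s d by (auto simp: w_def)
    ultimately show ?thesis using s by (auto simp: nonseifert_chords_eq in_chord_def out_chord_def)
  qed
  then have n: "norm w \<le> 1" using chords_subset by auto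
  have "Re w + (-1) * Im w = d" "Re w - (-1) * Im w = s" by (simp_all add: w_def field_simps)
  then have "bigon_chart j (-1) w = z"
    using bigon_chart_eq_iff[OF j _ n, of "-1" z] z j by (auto simp: d_def s_def)
  then show "z \<in> bigon_chart j (-1) ` nonseifert_chords" using w by blast
qed

lemma squeeze_resolves:
  "squeeze ` parallel_arcs = (cross_over ` parallel_arcs - (\<Union>j\<in>{1, -1}. bigon_chart j (-1) ` cball 0 1)) \<union>
    (\<Union>j\<in>{1, -1}. bigon_chart j (-1) ` nonseifert_chords)"
proof (rule set_eqI)
  fix z
  define q where "q = (Re z)\<^sup>2 - 1/4"
  have nz: "0 < 1 * Re z \<or> 0 < -1 * Re z" if "\<bar>q\<bar> \<le> 1/8"
  proof -
    have "Re z \<noteq> 0" using that by (auto simp: q_def)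
    then show ?thesis by auto
  qed
  have le: "(Re z)\<^sup>2 \<le> 3/4" if "\<bar>q\<bar> \<le> 1/8" using that unfolding q_def by linarith
  have 1: "z \<in> cross_over ` parallel_arcs \<and> z \<notin> (\<Union>j\<in>{1, -1}. bigon_chart j (-1) ` cball 0 1) \<longleftrightarrow>
    (Re z)\<^sup>2 \<le> 3/4 \<and> \<bar>Im z\<bar> = \<bar>q\<bar> \<and> \<not> \<bar>q\<bar> \<le> 1/8"
    using bigon_chart_mem(1)[of 1 "-1" z] bigon_chart_mem(1)[of "-1" "-1" z] nz
    unfolding cross_over_image q_def[symmetric] by (cases "\<bar>Im z\<bar> = \<bar>q\<bar>") (auto simp del: image_iff)
  have 2: "z \<in> (\<Union>j\<in>{1, -1}. bigon_chart j (-1) ` nonseifert_chords) \<longleftrightarrow> \<bar>q\<bar> \<le> 1/8 \<and> \<bar>Im z\<bar> = 1/8"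
    using bigon_chart_chords[of 1 z] bigon_chart_chords[of "-1" z] nz unfolding q_def[symmetric] by auto
  have 3: "z \<in> squeeze ` parallel_arcs \<longleftrightarrow> (Re z)\<^sup>2 \<le> 3/4 \<and> \<bar>Im z\<bar> = max \<bar>q\<bar> (1/8)"
    by (simp add: squeeze_image q_def)
  show "z \<in> squeeze ` parallel_arcs \<longleftrightarrow> z \<in> (cross_over ` parallel_arcs - (\<Union>j\<in>{1, -1}. bigon_chart j (-1) ` cball 0 1)) \<union>
    (\<Union>j\<in>{1, -1}. bigon_chart j (-1) ` nonseifert_chords)"
    unfolding Un_iff Diff_iff 1 2 3 using le by (auto simp: max_def)
qed

text \<open>The middle of the arc is not a double point, so up to an integer the increasing lift
  takes \<open>q\<close> to \<open>p\<close>. Just after that \<open>\<gamma>\<close> is on the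
  positive half of the arc and \<open>\<gamma>2\<close> on the negative one, which injectivity of
  \<open>\<alpha>\<close> forbids.\<close>

lemma (in knot_curve) not_opposite:
  assumes "knot_curve \<gamma>2" and dir: "same_direction \<gamma> \<gamma>2"
    and t1: "traverses \<gamma> \<alpha>" and t2: "traverses \<gamma>2 (\<lambda>x. \<alpha> (- x))"
    and inj: "inj_on \<alpha> {-1..1}" and nd: "\<alpha> 0 \<notin> double_points \<gamma>"
  shows False
proof -
  obtain a b f where f: "a < b" "continuous_on {a..b} f" "strict_mono_on {a..b} f" "f a = -1" "f b = 1"
    "\<And>t. t \<in> {a..b} \<Longrightarrow> \<gamma> t = \<alpha> (f t)"
    using t1 by (auto simp: traverses_def)
  obtain c d g where g: "c < d" "continuous_on {c..d} g" "strict_mono_on {c..d} g" "g c = -1" "g d = 1"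
    "\<And>t. t \<in> {c..d} \<Longrightarrow> \<gamma>2 t = \<alpha> (- g t)"
    using t2 by (auto simp: traverses_def)
  obtain p where p: "a \<le> p" "p \<le> b" "f p = 0" using IVT'[of f a 0 b] f by auto
  obtain q where q: "c \<le> q" "q \<le> d" "g q = 0" using IVT'[of g c 0 d] g by auto
  have p': "p < b" using p f(5) by (cases "p = b") auto
  have q': "q < d" using q g(5) by (cases "q = d") auto
  obtain \<epsilon> h where h: "0 < \<epsilon>" "continuous_on {q - \<epsilon>..q + \<epsilon>} h" "strict_mono_on {q - \<epsilon>..q + \<epsilon>} h"
    "\<And>t. t \<in> {q - \<epsilon>..q + \<epsilon>} \<Longrightarrow> \<gamma>2 t = \<gamma> (h t)"
    using dir unfolding same_direction_def lifts_up_at_def by blast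
  have eq: "\<gamma> (h q) = \<gamma> p" using h(4)[of q] h(1) g(6)[of q] q f(6)[of p] p by simp
  have "\<gamma> (h q) = \<alpha> 0" using eq f(6)[of p] p by simp
  then have "h q - p \<in> \<int>" using double_pointI[OF eq] nd by auto
  then have "- (h q - p) \<in> \<int>" by (rule Ints_minus)
  then have shift: "\<gamma> (h t - (h q - p)) = \<gamma> (h t)" for t by (intro periodic_Ints) simp
  have "\<exists>\<delta>>0. \<forall>t\<in>{q - \<epsilon>..q + \<epsilon>}. dist t q < \<delta> \<longrightarrow> dist (h t) (h q) < b - p"
    using h(1,2) p' unfolding continuous_on_iff by auto
  then obtain \<delta> where \<delta>: "0 < \<delta>" "\<And>t. t \<in> {q - \<epsilon>..q + \<epsilon>} \<Longrightarrow> dist t q < \<delta> \<Longrightarrow> dist (h t) (h q) < b - p" by blast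
  define t where "t = q + min (min \<epsilon> (\<delta> / 2)) (d - q)"
  have t: "q < t" "t \<in> {q - \<epsilon>..q + \<epsilon>}" "t \<le> d" "dist t q < \<delta>"
    using h(1) \<delta>(1) q' by (auto simp: t_def dist_real_def min_def)
  have lt: "h q < h t" using strict_mono_onD[OF h(3), of q t] t h(1) by auto
  have ht: "p < h t - (h q - p)" "h t - (h q - p) < b" using lt \<delta>(2)[OF t(2,4)] by (auto simp: dist_real_def)
  then have s: "h t - (h q - p) \<in> {a..b}" using p by auto
  have "0 < f (h t - (h q - p))" using strict_mono_onD[OF f(3), of p "h t - (h q - p)"] p s ht by auto
  moreover have "f (h t - (h q - p)) \<le> 1" using strict_mono_on_leD[OF f(3) s, of b] s f(5) by auto
  moreover have tc: "t \<in> {c..d}" using t q by auto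
  then have "0 < g t" using strict_mono_onD[OF g(3), of q t] q t by auto
  moreover have "g t \<le> 1" using strict_mono_on_leD[OF g(3) tc, of d] tc g(5) by auto
  moreover have "\<alpha> (f (h t - (h q - p))) = \<alpha> (- g t)"
    using f(6)[OF s] g(6)[OF tc] h(4)[OF t(2)] shift[of t] by simp
  ultimately show False using inj_onD[OF inj, of "f (h t - (h q - p))" "- g t"] by auto
qed

text \<open>The maps differ only where \<open>(Re z)\<^sup>2 < 3/8\<close>; there the squared norms
  are below \<open>3/8 + 1/16\<close>.\<close>

lemma squeeze_small:
  assumes "z \<in> parallel_arcs" "cross_over z \<noteq> squeeze z"
  shows "norm (cross_over z) \<le> 9/10" "norm (squeeze z) \<le> 9/10"
proof -
  have x: "(Re z)\<^sup>2 < 3/8"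
  proof (rule ccontr)
    assume "\<not> (Re z)\<^sup>2 < 3/8"
    then have "max \<bar>(Re z)\<^sup>2 - 1/4\<bar> (1/8) = (Re z)\<^sup>2 - 1/4" by linarith
    then show False using assms(2) by (simp add: cross_over_def squeeze_def)
  qed
  have "\<bar>Im z\<bar> = 1/2" using assms(1) by (simp add: parallel_arcs_iff)
  then have im: "\<bar>2 * Im z\<bar> = 1" by linarith
  have b: "(Re z)\<^sup>2 + (2 * Im z * c)\<^sup>2 \<le> (9/10)\<^sup>2" if "\<bar>c\<bar> \<le> 1/4" for c
  proof -
    have "\<bar>2 * Im z * c\<bar> \<le> 1/4" using that im by (simp add: abs_mult)
    then have "(2 * Im z * c)\<^sup>2 \<le> (1/4)\<^sup>2" by (simp add: abs_le_square_iff[symmetric])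
    then show ?thesis using x by (simp add: power2_eq_square)
  qed
  have q: "\<bar>(Re z)\<^sup>2 - 1/4\<bar> \<le> 1/4" by (rule square_bounds(2)[OF x])
  show "norm (cross_over z) \<le> 9/10" by (rule norm_le_if_squares) (use b[OF q] in \<open>simp_all add: cross_over_def\<close>)
  have "\<bar>max \<bar>(Re z)\<^sup>2 - 1/4\<bar> (1/8)\<bar> \<le> 1/4" using q by simp
  from b[OF this] show "norm (squeeze z) \<le> 9/10" by (intro norm_le_if_squares) (simp_all add: squeeze_def)
qed

lemma cross_over_double:
  "w \<in> {1/2, -1/2} \<longleftrightarrow> (\<exists>z\<in>parallel_arcs. \<exists>z'\<in>parallel_arcs. z \<noteq> z' \<and> cross_over z = w \<and> cross_over z' = w)"
proof
  assume w: "w \<in> {1/2, -1/2}"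
  then have re: "(Re w)\<^sup>2 = 1/4" "Im w = 0"
    by (elim insertE emptyE; simp only:; simp add: power2_eq_square)+
  have "Complex (Re w) (1/2) \<in> parallel_arcs" "Complex (Re w) (- (1/2)) \<in> parallel_arcs"
    unfolding parallel_arcs_iff complex.sel re by simp_all
  moreover have "cross_over (Complex (Re w) y) = w" for y
    unfolding cross_over_def complex.sel re by (simp add: complex_eq_iff re)
  moreover have "Complex (Re w) (1/2) \<noteq> Complex (Re w) (- (1/2))" by simp
  ultimately show "\<exists>z\<in>parallel_arcs. \<exists>z'\<in>parallel_arcs. z \<noteq> z' \<and> cross_over z = w \<and> cross_over z' = w" by blast
next
  assume "\<exists>z\<in>parallel_arcs. \<exists>z'\<in>parallel_arcs. z \<noteq> z' \<and> cross_over z = w \<and> cross_over z' = w"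
  then obtain z z' where z: "z \<in> parallel_arcs" "z' \<in> parallel_arcs" "z \<noteq> z'" "cross_over z = w" "cross_over z' = w" by blast
  have re: "Re z = Re w" "Re z' = Re w" using z(4,5) by (auto simp: cross_over_def)
  then have "Im z \<noteq> Im z'" using z(3) by (auto simp: complex_eq_iff)
  moreover have "Im w = 2 * Im z * ((Re w)\<^sup>2 - 1/4)"
    using arg_cong[OF z(4), of Im] re(1) by (simp add: cross_over_def)
  moreover have "Im w = 2 * Im z' * ((Re w)\<^sup>2 - 1/4)"
    using arg_cong[OF z(5), of Im] re(2) by (simp add: cross_over_def)
  ultimately have q: "(Re w)\<^sup>2 - 1/4 = 0" "Im w = 0" by auto
  then have "(Re w)\<^sup>2 = (1/2)\<^sup>2" by (simp add: power2_eq_square)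
  then have "Re w = 1/2 \<or> Re w = - (1/2)" by (simp only: power2_eq_iff)
  then show "w \<in> {1/2, -1/2}" using q(2) by (auto simp: complex_eq_iff)
qed

section \<open>Curves along the two chords and the charts at the new crossings\<close>

definition chord :: "real \<Rightarrow> real \<Rightarrow> complex" where
  "chord c x = Complex (half_chord * x) c"

lemma chord_sqr: "(half_chord * x)\<^sup>2 = 3/4 * x\<^sup>2"
  by (simp add: power_mult_distrib half_chord)

lemma chord_mem: "\<bar>c\<bar> = 1/2 \<Longrightarrow> x \<in> {-1..1} \<Longrightarrow> chord c x \<in> parallel_arcs"
proof -
  assume "\<bar>c\<bar> = 1/2" "x \<in> {-1..1}"
  moreover from this have "x\<^sup>2 \<le> 1" by (auto simp: abs_square_le_1)
  ultimately show ?thesis by (simp add: parallel_arcs_iff chord_def chord_sqr)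
qed

lemma parallel_arcs_chord:
  assumes "z \<in> parallel_arcs"
  obtains x where "x \<in> {-1..1}" "z = chord (Im z) x"
proof -
  have "(Re z / half_chord)\<^sup>2 \<le> 1" using assms half_chord by (simp add: parallel_arcs_iff power_divide)
  then have "\<bar>Re z / half_chord\<bar> \<le> 1" by (simp only: abs_square_le_1)
  then have "Re z / half_chord \<in> {-1..1}" unfolding abs_le_iff atLeastAtMost_iff by linarith
  moreover have "z = chord (Im z) (Re z / half_chord)" using half_chord(1) by (simp add: chord_def complex_eq_iff)
  ultimately show ?thesis by (rule that)
qed

text \<open>The parameter of a chord at which the axis coordinate \<open>s\<close> of the chart at
  \<open>j / 2\<close> is reached: the solution of \<open>x\<^sup>2 = 1/4 + j * s / 8\<close> on the
  side of \<open>j\<close>, divided by \<open>half_chord\<close>. It increases with \<open>s\<close>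
  for both signs.\<close>

definition branch_parameter :: "real \<Rightarrow> real \<Rightarrow> real" where
  "branch_parameter j s = j * sqrt (1/4 + j * s / 8) / half_chord"

lemma branch_parameter:
  assumes j: "j \<in> {1, -1}"
  shows "continuous_on {-1..1} (branch_parameter j)" "strict_mono_on {-1..1} (branch_parameter j)"
    "-1 \<le> branch_parameter j (-1)" "branch_parameter j 1 \<le> 1"
proof -
  show "continuous_on {-1..1} (branch_parameter j)"
    unfolding branch_parameter_def[abs_def] using half_chord(1) by (intro continuous_intros) auto
  show "strict_mono_on {-1..1} (branch_parameter j)"
    using j half_chord(1) by (auto intro!: strict_mono_onI simp: branch_parameter_def divide_strict_right_mono)
  have b: "\<bar>branch_parameter j s\<bar> \<le> 1" if "s \<in> {-1..1}" for s
  proof -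
    have "\<bar>j * s / 8\<bar> \<le> 1/8" unfolding sign_abs[OF j] using that by auto
    then have u: "0 \<le> 1/4 + j * s / 8" "1/4 + j * s / 8 \<le> 3/4" by linarith+
    then have "sqrt (1/4 + j * s / 8) \<le> half_chord" unfolding half_chord_def by (intro real_sqrt_le_mono)
    moreover have "\<bar>j\<bar> = 1" using j by auto
    ultimately show ?thesis using half_chord(1) u(1) by (simp add: branch_parameter_def abs_mult)
  qed
  show "-1 \<le> branch_parameter j (-1)" "branch_parameter j 1 \<le> 1" using b[of "-1"] b[of 1] by (auto simp: abs_le_iff)
qed

lemma branch_parameter_sqr:
  assumes j: "j \<in> {1, -1}" and s: "s \<in> {-1..1}"
  shows "(half_chord * branch_parameter j s)\<^sup>2 = 1/4 + j * s / 8"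
proof -
  have "\<bar>j * s / 8\<bar> \<le> 1/8" unfolding sign_abs[OF j] using s by auto
  then have u: "0 \<le> 1/4 + j * s / 8" by linarith
  have "half_chord * branch_parameter j s = j * sqrt (1/4 + j * s / 8)"
    using half_chord(1) by (simp add: branch_parameter_def)
  moreover have "j\<^sup>2 = 1" using j by auto
  ultimately show ?thesis using u by (simp add: power_mult_distrib)
qed

text \<open>In the coordinates \<open>q = (Re z)\<^sup>2 - 1/4\<close> and \<open>y = Im z\<close>
  the fold turns the upper chord into \<open>y = q\<close> and the lower one into
  \<open>y = - q\<close>, the two axes of the chart. The factors \<open>\<sigma>\<close> make the
  imaginary axis follow the lower chord in the direction of the curve.\<close>

lemma bigon_chart_axes:
  assumes j: "j \<in> {1, -1}" and \<sigma>: "\<sigma> \<in> {1, -1}" and s: "s \<in> {-1..1}"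
  shows "bigon_chart j \<sigma> (of_real s) = cross_over (chord (1/2) (branch_parameter j s))"
    "bigon_chart j \<sigma> (\<i> * of_real s) = cross_over (chord (- (1/2)) (\<sigma> * branch_parameter (\<sigma> * j) s))"
proof -
  show "bigon_chart j \<sigma> (of_real s) = cross_over (chord (1/2) (branch_parameter j s))"
    unfolding cross_over_def chord_def complex.sel branch_parameter_sqr[OF j s]
    using half_chord(1) by (simp add: bigon_chart_def branch_parameter_def)
  have \<sigma>j: "\<sigma> * j \<in> {1, -1}" using j \<sigma> by auto
  have \<sigma>\<sigma>: "\<sigma> * \<sigma> = 1" "\<sigma>\<^sup>2 = 1" using \<sigma> by auto
  have "(half_chord * (\<sigma> * branch_parameter (\<sigma> * j) s))\<^sup>2 = 1/4 + \<sigma> * j * s / 8"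
    using branch_parameter_sqr[OF \<sigma>j s] \<sigma>\<sigma> by (simp add: power_mult_distrib)
  note sq = this
  have re: "half_chord * (\<sigma> * branch_parameter (\<sigma> * j) s) = j * sqrt (1/4 + \<sigma> * j * s / 8)"
    using half_chord(1) \<sigma> by (auto simp: branch_parameter_def)
  show "bigon_chart j \<sigma> (\<i> * of_real s) = cross_over (chord (- (1/2)) (\<sigma> * branch_parameter (\<sigma> * j) s))"
    unfolding cross_over_def chord_def complex.sel sq unfolding re by (simp add: bigon_chart_def algebra_simps)
qed

text \<open>The sign \<open>\<sigma>\<close> is \<open>1\<close> if the curve runs along both chords in the same direction.\<close>

locale parallel_strands = knot_curve +
  fixes \<phi> :: "complex \<Rightarrow> real^3" and G :: "complex \<Rightarrow> complex" and \<sigma> :: real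
  assumes disk: "disk_embedding \<phi>" and strands: "range \<gamma> \<inter> \<phi> ` cball 0 1 = \<phi> ` parallel_arcs"
    and free: "double_points \<gamma> \<inter> \<phi> ` ball 0 1 = {}"
    and homeo: "disk_homeo G" "\<And>z. z \<in> parallel_arcs \<Longrightarrow> G z = squeeze z"
    and \<sigma>: "\<sigma> \<in> {1, -1}"
    and upper: "traverses \<gamma> (\<lambda>x. \<phi> (chord (1/2) x))"
    and lower: "traverses \<gamma> (\<lambda>x. \<phi> (chord (- (1/2)) (\<sigma> * x)))"
begin

sublocale disk_modification \<gamma> \<phi> parallel_arcs G cross_over "9/10" "{1/2, -1/2}"
proof
  show "disk_embedding \<phi>" "range \<gamma> \<inter> \<phi> ` cball 0 1 = \<phi> ` parallel_arcs" "double_points \<gamma> \<inter> \<phi> ` ball 0 1 = {}"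
    "disk_homeo G"
    by (fact disk strands free homeo(1))+
  show "parallel_arcs \<subseteq> cball 0 1" by (auto simp: parallel_arcs_def)
  show "continuous_on parallel_arcs cross_over"
    unfolding cross_over_def[abs_def] Complex_eq by (intro continuous_intros)
  show "finite {1/2, -1/2::complex}" "{1/2, -1/2::complex} \<subseteq> cball 0 (9/10)" by (auto simp: norm_divide)
  show "w \<in> {1/2, -1/2} \<longleftrightarrow> (\<exists>z\<in>parallel_arcs. \<exists>z'\<in>parallel_arcs. z \<noteq> z' \<and> cross_over z = w \<and> cross_over z' = w)" for w
    by (rule cross_over_double)
  show "(9/10::real) < 1" by simp
next
  fix z assume z: "z \<in> parallel_arcs"
  have n: "norm z = 1 \<longleftrightarrow> (Re z)\<^sup>2 = 3/4" by (rule parallel_arcs_norm[OF z])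
  show "cross_over z = z" if "norm z = 1" using that n by (simp add: cross_over_def complex_eq_iff)
  show "norm (cross_over z) < 1" if "norm z < 1"
  proof (rule norm_less_1_if_squares)
    have "(Re z)\<^sup>2 < 3/4" using that n z by (auto simp: parallel_arcs_iff)
    moreover have "\<bar>Im z\<bar> = 1/2" using z by (simp add: parallel_arcs_iff)
    then have "\<bar>2 * Im z\<bar> = 1" by linarith
    then have "(2 * Im z)\<^sup>2 = 1" by (metis power2_abs one_power2)
    then have "(2 * Im z * ((Re z)\<^sup>2 - 1/4))\<^sup>2 = ((Re z)\<^sup>2 - 1/4)\<^sup>2" by (simp only: power_mult_distrib mult_1)
    ultimately show "(Re (cross_over z))\<^sup>2 + (Im (cross_over z))\<^sup>2 < 1"
      using parabola_bound(2)[of "(Re z)\<^sup>2"] by (simp add: cross_over_def)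
  qed
  show "norm (cross_over z) \<le> 9/10 \<and> norm (G z) \<le> 9/10" if "cross_over z \<noteq> G z"
    using squeeze_small[OF z] that homeo(2)[OF z] by simp
next
  fix x y z assume "x \<in> parallel_arcs" "y \<in> parallel_arcs" "z \<in> parallel_arcs"
    "cross_over x = cross_over y" "cross_over y = cross_over z"
  then have "Re x = Re y" "Re y = Re z" "\<bar>Im x\<bar> = 1/2" "\<bar>Im y\<bar> = 1/2" "\<bar>Im z\<bar> = 1/2"
    by (auto simp: cross_over_def parallel_arcs_iff)
  then show "x = y \<or> y = z \<or> x = z" unfolding complex_eq_iff by linarith
qed

lemma modified_upper: "traverses modified (\<lambda>x. \<phi> (cross_over (chord (1/2) x)))"
  using traverses_modified[OF upper] chord_mem by simp

lemma modified_lower: "traverses modified (\<lambda>x. \<phi> (cross_over (chord (- (1/2)) (\<sigma> * x))))"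
  using traverses_modified[OF lower] chord_mem[of "- (1/2)"] \<sigma> by auto

lemma modified_bigon_chart:
  assumes j: "j \<in> {1, -1}"
  shows "crossing_chart modified (\<phi> (of_real (j / 2))) (\<phi> \<circ> bigon_chart j \<sigma>)"
proof -
  have \<sigma>j: "\<sigma> * j \<in> {1, -1}" using j \<sigma> by auto
  have inc: "bigon_chart j \<sigma> ` cball 0 1 \<subseteq> cball 0 1"
    using bigon_chart_facts(3)[OF j \<sigma>] by (rule order_trans) (rule subset_cball, simp)
  have 1: "traverses modified (\<lambda>s. \<phi> (bigon_chart j \<sigma> (of_real s)))"
    by (rule traverses_cong[OF traverses_reparametrize[OF modified_upper branch_parameter[OF j]]])
      (simp add: bigon_chart_axes[OF j \<sigma>])
  have 2: "traverses modified (\<lambda>s. \<phi> (bigon_chart j \<sigma> (\<i> * of_real s)))"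
    by (rule traverses_cong[OF traverses_reparametrize[OF modified_lower branch_parameter[OF \<sigma>j]]])
      (simp add: bigon_chart_axes[OF j \<sigma>])
  show ?thesis
    using modified_chartI[OF bigon_chart_facts(1,2)[OF j \<sigma>] inc bigon_chart_cross[OF j \<sigma>] 1 2]
    unfolding bigon_chart_facts(4)[OF j \<sigma>] .
qed

lemma corner_cases:
  assumes "w \<in> {1/2, -1/2 :: complex}"
  shows "(if 0 < Re w then 1 else -1 :: real) \<in> {1, -1}" "w = of_real ((if 0 < Re w then 1 else -1) / 2)"
  using assms by (auto simp: complex_eq_iff)

lemma modified_knot_curve: "knot_curve modified"
  using knot_curve_modified modified_bigon_chart corner_cases by metis

lemma coherent_arrangement:
  assumes "\<sigma> = -1"
  shows "\<exists>C C'. curve_arrangement (range \<gamma>) C \<and> curve_arrangement (range modified) C' \<and> isotopic C C'"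
proof (rule modified_arrangement)
  let ?j = "\<lambda>w::complex. if 0 < Re w then 1 else -1 :: real"
  fix w assume "w \<in> {1/2, -1/2 :: complex}"
  note w = corner_cases[OF this]
  show "crossing_chart modified (\<phi> w) (\<phi> \<circ> bigon_chart (?j w) \<sigma>)" using modified_bigon_chart[OF w(1)] unfolding w(2)[symmetric] .
  show "bigon_chart (?j w) \<sigma> ` cball 0 1 \<subseteq> cball 0 (9/10)" by (rule bigon_chart_facts(3)[OF w(1) \<sigma>])
next
  let ?j = "\<lambda>w::complex. if 0 < Re w then 1 else -1 :: real"
  fix w w' assume "w \<in> {1/2, -1/2 :: complex}" "w' \<in> {1/2, -1/2 :: complex}" and ne: "w \<noteq> w'"
  note w = corner_cases[OF this(1)] corner_cases[OF this(2)]
  have side: "0 < j * Re z" if jz: "j \<in> {1, -1}" "z \<in> bigon_chart j \<sigma> ` cball 0 1" for j z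
  proof -
    obtain w where "norm w \<le> 1" "bigon_chart j \<sigma> w = z" using jz(2) by auto
    then show ?thesis using bigon_chart_eq_iff[OF jz(1) \<sigma>] by blast
  qed
  have "?j w \<noteq> ?j w'" using ne w(2,4) by metis
  then have "?j w * x > 0 \<Longrightarrow> ?j w' * x > 0 \<Longrightarrow> False" for x :: real by (auto split: if_splits)
  then show "bigon_chart (?j w) \<sigma> ` cball 0 1 \<inter> bigon_chart (?j w') \<sigma> ` cball 0 1 = {}"
    using side[OF w(1)] side[OF w(3)] by blast
next
  have "G ` parallel_arcs = squeeze ` parallel_arcs" by (rule image_cong) (simp_all add: homeo(2))
  then show "G ` parallel_arcs = cross_over ` parallel_arcs -
      (\<Union>w\<in>{1/2, -1/2}. bigon_chart (if 0 < Re w then 1 else -1) \<sigma> ` cball 0 1) \<union>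
      (\<Union>w\<in>{1/2, -1/2}. bigon_chart (if 0 < Re w then 1 else -1) \<sigma> ` nonseifert_chords)"
    unfolding squeeze_resolves assms by simp
qed

end

text \<open>Curves with the same image have the same direction everywhere or opposite directions
  everywhere; the arc \<open>\<alpha>\<close> excludes the second case and \<open>\<beta>\<close>
  the first.\<close>

lemma not_antiparallel_edges:
  assumes "same_image \<gamma>1 \<gamma>2"
    and A: "traverses \<gamma>1 \<alpha>" "traverses \<gamma>2 \<alpha>" "inj_on \<alpha> {-1..1}" "\<alpha> 0 \<notin> double_points \<gamma>1"
    and B: "traverses \<gamma>1 \<beta>" "traverses \<gamma>2 (\<lambda>x. \<beta> (- x))" "inj_on \<beta> {-1..1}" "\<beta> 0 \<notin> double_points \<gamma>1"
  shows False
proof -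
  interpret same_image \<gamma>1 \<gamma>2 by fact
  show False using same_or_opposite_direction
  proof
    assume "same_direction \<gamma>1 \<gamma>2"
    then show False by (rule c1.not_opposite[OF c2.knot_curve_axioms _ B])
  next
    assume d: "same_direction (\<lambda>s. \<gamma>1 (- s)) \<gamma>2"
    interpret rev: knot_curve "\<lambda>s. \<gamma>1 (- s)" by (rule c1.reverse(1))
    have "traverses (\<lambda>s. \<gamma>1 (- s)) (\<lambda>x. \<alpha> (- x))" by (rule traverses_reverse) (simp add: A(1))
    moreover have "inj_on (\<lambda>x. \<alpha> (- x)) {-1..1}"
    proof (rule inj_onI)
      fix x y :: real assume "x \<in> {-1..1}" "y \<in> {-1..1}" "\<alpha> (- x) = \<alpha> (- y)"
      then show "x = y" using inj_onD[OF A(3), of "- x" "- y"] by auto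
    qed
    ultimately show False
      using rev.not_opposite[OF c2.knot_curve_axioms d, of "\<lambda>x. \<alpha> (- x)"] A(2,4) c1.reverse(2) by simp
  qed
qed

section \<open>The edges of the 2-gon and coherence\<close>

definition edge :: "real \<Rightarrow> real \<Rightarrow> complex" where
  "edge c s = Complex (s / 2) (c * (s\<^sup>2 - 1))"

lemma edge_images:
  "lower_edge = edge (1/4) ` {-1..1}" "upper_edge = (\<lambda>s. edge (- (1/4)) (- s)) ` {-1..1}"
proof -
  have h: "(\<lambda>s. s / 2) ` {-1..1::real} = {-(1/2)..1/2}" "(\<lambda>s. - s / 2) ` {-1..1::real} = {-(1/2)..1/2}"
  proof safe
    fix x :: real assume x: "x \<in> {-(1/2)..1/2}"
    show "x \<in> (\<lambda>s. s / 2) ` {-1..1}" by (rule image_eqI[of _ _ "2 * x"]) (use x in auto)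
    show "x \<in> (\<lambda>s. - s / 2) ` {-1..1}" by (rule image_eqI[of _ _ "- 2 * x"]) (use x in auto)
  qed auto
  show "lower_edge = edge (1/4) ` {-1..1}"
    unfolding lower_edge_def h(1)[symmetric] image_image
    by (rule image_cong) (simp_all add: edge_def power_divide diff_divide_distrib)
  show "upper_edge = (\<lambda>s. edge (- (1/4)) (- s)) ` {-1..1}"
    unfolding upper_edge_def h(2)[symmetric] image_image
    by (rule image_cong) (simp_all add: edge_def power_divide diff_divide_distrib)
qed

lemma edge_in_disk:
  assumes "\<bar>c\<bar> = 1/4" "s \<in> {-1..1}"
  shows "norm (edge c s) \<le> 9/10"
proof (rule norm_le_if_squares)
  have s: "s\<^sup>2 \<le> 1" "\<bar>s\<^sup>2 - 1\<bar> \<le> 1" using assms(2) by (auto simp: abs_square_le_1)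
  have "\<bar>c * (s\<^sup>2 - 1)\<bar> \<le> 1/4" unfolding abs_mult assms(1) using s(2) by simp
  then have "(c * (s\<^sup>2 - 1))\<^sup>2 \<le> (1/4)\<^sup>2" by (simp add: abs_le_square_iff[symmetric])
  then show "(Re (edge c s))\<^sup>2 + (Im (edge c s))\<^sup>2 \<le> (9/10)\<^sup>2"
    using s(1) by (simp add: edge_def power_divide power2_eq_square)
qed auto

text \<open>Between the crossings the strands have changed sides: the upper chord,
  \<open>c = 1/2\<close>, gives the lower edge \<open>edge (1/4)\<close>.\<close>

lemma edge_eq_cross_over: "edge (c / 2) (\<sigma> * s) = cross_over (chord c (\<sigma> * (s / (2 * half_chord))))"
proof -
  have e: "half_chord * (\<sigma> * (s / (2 * half_chord))) = \<sigma> * s / 2" using half_chord(1) by simp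
  show ?thesis unfolding cross_over_def chord_def complex.sel e
    by (simp add: edge_def power_divide algebra_simps)
qed

context parallel_strands
begin

lemma traverses_edges:
  "traverses modified (\<lambda>s. \<phi> (edge (1/4) s))" "traverses modified (\<lambda>s. \<phi> (edge (- (1/4)) (\<sigma> * s)))"
proof -
  have "sqrt (1/4) \<le> half_chord" unfolding half_chord_def by (intro real_sqrt_le_mono) simp
  then have h: "1 / (2 * half_chord) \<le> 1" using half_chord(1) by (simp add: real_sqrt_divide)
  have g: "continuous_on {-1..1} (\<lambda>s. s / (2 * half_chord))" "strict_mono_on {-1..1} (\<lambda>s. s / (2 * half_chord))"
    "-1 \<le> (-1) / (2 * half_chord)" "1 / (2 * half_chord) \<le> 1"
    using h half_chord(1) by (auto intro!: continuous_intros strict_mono_onI divide_strict_right_mono)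
  show "traverses modified (\<lambda>s. \<phi> (edge (1/4) s))"
    by (rule traverses_cong[OF traverses_reparametrize[OF modified_upper g]])
      (use edge_eq_cross_over[of "1/2" 1] in simp)
  show "traverses modified (\<lambda>s. \<phi> (edge (- (1/4)) (\<sigma> * s)))"
    by (rule traverses_cong[OF traverses_reparametrize[OF modified_lower g]])
      (use edge_eq_cross_over[of "- (1/2)" \<sigma>] in simp)
qed

lemma edge_inj:
  assumes "\<bar>c\<bar> = 1/4"
  shows "continuous_on {-1..1} (\<lambda>s. \<phi> (edge c s))" "inj_on (\<lambda>s. \<phi> (edge c s)) {-1..1}"
    "\<phi> (edge c 0) \<notin> double_points modified"
proof -
  have n: "norm (edge c s) \<le> 9/10" "norm (edge c s) \<le> 1" if "s \<in> {-1..1}" for s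
    using edge_in_disk[OF assms that] by auto
  show "continuous_on {-1..1} (\<lambda>s. \<phi> (edge c s))"
  proof (rule continuous_on_compose2[OF emb(1)])
    show "continuous_on {-1..1} (edge c)" unfolding edge_def[abs_def] Complex_eq by (intro continuous_intros) auto
    show "edge c ` {-1..1} \<subseteq> cball 0 1" using n(2) by auto
  qed
  show "inj_on (\<lambda>s. \<phi> (edge c s)) {-1..1}"
    by (rule inj_onI) (use n(2) phi_eq in \<open>simp add: edge_def\<close>)
  have "\<phi> (edge c 0) \<notin> \<phi> ` {1/2, -1/2}"
  proof
    assume "\<phi> (edge c 0) \<in> \<phi> ` {1/2, -1/2}"
    then obtain w where w: "w \<in> {1/2, -1/2}" "\<phi> (edge c 0) = \<phi> w" by blast
    then have "w = 1/2 \<or> w = -1/2" by blast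
    then have "norm w \<le> 1" "Re w \<noteq> 0" by (elim disjE; simp only:; simp add: norm_divide)+
    then have "edge c 0 = w" using w(2) phi_eq[OF n(2)[of 0]] by simp
    then show False using \<open>Re w \<noteq> 0\<close> by (auto simp: edge_def)
  qed
  then show "\<phi> (edge c 0) \<notin> double_points modified"
    unfolding double_modified using moved_not_double[OF n(1)[of 0]] by simp
qed

text \<open>For \<open>\<sigma> = 1\<close> the modified curve would run along both edges from left
  to right, while \<open>\<gamma>2\<close> runs back along the upper one;
  \<open>not_antiparallel_edges\<close> excludes this.\<close>

lemma coherent_imp_opposite:
  assumes "knot_curve \<gamma>2" "range \<gamma>2 = range modified"
    and l: "runs_along \<gamma>2 (\<phi> ` lower_edge) (\<phi> (-(1/2))) (\<phi> (1/2))"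
    and u: "runs_along \<gamma>2 (\<phi> ` upper_edge) (\<phi> (1/2)) (\<phi> (-(1/2)))"
  shows "\<sigma> = -1"
proof (rule ccontr)
  assume "\<sigma> \<noteq> -1"
  then have \<sigma>1: "\<sigma> = 1" using \<sigma> by auto
  interpret g2: knot_curve \<gamma>2 by fact
  interpret m: knot_curve modified by (rule modified_knot_curve)
  have si: "same_image modified \<gamma>2"
    unfolding same_image_def same_image_axioms_def using assms(2) m.knot_curve_axioms g2.knot_curve_axioms by simp
  have t: "traverses modified (\<lambda>s. \<phi> (edge (1/4) s))" "traverses modified (\<lambda>s. \<phi> (edge (- (1/4)) s))"
    using traverses_edges \<sigma>1 by simp_all
  have c: "\<bar>1/4\<bar> = (1/4::real)" "\<bar>- (1/4)\<bar> = (1/4::real)" by simp_all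
  have im: "\<alpha> ` {-1..1} \<subseteq> range modified" if "traverses modified \<alpha>" for \<alpha>
    using traverses_runs_along[OF that, of "-1" 1] unfolding runs_along_def by (auto dest!: sym[of "modified ` _"])
  have mid: "\<phi> (edge (1/4) 0) \<in> range \<gamma>2" "\<phi> (edge (- (1/4)) 0) \<in> range \<gamma>2"
    using im[OF t(1)] im[OF t(2)] unfolding assms(2) by auto
  \<comment> \<open>The midpoint of one edge is the point of the curve off the other edge that
    \<open>runs_along_imp_traverses\<close> asks for.\<close>
  have out: "\<phi> (edge (- c) 0) \<notin> (\<lambda>s. \<phi> (edge c s)) ` {-1..1}" if c: "\<bar>c\<bar> = 1/4" for c
  proof
    assume "\<phi> (edge (- c) 0) \<in> (\<lambda>s. \<phi> (edge c s)) ` {-1..1}"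
    then obtain s where s: "s \<in> {-1..1}" "\<phi> (edge (- c) 0) = \<phi> (edge c s)" by blast
    have "norm (edge (- c) 0) \<le> 1" "norm (edge c s) \<le> 1"
      using edge_in_disk[of "- c" 0] edge_in_disk[OF c s(1)] c by auto
    then have "edge (- c) 0 = edge c s" using phi_eq s(2) by simp
    then show False using c by (auto simp: edge_def)
  qed
  have ends: "edge c (-1) = -(1/2)" "edge c 1 = 1/2" for c by (simp_all add: edge_def complex_eq_iff)
  have "traverses \<gamma>2 (\<lambda>s. \<phi> (edge (1/4) s))"
    by (rule g2.runs_along_imp_traverses[OF edge_inj(1,2)[OF c(1)] mid(2) out[OF c(1)]])
      (use l in \<open>simp_all add: edge_images ends image_image\<close>)
  moreover have "traverses \<gamma>2 (\<lambda>s. \<phi> (edge (- (1/4)) (- s)))"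
  proof (rule g2.runs_along_imp_traverses)
    show "continuous_on {-1..1} (\<lambda>s. \<phi> (edge (- (1/4)) (- s)))"
      by (rule continuous_on_compose2[OF edge_inj(1)[OF c(2)], of _ uminus]) (auto intro!: continuous_intros)
    show "inj_on (\<lambda>s. \<phi> (edge (- (1/4)) (- s))) {-1..1}"
    proof (rule inj_onI)
      fix x y :: real assume "x \<in> {-1..1}" "y \<in> {-1..1}" "\<phi> (edge (- (1/4)) (- x)) = \<phi> (edge (- (1/4)) (- y))"
      then show "x = y" using inj_onD[OF edge_inj(2)[OF c(2)], of "- x" "- y"] by auto
    qed
    show "\<phi> (edge (- (- (1/4))) 0) \<in> range \<gamma>2" using mid(1) by simp
    show "\<phi> (edge (- (- (1/4))) 0) \<notin> (\<lambda>s. \<phi> (edge (- (1/4)) (- s))) ` {-1..1}"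
      using out[OF c(2)] by auto
    show "runs_along \<gamma>2 ((\<lambda>s. \<phi> (edge (- (1/4)) (- s))) ` {-1..1}) (\<phi> (edge (- (1/4)) (- (-1)))) (\<phi> (edge (- (1/4)) (- 1)))"
      using u by (simp add: edge_images ends image_image)
  qed
  ultimately show False
    using not_antiparallel_edges[OF si t(1) _ edge_inj(2,3)[OF c(1)] t(2) _ edge_inj(2,3)[OF c(2)]] by blast
qed

end

context knot_curve
begin

lemma traverses_chord:
  assumes c: "\<bar>c\<bar> = 1/2" and \<phi>: "disk_embedding \<phi>" and P: "range \<gamma> \<inter> \<phi> ` cball 0 1 = \<phi> ` parallel_arcs"
  shows "traverses \<gamma> (\<lambda>x. \<phi> (chord c x)) \<or> traverses \<gamma> (\<lambda>x. \<phi> (chord c (- x)))"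
    and "\<And>x. x \<in> {-1<..<1} \<Longrightarrow> \<phi> (chord c x) \<notin> double_points \<gamma>"
proof -
  have X: "parallel_arcs \<subseteq> cball 0 1" by (auto simp: parallel_arcs_def)
  have cont: "continuous_on {-1..1} (chord c)"
    unfolding chord_def[abs_def] Complex_eq by (intro continuous_intros)
  have inj: "inj_on (chord c) {-1..1}" using half_chord(1) by (auto simp: inj_on_def chord_def)
  have im: "chord c ` {-1..1} \<subseteq> parallel_arcs" using chord_mem[OF c] by auto
  have ends: "norm (chord c (-1)) = 1" "norm (chord c 1) = 1"
    using parallel_arcs_norm[OF chord_mem[OF c, of "-1"]] parallel_arcs_norm[OF chord_mem[OF c, of 1]] by (simp_all add: chord_def half_chord)
  have inside: "norm (chord c x) < 1" if x: "x \<in> {-1<..<1}" for x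
  proof -
    have x': "x \<in> {-1..1}" "x\<^sup>2 < 1" using x by (auto simp: abs_square_less_1 abs_less_iff)
    have "(Re (chord c x))\<^sup>2 \<noteq> 3/4" unfolding chord_def complex.sel chord_sqr using x'(2) by simp
    then have "norm (chord c x) \<noteq> 1" using parallel_arcs_norm[OF chord_mem[OF c x'(1)]] by simp
    then show ?thesis using chord_mem[OF c x'(1)] X by fastforce
  qed
  \<comment> \<open>The other strand is closed because a line cuts it out of the closed
    disk.\<close>
  have "parallel_arcs - chord c ` {-1..1} = cball 0 1 \<inter> {z. Im z = - c}"
  proof (intro equalityI subsetI)
    fix z assume z: "z \<in> parallel_arcs - chord c ` {-1..1}"
    then obtain x where x: "x \<in> {-1..1}" "z = chord (Im z) x" using parallel_arcs_chord[of z] by blast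
    then have "Im z \<noteq> c" using z by auto
    moreover have "\<bar>Im z\<bar> = 1/2" using z by (simp add: parallel_arcs_iff)
    ultimately have "Im z = - c" using c by linarith
    then show "z \<in> cball 0 1 \<inter> {z. Im z = - c}" using z X by auto
  next
    fix z assume "z \<in> cball 0 1 \<inter> {z. Im z = - c}"
    then show "z \<in> parallel_arcs - chord c ` {-1..1}" using c by (auto simp: parallel_arcs_def chord_def)
  qed
  moreover have "closed (cball 0 1 \<inter> {z. Im z = - c})"
    by (intro closed_Int closed_cball closed_Collect_eq continuous_intros)
  ultimately have rest: "closed (parallel_arcs - chord c ` {-1..1})" by simp
  note arc = traverses_disk_arc[OF \<phi> P X cont inj im ends inside rest]
  show "traverses \<gamma> (\<lambda>x. \<phi> (chord c x)) \<or> traverses \<gamma> (\<lambda>x. \<phi> (chord c (- x)))" by (rule arc(1))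
  show "\<And>x. x \<in> {-1<..<1} \<Longrightarrow> \<phi> (chord c x) \<notin> double_points \<gamma>" by (rule arc(2))
qed

lemma no_double_on_parallel_arcs:
  assumes \<phi>: "disk_embedding \<phi>" and P: "range \<gamma> \<inter> \<phi> ` cball 0 1 = \<phi> ` parallel_arcs"
  shows "double_points \<gamma> \<inter> \<phi> ` ball 0 1 = {}"
proof (rule ccontr)
  assume "double_points \<gamma> \<inter> \<phi> ` ball 0 1 \<noteq> {}"
  then obtain z where z: "\<phi> z \<in> double_points \<gamma>" "norm z < 1" by auto
  then have "\<phi> z \<in> \<phi> ` parallel_arcs" using P double_points_subset[of \<gamma>] by auto
  then obtain z' where z': "z' \<in> parallel_arcs" "\<phi> z = \<phi> z'" by blast
  have "norm z' \<le> 1" using z'(1) by (simp add: parallel_arcs_def)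
  then have "z = z'" using \<phi> z'(2) z(2) by (auto simp: disk_embedding_def dest!: inj_onD)
  then have zp: "z \<in> parallel_arcs" using z'(1) by simp
  then obtain x where x: "x \<in> {-1..1}" "z = chord (Im z) x" using parallel_arcs_chord by blast
  have c: "\<bar>Im z\<bar> = 1/2" using zp by (simp add: parallel_arcs_iff)
  have "(Re z)\<^sup>2 \<noteq> 3/4" using parallel_arcs_norm[OF zp] z(2) by simp
  moreover have "Re z = half_chord * x" using arg_cong[OF x(2), of Re] by (simp add: chord_def)
  ultimately have "x\<^sup>2 \<noteq> 1" using chord_sqr[of x] by auto
  then have "x \<noteq> -1" "x \<noteq> 1" by auto
  then have "x \<in> {-1<..<1}" using x(1) by auto
  then show False using traverses_chord(2)[OF c \<phi> P] x(2) z(1) by metis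
qed

end

lemma strong_RII_move_arrangements:
  assumes "knot_curve \<gamma>" and "strong_RII_move (range \<gamma>) P'"
  shows "\<exists>C C'. curve_arrangement (range \<gamma>) C \<and> curve_arrangement P' C' \<and> isotopic C C'"
proof -
  obtain \<phi> \<gamma>2 where hP: "disk_embedding \<phi>" "range \<gamma> \<inter> \<phi> ` cball 0 1 = \<phi> ` parallel_arcs"
    "P' \<inter> \<phi> ` cball 0 1 = \<phi> ` crossing_arcs" "range \<gamma> - \<phi> ` cball 0 1 = P' - \<phi> ` cball 0 1"
    and g2: "generic_immersion \<gamma>2" "P' = range \<gamma>2"
      "runs_along \<gamma>2 (\<phi> ` lower_edge) (\<phi> (-(1/2))) (\<phi> (1/2))" "runs_along \<gamma>2 (\<phi> ` upper_edge) (\<phi> (1/2)) (\<phi> (-(1/2)))"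
    using assms(2) unfolding strong_RII_move_def replaces_in_disk_def by (elim exE conjE)
  obtain G where hG: "disk_homeo G" "\<And>z. z \<in> parallel_arcs \<Longrightarrow> G z = squeeze z"
    by (rule squeeze_disk_homeo) blast
  \<comment> \<open>Once the upper chord is run from left to right, if necessary after reversal, the
    sign \<open>\<sigma>\<close> records the direction of the lower one.\<close>
  have main: ?thesis if k: "knot_curve \<gamma>'" and rg: "range \<gamma>' = range \<gamma>" and up: "traverses \<gamma>' (\<lambda>x. \<phi> (chord (1/2) x))" for \<gamma>'
  proof -
    interpret k: knot_curve \<gamma>' by fact
    have in': "range \<gamma>' \<inter> \<phi> ` cball 0 1 = \<phi> ` parallel_arcs" using hP(2) rg by simp
    have "\<exists>\<sigma>\<in>{1, -1}. traverses \<gamma>' (\<lambda>x. \<phi> (chord (- (1/2)) (\<sigma> * x)))"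
      using k.traverses_chord(1)[OF _ hP(1) in', of "- (1/2)"] by auto
    then obtain \<sigma> where \<sigma>: "\<sigma> \<in> {1, -1}" "traverses \<gamma>' (\<lambda>x. \<phi> (chord (- (1/2)) (\<sigma> * x)))" by blast
    interpret parallel_strands \<gamma>' \<phi> G \<sigma>
      by unfold_locales (fact hP(1) in' k.no_double_on_parallel_arcs[OF hP(1) in'] hG(1) \<sigma> up | erule hG(2))+
    have "range modified = (P' - \<phi> ` cball 0 1) \<union> (P' \<inter> \<phi> ` cball 0 1)"
      unfolding range_modified rg hP(3,4) crossing_arcs_eq ..
    then have rm: "range modified = P'" by blast
    have "\<sigma> = -1"
      by (rule coherent_imp_opposite[OF knot_curve_generic_immersion[OF g2(1)] _ g2(3,4)]) (simp add: rm g2(2))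
    from coherent_arrangement[OF this] show ?thesis unfolding rm rg .
  qed
  interpret knot_curve \<gamma> by fact
  have "\<bar>1/2\<bar> = (1/2::real)" by simp
  from traverses_chord(1)[OF this hP(1,2)] show ?thesis
  proof
    assume "traverses \<gamma> (\<lambda>x. \<phi> (chord (1/2) x))"
    then show ?thesis by (rule main[OF assms(1) refl])
  next
    assume "traverses \<gamma> (\<lambda>x. \<phi> (chord (1/2) (- x)))"
    then have "traverses (\<lambda>t. \<gamma> (- t)) (\<lambda>x. \<phi> (chord (1/2) x))" by (rule traverses_reverse)
    then show ?thesis by (rule main[OF reverse(1) range_reverse])
  qed
qed

subsection \<open>Invariance\<close>

lemma curve_arrangement_subset: "curve_arrangement P C \<Longrightarrow> C \<subseteq> S2"
  unfolding curve_arrangement_def charts_def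
  using resolve_on_subset knot_curve.crossing_chart_cross_disk knot_curve.axioms(1) closed_curve.sphere by metis

lemma curve_arrangement_if_circle_arrangement: "circle_arrangement P C \<Longrightarrow> curve_arrangement P C"
  unfolding circle_arrangement_iff curve_arrangement_def using knot_curve_generic_immersion by blast

lemma curve_arrangement_exists:
  assumes "knot_projection P"
  obtains C where "curve_arrangement P C"
proof -
  obtain \<gamma> where \<gamma>: "generic_immersion \<gamma>" "P = range \<gamma>" using assms by (auto simp: knot_projection_def)
  interpret knot_curve \<gamma> by (rule knot_curve_generic_immersion[OF \<gamma>(1)])
  obtain \<phi> where "charts \<gamma> \<phi>" using charts_exist[of "{}"] by auto
  then show ?thesis using that \<gamma>(2) knot_curve_axioms unfolding curve_arrangement_def by blast
qed

text \<open>By uniqueness, one isotopic pair of arrangements decides for all pairs.\<close>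

lemma isotopic_if_some_isotopic:
  assumes D: "curve_arrangement P D" "curve_arrangement P' D'" "isotopic D D'"
    and C: "curve_arrangement P C" "curve_arrangement P' C'"
  shows "isotopic C C'"
proof -
  have "isotopic C D" "isotopic D' C'" using curve_arrangement_unique D C by blast+
  then show ?thesis using D(3) isotopic_trans curve_arrangement_subset C(1) D(1) by meson
qed

lemma isotopic_if_step:
  assumes "strong_12_step P P'" and C: "curve_arrangement P C" "curve_arrangement P' C'"
  shows "isotopic C C'"
proof -
  have curve: "\<exists>\<gamma>. knot_curve \<gamma> \<and> Q = range \<gamma>" if "curve_arrangement Q D" for Q D
    using that unfolding curve_arrangement_def by blast
  have local_move: "isotopic C C'"
    if move: "RI_move P P' \<or> strong_RII_move P P'" "curve_arrangement P C" "curve_arrangement P' C'" for P P' C C'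
  proof -
    obtain \<gamma> where "knot_curve \<gamma>" "P = range \<gamma>" using curve[OF move(2)] by blast
    then have "\<exists>D D'. curve_arrangement P D \<and> curve_arrangement P' D' \<and> isotopic D D'"
      using move(1) RI_move_arrangements strong_RII_move_arrangements by blast
    then show ?thesis using isotopic_if_some_isotopic move(2,3) by blast
  qed
  have "isotopic P P' \<or> (RI_move P P' \<or> strong_RII_move P P') \<or> (RI_move P' P \<or> strong_RII_move P' P)"
    using assms(1) by (auto simp: strong_12_step_def)
  then show ?thesis
  proof (elim disjE[of "isotopic P P'"] disjE[of "RI_move P P' \<or> strong_RII_move P P'"])
    assume iso: "isotopic P P'"
    have "P \<subseteq> S2" using curve[OF C(1)] knot_curve.axioms(1) closed_curve.sphere by blast
    then obtain \<Gamma> where \<Gamma>: "isotopic_to_id \<Gamma>" "\<Gamma> ` P = P'" using iso isotopic_iff by blast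
    obtain K where "homeomorphism S2 S2 \<Gamma> K" using isotopic_to_id_homeomorphism[OF \<Gamma>(1)] by blast
    \<comment> \<open>The isotopy that moves \<open>P\<close> carries the arrangement along, to an
      arrangement of \<open>P'\<close>.\<close>
    from curve_arrangement_homeomorphism[OF C(1) this] have "isotopic (\<Gamma> ` C) C'"
      using curve_arrangement_unique C(2) \<Gamma>(2) by metis
    moreover have "isotopic C (\<Gamma> ` C)" using isotopic_iff[OF curve_arrangement_subset[OF C(1)]] \<Gamma>(1) by blast
    ultimately show ?thesis using isotopic_trans[OF curve_arrangement_subset[OF C(1)]] by blast
  next
    assume "RI_move P P' \<or> strong_RII_move P P'"
    then show ?thesis using local_move C by blast
  next
    assume "RI_move P' P \<or> strong_RII_move P' P"
    then have "isotopic C' C" using local_move C by blast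
    then show ?thesis by (rule isotopic_sym[OF curve_arrangement_subset[OF C(2)]])
  qed
qed

lemma isotopic_if_homotopic:
  assumes "strong_12_step\<^sup>*\<^sup>* P P'" "curve_arrangement P C" "curve_arrangement P' C'"
  shows "isotopic C C'"
  using assms(1,3)
proof (induction arbitrary: C' rule: rtranclp_induct)
  case base
  then show ?case using curve_arrangement_unique assms(2) by blast
next
  case (step Q R)
  \<comment> \<open>Every set on the way is a knot projection and therefore has an arrangement to
    compare with.\<close>
  then have "knot_projection Q" by (simp add: strong_12_step_def)
  then obtain D where D: "curve_arrangement Q D" by (rule curve_arrangement_exists)
  have "isotopic D C'" by (rule isotopic_if_step[OF step.hyps(2) D step.prems])
  then show ?case using step.IH[OF D] isotopic_trans[OF curve_arrangement_subset[OF assms(2)]] by blast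
qed

theorem theorem3:
  fixes P P' C C' :: "(real^3) set"
  assumes "knot_projection P" and "knot_projection P'"
    and "strongly_12_homotopic P P'"
    and "circle_arrangement P C" and "circle_arrangement P' C'"
  shows "isotopic C C'"
  using assms(3-5) isotopic_if_homotopic curve_arrangement_if_circle_arrangement
  unfolding strongly_12_homotopic_def by blast

end
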